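(* Let $n\in\mathbb N$, $1<p<\infty$, $-\frac np<r<0$, $r+\varrho=-n$, $1<q<\infty$, with conjugate exponents $p',q'$, and let $\{T_j\}_{j\in\mathbb N_0}$ be a sequence of operators with the following properties: (i) $T_j:D(\mathbb R^n)\to C(\mathbb R^n)$ for $j\in\mathbb N_0$, and the $T_j$, $j\in\mathbb N_0$, are either (a) linear, or (b) satisfy $$(T_j(f_1+f_2))(y)\le(T_jf_1)(y)+(T_jf_2)(y),\qquad (T_jf)(y)=(T_j(-f))(y),\qquad T_j0=0$$ for all $f,f_1,f_2\in D(\mathbb R^n)$ and $y\in\mathbb R^n$ (in particular, in case (b) the functions $T_jf$ are real-valued); (ii) there is a constant $c_1$, independent of $j\in\mathbb N_0$, $f$ and $y$, such that $$|(T_jf)(y)|\le c_1\int_{\mathbb R^n}\frac{|f(z)|}{|y-z|^n}\,dz$$ for all $f\in D(\mathbb R^n)$ and all $y\notin\operatorname{supp}(f)$; (iii) there is a constant $c_2$ such that $\|\{T_jf_j\}|L_p(\ell_q,\mathbb R^n)\|\le c_2\|\{f_j\}|L_p(\ell_q,\mathbb R^n)\|$ for all $\{f_j\}_{j\in\mathbb N_0}\subset D(\mathbb R^n)$. Then the following statements hold. 1. There are unique continuous and bounded extensions $\widetilde{T_j}$ of $T_j$ to $\overset{\circ}{L}{}^r_p(\mathbb R^n)$, $j\in\mathbb N_0$, and $\{\widetilde{T_j}\}_{j\in\mathbb N_0}$ is bounded from $\overset{\circ}{L}{}^r_p(\ell_q,\mathbb R^n)$ into itself. 2. If the $T_j$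 are linear for $j\in\mathbb N_0$, then the dual operators $\widetilde{T_j}':H^\varrho L_{p'}(\mathbb R^n)\to H^\varrho L_{p'}(\mathbb R^n)$ of the unique linear and bounded extensions $\widetilde{T_j}$ of $T_j$ to $\overset{\circ}{L}{}^r_p(\mathbb R^n)$ are such that $\{\widetilde{T_j}'\}_{j\in\mathbb N_0}$ is bounded from $H^\varrho L_{p'}(\ell_{q'},\mathbb R^n)$ into itself. If, in addition, the extensions of $T_j$ to $L_p(\mathbb R^n)$ provided by (iii) are formally self-adjoint for all $j\in\mathbb N_0$, then the $\widetilde{T_j}'$ are the unique linear and bounded extensions of $T_j$ acting in $H^\varrho L_{p'}(\mathbb R^n)$. 3. If the $T_j$ are linear for $j\in\mathbb N_0$, then there are linear and bounded extensions $\widetilde{T_j}$ of $T_j$ to $L^r_p(\mathbb R^n)$ such that $\{\widetilde{T_j}\}_{j\in\mathbb N_0}$ is bounded from $L^r_p(\ell_q,\mathbb R^n)$ into itself.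
   Context: Functions are complex-valued unless stated otherwise; $D(\mathbb R^n)=C_0^\infty(\mathbb R^n)$; $C(\mathbb R^n)$ denotes the bounded continuous functions on $\mathbb R^n$. An operator $T:X\to Y$ between normed spaces (not necessarily linear) is called bounded if $\|Tx|Y\|\le c\|x|X\|$ with $c$ independent of $x\in X$. A bounded operator $\widetilde T:X\to X$, where $D(\mathbb R^n)$ is contained in $X$, is an extension of $T$ to $X$ if it coincides with $T$ on $D(\mathbb R^n)$. A sequence of operators $\{T_j\}$ acts on sequences componentwise: $\{f_j\}\mapsto\{T_jf_j\}$. For $J\in\mathbb Z$, $M\in\mathbb Z^n$ put $Q_{J,M}=2^{-J}(M+[-1,1]^n)$. Morrey space: for $1<p<\infty$, $-\frac np\le r<0$, $L^r_p(\mathbb R^n)$ is the set of all $f\in L_p^{\rm loc}(\mathbb R^n)$ with $\|f|L^r_p(\mathbb R^n)\|=\sup_{J\in\mathbb Z,M\in\mathbb Z^n}2^{J(\frac np+r)}\|f|L_p(Q_{J,M})\|<\infty$; $\overset{\circ}{L}{}^r_p(\mathbb R^n)$ is the closure of $D(\mathbb R^n)$ in it. Predual Morrey space: for $1<p<\infty$, $-n<\varrho<-\frac np$, $H^\varrho L_p(\mathbb R^n)$ is the set of all $h\in S'(\mathbb R^n)$ which can be represented as $h=\sum_{J\in\mathbb Z,M\in\mathbb Z^n}\lambda_{J,M}a_{J,M}$ (convergence in $S'(\mathbb R^n)$) with $\operatorname{supp}a_{J,M}\subset Q_{J,M}$, $\|a_{J,M}|L_p(\mathbb R^n)\|\le2^{-J(\frac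 np+\varrho)}$ and $\sum_{J,M}|\lambda_{J,M}|<\infty$; its norm is the infimum of $\sum_{J,M}|\lambda_{J,M}|$ over all such representations. One has $H^\varrho L_p(\mathbb R^n)\subset L_u(\mathbb R^n)$ with $u=-n/\varrho$, so its elements are functions. (Here this is used with $p'$ in place of $p$.) Vector-valued versions: $L^r_p(\ell_q,\mathbb R^n)$ is the set of all sequences $\{f_j\}_{j\in\mathbb N_0}$ in $L^r_p(\mathbb R^n)$ with $\|\{f_j\}|L^r_p(\ell_q,\mathbb R^n)\|=\big\|\big(\sum_{j\ge0}|f_j(\cdot)|^q\big)^{1/q}\big|L^r_p(\mathbb R^n)\big\|<\infty$; $L_p(\ell_q,\mathbb R^n)$ is defined in the same way with the Lebesgue norm. $\overset{\circ}{L}{}^r_p(\ell_q,\mathbb R^n)$ is the subspace of those $\{f_j\}\in L^r_p(\ell_q,\mathbb R^n)$ for which there exist $f_j^k\in D(\mathbb R^n)$ ($j\in\mathbb N_0$, $k\in\mathbb N$) with $f_j^k=0$ for $j>k$ and $\|\{f_j-f_j^k\}_j|L^r_p(\ell_q,\mathbb R^n)\|\to0$ as $k\to\infty$. $H^\varrho L_p(\ell_q,\mathbb R^n)$ is the set of all sequences $\{g_j\}_{j\in\mathbb N_0}$ in $H^\varrho L_p(\mathbb R^n)$ such that $\big(\sum_{j\ge0}|g_j(\cdot)|^q\big)^{1/q}\in H^\varrho L_p(\mathbb R^n)$, normed by the $H^\varrho L_p(\mathbb R^n)$-norm of this function. Duality: dual operators are taken with respect to the identification of the dual of $\overset{\circ}{L}{}^r_p(\mathbb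 R^n)$ with $H^\varrho L_{p'}(\mathbb R^n)$ ($r+\varrho=-n$) via the bilinear pairing $\langle f,g\rangle=\int_{\mathbb R^n}f(x)g(x)\,dx$. "Formally self-adjoint" means $\int(T_jf)g\,dx=\int f\,(T_jg)\,dx$ for all $f,g\in D(\mathbb R^n)$. *)

theory Defs
  imports "HOL-Analysis.Analysis"
begin

text \<open>
  The dimension is \<open>n = CARD('n)\<close>. Elements of the Lebesgue-type spaces are represented by
  Lebesgue measurable functions; equality in these spaces is equality almost everywhere.
\<close>

type_synonym 'n cfun = "real ^ 'n \<Rightarrow> complex"

abbreviation ae_eq :: "('n::finite) cfun \<Rightarrow> 'n cfun \<Rightarrow> bool" (infix \<open>=ae\<close> 50)
  where "f =ae g \<equiv> AE x in lebesgue. f x = g x"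


subsection \<open>Test functions and tempered distributions\<close>

definition partial_derivative :: "'n \<Rightarrow> ('n::finite) cfun \<Rightarrow> 'n cfun" where
  "partial_derivative i f = (\<lambda>x. frechet_derivative f (at x) (axis i 1))"

definition iterated_partial :: "'n list \<Rightarrow> ('n::finite) cfun \<Rightarrow> 'n cfun" where
  "iterated_partial is f = foldr partial_derivative is f"

text \<open>
  Total differentiability of every iterated partial derivative makes all of them exist and be
  continuous, so this is the class of infinitely differentiable functions.
\<close>
definition smooth :: "('n::finite) cfun \<Rightarrow> bool" where
  "smooth f \<longleftrightarrow> (\<forall>is. iterated_partial is f differentiable_on UNIV)"

definition supp :: "('n::finite) cfun \<Rightarrow> (real ^ 'n) set" where
  "supp f = closure {x. f x \<noteq> 0}"

definition test_functions :: "('n::finite) cfun set" where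
  "test_functions = {f. smooth f \<and> compact (supp f)}"

definition schwartz_functions :: "('n::finite) cfun set" where
  "schwartz_functions = {\<phi>. smooth \<phi> \<and>
     (\<forall>is N. bounded (range (\<lambda>x. (1 + norm x) ^ N *\<^sub>R iterated_partial is \<phi> x)))}"

definition schwartz_seminorm :: "nat \<Rightarrow> ('n::finite) cfun \<Rightarrow> real" where
  "schwartz_seminorm N \<phi> =
     (SUP (is, x) \<in> {is. length is \<le> N} \<times> UNIV. (1 + norm x) ^ N * cmod (iterated_partial is \<phi> x))"

text \<open>Only the values of a functional on \<^const>\<open>schwartz_functions\<close> matter.\<close>
definition tempered_distribution :: "(('n::finite) cfun \<Rightarrow> complex) \<Rightarrow> bool" where
  "tempered_distribution u \<longleftrightarrow>
     (\<forall>\<phi>\<in>schwartz_functions. \<forall>\<psi>\<in>schwartz_functions. \<forall>a b.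
        u (\<lambda>x. a * \<phi> x + b * \<psi> x) = a * u \<phi> + b * u \<psi>) \<and>
     (\<exists>C N. \<forall>\<phi>\<in>schwartz_functions. cmod (u \<phi>) \<le> C * schwartz_seminorm N \<phi>)"

definition pairing :: "('n::finite) cfun \<Rightarrow> 'n cfun \<Rightarrow> complex" where
  "pairing f g = (LINT x|lebesgue. f x * g x)"


subsection \<open>Lebesgue and Morrey norms\<close>

text \<open>Power of an extended nonnegative number, for exponents \<open>a > 0\<close>.\<close>
definition epowr :: "ennreal \<Rightarrow> real \<Rightarrow> ennreal" where
  "epowr x a = (if x = \<infinity> then \<infinity> else ennreal (enn2real x powr a))"

definition Lp_enorm_on :: "real \<Rightarrow> (real ^ 'n) set \<Rightarrow> (real ^ 'n::finite \<Rightarrow> ennreal) \<Rightarrow> ennreal" where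
  "Lp_enorm_on p A F = epowr (\<integral>\<^sup>+x\<in>A. epowr (F x) p \<partial>lebesgue) (1 / p)"

definition eabs :: "('n::finite) cfun \<Rightarrow> real ^ 'n \<Rightarrow> ennreal" where
  "eabs f x = ennreal (cmod (f x))"

definition dyadic_cube :: "int \<Rightarrow> int ^ 'n \<Rightarrow> (real ^ 'n::finite) set" where
  "dyadic_cube J M =
     {2 powr (- real_of_int J) *\<^sub>R ((\<chi> i. real_of_int (M $ i)) + x) | x. \<forall>i. -1 \<le> x $ i \<and> x $ i \<le> 1}"

definition Lp_loc :: "real \<Rightarrow> ('n::finite) cfun set" where
  "Lp_loc p = {f \<in> borel_measurable lebesgue. \<forall>K. compact K \<longrightarrow> Lp_enorm_on p K (eabs f) < \<infinity>}"

definition morrey_enorm :: "real \<Rightarrow> real \<Rightarrow> (real ^ 'n::finite \<Rightarrow> ennreal) \<Rightarrow> ennreal" where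
  "morrey_enorm r p F =
     (SUP (J, M). ennreal (2 powr (real_of_int J * (real CARD('n) / p + r))) *
                  Lp_enorm_on p (dyadic_cube J M) F)"

definition morrey :: "real \<Rightarrow> real \<Rightarrow> ('n::finite) cfun set" where
  "morrey r p = {f \<in> Lp_loc p. morrey_enorm r p (eabs f) < \<infinity>}"

definition morrey0 :: "real \<Rightarrow> real \<Rightarrow> ('n::finite) cfun set" where
  "morrey0 r p = {f \<in> morrey r p.
     \<forall>\<epsilon>>0. \<exists>\<phi>\<in>test_functions. morrey_enorm r p (eabs (\<lambda>x. f x - \<phi> x)) < ennreal \<epsilon>}"


subsection \<open>Predual Morrey spaces\<close>

definition atomic_representation ::
  "real \<Rightarrow> real \<Rightarrow> (('n::finite) cfun \<Rightarrow> complex) \<Rightarrow> (int \<Rightarrow> int ^ 'n \<Rightarrow> complex) \<Rightarrow>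
     (int \<Rightarrow> int ^ 'n \<Rightarrow> 'n cfun) \<Rightarrow> bool" where
  "atomic_representation \<rho> p h c a \<longleftrightarrow>
     (\<forall>J M. a J M \<in> borel_measurable lebesgue \<and>
        (AE x in lebesgue. x \<notin> dyadic_cube J M \<longrightarrow> a J M x = 0) \<and>
        Lp_enorm_on p UNIV (eabs (a J M))
          \<le> ennreal (2 powr (- real_of_int J * (real CARD('n) / p + \<rho>)))) \<and>
     (\<lambda>(J, M). cmod (c J M)) summable_on UNIV \<and>
     (\<forall>\<phi>\<in>schwartz_functions.
        ((\<lambda>(J, M). c J M * pairing (a J M) \<phi>) has_sum h \<phi>) UNIV)"

definition predual_distributions :: "real \<Rightarrow> real \<Rightarrow> (('n::finite) cfun \<Rightarrow> complex) set" where
  "predual_distributions \<rho> p =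
     {h. tempered_distribution h \<and> (\<exists>c a. atomic_representation \<rho> p h c a)}"

definition predual_distribution_enorm ::
  "real \<Rightarrow> real \<Rightarrow> (('n::finite) cfun \<Rightarrow> complex) \<Rightarrow> ennreal" where
  "predual_distribution_enorm \<rho> p h =
     Inf {ennreal (\<Sum>\<^sub>\<infinity>(J, M). cmod (c J M)) | c a. atomic_representation \<rho> p h c a}"

text \<open>
  The distributions above are regular; the space is used through the functions
  representing them (determined almost everywhere).
\<close>
definition predual :: "real \<Rightarrow> real \<Rightarrow> ('n::finite) cfun set" where
  "predual \<rho> p = {f \<in> borel_measurable lebesgue.
     (\<forall>\<phi>\<in>schwartz_functions. integrable lebesgue (\<lambda>x. f x * \<phi> x)) \<and>
     pairing f \<in> predual_distributions \<rho> p}"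

definition predual_enorm :: "real \<Rightarrow> real \<Rightarrow> ('n::finite) cfun \<Rightarrow> ennreal" where
  "predual_enorm \<rho> p f = predual_distribution_enorm \<rho> p (pairing f)"


subsection \<open>Vector-valued spaces\<close>

definition lq_function :: "real \<Rightarrow> (nat \<Rightarrow> ('n::finite) cfun) \<Rightarrow> real ^ 'n \<Rightarrow> ennreal" where
  "lq_function q f x = epowr (\<Sum>j. ennreal (cmod (f j x) powr q)) (1 / q)"

definition morrey_lq :: "real \<Rightarrow> real \<Rightarrow> real \<Rightarrow> (nat \<Rightarrow> ('n::finite) cfun) set" where
  "morrey_lq r p q = {f. (\<forall>j. f j \<in> morrey r p) \<and> morrey_enorm r p (lq_function q f) < \<infinity>}"

definition morrey0_lq :: "real \<Rightarrow> real \<Rightarrow> real \<Rightarrow> (nat \<Rightarrow> ('n::finite) cfun) set" where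
  "morrey0_lq r p q = {f \<in> morrey_lq r p q.
     \<exists>\<phi>. (\<forall>k j. \<phi> k j \<in> test_functions) \<and> (\<forall>k j. j > k \<longrightarrow> \<phi> k j = (\<lambda>x. 0)) \<and>
         ((\<lambda>k. morrey_enorm r p (lq_function q (\<lambda>j x. f j x - \<phi> k j x))) \<longlongrightarrow> 0) sequentially}"

text \<open>
  Membership forces the pointwise \<open>\<ell>\<^sub>q\<close> norm to be finite almost everywhere; the complex-valued
  version is the corresponding element of the scalar space.
\<close>
definition lq_cfun :: "real \<Rightarrow> (nat \<Rightarrow> ('n::finite) cfun) \<Rightarrow> 'n cfun" where
  "lq_cfun q g = (\<lambda>x. complex_of_real (enn2real (lq_function q g x)))"

definition predual_lq :: "real \<Rightarrow> real \<Rightarrow> real \<Rightarrow> (nat \<Rightarrow> ('n::finite) cfun) set" where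
  "predual_lq \<rho> p q = {g. (\<forall>j. g j \<in> predual \<rho> p) \<and>
     (AE x in lebesgue. lq_function q g x < \<infinity>) \<and> lq_cfun q g \<in> predual \<rho> p}"


subsection \<open>Operators\<close>

text \<open>
  An operator on a space of almost-everywhere classes is a map of representatives that respects
  almost-everywhere equality. In the following, \<open>X\<close> is the space and \<open>N\<close> its norm.
\<close>
definition operator_on :: "('n::finite) cfun set \<Rightarrow> ('n cfun \<Rightarrow> 'n cfun) \<Rightarrow> bool" where
  "operator_on X T \<longleftrightarrow> (\<forall>f\<in>X. T f \<in> X) \<and> (\<forall>f\<in>X. \<forall>g\<in>X. f =ae g \<longrightarrow> T f =ae T g)"

definition bounded_operator ::
  "('n::finite) cfun set \<Rightarrow> ('n cfun \<Rightarrow> ennreal) \<Rightarrow> ('n cfun \<Rightarrow> 'n cfun) \<Rightarrow> bool" where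
  "bounded_operator X N T \<longleftrightarrow>
     operator_on X T \<and> (\<exists>c::real. \<forall>f\<in>X. N (T f) \<le> ennreal c * N f)"

definition continuous_operator ::
  "('n::finite) cfun set \<Rightarrow> ('n cfun \<Rightarrow> ennreal) \<Rightarrow> ('n cfun \<Rightarrow> 'n cfun) \<Rightarrow> bool" where
  "continuous_operator X N T \<longleftrightarrow>
     (\<forall>f\<in>X. \<forall>\<epsilon>>0. \<exists>\<delta>>0. \<forall>g\<in>X. N (\<lambda>x. g x - f x) < ennreal \<delta> \<longrightarrow>
        N (\<lambda>x. T g x - T f x) < ennreal \<epsilon>)"

definition linear_operator :: "('n::finite) cfun set \<Rightarrow> ('n cfun \<Rightarrow> 'n cfun) \<Rightarrow> bool" where
  "linear_operator X T \<longleftrightarrow> (\<forall>f\<in>X. \<forall>g\<in>X. \<forall>a b.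
     T (\<lambda>x. a * f x + b * g x) =ae (\<lambda>x. a * T f x + b * T g x))"

definition bounded_extension ::
  "('n::finite) cfun set \<Rightarrow> ('n cfun \<Rightarrow> ennreal) \<Rightarrow> ('n cfun \<Rightarrow> 'n cfun) \<Rightarrow>
     ('n cfun \<Rightarrow> 'n cfun) \<Rightarrow> bool" where
  "bounded_extension X N T T' \<longleftrightarrow>
     test_functions \<subseteq> X \<and> bounded_operator X N T' \<and> (\<forall>f\<in>test_functions. T' f =ae T f)"

definition continuous_bounded_extension ::
  "('n::finite) cfun set \<Rightarrow> ('n cfun \<Rightarrow> ennreal) \<Rightarrow> ('n cfun \<Rightarrow> 'n cfun) \<Rightarrow>
     ('n cfun \<Rightarrow> 'n cfun) \<Rightarrow> bool" where
  "continuous_bounded_extension X N T T' \<longleftrightarrow>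
     bounded_extension X N T T' \<and> continuous_operator X N T'"

definition linear_bounded_extension ::
  "('n::finite) cfun set \<Rightarrow> ('n cfun \<Rightarrow> ennreal) \<Rightarrow> ('n cfun \<Rightarrow> 'n cfun) \<Rightarrow>
     ('n cfun \<Rightarrow> 'n cfun) \<Rightarrow> bool" where
  "linear_bounded_extension X N T T' \<longleftrightarrow>
     bounded_extension X N T T' \<and> linear_operator X T'"

definition unique_operator_on ::
  "('n::finite) cfun set \<Rightarrow> (('n cfun \<Rightarrow> 'n cfun) \<Rightarrow> bool) \<Rightarrow> ('n cfun \<Rightarrow> 'n cfun) \<Rightarrow> bool" where
  "unique_operator_on X P T \<longleftrightarrow> P T \<and> (\<forall>S. P S \<longrightarrow> (\<forall>f\<in>X. S f =ae T f))"

text \<open>\<open>T'\<close> is the dual of \<open>T\<close> when the dual of \<open>X\<close> is identified with \<open>Y\<close> through \<^const>\<open>pairing\<close>.\<close>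
definition dual_operator ::
  "('n::finite) cfun set \<Rightarrow> 'n cfun set \<Rightarrow> ('n cfun \<Rightarrow> 'n cfun) \<Rightarrow> ('n cfun \<Rightarrow> 'n cfun) \<Rightarrow> bool" where
  "dual_operator X Y T T' \<longleftrightarrow>
     operator_on Y T' \<and> (\<forall>f\<in>X. \<forall>g\<in>Y. pairing (T f) g = pairing f (T' g))"

definition bounded_sequence_operator ::
  "(nat \<Rightarrow> ('n::finite) cfun) set \<Rightarrow> ((nat \<Rightarrow> 'n cfun) \<Rightarrow> ennreal) \<Rightarrow>
     (nat \<Rightarrow> 'n cfun \<Rightarrow> 'n cfun) \<Rightarrow> bool" where
  "bounded_sequence_operator Y N T \<longleftrightarrow>
     (\<forall>f\<in>Y. (\<lambda>j. T j (f j)) \<in> Y) \<and>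
     (\<exists>c::real. \<forall>f\<in>Y. N (\<lambda>j. T j (f j)) \<le> ennreal c * N f)"

text \<open>The two admissible kinds of operators from test functions to bounded continuous functions.\<close>
definition linear_on_test_functions :: "(('n::finite) cfun \<Rightarrow> 'n cfun) \<Rightarrow> bool" where
  "linear_on_test_functions T \<longleftrightarrow>
     (\<forall>f\<in>test_functions. \<forall>g\<in>test_functions. \<forall>a b.
        T (\<lambda>x. a * f x + b * g x) = (\<lambda>x. a * T f x + b * T g x))"

definition even_subadditive_on_test_functions :: "(('n::finite) cfun \<Rightarrow> 'n cfun) \<Rightarrow> bool" where
  "even_subadditive_on_test_functions T \<longleftrightarrow>
     (\<forall>f\<in>test_functions. \<forall>y. T f y \<in> \<real>) \<and>
     (\<forall>f\<^sub>1\<in>test_functions. \<forall>f\<^sub>2\<in>test_functions. \<forall>y.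
        Re (T (\<lambda>x. f\<^sub>1 x + f\<^sub>2 x) y) \<le> Re (T f\<^sub>1 y) + Re (T f\<^sub>2 y)) \<and>
     (\<forall>f\<in>test_functions. \<forall>y. T f y = T (\<lambda>x. - f x) y) \<and>
     T (\<lambda>x. 0) = (\<lambda>x. 0)"

definition formally_self_adjoint :: "(('n::finite) cfun \<Rightarrow> 'n cfun) \<Rightarrow> bool" where
  "formally_self_adjoint T \<longleftrightarrow>
     (\<forall>f\<in>test_functions. \<forall>g\<in>test_functions. pairing (T f) g = pairing f (T g))"

end

theory Submission imports Defs begin

text \<open>
  Fix a cube \<open>Q\<close> and split \<open>f\<close> into its restrictions to the double of \<open>Q\<close> and to the dyadic annuli
  around \<open>Q\<close>. The first piece is controlled by the bound in \<open>L\<^sub>p(\<ell>\<^sub>q)\<close>. On the \<open>k\<close>-th annulus the kernel is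
  of size \<open>1 / |2\<^sup>kQ|\<close>, so that by Hoelder's inequality the \<open>L\<^sub>p(Q)\<close> norm of the image is at most
  a constant times \<open>2^(-kn/p)\<close> times the \<open>L\<^sub>p(2^(k+1)Q)\<close> norm of \<open>f\<close>, where \<open>n\<close> is the dimension; the
  latter grows at most like \<open>2^(k(n/p+r))\<close> for \<open>f\<close> in the Morrey space, and the product is summable
  because \<open>r < 0\<close>. The extension to the Morrey space is the almost everywhere limit along truncations,
  and it preserves the closure of the test functions because \<open>T\<^sub>j \<phi>\<close> decays at infinity.

  Read dually, the same local estimate shows that the adjoint on \<open>L\<^sub>p\<^sub>'\<close> sends an atom supported in \<open>Q\<close> to
  pieces on the annuli whose atomic norms are summable. To sum over the atoms of a whole sequence
  \<open>{g\<^sub>j}\<close> at once, the norm of the predual space is expressed through majorants: only the size of the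
  atoms matters, and each \<open>g\<^sub>j\<close> is distributed proportionally among the atoms of one majorant of the
  \<open>\<ell>\<^sub>q\<^sub>'\<close> norm.
\<close>

subsection \<open>Powers and conjugate exponents\<close>

text \<open>Three obstacles shape the development. The operators need not be linear: the extension
  to Morrey spaces rests on the inequality |T_j f - T_j g| <= |T_j (f - g)|, which linear and even
  subadditive operators share. Both analytic hypotheses speak about test functions only, while the
  pieces of a function on annuli are not test functions; hence T_j is extended to L_p before
  anything is cut, and approximants keep their supports in prescribed open sets so that the kernel
  bound survives the limit. Test functions are not dense in the full Morrey space, and the predual
  is given through distributions; hence the dual operator is not taken from an abstract duality
  theorem but assembled from adjoints on L_p', and it is identified by its pairings with test
  functions. The weight of an atom is the inverse of the Morrey weight of its cube. Therefore the
  same geometric series, collected in \<open>C_morrey\<close>, governs both the Morrey estimate and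
  the predual estimate.\<close>

lemma epowr_ennreal [simp]: "0 \<le> t \<Longrightarrow> epowr (ennreal t) a = ennreal (t powr a)"
  by (simp add: epowr_def)

lemma epowr_top [simp]: "epowr top a = top"
  by (simp add: epowr_def)

lemma epowr_zero [simp]: "epowr 0 a = 0"
  by (simp add: epowr_def)

lemma epowr_mono: "0 < a \<Longrightarrow> x \<le> y \<Longrightarrow> epowr x a \<le> epowr y a"
  by (cases x; cases y) (auto simp: ennreal_leI powr_mono2 top_unique)

lemma epowr_epowr: "epowr (epowr x a) b = epowr x (a * b)"
  by (cases x) (auto simp: powr_powr)

lemma epowr_one [simp]: "epowr x 1 = x"
  by (cases x) auto

lemma epowr_eq_top_iff [simp]: "epowr x a = top \<longleftrightarrow> x = top"
  by (cases x) auto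

lemma epowr_less_top_iff [simp]: "epowr x a < top \<longleftrightarrow> x < top"
  by (simp add: less_top[symmetric])

lemma epowr_eq_zero_iff [simp]: "epowr x a = 0 \<longleftrightarrow> x = 0"
  by (cases x) (auto simp: ennreal_eq_0_iff)

lemma epowr_mult: "epowr (x * y) a = epowr x a * epowr y a"
proof (cases "x = 0 \<or> y = 0")
  case True then show ?thesis by auto
next
  case False then show ?thesis
    by (cases x; cases y) (auto simp: ennreal_mult'[symmetric] powr_mult ennreal_mult_top ennreal_top_mult)
qed

lemma epowr_add: "epowr x (a + b) = epowr x a * epowr x b"
  by (cases x) (auto simp: ennreal_mult'[symmetric] powr_add ennreal_mult_top ennreal_top_mult)

lemma epowr_le_iff:
  assumes "0 < a" shows "epowr x a \<le> y \<longleftrightarrow> x \<le> epowr y (1 / a)"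
proof
  assume "epowr x a \<le> y"
  then have "epowr (epowr x a) (1/a) \<le> epowr y (1/a)" using assms by (intro epowr_mono) auto
  then show "x \<le> epowr y (1 / a)" using assms by (simp add: epowr_epowr)
next
  assume "x \<le> epowr y (1/a)"
  then have "epowr x a \<le> epowr (epowr y (1/a)) a" using assms by (intro epowr_mono) auto
  then show "epowr x a \<le> y" using assms by (simp add: epowr_epowr)
qed

lemma less_epowr_iff:
  assumes "0 < a" shows "y < epowr x a \<longleftrightarrow> epowr y (1 / a) < x"
  using epowr_le_iff[OF assms, of x y] by (simp add: not_le[symmetric])

lemma measurable_epowr [measurable]:
  assumes [measurable]: "F \<in> borel_measurable M"
  shows "(\<lambda>x. epowr (F x) a) \<in> borel_measurable M"
proof -
  have "(\<lambda>x. epowr x a) \<in> borel_measurable borel"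
    unfolding epowr_def
  proof (rule measurable_If)
    have "{x \<in> space borel. x = (\<infinity>::ennreal)} = {\<infinity>}" by auto
    then show "{x \<in> space borel. x = (\<infinity>::ennreal)} \<in> sets borel" by simp
  qed measurable
  then show ?thesis by (rule measurable_compose[rotated]) simp
qed

text \<open>The equivalence \<open>less_epowr_iff\<close> moves the power across a strict
  inequality. This gives the one-sided estimate that Fatou's lemma for norms requires, directly from
  the description of \<open>liminf\<close> by eventual lower bounds.\<close>

lemma epowr_liminf_le:
  assumes "0 < a" shows "epowr (liminf X) a \<le> liminf (\<lambda>i. epowr (X i) a)"
  unfolding le_Liminf_iff
proof (intro allI impI)
  fix y assume "y < epowr (liminf X) a"
  then have "epowr y (1/a) < liminf X" using assms by (simp add: less_epowr_iff)
  then have "eventually (\<lambda>i. epowr y (1/a) < X i) sequentially" by (rule less_LiminfD)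
  then show "eventually (\<lambda>i. y < epowr (X i) a) sequentially"
    using assms by (simp add: less_epowr_iff)
qed

locale conjugate_exponents =
  fixes p P :: real
  assumes one_less: "1 < p" and conj_eq: "1 / p + 1 / P = 1"
begin

lemma conj_inverse: "1 / P = 1 - 1 / p" using conj_eq by simp

lemma conj_inverse_pos: "0 < 1 / P" "1 / P < 1"
  using one_less by (auto simp: conj_inverse)

lemma conj_pos: "0 < P" using conj_inverse_pos(1) by (simp add: zero_less_divide_iff)

lemma conj_one_less: "1 < P" using conj_inverse_pos(2) conj_pos by (simp add: divide_simps)

lemma pos: "0 < p" using one_less by simp

lemma conj_mult: "(p - 1) * P = p"
  using conj_eq conj_pos pos by (simp add: field_simps)

lemma conj_mult': "(P - 1) * p = P"
  using conj_eq conj_pos pos by (simp add: field_simps)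

lemma conj_sym: "conjugate_exponents P p"
  using conj_one_less conj_eq by unfold_locales auto

end

subsection \<open>The function norm of Lebesgue spaces\<close>

text \<open>The measure is arbitrary so that Lebesgue measure yields the L_p norms and
  \<open>count_space UNIV\<close> on the naturals yields the l_q norms; Hoelder, Minkowski and Fatou
  are then proved once for both.\<close>

definition Lnorm :: "'a measure \<Rightarrow> real \<Rightarrow> ('a \<Rightarrow> ennreal) \<Rightarrow> ennreal" where
  "Lnorm M p F = epowr (\<integral>\<^sup>+x. epowr (F x) p \<partial>M) (1 / p)"

lemma Lnorm_mono_AE:
  "0 < p \<Longrightarrow> (AE x in M. F x \<le> G x) \<Longrightarrow> Lnorm M p F \<le> Lnorm M p G"
  unfolding Lnorm_def by (intro epowr_mono nn_integral_mono_AE) (auto intro: epowr_mono)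

lemma epowr_Lnorm: "0 < p \<Longrightarrow> epowr (Lnorm M p F) p = (\<integral>\<^sup>+x. epowr (F x) p \<partial>M)"
  by (simp add: Lnorm_def epowr_epowr)

lemma Lnorm_cmult:
  assumes "0 < p" and [measurable]: "F \<in> borel_measurable M"
  shows "Lnorm M p (\<lambda>x. c * F x) = c * Lnorm M p F"
  using assms(1) by (simp add: Lnorm_def epowr_mult nn_integral_cmult epowr_epowr)

lemma Lnorm_eq_0_iff:
  assumes "F \<in> borel_measurable M"
  shows "Lnorm M p F = 0 \<longleftrightarrow> (AE x in M. F x = 0)"
  using assms by (simp add: Lnorm_def nn_integral_0_iff_AE)

lemma AE_finite_if_Lnorm_finite:
  assumes "0 < p" "F \<in> borel_measurable M" "Lnorm M p F < top"
  shows "AE x in M. F x < top"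
proof -
  have "(\<integral>\<^sup>+x. epowr (F x) p \<partial>M) \<noteq> \<infinity>" using assms(3) by (auto simp: Lnorm_def)
  then have "AE x in M. epowr (F x) p \<noteq> \<infinity>"
    using assms(2) by (intro nn_integral_noteq_infinite) auto
  then show ?thesis by (auto simp: less_top)
qed

lemma Lnorm_Fatou:
  assumes "0 < p" and [measurable]: "\<And>i. F i \<in> borel_measurable M"
    and le: "AE x in M. G x \<le> liminf (\<lambda>i. F i x)"
  shows "Lnorm M p G \<le> liminf (\<lambda>i. Lnorm M p (F i))"
proof -
  have "(\<integral>\<^sup>+x. epowr (G x) p \<partial>M) \<le> (\<integral>\<^sup>+x. liminf (\<lambda>i. epowr (F i x) p) \<partial>M)"
    using le assms(1)
    by (intro nn_integral_mono_AE) (auto intro: order_trans[OF epowr_mono epowr_liminf_le])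
  also have "\<dots> \<le> liminf (\<lambda>i. \<integral>\<^sup>+x. epowr (F i x) p \<partial>M)"
    by (intro nn_integral_liminf) auto
  finally have "Lnorm M p G \<le> epowr (liminf (\<lambda>i. \<integral>\<^sup>+x. epowr (F i x) p \<partial>M)) (1 / p)"
    unfolding Lnorm_def using assms(1) by (intro epowr_mono) auto
  also have "\<dots> \<le> liminf (\<lambda>i. Lnorm M p (F i))"
    unfolding Lnorm_def using assms(1) by (intro epowr_liminf_le) auto
  finally show ?thesis .
qed

lemma Lnorm_Fatou_le:
  assumes "0 < p" "\<And>i. F i \<in> borel_measurable M"
    and "AE x in M. G x \<le> liminf (\<lambda>i. F i x)" and "\<And>i. Lnorm M p (F i) \<le> R"
  shows "Lnorm M p G \<le> R"
proof -
  have "liminf (\<lambda>i. Lnorm M p (F i)) \<le> liminf (\<lambda>i::nat. R)"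
    using assms(4) by (intro Liminf_mono) auto
  then show ?thesis using Lnorm_Fatou[OF assms(1-3)] by (simp add: Liminf_const)
qed

lemma (in conjugate_exponents) Young_ennreal:
  "x * y \<le> ennreal (1/p) * epowr x p + ennreal (1/P) * epowr y P"
proof (cases "x = 0 \<or> y = 0")
  case True then show ?thesis by auto
next
  case False
  note pp = pos conj_pos
  show ?thesis
  proof (cases "x = top \<or> y = top")
    case True then show ?thesis using pp by (auto simp: ennreal_mult_top)
  next
    case F: False
    obtain a b where ab: "x = ennreal a" "y = ennreal b" "0 \<le> a" "0 \<le> b"
      using F by (cases x; cases y) auto
    have "a * b \<le> a powr p / p + b powr P / P"
      using Youngs_inequality[of p P a b] one_less conj_one_less conj_eq ab by simp
    then have "ennreal (a * b) \<le> ennreal (1/p * a powr p + 1/P * b powr P)" by (intro ennreal_leI) simp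
    also have "\<dots> = ennreal (1/p) * ennreal (a powr p) + ennreal (1/P) * ennreal (b powr P)"
      using pp by (subst ennreal_plus) (auto simp: ennreal_mult'[symmetric])
    finally show ?thesis using ab by (simp add: ennreal_mult')
  qed
qed

lemma (in conjugate_exponents) Hoelder:
  assumes [measurable]: "F \<in> borel_measurable M" "G \<in> borel_measurable M"
  shows "(\<integral>\<^sup>+x. F x * G x \<partial>M) \<le> Lnorm M p F * Lnorm M P G"
proof -
  let ?a = "Lnorm M p F" and ?b = "Lnorm M P G"
  note pp = pos conj_pos
  \<comment> \<open>A vanishing norm makes the product vanish almost everywhere, which settles 0
    times infinity. An infinite norm next to a nonzero one is trivial, so that only finite positive
    norms have to be normalised.\<close>
  consider "?a = 0" | "?b = 0" | "?a \<noteq> 0" "?b \<noteq> 0" "?a = top \<or> ?b = top"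
    | "?a \<noteq> 0" "?b \<noteq> 0" "?a \<noteq> top" "?b \<noteq> top" by blast
  then show ?thesis
  proof cases
    case 1
    then have "AE x in M. F x * G x = 0" by (auto simp: Lnorm_eq_0_iff)
    then show ?thesis by (subst nn_integral_cong_AE[of _ "\<lambda>_. 0"]) auto
  next
    case 2
    then have "AE x in M. F x * G x = 0" by (auto simp: Lnorm_eq_0_iff)
    then show ?thesis by (subst nn_integral_cong_AE[of _ "\<lambda>_. 0"]) auto
  next
    case 3 then show ?thesis by (auto simp: ennreal_mult_top ennreal_top_mult)
  next
    case 4
    obtain a where a: "?a = ennreal a" "0 < a"
      using 4 by (cases ?a) (auto simp: less_le)
    obtain b where b: "?b = ennreal b" "0 < b"
      using 4 by (cases ?b) (auto simp: less_le)
    let ?F = "\<lambda>x. ennreal (1/a) * F x" and ?G = "\<lambda>x. ennreal (1/b) * G x"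
    have 1: "Lnorm M p ?F = 1" using pp a by (simp add: Lnorm_cmult ennreal_mult'[symmetric])
    have 2: "Lnorm M P ?G = 1" using pp b by (simp add: Lnorm_cmult ennreal_mult'[symmetric])
    have "(\<integral>\<^sup>+x. ?F x * ?G x \<partial>M) \<le> (\<integral>\<^sup>+x. ennreal (1/p) * epowr (?F x) p + ennreal (1/P) * epowr (?G x) P \<partial>M)"
      by (intro nn_integral_mono Young_ennreal)
    also have "\<dots> = ennreal (1/p) * epowr (Lnorm M p ?F) p + ennreal (1/P) * epowr (Lnorm M P ?G) P"
      using pp by (simp add: nn_integral_add nn_integral_cmult epowr_Lnorm)
    also have "\<dots> = ennreal (1/p + 1/P)" unfolding 1 2 using pp
      by (subst ennreal_plus) (auto simp: epowr_def)
    finally have "(\<integral>\<^sup>+x. ?F x * ?G x \<partial>M) \<le> 1" by (simp add: conj_eq)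
    then have le: "ennreal (a * b) * (\<integral>\<^sup>+x. ?F x * ?G x \<partial>M) \<le> ennreal (a * b) * 1"
      by (intro mult_left_mono) auto
    have eq: "F x * G x = ennreal (a * b) * (?F x * ?G x)" for x
    proof -
      have "ennreal (a * b) * (?F x * ?G x) = ennreal (a * b) * (ennreal (1/a) * ennreal (1/b)) * (F x * G x)"
        by (simp add: mult_ac)
      also have "ennreal (a * b) * (ennreal (1/a) * ennreal (1/b)) = 1"
        using a(2) b(2) by (simp add: ennreal_mult'[symmetric])
      finally show ?thesis by simp
    qed
    have "(\<integral>\<^sup>+x. F x * G x \<partial>M) = ennreal (a * b) * (\<integral>\<^sup>+x. ?F x * ?G x \<partial>M)"
      by (subst eq, subst nn_integral_cmult) auto
    then show ?thesis using le a b by (simp add: ennreal_mult')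
  qed
qed

text \<open>The extremal test function is a truncation of the power \<open>G\<^sup>p\<^sup>-\<^sup>1\<close>.\<close>
lemma (in conjugate_exponents) Lnorm_leI_dual:
  assumes "sigma_finite_measure M" and [measurable]: "G \<in> borel_measurable M"
    and test: "\<And>b. b \<in> borel_measurable M \<Longrightarrow> (\<And>x. 0 \<le> b x) \<Longrightarrow> bdd_above (range b) \<Longrightarrow>
        emeasure M {x \<in> space M. b x \<noteq> 0} < top \<Longrightarrow> Lnorm M P (\<lambda>x. ennreal (b x)) < top \<Longrightarrow>
        (\<integral>\<^sup>+x. ennreal (b x) * G x \<partial>M) \<le> R * Lnorm M P (\<lambda>x. ennreal (b x))"
  shows "Lnorm M p G \<le> R"
proof -
  interpret sigma_finite_measure M by fact
  obtain A :: "nat \<Rightarrow> 'a set" where A: "range A \<subseteq> sets M" "(\<Union>i. A i) = space M"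
      "\<And>i. emeasure M (A i) \<noteq> \<infinity>" "incseq A"
    using sigma_finite_incseq by auto
  have [measurable]: "A i \<in> sets M" for i using A by auto
  note pp = pos conj_pos one_less
  \<comment> \<open>Cutting off both the domain and the values keeps the integral of the p-th power
    finite, so that a power of it may be divided out below. Fatou's lemma removes the cut-off at the
    end.\<close>
  define g where "g m x = (if x \<in> A m then enn2real (min (G x) (ennreal (real m))) else 0)" for m x
  have [measurable]: "g m \<in> borel_measurable M" for m unfolding g_def by measurable
  have g0: "0 \<le> g m x" for m x by (simp add: g_def)
  have gz: "x \<notin> A m \<Longrightarrow> g m x = 0" for m x by (simp add: g_def)
  have gm: "g m x \<le> m" for m x
    by (auto simp: g_def intro!: enn2real_leI min.coboundedI2)
  have gG: "ennreal (g m x) = (if x \<in> A m then min (G x) (ennreal (real m)) else 0)" for m x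
    by (cases "G x") (auto simp: g_def min_def top_unique ennreal_le_iff2)
  have gle: "Lnorm M p (\<lambda>x. ennreal (g m x)) \<le> R" for m
  proof -
    define b where "b x = g m x powr (p - 1)" for x
    have [measurable]: "b \<in> borel_measurable M" unfolding b_def by measurable
    let ?I = "\<integral>\<^sup>+x. epowr (ennreal (g m x)) p \<partial>M"
    have "?I \<le> (\<integral>\<^sup>+x. ennreal (m powr p) * indicator (A m) x \<partial>M)"
      using g0 gm pp by (intro nn_integral_mono)
        (auto simp: indicator_def ennreal_leI powr_mono2 gz)
    also have "\<dots> < top" using A(3)[of m]
      by (auto simp: nn_integral_cmult_indicator ennreal_mult_eq_top_iff less_top[symmetric])
    finally have fin: "?I < top" .
    have bP: "epowr (ennreal (b x)) P = epowr (ennreal (g m x)) p" for x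
      using g0 by (simp add: b_def powr_powr conj_mult)
    have bn: "Lnorm M P (\<lambda>x. ennreal (b x)) = epowr ?I (1/P)"
      by (simp only: Lnorm_def bP)
    have "?I = (\<integral>\<^sup>+x. ennreal (b x) * ennreal (g m x) \<partial>M)"
    proof (intro nn_integral_cong)
      fix x show "epowr (ennreal (g m x)) p = ennreal (b x) * ennreal (g m x)"
        using g0[of m x] powr_add[of "g m x" "p - 1" 1]
        by (simp add: b_def ennreal_mult'[symmetric])
    qed
    also have "\<dots> \<le> (\<integral>\<^sup>+x. ennreal (b x) * G x \<partial>M)"
      by (intro nn_integral_mono mult_left_mono) (auto simp: gG)
    also have "\<dots> \<le> R * Lnorm M P (\<lambda>x. ennreal (b x))"
    proof (intro test)
      show "bdd_above (range b)" unfolding b_def using gm g0 pp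
        by (intro bdd_aboveI[of _ "m powr (p - 1)"]) (auto intro!: powr_mono2)
      have "emeasure M {x \<in> space M. b x \<noteq> 0} \<le> emeasure M (A m)"
        by (intro emeasure_mono) (auto simp: b_def g_def split: if_splits)
      then show "emeasure M {x \<in> space M. b x \<noteq> 0} < top" using A(3)[of m] by (auto simp: less_top top_unique)
      show "Lnorm M P (\<lambda>x. ennreal (b x)) < top" using fin by (simp add: bn)
    qed (auto simp: b_def)
    finally have le: "?I \<le> R * epowr ?I (1/P)" by (simp add: bn)
    show ?thesis
    proof (cases "?I = 0")
      case True then show ?thesis by (simp add: Lnorm_def)
    next
      case False
      let ?c = "epowr ?I (1/P)"
      have c: "?c \<noteq> 0" "?c \<noteq> top" using False fin by auto
      have "epowr ?I (1/p) * ?c = ?I"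
        by (simp add: epowr_add[symmetric] conj_eq)
      then have "epowr ?I (1/p) * ?c \<le> R * ?c" using le by simp
      then have "epowr ?I (1/p) \<le> R" using c
        using ennreal_mult_le_mult_iff[of ?c "epowr ?I (1/p)" R] by (simp add: mult.commute)
      then show ?thesis by (simp add: Lnorm_def)
    qed
  qed
  have lim: "(\<lambda>m. ennreal (g m x)) \<longlonglongrightarrow> G x" if "x \<in> space M" for x
  proof -
    have "x \<in> (\<Union>i. A i)" using A(2) that by simp
    then obtain i where i: "x \<in> A i" by (rule UN_E)
    then have ev: "eventually (\<lambda>m. ennreal (g m x) = min (G x) (ennreal (real m))) sequentially"
      using \<open>incseq A\<close> by (auto simp: gG incseq_def eventually_sequentially intro!: exI[of _ i])
    have "(\<lambda>m. min (G x) (ennreal (real m))) \<longlonglongrightarrow> min (G x) top"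
      using of_nat_tendsto_top_ennreal
      by (intro tendsto_min tendsto_const) (simp only: ennreal_of_nat_eq_real_of_nat)
    then show ?thesis using tendsto_cong[OF ev] by simp
  qed
  show ?thesis
    by (rule Lnorm_Fatou_le[where F="\<lambda>m x. ennreal (g m x)"])
      (use gle pp lim_imp_Liminf[OF _ lim] in auto)
qed

section \<open>Minkowski inequalities obtained by dual testing\<close>

context
  fixes p :: real
  assumes p: "1 < p"
begin

interpretation conjugate_exponents p "p / (p - 1)"
  using p by unfold_locales (simp_all add: diff_divide_distrib)

text \<open>Testing against \<open>b\<close> turns the claim into additivity of the integral
  followed by Hoelder for each summand. The same pattern gives the versions for series and for
  integrals.\<close>

lemma Lnorm_add:
  assumes M: "sigma_finite_measure M" and [measurable]: "F \<in> borel_measurable M" "G \<in> borel_measurable M"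
  shows "Lnorm M p (\<lambda>x. F x + G x) \<le> Lnorm M p F + Lnorm M p G"
proof (rule Lnorm_leI_dual[OF M])
  fix b :: "'a \<Rightarrow> real" assume [measurable]: "b \<in> borel_measurable M"
  let ?b = "\<lambda>x. ennreal (b x)"
  have "(\<integral>\<^sup>+x. ?b x * (F x + G x) \<partial>M) = (\<integral>\<^sup>+x. F x * ?b x + G x * ?b x \<partial>M)"
    by (simp only: distrib_right mult.commute[of "ennreal (b _)"])
  also have "\<dots> = (\<integral>\<^sup>+x. F x * ?b x \<partial>M) + (\<integral>\<^sup>+x. G x * ?b x \<partial>M)"
    by (intro nn_integral_add) auto
  also have "\<dots> \<le> Lnorm M p F * Lnorm M (p / (p - 1)) ?b + Lnorm M p G * Lnorm M (p / (p - 1)) ?b"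
    by (intro add_mono Hoelder) auto
  finally show "(\<integral>\<^sup>+x. ?b x * (F x + G x) \<partial>M) \<le> (Lnorm M p F + Lnorm M p G) * Lnorm M (p / (p - 1)) ?b"
    by (simp add: distrib_right)
qed auto

lemma Lnorm_suminf:
  assumes M: "sigma_finite_measure M" and [measurable]: "\<And>i. F i \<in> borel_measurable M"
  shows "Lnorm M p (\<lambda>x. \<Sum>i. F i x) \<le> (\<Sum>i. Lnorm M p (F i))"
proof (rule Lnorm_leI_dual[OF M])
  fix b :: "'a \<Rightarrow> real" assume [measurable]: "b \<in> borel_measurable M"
  let ?b = "\<lambda>x. ennreal (b x)"
  have "(\<integral>\<^sup>+x. ?b x * (\<Sum>i. F i x) \<partial>M) = (\<integral>\<^sup>+x. (\<Sum>i. F i x * ?b x) \<partial>M)"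
    by (simp only: ennreal_suminf_multc mult.commute[of "ennreal (b _)"])
  also have "\<dots> = (\<Sum>i. \<integral>\<^sup>+x. F i x * ?b x \<partial>M)"
    by (intro nn_integral_suminf) auto
  also have "\<dots> \<le> (\<Sum>i. Lnorm M p (F i) * Lnorm M (p / (p - 1)) ?b)"
    by (intro suminf_le Hoelder) auto
  finally show "(\<integral>\<^sup>+x. ?b x * (\<Sum>i. F i x) \<partial>M) \<le> (\<Sum>i. Lnorm M p (F i)) * Lnorm M (p / (p - 1)) ?b"
    by (simp only: ennreal_suminf_multc)
qed auto

text \<open>After testing, sum and integral of nonnegative functions may be exchanged. The lemma
  moves the l_q norm of a sequence of kernel integrals under the integral sign.\<close>

lemma Lnorm_count_integral_le:
  fixes F :: "nat \<Rightarrow> 'a \<Rightarrow> ennreal"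
  assumes [measurable]: "\<And>j. F j \<in> borel_measurable N"
  shows "Lnorm (count_space UNIV) p (\<lambda>j. \<integral>\<^sup>+y. F j y \<partial>N)
      \<le> (\<integral>\<^sup>+y. Lnorm (count_space UNIV) p (\<lambda>j. F j y) \<partial>N)"
proof (rule Lnorm_leI_dual)
  show "sigma_finite_measure (count_space (UNIV :: nat set))"
    by (rule sigma_finite_measure_count_space)
  fix b :: "nat \<Rightarrow> real"
  let ?b = "\<lambda>x. ennreal (b x)" and ?C = "count_space (UNIV :: nat set)"
  have [measurable]: "(\<lambda>y. Lnorm ?C p (\<lambda>j. F j y)) \<in> borel_measurable N"
    unfolding Lnorm_def nn_integral_count_space_nat by measurable
  have "(\<integral>\<^sup>+j. ?b j * (\<integral>\<^sup>+y. F j y \<partial>N) \<partial>?C) = (\<Sum>j. \<integral>\<^sup>+y. F j y * ?b j \<partial>N)"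
    unfolding nn_integral_count_space_nat
    by (intro suminf_cong) (simp add: nn_integral_multc mult.commute[of "ennreal (b _)"])
  also have "\<dots> = (\<integral>\<^sup>+y. (\<Sum>j. F j y * ?b j) \<partial>N)"
    by (intro nn_integral_suminf[symmetric]) auto
  also have "\<dots> = (\<integral>\<^sup>+y. (\<integral>\<^sup>+j. F j y * ?b j \<partial>?C) \<partial>N)"
    unfolding nn_integral_count_space_nat ..
  also have "\<dots> \<le> (\<integral>\<^sup>+y. Lnorm ?C p (\<lambda>j. F j y) * Lnorm ?C (p / (p - 1)) ?b \<partial>N)"
    by (intro nn_integral_mono Hoelder) auto
  also have "\<dots> = (\<integral>\<^sup>+y. Lnorm ?C p (\<lambda>j. F j y) \<partial>N) * Lnorm ?C (p / (p - 1)) ?b"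
    by (simp add: nn_integral_multc)
  finally show "(\<integral>\<^sup>+j. ?b j * (\<integral>\<^sup>+y. F j y \<partial>N) \<partial>?C)
      \<le> (\<integral>\<^sup>+y. Lnorm ?C p (\<lambda>j. F j y) \<partial>N) * Lnorm ?C (p / (p - 1)) ?b" .
qed auto

end

subsection \<open>Lebesgue norms on subsets\<close>

lemma sigma_finite_lebesgue: "sigma_finite_measure (lebesgue :: 'a::euclidean_space measure)"
proof -

  obtain A :: "nat \<Rightarrow> 'a set" where A: "range A \<subseteq> sets lborel" "(\<Union>i. A i) = space lborel"
      "\<And>i. emeasure lborel (A i) \<noteq> \<infinity>"
    using lborel.sigma_finite by blast
  show ?thesis
  proof
    show "\<exists>B::'a set set. countable B \<and> B \<subseteq> sets lebesgue \<and> \<Union>B = space lebesgue \<and>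
        (\<forall>a\<in>B. emeasure lebesgue a \<noteq> \<infinity>)"
      using A by (intro exI[of _ "range A"]) (auto simp: emeasure_completion)
  qed
qed

text \<open>Restriction to a set becomes multiplication by an indicator, so that the facts on
  \<open>Lnorm\<close> carry over to norms on subsets.\<close>

lemma Lp_enorm_on_eq: "Lp_enorm_on p A F = Lnorm lebesgue p (\<lambda>x. F x * indicator A x)"
  unfolding Lp_enorm_on_def Lnorm_def
  by (intro arg_cong[of _ _ "\<lambda>t. epowr t (1/p)"] nn_integral_cong) (auto simp: indicator_def)

lemma Lp_enorm_on_UNIV: "Lp_enorm_on p UNIV F = Lnorm lebesgue p F"
  by (simp add: Lp_enorm_on_eq)

lemma Lp_enorm_on_indicator:
  "Lp_enorm_on p UNIV (\<lambda>x. F x * indicator A x) = Lp_enorm_on p A F"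
  by (simp add: Lp_enorm_on_eq)

lemma Lp_mono_AE:
  "0 < p \<Longrightarrow> (AE x in lebesgue. x \<in> A \<longrightarrow> F x \<le> G x) \<Longrightarrow> Lp_enorm_on p A F \<le> Lp_enorm_on p A G"
  unfolding Lp_enorm_on_eq by (intro Lnorm_mono_AE) (auto simp: indicator_def)

lemma Lp_mono:
  "0 < p \<Longrightarrow> (\<And>x. x \<in> A \<Longrightarrow> F x \<le> G x) \<Longrightarrow> Lp_enorm_on p A F \<le> Lp_enorm_on p A G"
  by (rule Lp_mono_AE) auto

lemma Lp_mono_set:
  "0 < p \<Longrightarrow> A \<subseteq> B \<Longrightarrow> Lp_enorm_on p A F \<le> Lp_enorm_on p B F"
  unfolding Lp_enorm_on_eq by (intro Lnorm_mono_AE) (auto simp: indicator_def)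

lemma Lp_le_UNIV: "0 < p \<Longrightarrow> Lp_enorm_on p A F \<le> Lp_enorm_on p UNIV F"
  by (rule Lp_mono_set) auto

lemma Lp_cmult:
  assumes "0 < p" "A \<in> sets lebesgue" "F \<in> borel_measurable lebesgue"
  shows "Lp_enorm_on p A (\<lambda>x. c * F x) = c * Lp_enorm_on p A F"
  using assms by (simp add: Lp_enorm_on_eq mult.assoc Lnorm_cmult)

lemma Lp_add:
  assumes "1 < p" "A \<in> sets lebesgue" "F \<in> borel_measurable lebesgue" "G \<in> borel_measurable lebesgue"
  shows "Lp_enorm_on p A (\<lambda>x. F x + G x) \<le> Lp_enorm_on p A F + Lp_enorm_on p A G"
  using assms by (simp add: Lp_enorm_on_eq distrib_right Lnorm_add sigma_finite_lebesgue)

lemma Lp_suminf: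
  assumes "1 < p" "A \<in> sets lebesgue" "\<And>i. F i \<in> borel_measurable lebesgue"
  shows "Lp_enorm_on p A (\<lambda>x. \<Sum>i. F i x) \<le> (\<Sum>i. Lp_enorm_on p A (F i))"
  using Lnorm_suminf[of p lebesgue "\<lambda>i x. F i x * indicator A x"] assms
  by (simp add: Lp_enorm_on_eq sigma_finite_lebesgue)

lemma Lp_Fatou:
  assumes "0 < p" "A \<in> sets lebesgue" "\<And>i. F i \<in> borel_measurable lebesgue"
    and "AE x in lebesgue. x \<in> A \<longrightarrow> G x \<le> liminf (\<lambda>i. F i x)"
  shows "Lp_enorm_on p A G \<le> liminf (\<lambda>i. Lp_enorm_on p A (F i))"
  unfolding Lp_enorm_on_eq using assms
  by (intro Lnorm_Fatou) (auto simp: indicator_def elim!: AE_mp)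

lemma Lp_Fatou_le:
  assumes "0 < p" "A \<in> sets lebesgue" "\<And>i. F i \<in> borel_measurable lebesgue"
    and "AE x in lebesgue. x \<in> A \<longrightarrow> G x \<le> liminf (\<lambda>i. F i x)" "\<And>i. Lp_enorm_on p A (F i) \<le> R"
  shows "Lp_enorm_on p A G \<le> R"
proof -
  have "liminf (\<lambda>i. Lp_enorm_on p A (F i)) \<le> liminf (\<lambda>i::nat. R)"
    using assms(5) by (intro Liminf_mono) auto
  then show ?thesis using Lp_Fatou[OF assms(1-4)] by (simp add: Liminf_const)
qed

lemma Lp_eq_0_iff:
  assumes "F \<in> borel_measurable lebesgue" "A \<in> sets lebesgue"
  shows "Lp_enorm_on p A F = 0 \<longleftrightarrow> (AE x in lebesgue. x \<in> A \<longrightarrow> F x = 0)"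
  using assms by (subst Lp_enorm_on_eq, subst Lnorm_eq_0_iff) (auto simp: indicator_def intro!: AE_cong)

lemma AE_finite_if_Lp_finite:
  assumes "0 < p" "F \<in> borel_measurable lebesgue" "A \<in> sets lebesgue" "Lp_enorm_on p A F < top"
  shows "AE x in lebesgue. x \<in> A \<longrightarrow> F x < top"
proof -
  have "AE x in lebesgue. F x * indicator A x < top"
    using assms by (intro AE_finite_if_Lnorm_finite[of p]) (auto simp: Lp_enorm_on_eq)
  then show ?thesis by eventually_elim (auto simp: indicator_def split: if_splits)
qed

lemma Lp_const:
  assumes "0 < p" "A \<in> sets lebesgue"
  shows "Lp_enorm_on p A (\<lambda>_. c) = c * epowr (emeasure lebesgue A) (1 / p)"
  using assms by (simp add: Lp_enorm_on_def nn_integral_cmult_indicator epowr_mult epowr_epowr)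

lemma (in conjugate_exponents) Hoelder_on:
  assumes [measurable]: "F \<in> borel_measurable lebesgue" "G \<in> borel_measurable lebesgue" "A \<in> sets lebesgue"
  shows "(\<integral>\<^sup>+x\<in>A. F x * G x \<partial>lebesgue) \<le> Lp_enorm_on p A F * Lp_enorm_on P A G"
proof -
  have "(\<integral>\<^sup>+x\<in>A. F x * G x \<partial>lebesgue) = (\<integral>\<^sup>+x. (F x * indicator A x) * (G x * indicator A x) \<partial>lebesgue)"
    by (intro nn_integral_cong) (auto simp: indicator_def)
  also have "\<dots> \<le> Lp_enorm_on p A F * Lp_enorm_on P A G"
    unfolding Lp_enorm_on_eq by (intro Hoelder) auto
  finally show ?thesis .
qed

subsection \<open>The pointwise \<open>\<ell>\<^sub>q\<close> norm\<close>

lemma lq_function_eq: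
  "lq_function q f x = Lnorm (count_space UNIV) q (\<lambda>j. ennreal (cmod (f j x)))"
  by (simp add: lq_function_def Lnorm_def nn_integral_count_space_nat)

lemma measurable_lq_function [measurable]:
  assumes [measurable]: "\<And>j. f j \<in> borel_measurable lebesgue"
  shows "lq_function q f \<in> borel_measurable lebesgue"
  unfolding lq_function_def[abs_def] by measurable

lemma measurable_eabs [measurable]:
  "f \<in> borel_measurable lebesgue \<Longrightarrow> eabs f \<in> borel_measurable lebesgue"
  unfolding eabs_def[abs_def] by measurable

lemma lq_mono:
  assumes "0 < q" "\<And>j. cmod (f j x) \<le> cmod (g j y)" shows "lq_function q f x \<le> lq_function q g y"
  unfolding lq_function_eq using assms by (intro Lnorm_mono_AE) (auto intro!: ennreal_leI)

lemma lq_triangle: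
  assumes "1 < q" "\<And>j. cmod (f j x) \<le> cmod (g j x) + cmod (h j x)"
  shows "lq_function q f x \<le> lq_function q g x + lq_function q h x"
proof -
  have "lq_function q f x \<le> Lnorm (count_space UNIV) q (\<lambda>j. ennreal (cmod (g j x)) + ennreal (cmod (h j x)))"
    unfolding lq_function_eq using assms
    by (intro Lnorm_mono_AE) (auto simp: ennreal_plus[symmetric] simp del: ennreal_plus)
  also have "\<dots> \<le> lq_function q g x + lq_function q h x"
    unfolding lq_function_eq using assms by (intro Lnorm_add sigma_finite_measure_count_space) auto
  finally show ?thesis .
qed

lemma lq_suminf:
  assumes "1 < q" "\<And>j. ennreal (cmod (f j x)) \<le> (\<Sum>i. ennreal (cmod (g i j x)))"
  shows "lq_function q f x \<le> (\<Sum>i. lq_function q (g i) x)"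
proof -
  have "lq_function q f x \<le> Lnorm (count_space UNIV) q (\<lambda>j. \<Sum>i. ennreal (cmod (g i j x)))"
    unfolding lq_function_eq using assms by (intro Lnorm_mono_AE) auto
  also have "\<dots> \<le> (\<Sum>i. lq_function q (g i) x)"
    unfolding lq_function_eq using assms by (intro Lnorm_suminf sigma_finite_measure_count_space) auto
  finally show ?thesis .
qed

lemma ennreal_le_suminf: "f j \<le> (\<Sum>i. f i)" for f :: "nat \<Rightarrow> ennreal"
proof -
  have "sum f {j} \<le> (\<Sum>i. f i)" by (rule sum_le_suminf) auto
  then show ?thesis by simp
qed

lemma lq_ge:
  assumes "0 < q" shows "ennreal (cmod (f j x)) \<le> lq_function q f x"
proof -
  have "ennreal (cmod (f j x) powr q) \<le> (\<Sum>j. ennreal (cmod (f j x) powr q))"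
    by (rule ennreal_le_suminf)
  then have "epowr (ennreal (cmod (f j x) powr q)) (1/q) \<le> lq_function q f x"
    unfolding lq_function_def using assms by (intro epowr_mono) auto
  then show ?thesis using assms by (simp add: powr_powr)
qed

lemma lq_single [simp]:
  assumes "0 < q" shows "lq_function q (\<lambda>i x. if i = j then f x else 0) x = ennreal (cmod (f x))"
proof -
  have "(\<Sum>i. ennreal (cmod (if i = j then f x else 0) powr q)) = (\<Sum>i\<in>{j}. ennreal (cmod (if i = j then f x else 0) powr q))"
    by (intro suminf_finite) auto
  then show ?thesis using assms by (simp add: lq_function_def powr_powr)
qed

text \<open>A sequence with one nonzero entry carries a scalar function into the vector-valued
  setting; scalar estimates become special cases of the estimates for sequences.\<close>

lemma lq_single_function: "0 < q \<Longrightarrow> lq_function q (\<lambda>i. if i = j then f else (\<lambda>x. 0)) = eabs f"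
proof
  fix x assume "0 < q"
  have "lq_function q (\<lambda>i. if i = j then f else (\<lambda>x. 0)) x = lq_function q (\<lambda>i x. if i = j then f x else 0) x"
    unfolding lq_function_def by (intro arg_cong[of _ _ "\<lambda>t. epowr t _"] suminf_cong) auto
  then show "lq_function q (\<lambda>i. if i = j then f else (\<lambda>x. 0)) x = eabs f x"
    using \<open>0 < q\<close> by (simp add: eabs_def)
qed

text \<open>Sequences are approximated entry by entry with errors of size 2^(-j). Comparison with
  the l_1 norm bounds the l_q norm of all errors together by a geometric series.\<close>

lemma lq_le_suminf:
  assumes "1 < q" shows "lq_function q f x \<le> (\<Sum>i. ennreal (cmod (f i x)))"
proof -
  have "lq_function q f x \<le> (\<Sum>i. lq_function q (\<lambda>k x. if k = i then f i x else 0) x)"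
  proof (rule lq_suminf[OF assms])
    fix j show "ennreal (cmod (f j x)) \<le> (\<Sum>i. ennreal (cmod (if j = i then f i x else 0)))"
      using ennreal_le_suminf[of "\<lambda>i. ennreal (cmod (if j = i then f i x else 0))" j] by simp
  qed
  then show ?thesis using assms by simp
qed

lemma lq_scale:
  assumes "0 < q" shows "lq_function q (\<lambda>j x. c x * f j x) x = ennreal (cmod (c x)) * lq_function q f x"
  using assms by (simp add: lq_function_eq norm_mult ennreal_mult' Lnorm_cmult)

lemma lq_Fatou:
  assumes "0 < q" "\<And>j. (\<lambda>k. f k j x) \<longlonglongrightarrow> g j x"
  shows "lq_function q g x \<le> liminf (\<lambda>k. lq_function q (f k) x)"
  unfolding lq_function_eq
proof (rule Lnorm_Fatou)
  have "liminf (\<lambda>i. ennreal (cmod (f i j x))) = ennreal (cmod (g j x))" for j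
    by (intro lim_imp_Liminf tendsto_ennrealI tendsto_norm assms) simp
  then show "AE j in count_space UNIV. ennreal (cmod (g j x)) \<le> liminf (\<lambda>i. ennreal (cmod (f i j x)))"
    by simp
qed (use assms in auto)

lemma (in conjugate_exponents) lq_Hoelder:
  "(\<Sum>j. ennreal (cmod (f j x)) * ennreal (cmod (g j x))) \<le> lq_function p f x * lq_function P g x"
  using Hoelder[of "\<lambda>j. ennreal (cmod (f j x))" "count_space UNIV" "\<lambda>j. ennreal (cmod (g j x))"]
  by (simp add: lq_function_eq nn_integral_count_space_nat)

subsection \<open>Cubes\<close>

text \<open>The annuli of the local estimate are differences of concentric cubes whose radii are not
  tied to the lattice of their centre, hence a notion with free centre and radius beside
  \<open>dyadic_cube\<close>.\<close>

definition cube :: "real ^ 'n \<Rightarrow> real \<Rightarrow> (real ^ 'n::finite) set" where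
  "cube x s = {z. \<forall>i. \<bar>z $ i - x $ i\<bar> \<le> s}"

lemma cube_eq_cbox: "cube x s = cbox (\<chi> i. x $ i - s) (\<chi> i. x $ i + s)"
  by (auto simp: cube_def mem_box_cart abs_le_iff algebra_simps)

lemma cube_sets [measurable]: "cube x s \<in> sets lebesgue" "cube x s \<in> sets borel"
  by (auto simp: cube_eq_cbox)

lemma compact_cube: "compact (cube x s)"
  by (simp add: cube_eq_cbox)

lemma cube_mono: "s \<le> t \<Longrightarrow> cube x s \<subseteq> cube x t"
  unfolding cube_def by (intro Collect_mono) (meson order_trans)

lemma emeasure_cube:
  fixes x :: "real ^ 'n::finite"
  assumes "0 \<le> s" shows "emeasure lebesgue (cube x s) = ennreal ((2 * s) ^ CARD('n))"
proof -
  have "x \<in> cube x s" using assms by (simp add: cube_def)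
  then have "cbox (\<chi> i. x $ i - s) (\<chi> i. x $ i + s) \<noteq> {}" by (auto simp: cube_eq_cbox)
  then have "measure lborel (cube x s) = (\<Prod>i\<in>(UNIV::'n set). 2 * s)"
    by (simp add: cube_eq_cbox content_cbox_cart)
  moreover have "emeasure lborel (cube x s) \<noteq> top"
    using emeasure_lborel_cbox_finite by (auto simp: cube_eq_cbox less_top)
  ultimately show ?thesis by (simp add: emeasure_eq_ennreal_measure)
qed

lemma emeasure_cube_lborel:
  fixes x :: "real ^ 'n::finite"
  assumes "0 \<le> s" shows "emeasure lborel (cube x s) = ennreal ((2 * s) ^ CARD('n))"
  using emeasure_cube[OF assms, of x] by simp

lemma dyadic_cube_eq:
  "dyadic_cube J M = cube (2 powr (- real_of_int J) *\<^sub>R (\<chi> i. real_of_int (M $ i))) (2 powr (- real_of_int J))"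
    (is "_ = cube (?s *\<^sub>R ?v) ?s")
proof (intro set_eqI iffI)
  fix z assume "z \<in> dyadic_cube J M"
  then obtain x where z: "z = ?s *\<^sub>R (?v + x)" and x: "\<And>i. -1 \<le> x $ i \<and> x $ i \<le> 1"
    by (auto simp: dyadic_cube_def)
  have "z $ i - (?s *\<^sub>R ?v) $ i = ?s * x $ i" for i by (simp add: z algebra_simps)
  moreover have "\<bar>?s * x $ i\<bar> \<le> ?s" for i
    using x[of i] mult_left_mono[of "\<bar>x $ i\<bar>" 1 ?s] by (simp add: abs_mult abs_le_iff)
  ultimately show "z \<in> cube (?s *\<^sub>R ?v) ?s" by (simp add: cube_def)
next
  fix z assume z: "z \<in> cube (?s *\<^sub>R ?v) ?s"
  let ?x = "(1 / ?s) *\<^sub>R (z - ?s *\<^sub>R ?v)"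
  have "z = ?s *\<^sub>R (?v + ?x)" by (simp add: scaleR_add_right)
  moreover have "-1 \<le> ?x $ i \<and> ?x $ i \<le> 1" for i
  proof -
    have "\<bar>z $ i - (?s *\<^sub>R ?v) $ i\<bar> \<le> ?s" using z by (simp add: cube_def)
    then have "\<bar>?x $ i\<bar> \<le> 1" by (simp add: abs_mult divide_le_eq)
    then show ?thesis unfolding abs_le_iff by linarith
  qed
  ultimately show "z \<in> dyadic_cube J M" unfolding dyadic_cube_def by blast
qed

lemma dyadic_cube_sets [measurable]: "dyadic_cube J M \<in> sets lebesgue"
  by (simp add: dyadic_cube_eq)

text \<open>Rounding the centre to the nearest lattice point moves each coordinate by at most half
  of 2^(-J), and the cube itself takes at most the other half. Dyadic cubes of one level overlap
  (spacing 2^(-J), side 2 * 2^(-J)), which is why one of them is enough.\<close>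

lemma cube_subset_dyadic:
  fixes x :: "real ^ 'n::finite"
  assumes "2 * s \<le> 2 powr (- real_of_int J)"
  obtains M where "cube x s \<subseteq> dyadic_cube J M"
proof -
  let ?t = "2 powr (- real_of_int J)"
  define M where "M = (\<chi> i. round (x $ i / ?t))"
  have near: "\<bar>x $ i - ?t * real_of_int (M $ i)\<bar> \<le> ?t / 2" for i
  proof -
    have "\<bar>real_of_int (M $ i) - x $ i / ?t\<bar> \<le> 1/2"
      unfolding M_def using of_int_round_abs_le[of "x $ i / ?t"] by simp
    then have "?t * \<bar>real_of_int (M $ i) - x $ i / ?t\<bar> \<le> ?t * (1/2)" by (intro mult_left_mono) auto
    then have "\<bar>?t * (real_of_int (M $ i) - x $ i / ?t)\<bar> \<le> ?t / 2" by (simp add: abs_mult)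
    then show ?thesis by (simp add: algebra_simps abs_minus_commute)
  qed
  have "cube x s \<subseteq> dyadic_cube J M"
  proof
    fix z assume "z \<in> cube x s"
    then have "\<bar>z $ i - x $ i\<bar> \<le> s" for i by (simp add: cube_def)
    then have "\<bar>z $ i - ?t * real_of_int (M $ i)\<bar> \<le> ?t" for i
      using near[of i] assms by (smt (verit) field_sum_of_halves)
    then show "z \<in> dyadic_cube J M" by (simp add: dyadic_cube_eq cube_def)
  qed
  then show ?thesis by (rule that)
qed

lemma Un_cubes: "(\<Union>m::nat. cube (x :: real ^ 'n::finite) (2 ^ m)) = UNIV"
proof (intro set_eqI iffI UNIV_I)
  fix z :: "real ^ 'n"
  obtain m :: nat where m: "norm (z - x) < 2 ^ m" using real_arch_pow[of 2] by auto
  have "\<bar>z $ i - x $ i\<bar> \<le> 2 ^ m" for i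
    using component_le_norm_cart[of "z - x" i] m by simp
  then show "z \<in> (\<Union>m. cube x (2 ^ m))" by (auto simp: cube_def)
qed

subsection \<open>Morrey norms\<close>

lemma morrey_enorm_ge:
  fixes M :: "int ^ 'n::finite"
  shows "ennreal (2 powr (real_of_int J * (real CARD('n) / p + r))) * Lp_enorm_on p (dyadic_cube J M) F
      \<le> morrey_enorm r p F"
  unfolding morrey_enorm_def by (rule SUP_upper2[of "(J, M)"]) auto

lemma morrey_enorm_leI:
  fixes F :: "real ^ 'n::finite \<Rightarrow> ennreal"
  assumes "\<And>J M. ennreal (2 powr (real_of_int J * (real CARD('n) / p + r))) * Lp_enorm_on p (dyadic_cube J M) F \<le> R"
  shows "morrey_enorm r p F \<le> R"
  unfolding morrey_enorm_def using assms by (auto intro: SUP_least)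

lemma morrey_mono_AE:
  assumes "0 < p" "AE x in lebesgue. F x \<le> G x"
  shows "morrey_enorm r p F \<le> morrey_enorm r p G"
proof (rule morrey_enorm_leI)
  fix J and M :: "int ^ 'a"
  have "Lp_enorm_on p (dyadic_cube J M) F \<le> Lp_enorm_on p (dyadic_cube J M) G"
    using assms by (intro Lp_mono_AE) auto
  then show "ennreal (2 powr (real_of_int J * (real CARD('a) / p + r))) * Lp_enorm_on p (dyadic_cube J M) F
      \<le> morrey_enorm r p G"
    by (intro order_trans[OF mult_left_mono morrey_enorm_ge]) auto
qed

lemma morrey_mono:
  "0 < p \<Longrightarrow> (\<And>x. F x \<le> G x) \<Longrightarrow> morrey_enorm r p F \<le> morrey_enorm r p G"
  by (rule morrey_mono_AE) auto

lemma morrey_cong_AE: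
  "0 < p \<Longrightarrow> AE x in lebesgue. F x = G x \<Longrightarrow> morrey_enorm r p F = morrey_enorm r p G"
  by (intro antisym morrey_mono_AE) (auto elim: AE_mp)

lemma morrey_add:
  assumes "1 < p" "F \<in> borel_measurable lebesgue" "G \<in> borel_measurable lebesgue"
  shows "morrey_enorm r p (\<lambda>x. F x + G x) \<le> morrey_enorm r p F + morrey_enorm r p G"
proof (rule morrey_enorm_leI)
  fix J and M :: "int ^ 'a"
  let ?w = "ennreal (2 powr (real_of_int J * (real CARD('a) / p + r)))"
  have "?w * Lp_enorm_on p (dyadic_cube J M) (\<lambda>x. F x + G x)
      \<le> ?w * (Lp_enorm_on p (dyadic_cube J M) F + Lp_enorm_on p (dyadic_cube J M) G)"
    using assms by (intro mult_left_mono Lp_add) auto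
  also have "\<dots> \<le> morrey_enorm r p F + morrey_enorm r p G"
    unfolding distrib_left[of ?w] by (intro add_mono morrey_enorm_ge)
  finally show "?w * Lp_enorm_on p (dyadic_cube J M) (\<lambda>x. F x + G x)
      \<le> morrey_enorm r p F + morrey_enorm r p G" .
qed

lemma morrey_suminf:
  assumes "1 < p" "\<And>i. F i \<in> borel_measurable lebesgue"
  shows "morrey_enorm r p (\<lambda>x. \<Sum>i. F i x) \<le> (\<Sum>i. morrey_enorm r p (F i))"
proof (rule morrey_enorm_leI)
  fix J and M :: "int ^ 'a"
  let ?w = "ennreal (2 powr (real_of_int J * (real CARD('a) / p + r)))"
  have "?w * Lp_enorm_on p (dyadic_cube J M) (\<lambda>x. \<Sum>i. F i x) \<le> ?w * (\<Sum>i. Lp_enorm_on p (dyadic_cube J M) (F i))"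
    using assms by (intro mult_left_mono Lp_suminf) auto
  also have "\<dots> = (\<Sum>i. ?w * Lp_enorm_on p (dyadic_cube J M) (F i))" by simp
  also have "\<dots> \<le> (\<Sum>i. morrey_enorm r p (F i))" by (intro suminf_le morrey_enorm_ge) auto
  finally show "?w * Lp_enorm_on p (dyadic_cube J M) (\<lambda>x. \<Sum>i. F i x) \<le> (\<Sum>i. morrey_enorm r p (F i))" .
qed

lemma morrey_Fatou:
  fixes F :: "nat \<Rightarrow> real ^ 'n::finite \<Rightarrow> ennreal"
  assumes "0 < p" "\<And>i. F i \<in> borel_measurable lebesgue"
    and "AE x in lebesgue. G x \<le> liminf (\<lambda>i. F i x)" "\<And>i. morrey_enorm r p (F i) \<le> R"
  shows "morrey_enorm r p G \<le> R"
proof (rule morrey_enorm_leI)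
  fix J and M :: "int ^ 'n"
  let ?w = "2 powr (real_of_int J * (real CARD('n) / p + r))"
  have "Lp_enorm_on p (dyadic_cube J M) G \<le> ennreal (1/?w) * R"
  proof (rule Lp_Fatou_le[OF assms(1) _ assms(2)])
    fix i
    have "ennreal ?w * Lp_enorm_on p (dyadic_cube J M) (F i) \<le> R"
      using morrey_enorm_ge assms(4) by (rule order_trans)
    then have "ennreal (1/?w) * (ennreal ?w * Lp_enorm_on p (dyadic_cube J M) (F i)) \<le> ennreal (1/?w) * R"
      by (intro mult_left_mono) auto
    then show "Lp_enorm_on p (dyadic_cube J M) (F i) \<le> ennreal (1/?w) * R"
      by (simp add: mult.assoc[symmetric] ennreal_mult'[symmetric])
  qed (use assms in auto)
  then have "ennreal ?w * Lp_enorm_on p (dyadic_cube J M) G \<le> ennreal ?w * (ennreal (1/?w) * R)"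
    by (intro mult_left_mono) auto
  then show "ennreal ?w * Lp_enorm_on p (dyadic_cube J M) G \<le> R"
    by (simp add: mult.assoc[symmetric] ennreal_mult'[symmetric])
qed

lemma Lp_le_morrey:
  fixes M :: "int ^ 'n::finite"
  shows "Lp_enorm_on p (dyadic_cube J M) F
      \<le> ennreal (2 powr (- real_of_int J * (real CARD('n) / p + r))) * morrey_enorm r p F"
proof -
  let ?w = "2 powr (real_of_int J * (real CARD('n) / p + r))" and ?v = "2 powr (- real_of_int J * (real CARD('n) / p + r))"
  have "ennreal ?v * (ennreal ?w * Lp_enorm_on p (dyadic_cube J M) F) \<le> ennreal ?v * morrey_enorm r p F"
    by (intro mult_left_mono morrey_enorm_ge) auto
  moreover have "?v * ?w = 1" by (simp add: powr_add[symmetric])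
  ultimately show ?thesis by (simp add: mult.assoc[symmetric] ennreal_mult'[symmetric])
qed

lemma Lp_cube_le_morrey:
  fixes x :: "real ^ 'n::finite"
  assumes "0 < p" "2 * s \<le> 2 powr (- real_of_int J)"
  shows "Lp_enorm_on p (cube x s) F
      \<le> ennreal (2 powr (- real_of_int J * (real CARD('n) / p + r))) * morrey_enorm r p F"
proof -
  obtain M where "cube x s \<subseteq> dyadic_cube J M" using cube_subset_dyadic assms(2) by blast
  then show ?thesis using Lp_le_morrey Lp_mono_set[OF assms(1)] by (blast intro: order_trans)
qed

lemma Lp_cube_finite:
  fixes x :: "real ^ 'n::finite"
  assumes "0 < p" "morrey_enorm r p F < top"
  shows "Lp_enorm_on p (cube x s) F < top"
proof -
  obtain m :: nat where m: "2 * s < 2 ^ m" using real_arch_pow[of 2] by auto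
  have "Lp_enorm_on p (cube x s) F \<le> ennreal (2 powr (- real_of_int (- int m) * (real CARD('n) / p + r))) * morrey_enorm r p F"
    using m by (intro Lp_cube_le_morrey assms) (simp add: powr_realpow)
  also have "\<dots> < top" using assms by (simp add: ennreal_mult_less_top)
  finally show ?thesis .
qed

lemma AE_cubesI:
  assumes "\<And>m::nat. AE x in lebesgue. x \<in> cube (0 :: real ^ 'n::finite) (2 ^ m) \<longrightarrow> Q x"
  shows "AE x in lebesgue. Q x"
proof -
  have "AE x in lebesgue. \<forall>m. x \<in> cube (0 :: real ^ 'n) (2 ^ m) \<longrightarrow> Q x"
    unfolding AE_all_countable using assms by blast
  then show ?thesis
  proof eventually_elim
    case (elim x)
    have "x \<in> (\<Union>m. cube 0 (2 ^ m))" by (simp add: Un_cubes)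
    then show ?case using elim by blast
  qed
qed

lemma morrey_eq_0_iff:
  fixes F :: "real ^ 'n::finite \<Rightarrow> ennreal"
  assumes "0 < p" "F \<in> borel_measurable lebesgue"
  shows "morrey_enorm r p F = 0 \<longleftrightarrow> (AE x in lebesgue. F x = 0)"
proof
  assume 0: "morrey_enorm r p F = 0"
  \<comment> \<open>The level -(m+1) supplies the factor 2 that the inclusion of an arbitrary cube
    in a dyadic one costs.\<close>
  have "Lp_enorm_on p (cube (0 :: real ^ 'n) (2 ^ m)) F = 0" for m
    using Lp_cube_le_morrey[of p "2^m" "- int (Suc m)" 0 F r] assms 0 by (simp add: powr_realpow powr_add)
  then show "AE x in lebesgue. F x = 0"
    by (rule_tac AE_cubesI) (simp add: Lp_eq_0_iff assms)
next
  assume *: "AE x in lebesgue. F x = 0"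
  have "morrey_enorm r p F = morrey_enorm r p (\<lambda>_::real ^ 'n. 0)"
    by (rule morrey_cong_AE[OF assms(1) *])
  moreover have "morrey_enorm r p (\<lambda>_::real ^ 'n. 0) \<le> 0"
    by (rule morrey_enorm_leI) (simp add: Lp_enorm_on_def)
  ultimately show "morrey_enorm r p F = 0" by simp
qed

lemma morrey_cmult_le:
  fixes F :: "real ^ 'n::finite \<Rightarrow> ennreal"
  assumes "0 < p" "F \<in> borel_measurable lebesgue"
  shows "morrey_enorm r p (\<lambda>x. c * F x) \<le> c * morrey_enorm r p F"
proof (rule morrey_enorm_leI)
  fix J and M :: "int ^ 'n"
  let ?w = "ennreal (2 powr (real_of_int J * (real CARD('n) / p + r)))"
  have "?w * Lp_enorm_on p (dyadic_cube J M) (\<lambda>x. c * F x) = c * (?w * Lp_enorm_on p (dyadic_cube J M) F)"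
    using assms by (simp add: Lp_cmult mult_ac)
  also have "\<dots> \<le> c * morrey_enorm r p F" by (intro mult_left_mono morrey_enorm_ge) auto
  finally show "?w * Lp_enorm_on p (dyadic_cube J M) (\<lambda>x. c * F x) \<le> c * morrey_enorm r p F" .
qed

text \<open>Small cubes are controlled by the supremum (as \<open>r < 0\<close>), large ones by the \<open>L\<^sub>p\<close> norm (as \<open>-n/p < r\<close>).\<close>
lemma morrey_le_sup_Lp:
  fixes F :: "real ^ 'n::finite \<Rightarrow> ennreal"
  assumes p: "0 < p" and r: "- real CARD('n) / p < r" "r < 0" and bd: "AE x in lebesgue. F x \<le> b"
  shows "morrey_enorm r p F \<le> ennreal (2 powr (real CARD('n) / p)) * b + Lp_enorm_on p UNIV F"
proof (rule morrey_enorm_leI)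
  fix J and M :: "int ^ 'n"
  let ?n = "real CARD('n)"
  let ?w = "2 powr (real_of_int J * (?n / p + r))"
  show "ennreal ?w * Lp_enorm_on p (dyadic_cube J M) F \<le> ennreal (2 powr (?n / p)) * b + Lp_enorm_on p UNIV F"
  proof (cases "0 \<le> J")
    case True
    have "Lp_enorm_on p (dyadic_cube J M) F \<le> Lp_enorm_on p (dyadic_cube J M) (\<lambda>_. b)"
      using p bd by (intro Lp_mono_AE) auto
    also have "\<dots> = b * ennreal (((2 * 2 powr (- J)) ^ CARD('n)) powr (1/p))"
      using p by (simp add: Lp_const dyadic_cube_eq emeasure_cube_lborel)
    also have "((2 * 2 powr (- J)) ^ CARD('n)) powr (1/p) = 2 powr ((1 - J) * ?n / p)"
    proof -
      have "(2 * 2 powr (- real_of_int J)) = 2 powr (1 - J)" by (simp add: powr_diff powr_minus divide_inverse)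
      then show ?thesis by (simp add: powr_realpow[symmetric] powr_powr)
    qed
    finally have "ennreal ?w * Lp_enorm_on p (dyadic_cube J M) F \<le> ennreal ?w * (b * ennreal (2 powr ((1 - J) * ?n / p)))"
      by (intro mult_left_mono) auto
    also have "\<dots> = ennreal (2 powr (?n / p + J * r)) * b"
      by (simp add: mult_ac ennreal_mult'[symmetric] powr_add[symmetric] field_simps)
        (simp add: mult_ac ennreal_mult'[symmetric] mult.assoc[symmetric] powr_add[symmetric] diff_divide_distrib)
    also have "\<dots> \<le> ennreal (2 powr (?n / p)) * b"
    proof -
      have "real_of_int J * r \<le> 0" using True r by (intro mult_nonneg_nonpos) auto
      then show ?thesis by (intro mult_right_mono ennreal_leI powr_mono) auto
    qed
    finally show ?thesis by (rule order_trans) simp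
  next
    case False
    have "0 < ?n / p + r" using r by simp
    then have "real_of_int J * (?n / p + r) \<le> 0" using False by (intro mult_nonpos_nonneg) auto
    then have "?w \<le> 2 powr 0" by (intro powr_mono) auto
    then have "ennreal ?w * Lp_enorm_on p (dyadic_cube J M) F \<le> 1 * Lp_enorm_on p UNIV F"
      using p by (intro mult_mono Lp_le_UNIV) auto
    then show ?thesis by (simp add: add_increasing)
  qed
qed

text \<open>A compact set lies in one cube, on which the Morrey norm controls the L_p norm; the
  local condition in the definition of the space is therefore implied by a finite norm.\<close>

lemma morrey_iff:
  fixes f :: "('n::finite) cfun"
  assumes "0 < p"
  shows "f \<in> morrey r p \<longleftrightarrow> f \<in> borel_measurable lebesgue \<and> morrey_enorm r p (eabs f) < top"
proof
  assume "f \<in> borel_measurable lebesgue \<and> morrey_enorm r p (eabs f) < top"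
  moreover have "Lp_enorm_on p K (eabs f) < \<infinity>" if "compact K" "morrey_enorm r p (eabs f) < top" for K
  proof -
    obtain B where B: "\<And>x. x \<in> K \<Longrightarrow> norm x \<le> B" using compact_imp_bounded[OF \<open>compact K\<close>] by (auto simp: bounded_iff)
    have "K \<subseteq> cube 0 B"
      using B by (auto simp: cube_def intro: order_trans[OF component_le_norm_cart])
    then have "Lp_enorm_on p K (eabs f) \<le> Lp_enorm_on p (cube 0 B) (eabs f)"
      using assms by (intro Lp_mono_set)
    also have "\<dots> < \<infinity>" using Lp_cube_finite[OF assms that(2)] by simp
    finally show ?thesis .
  qed
  ultimately show "f \<in> morrey r p" by (simp add: morrey_def Lp_loc_def)
qed (auto simp: morrey_def Lp_loc_def)

subsection \<open>Smooth functions\<close>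

lemma iterated_partial_Nil [simp]: "iterated_partial [] f = f"
  by (simp add: iterated_partial_def)

lemma iterated_partial_Cons: "iterated_partial (i # is) f = partial_derivative i (iterated_partial is f)"
  by (simp add: iterated_partial_def)

lemma iterated_partial_snoc: "iterated_partial (is @ [i]) f = iterated_partial is (partial_derivative i f)"
  by (simp add: iterated_partial_def)

lemma partial_derivative_eq:
  "(f has_derivative f') (at x) \<Longrightarrow> partial_derivative i f x = f' (axis i 1)"
  by (simp add: partial_derivative_def frechet_derivative_at[symmetric])

definition flat :: "real poly \<Rightarrow> real \<Rightarrow> real" where
  "flat P t = (if t \<le> 0 then 0 else poly P (1 / t) * exp (- (1 / t)))"

lemma poly_exp_tendsto_0: "((\<lambda>u. poly P u * exp (- u)) \<longlongrightarrow> (0::real)) at_top"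
proof -
  have "((\<lambda>u. \<Sum>i\<le>degree P. coeff P i * (u ^ i / exp u)) \<longlongrightarrow> (\<Sum>i\<le>degree P. coeff P i * 0)) at_top"
    by (intro tendsto_sum tendsto_mult tendsto_const tendsto_power_div_exp_0)
  then show ?thesis
    by (simp add: poly_altdef sum_distrib_right exp_minus divide_inverse mult.assoc)
qed

text \<open>For t > 0 differentiation of P(1/t) exp(-1/t) produces (1/t)^2 (P - P')(1/t) exp(-1/t).
  At t = 0 the right difference quotient is u P(u) exp(-u) with u = 1/h, and the exponential wins as
  u tends to infinity.\<close>

lemma flat_has_derivative:
  "(flat P has_real_derivative flat (monom 1 2 * (P - pderiv P)) t) (at t)"
proof -
  consider "t < 0" | "t = 0" | "0 < t" by linarith
  then show ?thesis
  proof cases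
    case 1
    have "((\<lambda>_. 0) has_real_derivative 0) (at t)" by simp
    then have "(flat P has_real_derivative 0) (at t)"
      by (rule has_field_derivative_transform_within_open[of _ _ _ "{..<0}"]) (use 1 in \<open>auto simp: flat_def\<close>)
    then show ?thesis using 1 by (simp add: flat_def)
  next
    case 3
    have "((\<lambda>t. poly P (1 / t) * exp (- (1 / t))) has_real_derivative
        flat (monom 1 2 * (P - pderiv P)) t) (at t)"
      using 3 by (auto intro!: derivative_eq_intros simp: flat_def poly_monom field_simps power2_eq_square)
    then show ?thesis
      by (rule has_field_derivative_transform_within_open[of _ _ _ "{0<..}"]) (use 3 in \<open>auto simp: flat_def\<close>)
  next
    case 2
    have l: "((\<lambda>h. flat P h / h) \<longlongrightarrow> 0) (at_left 0)"
      by (rule tendsto_eventually) (auto simp: flat_def eventually_at_filter)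
    have "((\<lambda>u. flat P (inverse u) / inverse u) \<longlongrightarrow> 0) at_top"
    proof (rule Lim_transform_eventually[OF poly_exp_tendsto_0[of "pCons 0 P"]])
      show "\<forall>\<^sub>F u in at_top. poly (pCons 0 P) u * exp (- u) = flat P (inverse u) / inverse u"
        using eventually_gt_at_top[of 0] by eventually_elim (simp add: flat_def divide_inverse mult_ac)
    qed
    then have "((\<lambda>h. flat P h / h) \<longlongrightarrow> 0) (at_right 0)" by (simp add: filterlim_at_right_to_top)
    with l have "((\<lambda>h. flat P h / h) \<longlongrightarrow> 0) (at 0)" by (rule filterlim_split_at)
    then show ?thesis using 2 by (simp add: has_field_derivative_iff flat_def)
  qed
qed

text \<open>Smoothness quantifies over all iterated partial derivatives, so that closure under
  products or inverses would call for Leibniz formulas of every order. A set of differentiable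
  functions that is closed under single partial derivatives consists of smooth functions, and
  closure under one derivative follows by induction over these generators.\<close>

inductive_set smooth_closure :: "('n::finite) cfun set" where
  base: "smooth f \<Longrightarrow> f \<in> smooth_closure"
| const: "(\<lambda>x. c) \<in> smooth_closure"
| linear: "bounded_linear l \<Longrightarrow> (\<lambda>x. complex_of_real (l x)) \<in> smooth_closure"
| flat: "bounded_linear l \<Longrightarrow> (\<lambda>x. complex_of_real (flat P (l x + c))) \<in> smooth_closure"
| add: "f \<in> smooth_closure \<Longrightarrow> g \<in> smooth_closure \<Longrightarrow> (\<lambda>x. f x + g x) \<in> smooth_closure"
| mult: "f \<in> smooth_closure \<Longrightarrow> g \<in> smooth_closure \<Longrightarrow> (\<lambda>x. f x * g x) \<in> smooth_closure"
| inverse: "f \<in> smooth_closure \<Longrightarrow> (\<And>x. f x \<noteq> 0) \<Longrightarrow> (\<lambda>x. inverse (f x)) \<in> smooth_closure"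

lemma smooth_partial: "smooth f \<Longrightarrow> smooth (partial_derivative i f)"
  unfolding smooth_def by (metis iterated_partial_snoc)

lemma smooth_differentiable: "smooth f \<Longrightarrow> f differentiable (at x)"
  unfolding smooth_def differentiable_on_def by (metis UNIV_I iterated_partial_Nil)

lemma smooth_closure_partial:
  fixes f :: "('n::finite) cfun"
  assumes "f \<in> smooth_closure"
  shows "(\<forall>x. f differentiable (at x)) \<and> (\<forall>i. partial_derivative i f \<in> smooth_closure)"
  using assms
proof induction
  case (base f)
  then show ?case by (simp add: smooth_differentiable smooth_partial smooth_closure.base)
next
  case (const c)
  have "partial_derivative i (\<lambda>x::real^'n. c) = (\<lambda>x. 0)" for i
    by (rule ext) (simp add: partial_derivative_eq[OF has_derivative_const])
  then show ?case by (simp add: smooth_closure.const)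
next
  case (linear l)
  have d: "((\<lambda>x. complex_of_real (l x)) has_derivative (\<lambda>h. complex_of_real (l h))) (at x)" for x
    using linear by (intro has_derivative_of_real bounded_linear_imp_has_derivative)
  have "partial_derivative i (\<lambda>x. complex_of_real (l x)) = (\<lambda>x. complex_of_real (l (axis i 1)))" for i
    by (rule ext) (simp add: partial_derivative_eq[OF d])
  then show ?case using d by (auto simp: smooth_closure.const differentiable_def)
next
  case (flat l P c)
  let ?Q = "monom 1 2 * (P - pderiv P)"
  have d: "((\<lambda>x. complex_of_real (flat P (l x + c))) has_derivative
      (\<lambda>h. complex_of_real (flat ?Q (l x + c) * l h))) (at x)" for x
  proof (rule has_derivative_of_real)
    have "((\<lambda>x. l x + c) has_derivative (\<lambda>h. l h + 0)) (at x)"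
      by (intro has_derivative_add has_derivative_const bounded_linear_imp_has_derivative flat)
    then have "((\<lambda>x. l x + c) has_derivative l) (at x)" by simp
    from has_derivative_compose[OF this flat_has_derivative[unfolded has_field_derivative_def]]
    show "((\<lambda>x. flat P (l x + c)) has_derivative (\<lambda>h. flat ?Q (l x + c) * l h)) (at x)" .
  qed
  have "partial_derivative i (\<lambda>x. complex_of_real (flat P (l x + c))) =
      (\<lambda>x. complex_of_real (flat ?Q (l x + c)) * complex_of_real (l (axis i 1)))" for i
    by (rule ext) (simp add: partial_derivative_eq[OF d])
  moreover have "(\<lambda>x. complex_of_real (flat ?Q (l x + c)) * complex_of_real (l (axis i 1))) \<in> smooth_closure" for i
    by (intro smooth_closure.mult smooth_closure.flat smooth_closure.const flat)
  ultimately show ?case using d by (auto simp: differentiable_def)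
next
  case (add f g)
  then obtain f' g' where d: "\<And>x. (f has_derivative f' x) (at x)" "\<And>x. (g has_derivative g' x) (at x)"
    unfolding differentiable_def by metis
  have d': "((\<lambda>x. f x + g x) has_derivative (\<lambda>h. f' x h + g' x h)) (at x)" for x
    by (intro has_derivative_add d)
  then have "partial_derivative i (\<lambda>x. f x + g x) = (\<lambda>x. partial_derivative i f x + partial_derivative i g x)" for i
    by (simp add: fun_eq_iff partial_derivative_eq[OF d'] partial_derivative_eq[OF d(1)] partial_derivative_eq[OF d(2)])
  then show ?case using d' add.IH by (auto simp: differentiable_def intro!: smooth_closure.add)
next
  case (mult f g)
  then obtain f' g' where d: "\<And>x. (f has_derivative f' x) (at x)" "\<And>x. (g has_derivative g' x) (at x)"
    unfolding differentiable_def by metis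
  have d': "((\<lambda>x. f x * g x) has_derivative (\<lambda>h. f x * g' x h + f' x h * g x)) (at x)" for x
    by (intro has_derivative_mult d)
  then have "partial_derivative i (\<lambda>x. f x * g x) = (\<lambda>x. f x * partial_derivative i g x + partial_derivative i f x * g x)" for i
    by (simp add: fun_eq_iff partial_derivative_eq[OF d'] partial_derivative_eq[OF d(1)] partial_derivative_eq[OF d(2)])
  then show ?case using d' mult by (auto simp: differentiable_def intro!: smooth_closure.add smooth_closure.mult)
next
  case (inverse f)
  then obtain f' where d: "\<And>x. (f has_derivative f' x) (at x)"
    unfolding differentiable_def by metis
  have d': "((\<lambda>x. inverse (f x)) has_derivative (\<lambda>h. - (inverse (f x) * f' x h * inverse (f x)))) (at x)" for x
    by (intro Deriv.has_derivative_inverse d inverse.hyps)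
  then have "partial_derivative i (\<lambda>x. inverse (f x)) =
      (\<lambda>x. (-1) * (inverse (f x) * (partial_derivative i f x * inverse (f x))))" for i
    by (simp add: fun_eq_iff partial_derivative_eq[OF d'] partial_derivative_eq[OF d])
  moreover have "(\<lambda>x. (-1) * (inverse (f x) * (partial_derivative i f x * inverse (f x)))) \<in> smooth_closure" for i
    using inverse by (intro smooth_closure.mult smooth_closure.const smooth_closure.inverse) auto
  ultimately show ?case using d' by (auto simp: differentiable_def)
qed

text \<open>Iterating the one-step result stays in the set, hence every member is smooth; the rule
  \<open>base\<close> gives the converse. The introduction rules of the set thus become closure
  rules for \<open>smooth\<close>.\<close>

lemma smooth_closure_eq: "smooth_closure = {f :: ('n::finite) cfun. smooth f}"
proof (intro equalityI subsetI CollectI)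
  fix f :: "'n cfun" assume f: "f \<in> smooth_closure"
  have "iterated_partial is f \<in> smooth_closure" for "is"
  proof (induction "is")
    case (Cons i "is") then show ?case by (simp add: iterated_partial_Cons smooth_closure_partial)
  qed (simp add: f)
  then show "smooth f"
    unfolding smooth_def differentiable_on_def
    using smooth_closure_partial differentiable_at_withinI by blast
qed (auto intro: smooth_closure.base)

lemmas smooth_intros = smooth_closure.intros(2-7)[unfolded smooth_closure_eq mem_Collect_eq]

lemma smooth_continuous: "smooth f \<Longrightarrow> continuous_on UNIV f"
  by (simp add: continuous_at_imp_continuous_on differentiable_imp_continuous_within smooth_differentiable)

lemma smooth_measurable [measurable_dest]:
  fixes f :: "('n::finite) cfun"
  assumes "smooth f" shows "f \<in> borel_measurable lebesgue"
proof -
  have "f \<in> borel_measurable lborel"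
    using borel_measurable_continuous_onI[OF smooth_continuous[OF assms]] by simp
  then show ?thesis by (rule measurable_completion)
qed

lemma smooth_prod: "finite A \<Longrightarrow> (\<And>a. a \<in> A \<Longrightarrow> smooth (f a)) \<Longrightarrow> smooth (\<lambda>x. \<Prod>a\<in>A. f a x)"
  by (induction A rule: finite_induct) (auto intro!: smooth_intros(1,5))

subsection \<open>Test functions\<close>

lemma supp_subset: "closed K \<Longrightarrow> (\<And>x. x \<notin> K \<Longrightarrow> f x = 0) \<Longrightarrow> supp f \<subseteq> K"
  unfolding supp_def by (rule closure_minimal) auto

lemma closed_supp [simp]: "closed (supp f)"
  by (simp add: supp_def)

lemma not_in_supp: "x \<notin> supp f \<Longrightarrow> f x = 0"
  unfolding supp_def using closure_subset[of "{x. f x \<noteq> 0}"] by auto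

lemma test_functionI:
  assumes "smooth f" "compact K" "\<And>x. x \<notin> K \<Longrightarrow> f x = 0" shows "f \<in> test_functions"
proof -
  have "supp f \<subseteq> K" using assms by (intro supp_subset compact_imp_closed)
  moreover have "compact (K \<inter> supp f)" using assms by (intro compact_Int_closed) (auto simp: supp_def)
  ultimately show ?thesis using assms by (simp add: test_functions_def Int_absorb1)
qed

lemma test_smooth: "f \<in> test_functions \<Longrightarrow> smooth f"
  by (simp add: test_functions_def)

lemma test_compact: "f \<in> test_functions \<Longrightarrow> compact (supp f)"
  by (simp add: test_functions_def)

lemma test_measurable [measurable_dest]: "f \<in> test_functions \<Longrightarrow> f \<in> borel_measurable lebesgue"
  by (simp add: smooth_measurable test_smooth)

lemma test_zero [simp]: "(\<lambda>x. 0) \<in> test_functions"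
  by (rule test_functionI[of _ "{}"]) (auto intro: smooth_intros)

lemma test_mult: "smooth g \<Longrightarrow> f \<in> test_functions \<Longrightarrow> (\<lambda>x. g x * f x) \<in> test_functions"
  by (rule test_functionI[of _ "supp f"]) (auto intro: smooth_intros test_smooth test_compact simp: not_in_supp)

lemma test_add: "f \<in> test_functions \<Longrightarrow> g \<in> test_functions \<Longrightarrow> (\<lambda>x. f x + g x) \<in> test_functions"
  by (rule test_functionI[of _ "supp f \<union> supp g"]) (auto intro: smooth_intros test_smooth test_compact simp: not_in_supp)

lemma test_cmult: "f \<in> test_functions \<Longrightarrow> (\<lambda>x. c * f x) \<in> test_functions"
  by (rule test_mult) (auto intro: smooth_intros)

lemma test_lincomb: "f \<in> test_functions \<Longrightarrow> g \<in> test_functions \<Longrightarrow> (\<lambda>x. a * f x + b * g x) \<in> test_functions"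
  by (intro test_add test_cmult)

lemma test_diff: "f \<in> test_functions \<Longrightarrow> g \<in> test_functions \<Longrightarrow> (\<lambda>x. f x - g x) \<in> test_functions"
  using test_lincomb[of f g 1 "-1"] by simp

lemma bounded_if_compact_supp:
  fixes f :: "('n::finite) cfun"
  assumes "continuous_on UNIV f" "compact K" "\<And>x. x \<notin> K \<Longrightarrow> f x = 0"
  obtains B where "0 \<le> B" "\<And>x. cmod (f x) \<le> B"
proof -
  have "bounded (f ` K)"
    using assms by (intro compact_imp_bounded compact_continuous_image) (auto intro: continuous_on_subset)
  then obtain B where B: "\<And>x. x \<in> K \<Longrightarrow> cmod (f x) \<le> B" by (auto simp: bounded_iff)
  have "cmod (f x) \<le> max B 0" for x
    using B[of x] assms(3)[of x] by (cases "x \<in> K") auto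
  then show ?thesis using that[of "max B 0"] by simp
qed

lemma iterated_partial_outside_supp:
  assumes "x \<notin> supp f" shows "iterated_partial is f x = 0"
  using assms
proof (induction "is" arbitrary: x)
  case Nil then show ?case by (simp add: not_in_supp)
next
  case (Cons i "is")
  have "((\<lambda>_. 0) has_derivative (\<lambda>_. 0 :: complex)) (at x)" by simp
  then have "(iterated_partial is f has_derivative (\<lambda>_. 0)) (at x)"
    by (rule has_derivative_transform_within_open[where s="- supp f"])
      (use Cons in \<open>auto simp: supp_def\<close>)
  then show ?case by (simp add: iterated_partial_Cons partial_derivative_eq)
qed

lemma smooth_iterated_partial: "smooth f \<Longrightarrow> smooth (iterated_partial is f)"
  by (induction "is") (auto simp: iterated_partial_Cons smooth_partial)

lemma test_subset_schwartz: "test_functions \<subseteq> schwartz_functions"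
proof
  fix f :: "'a cfun" assume f: "f \<in> test_functions"
  have "bounded (range (\<lambda>x. (1 + norm x) ^ N *\<^sub>R iterated_partial is f x))" for "is" N
  proof -
    obtain B where "\<And>x. cmod ((1 + norm x) ^ N *\<^sub>R iterated_partial is f x) \<le> B"
    proof (rule bounded_if_compact_supp[where K="supp f" and f="\<lambda>x. (1 + norm x) ^ N *\<^sub>R iterated_partial is f x"])
      show "continuous_on UNIV (\<lambda>x. (1 + norm x) ^ N *\<^sub>R iterated_partial is f x)"
        using f by (intro continuous_intros smooth_continuous smooth_iterated_partial test_smooth)
    qed (use f in \<open>auto simp: iterated_partial_outside_supp test_compact\<close>)
    then show ?thesis by (auto simp: bounded_iff)
  qed
  then show "f \<in> schwartz_functions" using f by (simp add: schwartz_functions_def test_smooth)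
qed

section \<open>Smooth transitions and plateau functions\<close>

definition smooth_step :: "real \<Rightarrow> real" where
  "smooth_step t = flat 1 t / (flat 1 t + flat 1 (1 - t))"

lemma flat_1: "0 \<le> flat 1 t" "0 < t \<Longrightarrow> 0 < flat 1 t" "t \<le> 0 \<Longrightarrow> flat 1 t = 0"
  by (auto simp: flat_def)

lemma smooth_step_denominator: "0 < flat 1 t + flat 1 (1 - t)"
  using flat_1[of t] flat_1[of "1 - t"] by (cases "0 < t") (auto intro: add_pos_nonneg)

lemma smooth_step_bounds: "0 \<le> smooth_step t" "smooth_step t \<le> 1"
  using flat_1(1)[of t] flat_1(1)[of "1 - t"] smooth_step_denominator[of t]
  by (auto simp: smooth_step_def divide_le_eq)

lemma smooth_step_0: "t \<le> 0 \<Longrightarrow> smooth_step t = 0"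
  by (simp add: smooth_step_def flat_1)

lemma smooth_step_1: "1 \<le> t \<Longrightarrow> smooth_step t = 1"
  using flat_1(2)[of t] by (simp add: smooth_step_def flat_1(3))

lemma smooth_smooth_step:
  assumes "bounded_linear l" shows "smooth (\<lambda>x. complex_of_real (smooth_step (l x + c)))"
proof -
  have e: "flat 1 (1 - (l x + c)) = flat 1 (- l x + (1 - c))" for x by (simp add: algebra_simps)
  have "smooth (\<lambda>x. complex_of_real (flat 1 (l x + c)) *
      inverse (complex_of_real (flat 1 (l x + c)) + complex_of_real (flat 1 (- l x + (1 - c)))))"
  proof (intro smooth_intros(3-6) assms bounded_linear_minus)
    fix x show "complex_of_real (flat 1 (l x + c)) + complex_of_real (flat 1 (- l x + (1 - c))) \<noteq> 0"
      using smooth_step_denominator[of "l x + c"] unfolding e of_real_add[symmetric] of_real_eq_0_iff by simp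
  qed
  then show ?thesis by (simp add: smooth_step_def e divide_inverse)
qed

lemma cube_plateau:
  fixes x :: "real ^ 'n::finite"
  assumes d: "0 < d"
  obtains \<psi> :: "real ^ 'n \<Rightarrow> real" where "smooth (\<lambda>z. complex_of_real (\<psi> z))"
    "\<And>z. 0 \<le> \<psi> z" "\<And>z. \<psi> z \<le> 1" "\<And>z. z \<in> cube x s \<Longrightarrow> \<psi> z = 1" "\<And>z. z \<notin> cube x (s + d) \<Longrightarrow> \<psi> z = 0"
proof
  \<comment> \<open>The two factors are \<open>smooth_step\<close> at 1 + (s + (z_i - x_i))/d and at
    1 + (s - (z_i - x_i))/d: both arguments are at least 1 inside the cube, and one is at most 0
    beyond s + d. They are written as a linear form plus a constant to match
    \<open>smooth_smooth_step\<close>.\<close>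
  define u where "u i z = smooth_step ((1/d) * z $ i + (s + d - x $ i) / d) * smooth_step ((-1/d) * z $ i + (s + d + x $ i) / d)"
    for i and z :: "real ^ 'n"
  let ?\<psi> = "\<lambda>z. \<Prod>i\<in>UNIV. u i z"
  have l: "bounded_linear (\<lambda>z::real^'n. c * z $ i)" for c i
    by (rule bounded_linear_const_mult[OF bounded_linear_vec_nth])
  show "smooth (\<lambda>z. complex_of_real (?\<psi> z))"
    unfolding of_real_prod u_def of_real_mult
    by (intro smooth_prod smooth_intros(5) smooth_smooth_step l) auto
  show "0 \<le> ?\<psi> z" for z by (intro prod_nonneg) (auto simp: u_def smooth_step_bounds)
  show "?\<psi> z \<le> 1" for z
    by (intro prod_le_1) (auto simp: u_def smooth_step_bounds mult_le_one)
  have a: "(1/d) * z $ i + (s + d - x $ i) / d = 1 + (s + (z $ i - x $ i)) / d"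
    "(-1/d) * z $ i + (s + d + x $ i) / d = 1 + (s - (z $ i - x $ i)) / d" for z :: "real ^ 'n" and i
    using d by (simp_all add: field_simps)
  show "?\<psi> z = 1" if "z \<in> cube x s" for z
  proof -
    have "u i z = 1" for i
    proof -
      have "\<bar>z $ i - x $ i\<bar> \<le> s" using that by (simp add: cube_def)
      then have "0 \<le> (s + (z $ i - x $ i)) / d" "0 \<le> (s - (z $ i - x $ i)) / d"
        using d by (auto intro!: divide_nonneg_pos)
      then show ?thesis unfolding u_def a by (simp add: smooth_step_1)
    qed
    then show ?thesis by simp
  qed
  show "?\<psi> z = 0" if z: "z \<notin> cube x (s + d)" for z
  proof -
    obtain i where i: "s + d < \<bar>z $ i - x $ i\<bar>" using z by (auto simp: cube_def not_le)
    then have "1 + (s + (z $ i - x $ i)) / d \<le> 0 \<or> 1 + (s - (z $ i - x $ i)) / d \<le> 0"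
      using d by (auto simp: field_simps abs_if split: if_splits)
    then have "u i z = 0" unfolding u_def a using smooth_step_0 by auto
    then show ?thesis by (intro prod_zero) auto
  qed
qed

lemma cube_subset_ball:
  fixes x :: "real ^ 'n::finite"
  assumes "real CARD('n) * s < d" shows "cube x s \<subseteq> ball x d"
proof
  fix z assume "z \<in> cube x s"
  then have "(\<Sum>i\<in>UNIV. \<bar>(z - x) $ i\<bar>) \<le> (\<Sum>i\<in>(UNIV::'n set). s)"
    by (intro sum_mono) (simp add: cube_def)
  then have "norm (z - x) < d" using norm_le_l1_cart[of "z - x"] assms by simp
  then show "z \<in> ball x d" by (simp add: dist_norm norm_minus_commute)
qed

lemma ball_subset_cube: "ball x d \<subseteq> cube x d"
proof
  fix z assume "z \<in> ball x d"
  then have "norm (z - x) < d" by (simp add: dist_norm norm_minus_commute)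
  then show "z \<in> cube x d"
    using component_le_norm_cart[of "z - x"] by (auto simp: cube_def intro: order_trans less_imp_le)
qed

text \<open>By compactness finitely many cubes cover K while their doubles stay in U. With a plateau
  psi on each cube, 1 minus the product of the factors 1 - psi equals 1 wherever one psi is 1 and
  vanishes wherever all of them vanish.\<close>

lemma plateau:
  fixes K U :: "(real ^ 'n::finite) set"
  assumes K: "compact K" and U: "open U" and KU: "K \<subseteq> U"
  obtains \<eta> :: "real ^ 'n \<Rightarrow> real" where "(\<lambda>x. complex_of_real (\<eta> x)) \<in> test_functions"
    "supp (\<lambda>x. complex_of_real (\<eta> x)) \<subseteq> U" "\<And>x. 0 \<le> \<eta> x" "\<And>x. \<eta> x \<le> 1" "\<And>x. x \<in> K \<Longrightarrow> \<eta> x = 1"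
proof -
  have "\<exists>e>0. cube x (e + e) \<subseteq> U" if x: "x \<in> K" for x
  proof -
    obtain d where d: "0 < d" "ball x d \<subseteq> U" using openE[OF U, of x] KU x by blast
    have "cube x (d / (4 * CARD('n)) + d / (4 * CARD('n))) \<subseteq> ball x d"
      using d by (intro cube_subset_ball) (simp add: field_simps)
    then show ?thesis using d by (intro exI[of _ "d / (4 * CARD('n))"]) auto
  qed
  then obtain e where e: "\<And>x. x \<in> K \<Longrightarrow> 0 < e x" "\<And>x. x \<in> K \<Longrightarrow> cube x (e x + e x) \<subseteq> U" by metis
  have "K \<subseteq> (\<Union>x\<in>K. ball x (e x))" using e(1) by (auto intro!: bexI)
  then obtain F where F: "F \<subseteq> K" "finite F" "K \<subseteq> (\<Union>x\<in>F. ball x (e x))"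
    using compactE_image[OF K, of K "\<lambda>x. ball x (e x)"] by auto
  have "\<exists>\<psi> :: real ^ 'n \<Rightarrow> real. smooth (\<lambda>z. complex_of_real (\<psi> z)) \<and> (\<forall>z. 0 \<le> \<psi> z \<and> \<psi> z \<le> 1) \<and>
      (\<forall>z\<in>cube x (e x). \<psi> z = 1) \<and> (\<forall>z. z \<notin> cube x (e x + e x) \<longrightarrow> \<psi> z = 0)" if "x \<in> F" for x
  proof -
    have "0 < e x" using e(1) F(1) that by auto
    then obtain \<psi> :: "real ^ 'n \<Rightarrow> real" where "smooth (\<lambda>z. complex_of_real (\<psi> z))"
      "\<And>z. 0 \<le> \<psi> z" "\<And>z. \<psi> z \<le> 1" "\<And>z. z \<in> cube x (e x) \<Longrightarrow> \<psi> z = 1" "\<And>z. z \<notin> cube x (e x + e x) \<Longrightarrow> \<psi> z = 0"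
      by (rule cube_plateau[where x=x and s="e x"]) (rule that; assumption)
    then show ?thesis by (intro exI[of _ \<psi>]) auto
  qed
  then obtain \<psi> :: "real ^ 'n \<Rightarrow> real ^ 'n \<Rightarrow> real" where \<psi>:
    "\<And>x. x \<in> F \<Longrightarrow> smooth (\<lambda>z. complex_of_real (\<psi> x z))" "\<And>x z. x \<in> F \<Longrightarrow> 0 \<le> \<psi> x z \<and> \<psi> x z \<le> 1"
    "\<And>x z. x \<in> F \<Longrightarrow> z \<in> cube x (e x) \<Longrightarrow> \<psi> x z = 1"
    "\<And>x z. x \<in> F \<Longrightarrow> z \<notin> cube x (e x + e x) \<Longrightarrow> \<psi> x z = 0" by metis
  define \<eta> where "\<eta> z = 1 - (\<Prod>x\<in>F. 1 - \<psi> x z)" for z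
  define L where "L = (\<Union>x\<in>F. cube x (e x + e x))"
  have L: "compact L" unfolding L_def using F(2) by (intro compact_UN) (auto simp: compact_cube)
  have z: "\<eta> z = 0" if "z \<notin> L" for z
    using that \<psi>(4) by (simp add: \<eta>_def L_def)
  have "smooth (\<lambda>z. 1 + (-1) * (\<Prod>x\<in>F. 1 + (-1) * complex_of_real (\<psi> x z)))"
    using F(2) \<psi>(1) by (intro smooth_intros(1,4,5) smooth_prod) auto
  then have s: "smooth (\<lambda>z. complex_of_real (\<eta> z))" by (simp add: \<eta>_def)
  show ?thesis
  proof (rule that[of \<eta>])
    show "(\<lambda>x. complex_of_real (\<eta> x)) \<in> test_functions"
      using s L z by (intro test_functionI[of _ L]) auto
    have "supp (\<lambda>x. complex_of_real (\<eta> x)) \<subseteq> L"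
      using L z by (intro supp_subset compact_imp_closed) auto
    also have "L \<subseteq> U" using e(2) F(1) by (auto simp: L_def)
    finally show "supp (\<lambda>x. complex_of_real (\<eta> x)) \<subseteq> U" .
    show "0 \<le> \<eta> x" for x unfolding \<eta>_def using \<psi>(2) by (simp add: prod_le_1)
    show "\<eta> x \<le> 1" for x unfolding \<eta>_def using \<psi>(2) by (simp add: prod_nonneg)
    show "\<eta> x = 1" if x: "x \<in> K" for x
    proof -
      obtain y where y: "y \<in> F" "x \<in> ball y (e y)" using F(3) x by blast
      then have "\<psi> y x = 1" using ball_subset_cube \<psi>(3) by blast
      then have "(\<Prod>x'\<in>F. 1 - \<psi> x' x) = 0" using y F(2) by (intro prod_zero) auto
      then show ?thesis by (simp add: \<eta>_def)
    qed
  qed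
qed

text \<open>Stone-Weierstrass polynomials for the real and the imaginary part are smooth, and a
  plateau gives them compact support. The cut-off leaves \<open>g\<close> unchanged because
  \<open>g\<close> vanishes where the plateau is below 1.\<close>

lemma test_uniform_approx:
  fixes g :: "('n::finite) cfun"
  assumes g: "continuous_on UNIV g" "\<And>x. x \<notin> cube 0 a \<Longrightarrow> g x = 0" and e: "0 < e"
  obtains \<phi> where "\<phi> \<in> test_functions" "\<And>x. cmod (g x - \<phi> x) \<le> e" "\<And>x. x \<notin> cube 0 (a + 1) \<Longrightarrow> \<phi> x = 0"
proof -
  let ?S = "cube (0 :: real ^ 'n) (a + 1)"
  have poly_smooth: "smooth (\<lambda>x. complex_of_real (h x))" if "real_polynomial_function h" for h :: "real ^ 'n \<Rightarrow> real"
    using that by induction (auto intro: smooth_intros)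
  have c: "continuous_on ?S (\<lambda>x. Re (g x))" "continuous_on ?S (\<lambda>x. Im (g x))"
    by (auto intro!: continuous_intros continuous_on_subset[OF g(1)])
  obtain P where P: "real_polynomial_function P" "\<And>x. x \<in> ?S \<Longrightarrow> \<bar>Re (g x) - P x\<bar> < e / 2"
    using Stone_Weierstrass_real_polynomial_function[OF compact_cube c(1), of "e/2"] e by auto
  obtain Q where Q: "real_polynomial_function Q" "\<And>x. x \<in> ?S \<Longrightarrow> \<bar>Im (g x) - Q x\<bar> < e / 2"
    using Stone_Weierstrass_real_polynomial_function[OF compact_cube c(2), of "e/2"] e by auto
  obtain \<psi> :: "real ^ 'n \<Rightarrow> real" where \<psi>: "smooth (\<lambda>z. complex_of_real (\<psi> z))"
    "\<And>z. 0 \<le> \<psi> z" "\<And>z. \<psi> z \<le> 1" "\<And>z. z \<in> cube 0 a \<Longrightarrow> \<psi> z = 1" "\<And>z. z \<notin> ?S \<Longrightarrow> \<psi> z = 0"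
    using cube_plateau[of 1 "0::real^'n" a] by auto
  define \<phi> where "\<phi> x = complex_of_real (\<psi> x) * (complex_of_real (P x) + \<i> * complex_of_real (Q x))" for x
  have "smooth \<phi>" unfolding \<phi>_def by (intro smooth_intros(1,4,5) \<psi>(1) poly_smooth P(1) Q(1))
  show ?thesis
  proof (rule that[of \<phi>])
    show "\<phi> \<in> test_functions"
      using \<open>smooth \<phi>\<close> \<psi>(5) by (intro test_functionI[OF _ compact_cube[of 0 "a+1"]]) (auto simp: \<phi>_def)
    show "\<phi> x = 0" if "x \<notin> ?S" for x using \<psi>(5) that by (simp add: \<phi>_def)
    show "cmod (g x - \<phi> x) \<le> e" for x
    proof (cases "x \<in> ?S")
      case True
      have "g x = complex_of_real (\<psi> x) * g x" using g(2)[of x] \<psi>(4)[of x] by (cases "x \<in> cube 0 a") auto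
      then have "g x - \<phi> x = complex_of_real (\<psi> x) * (g x - (complex_of_real (P x) + \<i> * complex_of_real (Q x)))"
        by (simp add: \<phi>_def algebra_simps)
      then have "cmod (g x - \<phi> x) = \<psi> x * cmod (g x - (complex_of_real (P x) + \<i> * complex_of_real (Q x)))"
        using \<psi>(2) by (simp add: norm_mult)
      also have "\<dots> \<le> 1 * cmod (g x - (complex_of_real (P x) + \<i> * complex_of_real (Q x)))"
        using \<psi>(3) by (intro mult_right_mono) auto
      also have "\<dots> \<le> \<bar>Re (g x) - P x\<bar> + \<bar>Im (g x) - Q x\<bar>"
        using cmod_le[of "g x - (complex_of_real (P x) + \<i> * complex_of_real (Q x))"] by simp
      also have "\<dots> \<le> e" using P(2)[OF True] Q(2)[OF True] by simp
      finally show ?thesis .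
    next
      case False
      then have "x \<notin> cube 0 a" using cube_mono[of a "a+1"] by auto
      then show ?thesis using False g(2) \<psi>(5) e by (simp add: \<phi>_def)
    qed
  qed
qed

subsection \<open>Density and the fundamental lemma of the calculus of variations\<close>

abbreviation Lp_norm :: "real \<Rightarrow> ('n::finite) cfun \<Rightarrow> ennreal" where
  "Lp_norm p f \<equiv> Lp_enorm_on p UNIV (eabs f)"

definition Lp_space :: "real \<Rightarrow> ('n::finite) cfun set" where
  "Lp_space p = {f \<in> borel_measurable lebesgue. Lp_norm p f < top}"

lemma Lp_space_measurable [measurable_dest]: "f \<in> Lp_space p \<Longrightarrow> f \<in> borel_measurable lebesgue"
  by (simp add: Lp_space_def)

lemma eabs_triangle: "eabs (\<lambda>x. f x + g x) x \<le> eabs f x + eabs g x"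
  by (simp add: eabs_def ennreal_plus[symmetric] norm_triangle_ineq del: ennreal_plus)

lemma Lp_norm_triangle:
  assumes "1 < p" "f \<in> borel_measurable lebesgue" "g \<in> borel_measurable lebesgue"
  shows "Lp_norm p (\<lambda>x. f x + g x) \<le> Lp_norm p f + Lp_norm p g"
proof -
  have "Lp_norm p (\<lambda>x. f x + g x) \<le> Lp_enorm_on p UNIV (\<lambda>x. eabs f x + eabs g x)"
    using assms by (intro Lp_mono eabs_triangle) auto
  also have "\<dots> \<le> Lp_norm p f + Lp_norm p g" using assms by (intro Lp_add) auto
  finally show ?thesis .
qed

lemma Lp_norm_cmult:
  assumes "0 < p" "f \<in> borel_measurable lebesgue"
  shows "Lp_norm p (\<lambda>x. c * f x) = ennreal (cmod c) * Lp_norm p f"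
proof -
  have "eabs (\<lambda>x. c * f x) = (\<lambda>x. ennreal (cmod c) * eabs f x)"
    by (simp add: eabs_def fun_eq_iff norm_mult ennreal_mult')
  then show ?thesis using assms by (simp add: Lp_cmult)
qed

lemma Lp_norm_minus_commute: "Lp_norm p (\<lambda>x. f x - g x) = Lp_norm p (\<lambda>x. g x - f x)"
  by (rule arg_cong[of _ _ "Lp_enorm_on p UNIV"]) (simp add: eabs_def fun_eq_iff norm_minus_commute)

lemma Lp_norm_zero [simp]: "Lp_norm p (\<lambda>x. 0) = 0"
  by (simp add: eabs_def Lp_enorm_on_def)

lemma Lp_space_lincomb:
  assumes "1 < p" "f \<in> Lp_space p" "g \<in> Lp_space p" shows "(\<lambda>x. a * f x + b * g x) \<in> Lp_space p"
proof -
  have "Lp_norm p (\<lambda>x. a * f x + b * g x) \<le> ennreal (cmod a) * Lp_norm p f + ennreal (cmod b) * Lp_norm p g"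
    using assms by (intro order_trans[OF Lp_norm_triangle]) (auto simp: Lp_norm_cmult)
  also have "\<dots> < top" using assms by (auto simp: Lp_space_def ennreal_mult_less_top)
  finally show ?thesis using assms by (auto simp: Lp_space_def)
qed

lemma Lp_space_diff: "1 < p \<Longrightarrow> f \<in> Lp_space p \<Longrightarrow> g \<in> Lp_space p \<Longrightarrow> (\<lambda>x. f x - g x) \<in> Lp_space p"
  using Lp_space_lincomb[of p f g 1 "-1"] by simp

lemma Lp_space_add: "1 < p \<Longrightarrow> f \<in> Lp_space p \<Longrightarrow> g \<in> Lp_space p \<Longrightarrow> (\<lambda>x. f x + g x) \<in> Lp_space p"
  using Lp_space_lincomb[of p f g 1 1] by simp

lemma Lp_space_zero [simp]: "(\<lambda>x. 0) \<in> Lp_space p"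
  by (simp add: Lp_space_def)

lemma Lp_space_dominated:
  assumes "0 < p" "f \<in> borel_measurable lebesgue" "g \<in> Lp_space p" "AE x in lebesgue. cmod (f x) \<le> cmod (g x)"
  shows "f \<in> Lp_space p"
proof -
  have "Lp_norm p f \<le> Lp_norm p g"
    using assms by (intro Lp_mono_AE) (auto simp: eabs_def elim!: AE_mp intro!: ennreal_leI)
  then show ?thesis using assms by (auto simp: Lp_space_def)
qed

lemma Lp_norm_bounded_finite_support:
  assumes "0 < p" "\<And>x. cmod (f x) \<le> B" "\<And>x. x \<notin> A \<Longrightarrow> f x = 0" "A \<in> sets lebesgue"
  shows "Lp_norm p f \<le> ennreal B * epowr (emeasure lebesgue A) (1 / p)"
proof -
  have "Lp_norm p f = Lp_enorm_on p A (eabs f)"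
    unfolding Lp_enorm_on_indicator[symmetric, of p A "eabs f"] using assms(3)
    by (intro arg_cong[of _ _ "Lp_enorm_on p UNIV"]) (auto simp: eabs_def indicator_def fun_eq_iff)
  also have "\<dots> \<le> Lp_enorm_on p A (\<lambda>_. ennreal B)"
    using assms by (intro Lp_mono) (auto simp: eabs_def intro: ennreal_leI)
  also have "\<dots> = ennreal B * epowr (emeasure lebesgue A) (1 / p)" using assms by (simp add: Lp_const)
  finally show ?thesis .
qed

lemma bounded_finite_support_in_Lp_space:
  assumes "0 < p" "\<And>x. cmod (f x) \<le> B" "\<And>x. x \<notin> A \<Longrightarrow> f x = 0" "A \<in> sets lebesgue"
    "emeasure lebesgue A < top" "f \<in> borel_measurable lebesgue"
  shows "f \<in> Lp_space p"
proof -
  have "ennreal B * epowr (emeasure lebesgue A) (1 / p) < top" using assms by (simp add: ennreal_mult_less_top)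
  moreover have "Lp_norm p f \<le> ennreal B * epowr (emeasure lebesgue A) (1 / p)"
    using assms(1-4) by (rule Lp_norm_bounded_finite_support)
  ultimately show ?thesis using assms(6) by (auto simp: Lp_space_def intro: le_less_trans)
qed

lemma test_bounded:
  assumes "\<phi> \<in> test_functions" obtains B where "0 \<le> B" "\<And>x. cmod (\<phi> x) \<le> B"
  by (rule bounded_if_compact_supp[of \<phi> "supp \<phi>", OF smooth_continuous[OF test_smooth[OF assms]] test_compact[OF assms]])
    (auto simp: not_in_supp intro: that)

lemma test_Lp_space:
  assumes "0 < p" "\<phi> \<in> test_functions" shows "\<phi> \<in> Lp_space p"
proof -
  obtain B where B: "0 \<le> B" "\<And>x. cmod (\<phi> x) \<le> B" using test_bounded[OF assms(2)] by blast
  have "supp \<phi> \<in> lmeasurable" using assms by (intro lmeasurable_compact test_compact)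
  then have "supp \<phi> \<in> sets lebesgue" "emeasure lebesgue (supp \<phi>) < top" by (auto simp: fmeasurable_def)
  then show ?thesis
    using assms B by (intro bounded_finite_support_in_Lp_space[of p \<phi> B "supp \<phi>"]) (auto simp: not_in_supp)
qed

text \<open>The factor \<open>K\<close> admits simple functions bounded by 2|f|, as the
  approximation theorem delivers them; the difference is dominated by (1 + |K|) |f|.\<close>

lemma Lp_dominated_convergence:
  fixes f :: "('n::finite) cfun"
  assumes p: "1 < p" and f: "f \<in> Lp_space p" and s: "\<And>i. s i \<in> borel_measurable lebesgue"
    and bd: "\<And>i x. cmod (s i x) \<le> K * cmod (f x)" and lim: "\<And>x. (\<lambda>i. s i x) \<longlonglongrightarrow> f x" and e: "0 < e"
  shows "eventually (\<lambda>i. Lp_norm p (\<lambda>x. f x - s i x) < ennreal e) sequentially"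
proof -
  note [measurable] = s Lp_space_measurable[OF f]
  have m: "(\<lambda>x. epowr (eabs (\<lambda>x. f x - s i x) x) p) \<in> borel_measurable lebesgue" for i by measurable
  have K: "cmod (f x - s i x) \<le> (1 + \<bar>K\<bar>) * cmod (f x)" for i x
  proof -
    have "cmod (f x - s i x) \<le> cmod (f x) + cmod (s i x)" by (rule norm_triangle_ineq4)
    also have "cmod (s i x) \<le> \<bar>K\<bar> * cmod (f x)"
      using bd[of i x] by (rule order_trans) (auto intro: mult_right_mono)
    finally show ?thesis by (simp add: algebra_simps)
  qed
  have "(\<lambda>i. \<integral>\<^sup>+x. epowr (eabs (\<lambda>x. f x - s i x) x) p \<partial>lebesgue) \<longlonglongrightarrow> (\<integral>\<^sup>+x. 0 \<partial>(lebesgue :: (real^'n) measure))"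
  proof (rule nn_integral_dominated_convergence[where w="\<lambda>x. ennreal ((1 + \<bar>K\<bar>) powr p) * epowr (eabs f x) p"])
    show "AE x in lebesgue. epowr (eabs (\<lambda>x. f x - s i x) x) p \<le> ennreal ((1 + \<bar>K\<bar>) powr p) * epowr (eabs f x) p" for i
    proof (rule AE_I2)
      fix x
      have "cmod (f x - s i x) powr p \<le> ((1 + \<bar>K\<bar>) * cmod (f x)) powr p"
        using K p by (intro powr_mono2) auto
      then show "epowr (eabs (\<lambda>x. f x - s i x) x) p \<le> ennreal ((1 + \<bar>K\<bar>) powr p) * epowr (eabs f x) p"
        by (auto simp: eabs_def powr_mult ennreal_mult'[symmetric] intro!: ennreal_leI)
    qed
    have "(\<integral>\<^sup>+x. epowr (eabs f x) p \<partial>lebesgue) < top"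
      using f by (simp add: Lp_space_def Lp_enorm_on_UNIV Lnorm_def)
    then show "(\<integral>\<^sup>+x. ennreal ((1 + \<bar>K\<bar>) powr p) * epowr (eabs f x) p \<partial>lebesgue) < \<infinity>"
      by (simp add: nn_integral_cmult ennreal_mult_less_top)
    show "AE x in lebesgue. (\<lambda>i. epowr (eabs (\<lambda>x. f x - s i x) x) p) \<longlonglongrightarrow> 0"
    proof (rule AE_I2)
      fix x
      have "(\<lambda>i. cmod (f x - s i x)) \<longlonglongrightarrow> cmod (f x - f x)" by (intro tendsto_intros lim)
      then have "(\<lambda>i. cmod (f x - s i x) powr p) \<longlonglongrightarrow> 0 powr p"
        using p by (intro tendsto_powr') auto
      then have "(\<lambda>i. ennreal (cmod (f x - s i x) powr p)) \<longlonglongrightarrow> ennreal 0"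
        using p by (intro tendsto_ennrealI) simp
      then show "(\<lambda>i. epowr (eabs (\<lambda>x. f x - s i x) x) p) \<longlonglongrightarrow> 0" by (simp add: eabs_def)
    qed
  qed (use m in auto)
  then have "eventually (\<lambda>i. (\<integral>\<^sup>+x. epowr (eabs (\<lambda>x. f x - s i x) x) p \<partial>lebesgue) < epowr (ennreal e) p) sequentially"
    using e p by (intro order_tendstoD(2)) auto
  then show ?thesis
  proof eventually_elim
    case (elim i)
    have "epowr (epowr (ennreal e) p) (1/p) = ennreal e" using p by (simp only: epowr_epowr) simp
    then show ?case using elim less_epowr_iff[of p "\<integral>\<^sup>+x. epowr (eabs (\<lambda>x. f x - s i x) x) p \<partial>lebesgue" "ennreal e"] p
      by (simp add: Lp_enorm_on_UNIV Lnorm_def)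
  qed
qed

lemma simple_approx:
  fixes f :: "('n::finite) cfun"
  assumes "f \<in> borel_measurable lebesgue"
  obtains s where "\<And>i. simple_function lebesgue (s i)" "\<And>x. (\<lambda>i. s i x) \<longlonglongrightarrow> f x" "\<And>i x. cmod (s i x) \<le> 2 * cmod (f x)"
  using borel_measurable_implies_sequence_metric[OF assms, of 0] by (auto simp: dist_norm)

text \<open>Regularity of Lebesgue measure places a compact set T inside A and an open set V around
  T. A plateau between T and V intersected with U differs from the indicator of A only on a set of
  small measure, and by at most 1 there.\<close>

lemma indicator_test_approx:
  fixes A :: "(real ^ 'n::finite) set"
  assumes p: "1 < p" and A: "A \<in> sets lebesgue" "emeasure lebesgue A < top" and U: "open U" "A \<subseteq> U" and e: "0 < e"
  obtains \<phi> where "\<phi> \<in> test_functions" "supp \<phi> \<subseteq> U" "Lp_norm p (\<lambda>x. indicator A x - \<phi> x) < ennreal e"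
proof -
  \<comment> \<open>Three exceptional sets of measure below \<open>d\<close> each contribute at most
    (3 d)^(1/p) = e/2 to the norm.\<close>
  define d where "d = (e/2) powr p / 3"
  have d: "0 < d" using e by (simp add: d_def)
  let ?C = "\<lambda>m. cube (0 :: real ^ 'n) (2 ^ m)"
  have inc: "incseq ?C" by (intro monoI cube_mono) (simp add: power_increasing)
  have L: "(\<lambda>m. emeasure lebesgue (A - ?C m)) \<longlonglongrightarrow> emeasure lebesgue (\<Inter>m. A - ?C m)"
  proof (rule Lim_emeasure_decseq)
    show "decseq (\<lambda>m. A - ?C m)" using inc by (auto simp: decseq_def incseq_def)
    show "emeasure lebesgue (A - ?C m) \<noteq> \<infinity>" for m
      using emeasure_mono[of "A - ?C m" A lebesgue] A by (auto simp: top_unique)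
  qed (use A in auto)
  have "(\<Inter>m. A - ?C m) = {}" using Un_cubes[of 0] by blast
  then have "(\<lambda>m. emeasure lebesgue (A - ?C m)) \<longlonglongrightarrow> 0" using L by (simp only: emeasure_empty)
  then have "eventually (\<lambda>m. emeasure lebesgue (A - ?C m) < ennreal d) sequentially"
    using d by (intro order_tendstoD(2)[of _ 0]) auto
  then obtain m where m: "emeasure lebesgue (A - ?C m) < ennreal d" by (auto simp: eventually_sequentially)
  obtain T where T: "closed T" "T \<subseteq> A \<inter> ?C m" "(A \<inter> ?C m) - T \<in> lmeasurable" "emeasure lebesgue ((A \<inter> ?C m) - T) < ennreal d"
    using sets_lebesgue_inner_closed[of "A \<inter> ?C m" d] A(1) d by auto
  have Tc: "compact T"
    using compact_Int_closed[OF compact_cube T(1), of 0 "2^m"] T(2) by (simp add: Int_absorb1)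
  have Ts: "T \<in> sets lebesgue" using T(1) by auto
  obtain V where V: "open V" "T \<subseteq> V" "V - T \<in> lmeasurable" "emeasure lebesgue (V - T) < ennreal d"
    using sets_lebesgue_outer_open[OF Ts d] by blast
  obtain \<eta> :: "real ^ 'n \<Rightarrow> real" where \<eta>: "(\<lambda>x. complex_of_real (\<eta> x)) \<in> test_functions"
    "supp (\<lambda>x. complex_of_real (\<eta> x)) \<subseteq> V \<inter> U" "\<And>x. 0 \<le> \<eta> x" "\<And>x. \<eta> x \<le> 1" "\<And>x. x \<in> T \<Longrightarrow> \<eta> x = 1"
    by (rule plateau[OF Tc, of "V \<inter> U"]) (use V U T in auto)
  let ?D = "(A - ?C m) \<union> ((A \<inter> ?C m) - T) \<union> (V - T)"
  let ?f = "\<lambda>x. indicator A x - complex_of_real (\<eta> x)"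
  have D: "?D \<in> sets lebesgue" using A(1) T(3) V(3) by (auto simp: fmeasurable_def)
  have "Lp_norm p ?f \<le> ennreal 1 * epowr (emeasure lebesgue ?D) (1/p)"
  proof (rule Lp_norm_bounded_finite_support)
    show "cmod (?f x) \<le> 1" for x
    proof -
      have "?f x = complex_of_real (indicator A x - \<eta> x)" by (simp add: indicator_def)
      then have "cmod (?f x) = \<bar>indicator A x - \<eta> x\<bar>" by (simp only: norm_of_real)
      then show ?thesis using \<eta>(3,4)[of x] by (auto simp: indicator_def abs_if)
    qed
    show "?f x = 0" if "x \<notin> ?D" for x
    proof (cases "x \<in> T")
      case True then show ?thesis using \<eta>(5) T(2) by (auto simp: indicator_def)
    next
      case False
      then have "x \<notin> V" "x \<notin> A" using that by auto
      then have "x \<notin> supp (\<lambda>x. complex_of_real (\<eta> x))" using \<eta>(2) by auto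
      then show ?thesis using \<open>x \<notin> A\<close> not_in_supp[of x "\<lambda>x. complex_of_real (\<eta> x)"] by simp
    qed
  qed (use p D in auto)
  also have "emeasure lebesgue ?D < ennreal (3 * d)"
  proof -
    have "emeasure lebesgue ?D \<le> emeasure lebesgue (A - ?C m) + emeasure lebesgue ((A \<inter> ?C m) - T) + emeasure lebesgue (V - T)"
      using A(1) T(3) V(3) by (intro order_trans[OF emeasure_subadditive] add_mono emeasure_subadditive) (auto simp: fmeasurable_def)
    also have "\<dots> < ennreal d + ennreal d + ennreal d" by (intro add_strict_mono m T(4) V(4))
    also have "\<dots> = ennreal (3 * d)" using d by (simp add: ennreal_plus[symmetric] del: ennreal_plus)
    finally show ?thesis .
  qed
  then have "epowr (emeasure lebesgue ?D) (1/p) \<le> epowr (ennreal (3 * d)) (1/p)"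
    using p by (intro epowr_mono) auto
  also have "\<dots> = ennreal (e/2)" using d e p by (simp add: d_def powr_powr)
  also have "\<dots> < ennreal e" using e by (simp add: ennreal_less_iff)
  finally have "Lp_norm p ?f < ennreal e" by simp
  then show ?thesis using that[OF \<eta>(1)] \<eta>(2) by auto
qed

lemma simple_function_sum:
  fixes s :: "('n::finite) cfun"
  assumes s: "simple_function lebesgue s"
  shows "s x = (\<Sum>y\<in>range s - {0}. y * indicator (s -` {y}) x)"
proof -
  have fin: "finite (range s - {0})" using simple_functionD(1)[OF s] by simp
  show ?thesis
  proof (cases "s x = 0")
    case True
    then have "(\<Sum>y\<in>range s - {0}. y * indicator (s -` {y}) x) = 0"
      by (intro sum.neutral) (auto simp: indicator_def)
    then show ?thesis using True by simp
  next
    case False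
    have "(\<Sum>y\<in>range s - {0}. y * indicator (s -` {y}) x) = (\<Sum>y\<in>range s - {0}. if y = s x then y else 0)"
      by (intro sum.cong) (auto simp: indicator_def)
    also have "\<dots> = s x" using fin False by (simp add: sum.delta)
    finally show ?thesis ..
  qed
qed

lemma simple_function_level_sets:
  fixes s :: "('n::finite) cfun"
  assumes p: "0 < p" and s: "simple_function lebesgue s" "s \<in> Lp_space p" and y: "y \<noteq> 0"
  shows "s -` {y} \<in> sets lebesgue" "emeasure lebesgue (s -` {y}) < top"
proof -
  show m: "s -` {y} \<in> sets lebesgue" using simple_functionD(2)[OF s(1), of "{y}"] by simp
  have "ennreal (cmod y) * epowr (emeasure lebesgue (s -` {y})) (1/p) = Lp_enorm_on p (s -` {y}) (\<lambda>_. ennreal (cmod y))"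
    using p m by (simp add: Lp_const)
  also have "\<dots> \<le> Lp_enorm_on p (s -` {y}) (eabs s)" using p by (intro Lp_mono) (auto simp: eabs_def)
  also have "\<dots> \<le> Lp_norm p s" using p by (rule Lp_le_UNIV)
  also have "\<dots> < top" using s(2) by (simp add: Lp_space_def)
  finally show "emeasure lebesgue (s -` {y}) < top"
    using y by (auto simp: ennreal_mult_less_top ennreal_mult_eq_top_iff less_top[symmetric])
qed

text \<open>The approximants must keep their supports in U: the kernel bound is passed to limits,
  and it holds at a point only as long as the supports stay away from that point.\<close>

lemma test_dense:
  fixes f :: "('n::finite) cfun"
  assumes p: "1 < p" and f: "f \<in> Lp_space p" and U: "open U" "\<And>x. x \<notin> U \<Longrightarrow> f x = 0" and e: "0 < e"
  obtains \<phi> where "\<phi> \<in> test_functions" "supp \<phi> \<subseteq> U" "Lp_norm p (\<lambda>x. f x - \<phi> x) < ennreal e"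
proof -
  obtain s where s: "\<And>i. simple_function lebesgue (s i)" "\<And>x. (\<lambda>i. s i x) \<longlonglongrightarrow> f x" "\<And>i x. cmod (s i x) \<le> 2 * cmod (f x)"
    using simple_approx[OF Lp_space_measurable[OF f]] by blast
  have sm [measurable]: "s i \<in> borel_measurable lebesgue" for i using s(1) by (rule borel_measurable_simple_function)
  have [measurable]: "f \<in> borel_measurable lebesgue" using f by (rule Lp_space_measurable)
  have "eventually (\<lambda>i. Lp_norm p (\<lambda>x. f x - s i x) < ennreal (e/2)) sequentially"
    using e by (intro Lp_dominated_convergence[OF p f, where K=2] s sm) auto
  then obtain i where i: "Lp_norm p (\<lambda>x. f x - s i x) < ennreal (e/2)" by (auto simp: eventually_sequentially)
  have "(\<lambda>x. 2 * f x) \<in> Lp_space p" using Lp_space_lincomb[OF p f f, of 2 0] by simp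
  then have sp: "s i \<in> Lp_space p" using p s(3) by (intro Lp_space_dominated[OF _ sm]) (auto simp: norm_mult)
  have "\<exists>\<phi>\<in>test_functions. supp \<phi> \<subseteq> U \<and> Lp_norm p (\<lambda>x. (\<Sum>y\<in>Y. y * indicator (s i -` {y}) x) - \<phi> x) < ennreal \<epsilon>"
    if "finite Y" "Y \<subseteq> range (s i) - {0}" "0 < \<epsilon>" for Y \<epsilon>
    using that
  proof (induction Y arbitrary: \<epsilon> rule: finite_induct)
    case empty
    have "supp (\<lambda>x::real^'n. 0::complex) = {}" by (simp add: supp_def)
    then show ?case using empty by (intro bexI[of _ "\<lambda>x. 0"]) auto
  next
    case (insert y Y)
    obtain \<phi> where \<phi>: "\<phi> \<in> test_functions" "supp \<phi> \<subseteq> U"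
        "Lp_norm p (\<lambda>x. (\<Sum>y\<in>Y. y * indicator (s i -` {y}) x) - \<phi> x) < ennreal (\<epsilon>/2)"
      using insert.IH[of "\<epsilon>/2"] insert.prems by auto
    have y: "y \<noteq> 0" using insert.prems by auto
    note ls = simple_function_level_sets[OF _ s(1) sp y]
    \<comment> \<open>The bound |s_i| <= 2|f| forces every level set of a nonzero value into the set
      where f does not vanish, hence into U.\<close>
    have sub: "s i -` {y} \<subseteq> U"
    proof
      fix x assume "x \<in> s i -` {y}"
      then have "cmod y \<le> 2 * cmod (f x)" using s(3)[of i x] by simp
      then show "x \<in> U" using U(2)[of x] y by (cases "x \<in> U") simp_all
    qed
    obtain \<psi> where \<psi>: "\<psi> \<in> test_functions" "supp \<psi> \<subseteq> U"
        "Lp_norm p (\<lambda>x. indicator (s i -` {y}) x - \<psi> x) < ennreal (\<epsilon> / 2 / cmod y)"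
      using indicator_test_approx[OF p ls(1) ls(2) U(1) sub, of "\<epsilon> / 2 / cmod y"] p y insert.prems by auto
    have [measurable]: "s i -` {z} \<in> sets lebesgue" for z using simple_functionD(2)[OF s(1)[of i], of "{z}"] by simp
    have aux: "(S - u) + y * (v - w) = (y * v + S) - (u + y * w)" for S u v w :: complex
      by (simp add: algebra_simps)
    note [measurable] = test_measurable[OF \<phi>(1)] test_measurable[OF \<psi>(1)]
    let ?a = "\<lambda>x. (\<Sum>y\<in>Y. y * indicator (s i -` {y}) x) - \<phi> x" and ?b = "\<lambda>x. indicator (s i -` {y}) x - \<psi> x"
    have "Lp_norm p (\<lambda>x. ?a x + y * ?b x) \<le> Lp_norm p ?a + ennreal (cmod y) * Lp_norm p ?b"
      using p by (intro order_trans[OF Lp_norm_triangle]) (auto simp: Lp_norm_cmult)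
    also have "\<dots> < ennreal (\<epsilon>/2) + ennreal (\<epsilon>/2)"
    proof (rule add_strict_mono[OF \<phi>(3)])
      have "ennreal (cmod y) * Lp_norm p ?b < ennreal (cmod y) * ennreal (\<epsilon> / 2 / cmod y)"
        using y \<psi>(3) by (intro ennreal_mult_strict_left_mono) auto
      then show "ennreal (cmod y) * Lp_norm p ?b < ennreal (\<epsilon>/2)"
        using y by (simp add: ennreal_mult'[symmetric])
    qed
    also have "\<dots> = ennreal \<epsilon>" using insert.prems by (simp add: ennreal_plus[symmetric] del: ennreal_plus)
    finally have "Lp_norm p (\<lambda>x. (\<Sum>y\<in>insert y Y. y * indicator (s i -` {y}) x) - (\<phi> x + y * \<psi> x)) < ennreal \<epsilon>"
      by (simp only: aux sum.insert[OF insert.hyps])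
    moreover have "supp (\<lambda>x. \<phi> x + y * \<psi> x) \<subseteq> U"
    proof -
      have "supp (\<lambda>x. \<phi> x + y * \<psi> x) \<subseteq> supp \<phi> \<union> supp \<psi>"
        by (rule supp_subset) (auto simp: not_in_supp)
      then show ?thesis using \<phi>(2) \<psi>(2) by auto
    qed
    ultimately show ?case using \<phi>(1) \<psi>(1) by (intro bexI[of _ "\<lambda>x. \<phi> x + y * \<psi> x"] conjI test_add test_cmult) auto
  qed
  from this[of "range (s i) - {0}" "e/2"] obtain \<phi> where \<phi>: "\<phi> \<in> test_functions" "supp \<phi> \<subseteq> U"
      "Lp_norm p (\<lambda>x. s i x - \<phi> x) < ennreal (e/2)"
    using simple_functionD(1)[OF s(1)] e unfolding simple_function_sum[OF s(1), symmetric] by auto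
  note [measurable] = test_measurable[OF \<phi>(1)]
  have "Lp_norm p (\<lambda>x. (f x - s i x) + (s i x - \<phi> x)) \<le> Lp_norm p (\<lambda>x. f x - s i x) + Lp_norm p (\<lambda>x. s i x - \<phi> x)"
    using p by (intro Lp_norm_triangle) auto
  also have "\<dots> < ennreal (e/2) + ennreal (e/2)" by (intro add_strict_mono i \<phi>(3))
  also have "\<dots> = ennreal e" using e by (simp add: ennreal_plus[symmetric] del: ennreal_plus)
  finally show ?thesis using that \<phi> by simp
qed

text \<open>On a closed subset T of {g > 0} the integral of g over bounded parts is zero although g
  is positive, so T is a null set. Inner regularity then leaves {g > 0} with arbitrarily small
  measure.\<close>

lemma AE_nonpos_if_compact_integrals_zero:
  fixes g :: "real ^ 'n::finite \<Rightarrow> real"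
  assumes [measurable]: "g \<in> borel_measurable lebesgue"
    and K: "\<And>K. compact K \<Longrightarrow> integrable lebesgue (\<lambda>x. indicator K x * g x) \<and> (LINT x|lebesgue. indicator K x * g x) = 0"
  shows "AE x in lebesgue. g x \<le> 0"
proof -
  let ?A = "{x. 0 < g x}"
  have "{x \<in> space lebesgue. 0 < g x} \<in> sets lebesgue" by measurable
  then have A: "?A \<in> sets lebesgue" by simp
  have "emeasure lebesgue ?A \<le> ennreal e" if e: "0 < e" for e
  proof -
    obtain T where T: "closed T" "T \<subseteq> ?A" "?A - T \<in> lmeasurable" "emeasure lebesgue (?A - T) < ennreal e"
      using sets_lebesgue_inner_closed[OF A e] by blast
    have "AE x in lebesgue. x \<in> cube 0 (2 ^ m) \<longrightarrow> x \<notin> T" for m :: nat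
    proof -
      have c: "compact (T \<inter> cube 0 (2 ^ m))" by (rule closed_Int_compact[OF T(1) compact_cube])
      have "AE x in lebesgue. 0 \<le> indicator (T \<inter> cube 0 (2 ^ m)) x * g x"
        using T(2) by (intro AE_I2) (auto simp: indicator_def less_imp_le)
      then have "AE x in lebesgue. indicator (T \<inter> cube 0 (2 ^ m)) x * g x = 0"
        using K[OF c] integral_nonneg_eq_0_iff_AE by blast
      then show ?thesis by eventually_elim (use T(2) in \<open>auto simp: indicator_def split: if_splits\<close>)
    qed
    then have "AE x in lebesgue. x \<notin> T" by (rule AE_cubesI)
    moreover have "T \<in> sets lebesgue" using T(1) by auto
    ultimately have "emeasure lebesgue T = 0" by (subst (asm) AE_iff_null) (auto simp: null_sets_def)
    have "emeasure lebesgue (T \<union> (?A - T)) \<le> emeasure lebesgue T + emeasure lebesgue (?A - T)"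
      using \<open>T \<in> sets lebesgue\<close> A by (intro emeasure_subadditive sets.Diff)
    moreover have "T \<union> (?A - T) = ?A" using T(2) by blast
    ultimately have "emeasure lebesgue ?A \<le> emeasure lebesgue T + emeasure lebesgue (?A - T)" by (simp only:)
    also have "\<dots> = emeasure lebesgue (?A - T)" by (simp only: \<open>emeasure lebesgue T = 0\<close> add_0)
    finally show ?thesis using T(4) by (meson less_imp_le order_trans)
  qed
  then have "emeasure lebesgue ?A \<le> 0" by (rule_tac ennreal_le_epsilon) (simp only: add_0)
  then have "?A \<in> null_sets lebesgue" using A by auto
  then have "AE x in lebesgue. x \<notin> ?A" by (rule AE_not_in)
  then show ?thesis by eventually_elim auto
qed

text \<open>Plateaus that shrink to a compact set K turn vanishing pairings with test functions into
  vanishing integrals over K.\<close>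

lemma AE_zero_if_test_integrals_zero:
  fixes f :: "('n::finite) cfun"
  assumes [measurable]: "f \<in> borel_measurable lebesgue"
    and int: "\<And>\<phi>. \<phi> \<in> test_functions \<Longrightarrow> integrable lebesgue (\<lambda>x. f x * \<phi> x)"
    and zero: "\<And>\<phi>. \<phi> \<in> test_functions \<Longrightarrow> pairing f \<phi> = 0"
  shows "AE x in lebesgue. f x = 0"
proof -
  have K: "integrable lebesgue (\<lambda>x. indicator K x * f x) \<and> (LINT x|lebesgue. indicator K x * f x) = 0"
    if K: "compact K" "K \<noteq> {}" for K
  proof -
    obtain B where B: "\<And>x. x \<in> K \<Longrightarrow> norm x \<le> B" using compact_imp_bounded[OF K(1)] by (auto simp: bounded_iff)
    \<comment> \<open>This plateau equals 1 on a ball containing all the sets \<open>V k\<close>, so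
      that |f \<psi>| is one integrable majorant for the whole sequence.\<close>
    obtain \<psi> :: "real ^ 'n \<Rightarrow> real" where \<psi>: "(\<lambda>x. complex_of_real (\<psi> x)) \<in> test_functions"
      "\<And>x. 0 \<le> \<psi> x" "\<And>x. x \<in> cball 0 (B+1) \<Longrightarrow> \<psi> x = 1"
      by (rule plateau[of "cball (0 :: real ^ 'n) (B+1)" UNIV]) auto
    define V where "V k = {x. infdist x K < 1 / real (Suc k)} \<inter> ball 0 (B + 1)" for k
    have "open {x. infdist x K < 1 / real (Suc k)}" for k by (intro open_Collect_less continuous_intros)
    moreover have "norm x < B + 1" if "x \<in> K" for x using B[OF that] by simp
    ultimately have V: "open (V k)" "K \<subseteq> V k" for k
      by (auto simp: V_def dist_norm)
    have "\<exists>\<eta> :: real ^ 'n \<Rightarrow> real. (\<lambda>x. complex_of_real (\<eta> x)) \<in> test_functions \<and>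
      supp (\<lambda>x. complex_of_real (\<eta> x)) \<subseteq> V k \<and> (\<forall>x. 0 \<le> \<eta> x \<and> \<eta> x \<le> 1) \<and> (\<forall>x\<in>K. \<eta> x = 1)" for k
      by (rule plateau[OF K(1) V]) blast
    then obtain \<eta> :: "nat \<Rightarrow> real ^ 'n \<Rightarrow> real" where \<eta>: "\<And>k. (\<lambda>x. complex_of_real (\<eta> k x)) \<in> test_functions"
      "\<And>k. supp (\<lambda>x. complex_of_real (\<eta> k x)) \<subseteq> V k" "\<And>k x. 0 \<le> \<eta> k x" "\<And>k x. \<eta> k x \<le> 1" "\<And>k x. x \<in> K \<Longrightarrow> \<eta> k x = 1"
      by metis
    note [measurable] = test_measurable[OF \<eta>(1)] test_measurable[OF \<psi>(1)]
    have \<eta>0: "\<eta> k x = 0" if "x \<notin> V k" for k x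
      using not_in_supp[of x "\<lambda>x. complex_of_real (\<eta> k x)"] \<eta>(2)[of k] that by auto
    have lim: "(\<lambda>k. f x * complex_of_real (\<eta> k x)) \<longlonglongrightarrow> indicator K x * f x" for x
    proof (cases "x \<in> K")
      case True then show ?thesis using \<eta>(5) by simp
    next
      case False
      then have "0 < infdist x K" using K compact_imp_closed by (metis in_closed_iff_infdist_zero infdist_nonneg less_le)
      then have "eventually (\<lambda>k. 1 / real (Suc k) < infdist x K) sequentially"
        using LIMSEQ_inverse_real_of_nat by (intro order_tendstoD) (simp_all add: inverse_eq_divide)
      then have "eventually (\<lambda>k. \<eta> k x = 0) sequentially"
        by eventually_elim (intro \<eta>0, auto simp: V_def)
      then show ?thesis using False by (intro tendsto_eventually) (auto elim: eventually_mono)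
    qed
    have bd: "norm (f x * complex_of_real (\<eta> k x)) \<le> norm (f x * complex_of_real (\<psi> x))" for k x
    proof (cases "x \<in> V k")
      case True
      then have "\<psi> x = 1" using \<psi>(3)[of x] by (simp add: V_def dist_norm)
      then show ?thesis using \<eta>(3,4)[of k x] by (simp add: norm_mult mult_left_le)
    qed (simp add: \<eta>0)
    have w: "integrable lebesgue (\<lambda>x. norm (f x * complex_of_real (\<psi> x)))"
      using int[OF \<psi>(1)] by (rule integrable_norm)
    have m: "(\<lambda>x. indicator K x * f x) \<in> borel_measurable lebesgue"
      using K(1) by (intro borel_measurable_times borel_measurable_indicator) (auto dest: compact_imp_closed)
    have "(\<lambda>k. LINT x|lebesgue. f x * complex_of_real (\<eta> k x)) \<longlonglongrightarrow> (LINT x|lebesgue. indicator K x * f x)"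
      using m w lim bd by (intro integral_dominated_convergence[where w="\<lambda>x. norm (f x * complex_of_real (\<psi> x))"]) auto
    then have "(LINT x|lebesgue. indicator K x * f x) = 0"
      using zero[OF \<eta>(1)] by (simp add: pairing_def LIMSEQ_const_iff)
    moreover have "integrable lebesgue (\<lambda>x. indicator K x * f x)"
      using m w lim bd by (intro integrable_dominated_convergence[where w="\<lambda>x. norm (f x * complex_of_real (\<psi> x))" and s="\<lambda>k x. f x * complex_of_real (\<eta> k x)"]) auto
    ultimately show ?thesis by simp
  qed
  have K': "integrable lebesgue (\<lambda>x. indicator K x * f x) \<and> (LINT x|lebesgue. indicator K x * f x) = 0" if "compact K" for K
    using K[OF that] by (cases "K = {}") auto
  have *: "integrable lebesgue (\<lambda>x. indicator K x * l (f x)) \<and> (LINT x|lebesgue. indicator K x * l (f x)) = 0"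
    if "compact K" "bounded_linear l" for K and l :: "complex \<Rightarrow> real"
  proof -
    have e: "l (indicator K x * f x) = indicator K x * l (f x)" for x
      using linear_0[OF bounded_linear.linear[OF that(2)]] by (auto simp: indicator_def)
    show ?thesis using integrable_bounded_linear[OF that(2), of lebesgue "\<lambda>x. indicator K x * f x"]
        integral_bounded_linear[OF that(2), of lebesgue "\<lambda>x. indicator K x * f x"] K'[OF that(1)]
        linear_0[OF bounded_linear.linear[OF that(2)]] by (simp add: e)
  qed
  have **: "AE x in lebesgue. l (f x) \<le> 0" if "bounded_linear l" for l :: "complex \<Rightarrow> real"
  proof (rule AE_nonpos_if_compact_integrals_zero)
    have "l \<in> borel_measurable borel"
      using linear_continuous_on[OF that] by (rule borel_measurable_continuous_onI)
    then show "(\<lambda>x. l (f x)) \<in> borel_measurable lebesgue" by measurable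
  qed (rule *[OF _ that])
  \<comment> \<open>The one-sided statement for Re, -Re, Im and -Im together gives f = 0.\<close>
  note re = **[OF bounded_linear_Re] **[OF bounded_linear_minus[OF bounded_linear_Re]]
    **[OF bounded_linear_Im] **[OF bounded_linear_minus[OF bounded_linear_Im]]
  show ?thesis using re by eventually_elim (simp add: complex_eq_iff)
qed

subsection \<open>The Riesz representation theorem for Lebesgue spaces\<close>

text \<open>This is the positive part of a charge. Only sets of finite measure are tested, because
  the charge will be defined through indicators in L_p; \<open>ennreal\<close> replaces negative
  values by 0.\<close>

definition upper_variation :: "'a measure \<Rightarrow> ('a set \<Rightarrow> real) \<Rightarrow> 'a set \<Rightarrow> ennreal" where
  "upper_variation M \<nu> A = (SUP E\<in>{E \<in> sets M. E \<subseteq> A \<and> emeasure M E < top}. ennreal (\<nu> E))"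

text \<open>The bound by a power of the measure takes the place of countable additivity: remainders
  of small measure have small charge, and null sets have charge zero, as absolute continuity
  demands.\<close>

locale finite_part_charge =
  fixes M :: "'a measure" and \<nu> :: "'a set \<Rightarrow> real" and C :: ennreal and p :: real
  assumes p_pos: "0 < p" and C_finite: "C < top"
    and additive: "\<And>A B. A \<in> sets M \<Longrightarrow> B \<in> sets M \<Longrightarrow> emeasure M A < top \<Longrightarrow> emeasure M B < top \<Longrightarrow>
      A \<inter> B = {} \<Longrightarrow> \<nu> (A \<union> B) = \<nu> A + \<nu> B"
    and bound: "\<And>A. A \<in> sets M \<Longrightarrow> emeasure M A < top \<Longrightarrow> ennreal \<bar>\<nu> A\<bar> \<le> C * epowr (emeasure M A) (1 / p)"
begin

lemma finite_subset: "E \<in> sets M \<Longrightarrow> A \<in> sets M \<Longrightarrow> emeasure M A < top \<Longrightarrow> E \<subseteq> A \<Longrightarrow> emeasure M E < top"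
  using emeasure_mono[of E A M] by (auto intro: le_less_trans)

lemma null: "A \<in> sets M \<Longrightarrow> emeasure M A = 0 \<Longrightarrow> \<nu> A = 0"
  using bound[of A] by simp

lemma empty: "\<nu> {} = 0"
  by (rule null) auto

lemma upper_variation_ge:
  "E \<in> sets M \<Longrightarrow> E \<subseteq> A \<Longrightarrow> emeasure M E < top \<Longrightarrow> ennreal (\<nu> E) \<le> upper_variation M \<nu> A"
  unfolding upper_variation_def by (rule SUP_upper) auto

lemma upper_variation_le:
  assumes "\<And>E. E \<in> sets M \<Longrightarrow> E \<subseteq> A \<Longrightarrow> emeasure M E < top \<Longrightarrow> ennreal (\<nu> E) \<le> R"
  shows "upper_variation M \<nu> A \<le> R"
  unfolding upper_variation_def using assms by (intro SUP_least) auto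

lemma upper_variation_finite:
  assumes A: "A \<in> sets M" "emeasure M A < top" shows "upper_variation M \<nu> A < top"
proof -
  have "upper_variation M \<nu> A \<le> C * epowr (emeasure M A) (1 / p)"
  proof (rule upper_variation_le)
    fix E assume E: "E \<in> sets M" "E \<subseteq> A" "emeasure M E < top"
    have "ennreal (\<nu> E) \<le> ennreal \<bar>\<nu> E\<bar>" by (intro ennreal_leI) auto
    also have "\<dots> \<le> C * epowr (emeasure M E) (1 / p)" using bound E by simp
    also have "\<dots> \<le> C * epowr (emeasure M A) (1 / p)"
      using E A p_pos by (intro mult_left_mono epowr_mono emeasure_mono) auto
    finally show "ennreal (\<nu> E) \<le> C * epowr (emeasure M A) (1 / p)" .
  qed
  also have "\<dots> < top" using A C_finite by (simp add: ennreal_mult_less_top)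
  finally show ?thesis .
qed

lemma upper_variation_superadditive:
  assumes "A \<in> sets M" "B \<in> sets M" "A \<inter> B = {}"
  shows "upper_variation M \<nu> A + upper_variation M \<nu> B \<le> upper_variation M \<nu> (A \<union> B)"
proof -
  let ?S = "\<lambda>A. {E \<in> sets M. E \<subseteq> A \<and> emeasure M E < top}"
  have ne: "?S X \<noteq> {}" for X by (auto intro!: exI[of _ "{}"])
  have "ennreal (\<nu> E) + ennreal (\<nu> E') \<le> upper_variation M \<nu> (A \<union> B)" if E: "E \<in> ?S A" "E' \<in> ?S B" for E E'
  proof -
    have u: "E \<union> E' \<in> sets M" "E \<inter> E' = {}" using E assms by auto
    have f: "emeasure M (E \<union> E') < top"
      using E emeasure_subadditive[of E M E'] by (auto intro: le_less_trans)
    \<comment> \<open>If one of the values is negative, \<open>ennreal\<close> turns it into 0 and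
      the other set alone is admissible; otherwise the disjoint union is.\<close>
    consider "\<nu> E \<le> 0" | "\<nu> E' \<le> 0" | "0 \<le> \<nu> E" "0 \<le> \<nu> E'" by linarith
    then show ?thesis
    proof cases
      case 1
      then show ?thesis using upper_variation_ge[of E' "A \<union> B"] E by (simp add: ennreal_neg le_supI2)
    next
      case 2
      then show ?thesis using upper_variation_ge[of E "A \<union> B"] E by (simp add: ennreal_neg le_supI1)
    next
      case 3
      then have "ennreal (\<nu> E) + ennreal (\<nu> E') = ennreal (\<nu> (E \<union> E'))"
        using additive[of E E'] E u by (simp add: ennreal_plus)
      also have "\<dots> \<le> upper_variation M \<nu> (A \<union> B)" using u f E by (intro upper_variation_ge) auto
      finally show ?thesis .
    qed
  qed
  then have "ennreal (\<nu> E) + upper_variation M \<nu> B \<le> upper_variation M \<nu> (A \<union> B)" if "E \<in> ?S A" for E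
    unfolding upper_variation_def[of M \<nu> B] using that ne[of B]
    by (subst ennreal_SUP_add_right) (auto intro: SUP_least)
  then show ?thesis
    unfolding upper_variation_def[of M \<nu> A] using ne[of A]
    by (subst ennreal_SUP_add_left[symmetric]) (auto intro: SUP_least)
qed

lemma upper_variation_empty: "upper_variation M \<nu> {} = 0"
proof -
  have "upper_variation M \<nu> {} \<le> 0" by (rule upper_variation_le) (auto simp: empty)
  then show ?thesis by simp
qed

lemma upper_variation_sum_le:
  fixes A :: "nat \<Rightarrow> 'a set"
  assumes "range A \<subseteq> sets M" "disjoint_family A"
  shows "(\<Sum>i<m. upper_variation M \<nu> (A i)) \<le> upper_variation M \<nu> (\<Union>i<m. A i)"
proof (induction m)
  case (Suc m)
  have "(\<Union>i<m. A i) \<inter> A m = {}"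
    using assms(2) by (auto simp: disjoint_family_on_def) (metis IntI empty_iff less_irrefl)
  then have "upper_variation M \<nu> (\<Union>i<m. A i) + upper_variation M \<nu> (A m) \<le> upper_variation M \<nu> ((\<Union>i<m. A i) \<union> A m)"
    using assms(1) by (intro upper_variation_superadditive) auto
  moreover have "(\<Union>i<m. A i) \<union> A m = (\<Union>i<Suc m. A i)" by (auto simp: less_Suc_eq)
  ultimately show ?case using Suc by (auto intro: order_trans add_right_mono)
qed simp

lemma sum_partition:
  fixes A :: "nat \<Rightarrow> 'a set"
  assumes "range A \<subseteq> sets M" "disjoint_family A" "E \<in> sets M" "emeasure M E < top"
  shows "\<nu> E = (\<Sum>i<m. \<nu> (E \<inter> A i)) + \<nu> (E - (\<Union>i<m. A i))"
proof (induction m)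
  case (Suc m)
  have As: "A i \<in> sets M" for i using assms(1) by auto
  have "\<nu> (E - (\<Union>i<m. A i)) = \<nu> ((E \<inter> A m) \<union> (E - (\<Union>i<Suc m. A i)))"
  proof (rule arg_cong[of _ _ \<nu>])
    show "E - (\<Union>i<m. A i) = (E \<inter> A m) \<union> (E - (\<Union>i<Suc m. A i))"
      using assms(2) by (auto simp: disjoint_family_on_def less_Suc_eq) (metis IntI empty_iff less_irrefl)
  qed
  also have "\<dots> = \<nu> (E \<inter> A m) + \<nu> (E - (\<Union>i<Suc m. A i))"
  proof (rule additive)
    show "emeasure M (E \<inter> A m) < top" "emeasure M (E - (\<Union>i<Suc m. A i)) < top"
      by (rule finite_subset[of _ E]; use assms As in auto)+
  qed (use assms As in auto)
  finally show ?case using Suc by simp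
qed simp

text \<open>One inequality is the limit of finite superadditivity. For the other, a test set E is
  split into its parts in the first m sets and a remainder; the measure of the remainder tends to 0
  because E has finite measure, and the bound makes its charge negligible.\<close>

lemma upper_variation_countably_additive:
  assumes A: "range A \<subseteq> sets M" "disjoint_family A"
  shows "(\<Sum>i. upper_variation M \<nu> (A i)) = upper_variation M \<nu> (\<Union>i. A i)"
proof (rule antisym)
  have mono: "upper_variation M \<nu> X \<le> upper_variation M \<nu> Y" if "X \<subseteq> Y" for X Y
    using that by (intro upper_variation_le upper_variation_ge) auto
  have "(\<Sum>i<m. upper_variation M \<nu> (A i)) \<le> upper_variation M \<nu> (\<Union>i. A i)" for m
    using upper_variation_sum_le[OF A, of m] mono[of "\<Union>i<m. A i" "\<Union>i. A i"] by (auto intro: order_trans)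
  then show "(\<Sum>i. upper_variation M \<nu> (A i)) \<le> upper_variation M \<nu> (\<Union>i. A i)"
    by (intro suminf_le_const) auto
  show "upper_variation M \<nu> (\<Union>i. A i) \<le> (\<Sum>i. upper_variation M \<nu> (A i))"
  proof (rule upper_variation_le)
    fix E assume E: "E \<in> sets M" "E \<subseteq> (\<Union>i. A i)" "emeasure M E < top"
    have As: "A i \<in> sets M" for i using A(1) by auto
    let ?R = "\<lambda>m. E - (\<Union>i<m. A i)"
    have R: "?R m \<in> sets M" "emeasure M (?R m) < top" for m
      using As E by (auto intro: finite_subset[of _ E])
    have "(\<lambda>m. emeasure M (?R m)) \<longlonglongrightarrow> emeasure M (\<Inter>m. ?R m)"
    proof (rule Lim_emeasure_decseq)
      show "decseq ?R" by (auto simp: decseq_def)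
    qed (use R in \<open>auto simp: less_top\<close>)
    moreover have "(\<Inter>m. ?R m) = {}" using E(2) by auto
    ultimately have lim: "(\<lambda>m. emeasure M (?R m)) \<longlonglongrightarrow> 0" by (simp only: emeasure_empty)
    have le: "ennreal (\<nu> E) \<le> (\<Sum>i. upper_variation M \<nu> (A i)) + C * epowr (emeasure M (?R m)) (1 / p)" for m
    proof -
      have "ennreal (\<nu> E) \<le> ennreal ((\<Sum>i<m. max 0 (\<nu> (E \<inter> A i))) + \<bar>\<nu> (?R m)\<bar>)"
        unfolding sum_partition[OF A E(1,3), of m] by (intro ennreal_leI add_mono sum_mono) auto
      also have "\<dots> = (\<Sum>i<m. ennreal (\<nu> (E \<inter> A i))) + ennreal \<bar>\<nu> (?R m)\<bar>"
      proof -
        have "ennreal (max 0 t) = ennreal t" for t :: real by (simp add: max_def ennreal_neg)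
        moreover have "ennreal (\<Sum>i<m. max 0 (\<nu> (E \<inter> A i))) = (\<Sum>i<m. ennreal (max 0 (\<nu> (E \<inter> A i))))"
          by (subst sum_ennreal) auto
        ultimately show ?thesis by (subst ennreal_plus) (auto intro!: sum_nonneg)
      qed
      also have "\<dots> \<le> (\<Sum>i<m. upper_variation M \<nu> (A i)) + C * epowr (emeasure M (?R m)) (1 / p)"
      proof (rule add_mono[OF sum_mono bound[OF R]])
        fix i
        have "emeasure M (E \<inter> A i) < top" by (rule finite_subset[of _ E]) (use As E in auto)
        then show "ennreal (\<nu> (E \<inter> A i)) \<le> upper_variation M \<nu> (A i)"
          using As E by (intro upper_variation_ge) auto
      qed
      also have "(\<Sum>i<m. upper_variation M \<nu> (A i)) \<le> (\<Sum>i. upper_variation M \<nu> (A i))"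
        by (intro sum_le_suminf) auto
      finally show ?thesis by (simp add: add_right_mono)
    qed
    show "ennreal (\<nu> E) \<le> (\<Sum>i. upper_variation M \<nu> (A i))"
    proof (rule ennreal_le_epsilon)
      fix e :: real assume e: "0 < e"
      \<comment> \<open>With d = (e/(c+1))^p the bound becomes c e/(c+1) <= e; the summand 1 covers
        c = 0.\<close>
      have "\<exists>d>0. C * epowr (ennreal d) (1 / p) \<le> ennreal e"
      proof -
        obtain c where c: "C = ennreal c" "0 \<le> c" using C_finite by (cases C) auto
        have "C * epowr (ennreal ((e / (c + 1)) powr p)) (1/p) = ennreal (c * (e / (c + 1)))"
          using c e p_pos by (simp add: powr_powr ennreal_mult'[symmetric])
        also have "\<dots> \<le> ennreal e" using c e by (intro ennreal_leI) (simp add: field_simps)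
        finally show ?thesis using c e by (intro exI[of _ "(e / (c + 1)) powr p"]) auto
      qed
      then obtain d where d: "0 < d" "C * epowr (ennreal d) (1 / p) \<le> ennreal e" by blast
      have "eventually (\<lambda>m. emeasure M (?R m) < ennreal d) sequentially"
        using lim d by (intro order_tendstoD(2)[of _ 0]) auto
      then obtain m where m: "emeasure M (?R m) < ennreal d" by (auto simp: eventually_sequentially)
      have "C * epowr (emeasure M (?R m)) (1 / p) \<le> C * epowr (ennreal d) (1 / p)"
        using m p_pos by (intro mult_left_mono epowr_mono) auto
      then show "ennreal (\<nu> E) \<le> (\<Sum>i. upper_variation M \<nu> (A i)) + ennreal e"
        using le[of m] d(2) by (meson add_left_mono order_trans)
    qed
  qed
qed

lemma upper_variation_density:
  assumes "sigma_finite_measure M"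
  obtains f where "f \<in> borel_measurable M" "\<And>A. A \<in> sets M \<Longrightarrow> (\<integral>\<^sup>+x\<in>A. f x \<partial>M) = upper_variation M \<nu> A"
proof -
  interpret sigma_finite_measure M by fact
  define N where "N = measure_of (space M) (sets M) (upper_variation M \<nu>)"
  have N: "emeasure N A = upper_variation M \<nu> A" if "A \<in> sets M" for A
    unfolding N_def
  proof (rule emeasure_measure_of_sigma)
    show "sigma_algebra (space M) (sets M)" by (rule sets.sigma_algebra_axioms)
    show "positive (sets M) (upper_variation M \<nu>)" by (simp add: positive_def upper_variation_empty)
    show "countably_additive (sets M) (upper_variation M \<nu>)"
      by (auto simp: countably_additive_def upper_variation_countably_additive)
  qed (fact that)
  have sN: "sets N = sets M" by (simp add: N_def sets.sigma_sets_eq)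
  have "absolutely_continuous M N"
    unfolding absolutely_continuous_def
  proof
    fix A assume A: "A \<in> null_sets M"
    have "upper_variation M \<nu> A \<le> 0"
    proof (rule upper_variation_le)
      fix E assume "E \<in> sets M" "E \<subseteq> A" "emeasure M E < top"
      then have "\<nu> E = 0" using A emeasure_mono[of E A M] by (intro null) (auto simp: null_sets_def)
      then show "ennreal (\<nu> E) \<le> 0" by simp
    qed
    then show "A \<in> null_sets N" using A N sN by (auto simp: null_sets_def)
  qed
  then obtain f where f: "f \<in> borel_measurable M" "density M f = N"
    using Radon_Nikodym sN by blast
  show ?thesis
  proof (rule that[OF f(1)])
    fix A assume A: "A \<in> sets M"
    have "emeasure (density M f) A = (\<integral>\<^sup>+x\<in>A. f x \<partial>M)" using f(1) A by (rule emeasure_density)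
    then show "(\<integral>\<^sup>+x\<in>A. f x \<partial>M) = upper_variation M \<nu> A" using N[OF A] f(2) by simp
  qed
qed

lemma uminus: "finite_part_charge M (\<lambda>A. - \<nu> A) C p"
  by unfold_locales (auto simp: p_pos C_finite additive bound)

text \<open>For E inside A, the charge of E is that of A minus that of A - E, hence at most that of
  A plus the lower variation. The supremum over E gives one inequality, and the same argument for
  the negated charge gives the other.\<close>

lemma Jordan_decomposition:
  assumes A: "A \<in> sets M" "emeasure M A < top"
  shows "\<nu> A = enn2real (upper_variation M \<nu> A) - enn2real (upper_variation M (\<lambda>A. - \<nu> A) A)"
proof -
  have le: "enn2real (upper_variation M \<mu> A) \<le> \<mu> A + enn2real (upper_variation M (\<lambda>A. - \<mu> A) A)"
    if "finite_part_charge M \<mu> C p" for \<mu>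
  proof -
    interpret m: finite_part_charge M \<mu> C p by fact
    interpret n: finite_part_charge M "\<lambda>A. - \<mu> A" C p by (rule m.uminus)
    let ?v = "enn2real (upper_variation M (\<lambda>A. - \<mu> A) A)"
    have v: "- \<mu> E \<le> ?v" if "E \<in> sets M" "E \<subseteq> A" for E
    proof -
      have "emeasure M E < top" using that A by (intro finite_subset[of E A])
      then have "ennreal (- \<mu> E) \<le> upper_variation M (\<lambda>A. - \<mu> A) A" using that by (intro n.upper_variation_ge)
      also have "\<dots> = ennreal ?v" using n.upper_variation_finite[OF A] by simp
      finally show ?thesis by (simp add: ennreal_le_iff)
    qed
    have "upper_variation M \<mu> A \<le> ennreal (\<mu> A + ?v)"
    proof (rule m.upper_variation_le)
      fix E assume E: "E \<in> sets M" "E \<subseteq> A" "emeasure M E < top"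
      have "\<mu> (E \<union> (A - E)) = \<mu> E + \<mu> (A - E)"
        using E A by (intro m.additive finite_subset[of "A - E" A]) auto
      moreover have "E \<union> (A - E) = A" using E by auto
      ultimately show "ennreal (\<mu> E) \<le> ennreal (\<mu> A + ?v)"
        using v[of "A - E"] E A by (intro ennreal_leI) auto
    qed
    then show ?thesis using v[of A] A by (intro enn2real_leI) auto
  qed
  show ?thesis using le[OF finite_part_charge_axioms] le[OF uminus] by simp
qed

lemma density:
  assumes "sigma_finite_measure M"
  obtains h :: "'a \<Rightarrow> real" where "h \<in> borel_measurable M"
    "\<And>A. A \<in> sets M \<Longrightarrow> emeasure M A < top \<Longrightarrow> integrable M (\<lambda>x. indicator A x * h x)"
    "\<And>A. A \<in> sets M \<Longrightarrow> emeasure M A < top \<Longrightarrow> (LINT x|M. indicator A x * h x) = \<nu> A"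
proof -
  interpret n: finite_part_charge M "\<lambda>A. - \<nu> A" C p by (rule uminus)
  obtain f where f [measurable]: "f \<in> borel_measurable M" and f': "\<And>A. A \<in> sets M \<Longrightarrow> (\<integral>\<^sup>+x\<in>A. f x \<partial>M) = upper_variation M \<nu> A"
    using upper_variation_density[OF assms] by blast
  obtain g where g [measurable]: "g \<in> borel_measurable M" and g': "\<And>A. A \<in> sets M \<Longrightarrow> (\<integral>\<^sup>+x\<in>A. g x \<partial>M) = upper_variation M (\<lambda>A. - \<nu> A) A"
    using n.upper_variation_density[OF assms] by blast
  have *: "integrable M (\<lambda>x. indicator A x * enn2real (k x)) \<and> (LINT x|M. indicator A x * enn2real (k x)) = enn2real (\<integral>\<^sup>+x\<in>A. k x \<partial>M)"
    if [measurable]: "k \<in> borel_measurable M" "A \<in> sets M" and fin: "(\<integral>\<^sup>+x\<in>A. k x \<partial>M) < top" for k A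
  proof -
    have "AE x in M. k x * indicator A x \<noteq> \<infinity>" using fin by (intro nn_integral_noteq_infinite) auto
    then have "AE x in M. ennreal (indicator A x * enn2real (k x)) = k x * indicator A x"
      by eventually_elim (auto simp: indicator_def less_top split: if_splits)
    then have e: "(\<integral>\<^sup>+x. ennreal (indicator A x * enn2real (k x)) \<partial>M) = (\<integral>\<^sup>+x\<in>A. k x \<partial>M)"
      by (rule nn_integral_cong_AE)
    have "integrable M (\<lambda>x. indicator A x * enn2real (k x))"
      using e fin by (intro integrableI_nonneg) auto
    then show ?thesis using e by (subst integral_eq_nn_integral) auto
  qed
  show ?thesis
  proof (rule that[of "\<lambda>x. enn2real (f x) - enn2real (g x)"])
    fix A assume A: "A \<in> sets M" "emeasure M A < top"
    note F = *[OF f A(1)] and G = *[OF g A(1)]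
    have fin: "(\<integral>\<^sup>+x\<in>A. f x \<partial>M) < top" "(\<integral>\<^sup>+x\<in>A. g x \<partial>M) < top"
      using f'[OF A(1)] g'[OF A(1)] upper_variation_finite[OF A] n.upper_variation_finite[OF A] by auto
    show "integrable M (\<lambda>x. indicator A x * (enn2real (f x) - enn2real (g x)))"
      using F[OF fin(1)] G[OF fin(2)] by (simp add: right_diff_distrib)
    show "(LINT x|M. indicator A x * (enn2real (f x) - enn2real (g x))) = \<nu> A"
      using F[OF fin(1)] G[OF fin(2)] f'[OF A(1)] g'[OF A(1)] Jordan_decomposition[OF A] by (simp add: right_diff_distrib)
  qed auto
qed

end

lemma (in conjugate_exponents) integrable_mult:
  assumes f: "f \<in> Lp_space p" and g: "g \<in> Lp_space P"
  shows "integrable lebesgue (\<lambda>x. f x * g x)"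
    and "ennreal (cmod (LINT x|lebesgue. f x * g x)) \<le> Lp_norm p f * Lp_norm P g"
proof -
  note [measurable] = Lp_space_measurable[OF f] Lp_space_measurable[OF g]
  have e: "(\<integral>\<^sup>+x. ennreal (cmod (f x * g x)) \<partial>lebesgue) \<le> Lp_norm p f * Lp_norm P g"
    using Hoelder[of "eabs f" lebesgue "eabs g"] by (simp add: Lp_enorm_on_UNIV eabs_def norm_mult ennreal_mult')
  also have "\<dots> < top" using f g by (simp add: Lp_space_def ennreal_mult_less_top)
  finally show i: "integrable lebesgue (\<lambda>x. f x * g x)" by (intro integrableI_bounded) auto
  have "ennreal (cmod (LINT x|lebesgue. f x * g x)) \<le> (\<integral>\<^sup>+x. ennreal (cmod (f x * g x)) \<partial>lebesgue)"
    using i by (rule integral_norm_bound_ennreal)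
  then show "ennreal (cmod (LINT x|lebesgue. f x * g x)) \<le> Lp_norm p f * Lp_norm P g" using e by (rule order_trans)
qed

text \<open>The value of the functional on indicators is a charge whose real and imaginary parts
  have densities. The resulting h represents the functional on simple functions; its norm is then
  bounded by dual testing, and Hoelder finally makes f h integrable for every f in L_p.\<close>

theorem (in conjugate_exponents) Riesz_representation:
  fixes \<Lambda> :: "('n::finite) cfun \<Rightarrow> complex"
  assumes lin: "\<And>f g a b. f \<in> Lp_space p \<Longrightarrow> g \<in> Lp_space p \<Longrightarrow> \<Lambda> (\<lambda>x. a * f x + b * g x) = a * \<Lambda> f + b * \<Lambda> g"
    and bd: "\<And>f. f \<in> Lp_space p \<Longrightarrow> ennreal (cmod (\<Lambda> f)) \<le> C * Lp_norm p f" and C: "C < top"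
  obtains h where "h \<in> Lp_space P" "Lp_norm P h \<le> C" "\<And>f. f \<in> Lp_space p \<Longrightarrow> \<Lambda> f = pairing f h"
proof -
  let ?L = "lebesgue :: (real ^ 'n) measure"
  have zero: "\<Lambda> (\<lambda>x. 0) = 0" using lin[of "\<lambda>x. 0" "\<lambda>x. 0" 0 0] by simp
  have diff: "\<Lambda> f - \<Lambda> g = \<Lambda> (\<lambda>x. f x - g x)" if "f \<in> Lp_space p" "g \<in> Lp_space p" for f g
    using lin[OF that, of 1 "-1"] by simp
  have ind: "indicator A \<in> Lp_space p" if "A \<in> sets ?L" "emeasure ?L A < top" for A
    using that pos by (intro bounded_finite_support_in_Lp_space[of p _ 1 A]) (auto simp: indicator_def)
  define \<nu> where "\<nu> A = \<Lambda> (indicator A)" for A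
  have add: "\<nu> (A \<union> B) = \<nu> A + \<nu> B" if "A \<in> sets ?L" "B \<in> sets ?L" "emeasure ?L A < top" "emeasure ?L B < top" "A \<inter> B = {}" for A B
  proof -
    have "indicator (A \<union> B) = (\<lambda>x. 1 * indicator A x + 1 * indicator B x :: complex)"
      using that(5) by (auto simp: indicator_def fun_eq_iff)
    then show ?thesis unfolding \<nu>_def using lin[OF ind ind, OF that(1,3) that(2,4), of 1 1] by simp
  qed
  have bnd: "ennreal (cmod (\<nu> A)) \<le> C * epowr (emeasure ?L A) (1/p)" if "A \<in> sets ?L" "emeasure ?L A < top" for A
  proof -
    have "Lp_norm p (indicator A :: 'n cfun) \<le> ennreal 1 * epowr (emeasure ?L A) (1/p)"
      using that pos by (intro Lp_norm_bounded_finite_support) (auto simp: indicator_def)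
    then have "C * Lp_norm p (indicator A :: 'n cfun) \<le> C * epowr (emeasure ?L A) (1/p)"
      by (intro mult_left_mono) auto
    then show ?thesis unfolding \<nu>_def using bd[OF ind[OF that]] by (rule order_trans[rotated])
  qed
  interpret R: finite_part_charge ?L "\<lambda>A. Re (\<nu> A)" C p
  proof
    fix A B assume "A \<in> sets ?L" "B \<in> sets ?L" "emeasure ?L A < top" "emeasure ?L B < top" "A \<inter> B = {}"
    then show "Re (\<nu> (A \<union> B)) = Re (\<nu> A) + Re (\<nu> B)" by (simp only: add plus_complex.simps)
  qed (use pos C order_trans[OF ennreal_leI[OF abs_Re_le_cmod] bnd] in blast)+
  interpret I: finite_part_charge ?L "\<lambda>A. Im (\<nu> A)" C p
  proof
    fix A B assume "A \<in> sets ?L" "B \<in> sets ?L" "emeasure ?L A < top" "emeasure ?L B < top" "A \<inter> B = {}"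
    then show "Im (\<nu> (A \<union> B)) = Im (\<nu> A) + Im (\<nu> B)" by (simp only: add plus_complex.simps)
  qed (use pos C order_trans[OF ennreal_leI[OF abs_Im_le_cmod] bnd] in blast)+
  obtain u :: "real ^ 'n \<Rightarrow> real" where u: "u \<in> borel_measurable ?L"
    "\<And>A. A \<in> sets ?L \<Longrightarrow> emeasure ?L A < top \<Longrightarrow> integrable ?L (\<lambda>x. indicator A x * u x)"
    "\<And>A. A \<in> sets ?L \<Longrightarrow> emeasure ?L A < top \<Longrightarrow> (LINT x|?L. indicator A x * u x) = Re (\<nu> A)"
    using R.density[OF sigma_finite_lebesgue] by blast
  obtain v :: "real ^ 'n \<Rightarrow> real" where v: "v \<in> borel_measurable ?L"
    "\<And>A. A \<in> sets ?L \<Longrightarrow> emeasure ?L A < top \<Longrightarrow> integrable ?L (\<lambda>x. indicator A x * v x)"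
    "\<And>A. A \<in> sets ?L \<Longrightarrow> emeasure ?L A < top \<Longrightarrow> (LINT x|?L. indicator A x * v x) = Im (\<nu> A)"
    using I.density[OF sigma_finite_lebesgue] by blast
  define h where "h x = complex_of_real (u x) + \<i> * complex_of_real (v x)" for x
  note [measurable] = u(1) v(1)
  have hm [measurable]: "h \<in> borel_measurable lebesgue" unfolding h_def by measurable
  have hA: "integrable ?L (\<lambda>x. indicator A x * h x)" "(LINT x|?L. indicator A x * h x) = \<nu> A"
    if A: "A \<in> sets ?L" "emeasure ?L A < top" for A
  proof -
    have e: "indicator A x * h x = complex_of_real (indicator A x * u x) + \<i> * complex_of_real (indicator A x * v x)" for x
      by (simp add: h_def indicator_def)
    show "integrable ?L (\<lambda>x. indicator A x * h x)"
      unfolding e using u(2)[OF A] v(2)[OF A] by (intro Bochner_Integration.integrable_add integrable_mult_right integrable_of_real)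
    have "(LINT x|?L. indicator A x * h x) = (LINT x|?L. complex_of_real (indicator A x * u x)) +
        (LINT x|?L. \<i> * complex_of_real (indicator A x * v x))"
      unfolding e using u(2)[OF A] v(2)[OF A]
      by (intro Bochner_Integration.integral_add integrable_mult_right integrable_of_real)
    also have "\<dots> = complex_of_real (Re (\<nu> A)) + \<i> * complex_of_real (Im (\<nu> A))"
      by (simp only: integral_mult_right_zero integral_complex_of_real u(3)[OF A] v(3)[OF A])
    finally have "(LINT x|?L. indicator A x * h x) = complex_of_real (Re (\<nu> A)) + \<i> * complex_of_real (Im (\<nu> A))" .
    then show "(LINT x|?L. indicator A x * h x) = \<nu> A" by (simp add: complex_eq_iff)
  qed
  have simple: "integrable ?L (\<lambda>x. s x * h x) \<and> \<Lambda> s = (LINT x|?L. s x * h x)"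
    if s: "simple_function ?L s" "s \<in> Lp_space p" for s
  proof -
    note ls = simple_function_level_sets[OF pos s]
    have "(\<lambda>x. \<Sum>y\<in>Y. y * indicator (s -` {y}) x) \<in> Lp_space p \<and>
        integrable ?L (\<lambda>x. (\<Sum>y\<in>Y. y * indicator (s -` {y}) x) * h x) \<and>
        \<Lambda> (\<lambda>x. \<Sum>y\<in>Y. y * indicator (s -` {y}) x) = (LINT x|?L. (\<Sum>y\<in>Y. y * indicator (s -` {y}) x) * h x)"
      if "finite Y" "Y \<subseteq> range s - {0}" for Y
      using that
    proof (induction Y rule: finite_induct)
      case empty then show ?case using zero by simp
    next
      case (insert y Y)
      have y: "y \<noteq> 0" using insert.prems by auto
      note IH = insert.IH[OF order_trans[OF subset_insertI insert.prems]]
      let ?S = "\<lambda>x. \<Sum>y\<in>Y. y * indicator (s -` {y}) x" and ?i = "indicator (s -` {y}) :: 'n cfun"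
      have e: "(\<lambda>x. \<Sum>y\<in>insert y Y. y * indicator (s -` {y}) x) = (\<lambda>x. y * ?i x + 1 * ?S x)"
        by (simp only: sum.insert[OF insert.hyps] mult_1)
      have e2: "(y * ?i x + 1 * ?S x) * h x = y * (?i x * h x) + ?S x * h x" for x by (simp only: distrib_right mult_1 mult.assoc)
      have 1: "(\<lambda>x. y * ?i x + 1 * ?S x) \<in> Lp_space p"
        using IH ls[OF y] one_less by (intro Lp_space_lincomb ind) auto
      have 2: "integrable ?L (\<lambda>x. (y * ?i x + 1 * ?S x) * h x)"
        unfolding e2 using IH hA(1)[OF ls[OF y]] by (intro Bochner_Integration.integrable_add integrable_mult_right) auto
      have "\<Lambda> (\<lambda>x. y * ?i x + 1 * ?S x) = y * \<Lambda> ?i + 1 * \<Lambda> ?S"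
        using IH ls[OF y] by (intro lin ind) auto
      also have "\<dots> = y * (LINT x|?L. ?i x * h x) + (LINT x|?L. ?S x * h x)"
        using IH hA(2)[OF ls[OF y]] by (simp only: \<nu>_def mult_1)
      also have "\<dots> = (LINT x|?L. y * (?i x * h x) + ?S x * h x)"
        using IH hA(1)[OF ls[OF y]] by (subst Bochner_Integration.integral_add) (simp_all only: integral_mult_right_zero integrable_mult_right)
      finally have 3: "\<Lambda> (\<lambda>x. y * ?i x + 1 * ?S x) = (LINT x|?L. (y * ?i x + 1 * ?S x) * h x)" unfolding e2 .
      show ?case unfolding fun_cong[OF e] using 1 2 3 by blast
    qed
    from this[of "range s - {0}"] show ?thesis
      using simple_functionD(1)[OF s(1)] unfolding simple_function_sum[OF s(1), symmetric] by auto
  qed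
  \<comment> \<open>Integrability of f h is a premise here because the norm of h is still unknown.
    Bounded functions supported on sets of finite measure satisfy it, and these are enough to bound
    that norm.\<close>
  have limit: "\<Lambda> f = (LINT x|?L. f x * h x)"
    if f: "f \<in> Lp_space p" and i: "integrable ?L (\<lambda>x. f x * h x)" for f
  proof -
    obtain s where s: "\<And>i. simple_function lebesgue (s i)" "\<And>x. (\<lambda>i. s i x) \<longlonglongrightarrow> f x" "\<And>i x. cmod (s i x) \<le> 2 * cmod (f x)"
      using simple_approx[OF Lp_space_measurable[OF f]] by blast
    have sm [measurable]: "s i \<in> borel_measurable lebesgue" for i using s(1) by (rule borel_measurable_simple_function)
    note [measurable] = Lp_space_measurable[OF f]
    have "(\<lambda>x. 2 * f x) \<in> Lp_space p" using Lp_space_lincomb[OF one_less f f, of 2 0] by simp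
    then have sp: "s i \<in> Lp_space p" for i using pos s(3) by (intro Lp_space_dominated[OF _ sm]) (auto simp: norm_mult)
    have "(\<lambda>i. LINT x|?L. s i x * h x) \<longlonglongrightarrow> (LINT x|?L. f x * h x)"
    proof (rule integral_dominated_convergence[where w="\<lambda>x. 2 * norm (f x * h x)"])
      show "integrable ?L (\<lambda>x. 2 * norm (f x * h x))" using i by auto
      show "AE x in ?L. (\<lambda>i. s i x * h x) \<longlonglongrightarrow> f x * h x" by (intro AE_I2 tendsto_intros s)
      show "AE x in ?L. norm (s i x * h x) \<le> 2 * norm (f x * h x)" for i
      proof (rule AE_I2)
        fix x show "norm (s i x * h x) \<le> 2 * norm (f x * h x)"
          using mult_right_mono[OF s(3)[of i x], of "cmod (h x)"] by (simp add: norm_mult mult.assoc)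
      qed
    qed auto
    then have 1: "(\<lambda>i. \<Lambda> (s i)) \<longlonglongrightarrow> (LINT x|?L. f x * h x)" using simple[OF s(1) sp] by simp
    obtain c where c: "C = ennreal c" "0 \<le> c" using C by (cases C) auto
    have "(\<lambda>i. \<Lambda> (s i)) \<longlonglongrightarrow> \<Lambda> f"
    proof (rule LIMSEQ_I)
      fix r :: real assume r: "0 < r"
      have "eventually (\<lambda>i. Lp_norm p (\<lambda>x. f x - s i x) < ennreal (r / (c + 1))) sequentially"
        using r c by (intro Lp_dominated_convergence[OF one_less f, where K=2] s sm) auto
      then obtain N where N: "\<And>i. N \<le> i \<Longrightarrow> Lp_norm p (\<lambda>x. f x - s i x) < ennreal (r / (c + 1))"
        by (auto simp: eventually_sequentially)
      have "norm (\<Lambda> (s i) - \<Lambda> f) < r" if "N \<le> i" for i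
      proof -
        have "ennreal (cmod (\<Lambda> f - \<Lambda> (s i))) \<le> C * Lp_norm p (\<lambda>x. f x - s i x)"
          unfolding diff[OF f sp] using f sp one_less by (intro bd Lp_space_diff)
        also have "\<dots> \<le> C * ennreal (r / (c + 1))" using N[OF that] by (intro mult_left_mono) auto
        also have "\<dots> = ennreal (c * (r / (c + 1)))" using c r by (simp add: ennreal_mult'[symmetric])
        finally have "cmod (\<Lambda> f - \<Lambda> (s i)) \<le> c * (r / (c + 1))" using c r by (simp add: ennreal_le_iff)
        also have "\<dots> < r" using c r by (simp add: field_simps)
        finally show ?thesis by (simp add: norm_minus_commute)
      qed
      then show "\<exists>N. \<forall>i\<ge>N. norm (\<Lambda> (s i) - \<Lambda> f) < r" by blast
    qed
    then show ?thesis using 1 by (rule LIMSEQ_unique)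
  qed
  have norm: "Lp_norm P h \<le> C"
    unfolding Lp_enorm_on_UNIV
  proof (rule conjugate_exponents.Lnorm_leI_dual[OF conj_sym sigma_finite_lebesgue])
    fix b :: "real ^ 'n \<Rightarrow> real"
    assume [measurable]: "b \<in> borel_measurable ?L" and b: "\<And>x. 0 \<le> b x" "bdd_above (range b)"
      "emeasure ?L {x \<in> space ?L. b x \<noteq> 0} < top"
    obtain B where B: "\<And>x. b x \<le> B" using b(2) by (auto simp: bdd_above_def)
    let ?A = "{x \<in> space ?L. b x \<noteq> 0}"
    have A: "?A \<in> sets ?L" by measurable
    \<comment> \<open>Multiplying \<open>b\<close> by the conjugate phase of h makes f h equal to b
      |h|; where h vanishes, division by zero returns 0, as it should.\<close>
    define f where "f x = complex_of_real (b x) * (cnj (h x) / complex_of_real (cmod (h x)))" for x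
    have [measurable]: "cnj \<in> borel_measurable borel"
      by (intro borel_measurable_continuous_onI continuous_intros)
    have [measurable]: "f \<in> borel_measurable ?L" unfolding f_def by measurable
    have fb: "cmod (f x) \<le> b x" for x using b(1)[of x] by (simp add: f_def norm_mult norm_divide)
    have fh: "f x * h x = complex_of_real (b x * cmod (h x))" for x
    proof (cases "h x = 0")
      case False
      have "cnj (h x) * h x = complex_of_real (cmod (h x) * cmod (h x))"
        by (simp add: complex_norm_square[symmetric] mult.commute power2_eq_square[symmetric])
      moreover have "f x * h x = complex_of_real (b x) * ((cnj (h x) * h x) / complex_of_real (cmod (h x)))"
        by (simp add: f_def)
      ultimately show ?thesis using False by simp
    qed (simp add: f_def)
    have f: "f \<in> Lp_space p"
    proof (rule bounded_finite_support_in_Lp_space[OF pos _ _ A])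
      show "cmod (f x) \<le> B" for x using fb[of x] B[of x] by simp
      show "f x = 0" if "x \<notin> ?A" for x using that by (simp add: f_def)
    qed (use b in auto)
    have i: "integrable ?L (\<lambda>x. f x * h x)"
    proof (rule Bochner_Integration.integrable_bound)
      show "integrable ?L (\<lambda>x. complex_of_real B * (indicator ?A x * h x))"
        by (rule integrable_mult_right[OF hA(1)[OF A b(3)]])
      show "AE x in ?L. norm (f x * h x) \<le> norm (complex_of_real B * (indicator ?A x * h x))"
        using fb B b(1) by (intro AE_I2) (auto simp: norm_mult indicator_def f_def norm_divide intro!: mult_right_mono order_trans[OF _ abs_ge_self])
    qed auto
    have "(\<integral>\<^sup>+x. ennreal (b x) * eabs h x \<partial>?L) = (\<integral>\<^sup>+x. ennreal (b x * cmod (h x)) \<partial>?L)"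
      using b(1) by (simp add: eabs_def ennreal_mult')
    also have "\<dots> = (\<integral>\<^sup>+x. ennreal (norm (f x * h x)) \<partial>?L)"
      using b(1) by (simp add: fh norm_mult)
    also have "\<dots> = ennreal (LINT x|?L. norm (f x * h x))"
      using i by (intro nn_integral_eq_integral) auto
    also have "(LINT x|?L. norm (f x * h x)) = (LINT x|?L. b x * cmod (h x))" using b(1) by (simp add: fh norm_mult)
    also have "\<dots> = Re (\<Lambda> f)"
      unfolding limit[OF f i] by (simp only: fh integral_complex_of_real Re_complex_of_real)
    also have "ennreal (Re (\<Lambda> f)) \<le> ennreal (cmod (\<Lambda> f))" by (intro ennreal_leI complex_Re_le_cmod)
    also have "\<dots> \<le> C * Lp_norm p f" using f by (rule bd)
    also have "\<dots> \<le> C * Lnorm ?L p (\<lambda>x. ennreal (b x))"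
      unfolding Lp_enorm_on_UNIV using pos fb by (intro mult_left_mono Lnorm_mono_AE) (auto simp: eabs_def intro: ennreal_leI)
    finally show "(\<integral>\<^sup>+x. ennreal (b x) * eabs h x \<partial>?L) \<le> C * Lnorm ?L p (\<lambda>x. ennreal (b x))" .
  qed auto
  have hP: "h \<in> Lp_space P" using norm C by (auto simp: Lp_space_def)
  show ?thesis
    by (rule that[OF hP norm]) (use limit integrable_mult(1)[OF _ hP] in \<open>auto simp: pairing_def\<close>)
qed

subsection \<open>The predual Morrey norm as a function norm\<close>

text \<open>The cubes form an arbitrary sequence in which repetitions are allowed, not one summand
  per dyadic cube. Majorants can then be merged and shifted freely; equal cubes are collected only
  when an atomic representation is built.\<close>

definition atomic_majorant ::
  "(real ^ 'n::finite \<Rightarrow> ennreal) \<Rightarrow> (nat \<Rightarrow> int) \<Rightarrow> (nat \<Rightarrow> int ^ 'n) \<Rightarrow> (nat \<Rightarrow> real ^ 'n \<Rightarrow> ennreal) \<Rightarrow> bool" where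
  "atomic_majorant F J M b \<longleftrightarrow>
     (\<forall>i. b i \<in> borel_measurable lebesgue \<and> (\<forall>x. x \<notin> dyadic_cube (J i) (M i) \<longrightarrow> b i x = 0)) \<and>
     (AE x in lebesgue. F x \<le> (\<Sum>i. b i x))"

text \<open>This is the inverse of the norm bound on an atom at level J: weight times L_p norm is
  the coefficient needed to write a function as a multiple of an admissible atom.\<close>

definition atom_weight :: "'n::finite itself \<Rightarrow> real \<Rightarrow> real \<Rightarrow> int \<Rightarrow> ennreal" where
  "atom_weight _ \<rho> p J = ennreal (2 powr (real_of_int J * (real CARD('n) / p + \<rho>)))"

definition atomic_cost :: "real \<Rightarrow> real \<Rightarrow> (nat \<Rightarrow> int) \<Rightarrow> (nat \<Rightarrow> real ^ 'n::finite \<Rightarrow> ennreal) \<Rightarrow> ennreal" where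
  "atomic_cost \<rho> p J b = (\<Sum>i. atom_weight TYPE('n) \<rho> p (J i) * Lp_enorm_on p UNIV (b i))"

text \<open>
  The lattice norm behind \<^const>\<open>predual_enorm\<close>: only the size of the atoms matters, so an atomic
  decomposition can be replaced by a majorant.
\<close>
definition atomic_norm :: "real \<Rightarrow> real \<Rightarrow> (real ^ 'n::finite \<Rightarrow> ennreal) \<Rightarrow> ennreal" where
  "atomic_norm \<rho> p F = Inf {atomic_cost \<rho> p J b | J M b. atomic_majorant F J M b}"

lemma ennreal_mult_divide_cancel:
  fixes a c :: ennreal
  assumes "c \<noteq> 0" "c < top" shows "c * (a / c) = a"
proof -
  obtain t where t: "c = ennreal t" "0 < t" using assms by (cases c) (auto simp: less_le)
  show ?thesis
  proof (cases a)
    case (real s)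
    then show ?thesis using t by (simp add: divide_ennreal ennreal_mult'[symmetric])
  next
    case top
    then show ?thesis using t by (simp add: ennreal_top_divide ennreal_mult_top)
  qed
qed

lemma le_cmult_Inf:
  fixes a c :: ennreal
  assumes c: "c \<noteq> 0" "c < top" and le: "\<And>X. X \<in> A \<Longrightarrow> a \<le> c * X"
  shows "a \<le> c * Inf A"
proof -
  have "a / c \<le> Inf A"
    using c le by (intro Inf_greatest divide_le_posI_ennreal) (auto simp: zero_less_iff_neq_zero)
  then have "c * (a / c) \<le> c * Inf A" by (rule mult_left_mono) simp
  then show ?thesis by (simp only: ennreal_mult_divide_cancel[OF c])
qed

lemma atom_weight_simps [simp]: "atom_weight t \<rho> p J \<noteq> 0" "atom_weight t \<rho> p J \<noteq> top" "atom_weight t \<rho> p J < top"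
  by (auto simp: atom_weight_def)

lemma atomic_norm_le: "atomic_majorant F J M b \<Longrightarrow> atomic_norm \<rho> p F \<le> atomic_cost \<rho> p J b"
  unfolding atomic_norm_def by (rule Inf_lower) blast

lemma atomic_norm_less:
  assumes "atomic_norm \<rho> p F < S"
  obtains J M b where "atomic_majorant F J M b" "atomic_cost \<rho> p J b < S"
  using assms unfolding atomic_norm_def Inf_less_iff by blast

lemma atomic_norm_mono_AE:
  assumes "AE x in lebesgue. F x \<le> G x" shows "atomic_norm \<rho> p F \<le> atomic_norm \<rho> p G"
proof -
  have "atomic_majorant G J M b \<Longrightarrow> atomic_majorant F J M b" for J M b
    using assms unfolding atomic_majorant_def by (auto elim: AE_mp intro: order_trans)
  then show ?thesis unfolding atomic_norm_def by (intro Inf_superset_mono) blast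
qed

lemma atomic_norm_cong_AE:
  "AE x in lebesgue. F x = G x \<Longrightarrow> atomic_norm \<rho> p F = atomic_norm \<rho> p G"
  by (intro antisym atomic_norm_mono_AE) (auto elim: AE_mp)

lemma atomic_majorant_measurable: "atomic_majorant F J M b \<Longrightarrow> b i \<in> borel_measurable lebesgue"
  by (simp add: atomic_majorant_def)

text \<open>Majorants that are optimal up to e 2^(-k-1) are merged into a single sequence through
  \<open>prod_decode\<close>. This countable triangle inequality is what allows summation over
  annuli and over atoms.\<close>

lemma atomic_norm_suminf:
  "atomic_norm \<rho> p (\<lambda>x. \<Sum>k. F k x) \<le> (\<Sum>k. atomic_norm \<rho> p (F k :: real ^ 'n::finite \<Rightarrow> ennreal))"
proof (cases "(\<Sum>k. atomic_norm \<rho> p (F k)) < top")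
  case True
  show ?thesis
  proof (rule ennreal_le_epsilon)
    fix e :: real assume e: "0 < e"
    have fin: "atomic_norm \<rho> p (F k) < top" for k
      using True ennreal_le_suminf[of "\<lambda>k. atomic_norm \<rho> p (F k)" k] by (rule le_less_trans[rotated])
    have "\<exists>J M b. atomic_majorant (F k) J M b \<and> atomic_cost \<rho> p J b < atomic_norm \<rho> p (F k) + ennreal (e * (1/2) ^ Suc k)" for k
    proof -
      have "atomic_norm \<rho> p (F k) < atomic_norm \<rho> p (F k) + ennreal (e * (1/2) ^ Suc k)"
        using fin[of k] e by (cases "atomic_norm \<rho> p (F k)") (auto simp: ennreal_plus[symmetric] ennreal_less_iff simp del: ennreal_plus)
      then show ?thesis by (meson atomic_norm_less)
    qed
    then obtain J M b where *: "\<And>k. atomic_majorant (F k) (J k) (M k) (b k)"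
      "\<And>k. atomic_cost \<rho> p (J k) (b k) < atomic_norm \<rho> p (F k) + ennreal (e * (1/2) ^ Suc k)"
      by metis
    define J' where "J' i = (case prod_decode i of (k, l) \<Rightarrow> J k l)" for i
    define M' where "M' i = (case prod_decode i of (k, l) \<Rightarrow> M k l)" for i
    define b' where "b' i = (case prod_decode i of (k, l) \<Rightarrow> b k l)" for i
    have "atomic_majorant (\<lambda>x. \<Sum>k. F k x) J' M' b'"
      unfolding atomic_majorant_def
    proof (intro conjI allI impI)
      fix i show "b' i \<in> borel_measurable lebesgue"
        using *(1) by (auto simp: b'_def atomic_majorant_def split: prod.split)
      fix x assume "x \<notin> dyadic_cube (J' i) (M' i)" then show "b' i x = 0"
        using *(1) by (auto simp: b'_def J'_def M'_def atomic_majorant_def split: prod.splits)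
    next
      have "AE x in lebesgue. \<forall>k. F k x \<le> (\<Sum>i. b k i x)"
        unfolding AE_all_countable using *(1) by (auto simp: atomic_majorant_def)
      then show "AE x in lebesgue. (\<Sum>k. F k x) \<le> (\<Sum>i. b' i x)"
      proof eventually_elim
        case (elim x)
        have "(\<Sum>i. case prod_decode i of (k, l) \<Rightarrow> b k l x) = (\<Sum>k. \<Sum>l. b k l x)"
          by (rule suminf_ennreal_2dimen[where f="\<lambda>(k, l). b k l x"]) auto
        moreover have "(\<lambda>i. b' i x) = (\<lambda>i. case prod_decode i of (k, l) \<Rightarrow> b k l x)"
          by (auto simp: b'_def fun_eq_iff split: prod.split)
        ultimately show ?case using elim by (auto intro: suminf_le)
      qed
    qed
    then have "atomic_norm \<rho> p (\<lambda>x. \<Sum>k. F k x) \<le> atomic_cost \<rho> p J' b'" by (rule atomic_norm_le)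
    also have "\<dots> = (\<Sum>k. atomic_cost \<rho> p (J k) (b k))"
    proof -
      let ?f = "\<lambda>(k, l). atom_weight TYPE('n) \<rho> p (J k l) * Lp_enorm_on p UNIV (b k l)"
      have "(\<Sum>i. ?f (prod_decode i)) = (\<Sum>k. atomic_cost \<rho> p (J k) (b k))"
        by (rule suminf_ennreal_2dimen) (simp add: atomic_cost_def)
      moreover have "atomic_cost \<rho> p J' b' = (\<Sum>i. ?f (prod_decode i))"
        unfolding atomic_cost_def by (intro suminf_cong) (auto simp: J'_def b'_def split: prod.split)
      ultimately show ?thesis by simp
    qed
    also have "\<dots> \<le> (\<Sum>k. atomic_norm \<rho> p (F k) + ennreal (e * (1/2) ^ Suc k))"
      using *(2) by (intro suminf_le less_imp_le) auto
    also have "\<dots> = (\<Sum>k. atomic_norm \<rho> p (F k)) + (\<Sum>k. ennreal (e * (1/2) ^ Suc k))"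
      by (rule suminf_add[symmetric]) auto
    also have "(\<Sum>k. ennreal (e * (1/2) ^ Suc k)) = ennreal e"
    proof (rule suminf_ennreal_eq)
      show "(\<lambda>k. e * (1/2) ^ Suc k) sums e"
        using sums_mult[OF power_half_series, of e] by simp
    qed (use e in auto)
    finally show "atomic_norm \<rho> p (\<lambda>x. \<Sum>k. F k x) \<le> (\<Sum>k. atomic_norm \<rho> p (F k)) + ennreal e" .
  qed
qed (auto simp: not_less top_unique)

lemma suminf_ennreal_single: "(\<Sum>i. if i = k then v else 0) = (v :: ennreal)"
proof -
  have "(\<Sum>i. if i = k then v else 0) = (\<Sum>i\<in>{k}. if i = k then v else 0)" by (rule suminf_finite) auto
  then show ?thesis by simp
qed

lemma suminf_ennreal_swap: "(\<Sum>k. \<Sum>i. g i k) = (\<Sum>i. \<Sum>k. g i k :: ennreal)"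
proof -
  have "(\<integral>\<^sup>+k. (\<Sum>i. g i k) \<partial>count_space UNIV) = (\<Sum>i. \<integral>\<^sup>+k. g i k \<partial>count_space UNIV)"
    by (rule nn_integral_suminf) auto
  then show ?thesis by (simp add: nn_integral_count_space_nat)
qed

lemma atomic_norm_single:
  fixes F :: "real ^ 'n::finite \<Rightarrow> ennreal"
  assumes "F \<in> borel_measurable lebesgue" "\<And>x. x \<notin> dyadic_cube J M \<Longrightarrow> F x = 0"
  shows "atomic_norm \<rho> p F \<le> atom_weight TYPE('n) \<rho> p J * Lp_enorm_on p UNIV F"
proof -
  have "atomic_majorant F (\<lambda>_. J) (\<lambda>_. M) (\<lambda>i x. if i = 0 then F x else 0)"
    using assms by (auto simp: atomic_majorant_def suminf_ennreal_single)
  then have "atomic_norm \<rho> p F \<le> atomic_cost \<rho> p (\<lambda>_. J) (\<lambda>i x. if i = 0 then F x else 0)"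
    by (rule atomic_norm_le)
  also have "\<dots> = (\<Sum>i::nat. if i = 0 then atom_weight TYPE('n) \<rho> p J * Lp_enorm_on p UNIV F else 0)"
    unfolding atomic_cost_def by (intro suminf_cong) (simp add: Lp_enorm_on_def)
  finally show ?thesis by (simp add: suminf_ennreal_single)
qed

lemma atomic_norm_cube:
  fixes F :: "real ^ 'n::finite \<Rightarrow> ennreal"
  assumes "F \<in> borel_measurable lebesgue" "\<And>x. x \<notin> cube z s \<Longrightarrow> F x = 0" "2 * s \<le> 2 powr (- real_of_int J)"
  shows "atomic_norm \<rho> p F \<le> atom_weight TYPE('n) \<rho> p J * Lp_enorm_on p UNIV F"
proof -
  obtain M where "cube z s \<subseteq> dyadic_cube J M" using cube_subset_dyadic assms(3) by blast
  then show ?thesis using assms by (intro atomic_norm_single[of F J M]) auto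
qed

lemma atomic_norm_add: "atomic_norm \<rho> p (\<lambda>x. F x + G x) \<le> atomic_norm \<rho> p F + atomic_norm \<rho> p G"
proof -
  let ?H = "\<lambda>k::nat. if k = 0 then F else if k = 1 then G else (\<lambda>_. 0)"
  have fin2: "(\<Sum>k. h k) = h 0 + h 1" if "\<And>k. 1 < k \<Longrightarrow> h k = 0" for h :: "nat \<Rightarrow> ennreal"
  proof -
    have "(\<Sum>k. h k) = (\<Sum>k\<in>{0,1}. h k)" by (rule suminf_finite) (use that in auto)
    then show ?thesis by simp
  qed
  have z: "atomic_norm \<rho> p (\<lambda>_. 0) = 0"
    using atomic_norm_single[of "\<lambda>_. 0" 0 0 \<rho> p] by (simp add: Lp_enorm_on_def)
  have "atomic_norm \<rho> p (\<lambda>x. \<Sum>k. ?H k x) \<le> (\<Sum>k. atomic_norm \<rho> p (?H k))" by (rule atomic_norm_suminf)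
  moreover have "(\<Sum>k. ?H k x) = F x + G x" for x by (subst fin2) auto
  moreover have "(\<Sum>k. atomic_norm \<rho> p (?H k)) = atomic_norm \<rho> p F + atomic_norm \<rho> p G" by (subst fin2) (auto simp: z)
  ultimately show ?thesis by simp
qed

lemma atomic_norm_cmult_le:
  fixes F :: "real ^ 'n::finite \<Rightarrow> ennreal"
  assumes p: "0 < p" and c: "c < top"
  shows "atomic_norm \<rho> p (\<lambda>x. c * F x) \<le> c * atomic_norm \<rho> p F"
proof -
  have "atomic_norm \<rho> p (\<lambda>x. c * F x) \<le> c * atomic_cost \<rho> p J b" if "atomic_majorant F J M b" for J M b
  proof -
    note [measurable] = atomic_majorant_measurable[OF that]
    have "(\<lambda>x. c * b i x) \<in> borel_measurable lebesgue" for i by measurable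
    then have "atomic_majorant (\<lambda>x. c * F x) J M (\<lambda>i x. c * b i x)"
      using that by (auto simp: atomic_majorant_def elim!: AE_mp intro!: mult_left_mono)
    then have "atomic_norm \<rho> p (\<lambda>x. c * F x) \<le> atomic_cost \<rho> p J (\<lambda>i x. c * b i x)" by (rule atomic_norm_le)
    also have "\<dots> = (\<Sum>i. c * (atom_weight TYPE('n) \<rho> p (J i) * Lp_enorm_on p UNIV (b i)))"
      unfolding atomic_cost_def using that p
      by (intro suminf_cong) (simp add: Lp_cmult atomic_majorant_measurable mult_ac)
    finally show ?thesis by (simp add: atomic_cost_def)
  qed
  then have le: "atomic_norm \<rho> p (\<lambda>x. c * F x) \<le> c * X"
    if "X \<in> {atomic_cost \<rho> p J b | J M b. atomic_majorant F J M b}" for X using that by blast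
  show ?thesis
  proof (cases "c = 0")
    case True
    then show ?thesis using atomic_norm_single[of "\<lambda>_. 0" 0 0 \<rho> p] by (simp add: Lp_enorm_on_def)
  next
    case False
    then show ?thesis unfolding atomic_norm_def[of _ _ F] using c le by (rule le_cmult_Inf)
  qed
qed

text \<open>This weight distributes a function among the summands of a majorant. The fraction
  depends on the point and on the majorant only, so that one choice serves all entries of a
  sequence. It is 0 where the sum is 0 or infinite.\<close>

definition share :: "(nat \<Rightarrow> 'a \<Rightarrow> ennreal) \<Rightarrow> nat \<Rightarrow> 'a \<Rightarrow> real" where
  "share b i x = enn2real (b i x / (\<Sum>i. b i x))"

lemma share_nonneg: "0 \<le> share b i x" by (simp add: share_def)

lemma share_measurable [measurable]:
  assumes [measurable]: "\<And>i. b i \<in> borel_measurable M" shows "share b i \<in> borel_measurable M"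
  unfolding share_def[abs_def] by measurable

lemma share_mult_le: "ennreal (share b i x) * (\<Sum>i. b i x) \<le> b i x"
proof (cases "(\<Sum>i. b i x) = top \<or> (\<Sum>i. b i x) = 0")
  case True then show ?thesis by (auto simp: share_def divide_ennreal_def)
next
  case False
  have "b i x \<le> (\<Sum>i. b i x)" by (rule ennreal_le_suminf)
  then have "b i x < top" using False by (auto simp: less_top[symmetric] top_unique)
  then have "b i x / (\<Sum>i. b i x) < top" using False by (auto simp: ennreal_divide_eq_top_iff less_top[symmetric])
  then have "ennreal (share b i x) = b i x / (\<Sum>i. b i x)" by (simp add: share_def)
  then show ?thesis using False by (simp add: ennreal_mult_divide_cancel mult.commute[of "b i x / _"] less_top)
qed

lemma share_sums:
  assumes "0 < (\<Sum>i. b i x)" "(\<Sum>i. b i x) < top"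
  shows "(\<lambda>i. share b i x) sums 1"
proof -
  have lt: "b i x < top" for i using ennreal_le_suminf[of "\<lambda>i. b i x" i] assms(2) by (rule le_less_trans)
  have "b i x / (\<Sum>i. b i x) < top" for i
    using lt[of i] assms by (auto simp: ennreal_divide_eq_top_iff less_top[symmetric])
  then have "(\<Sum>i. ennreal (share b i x)) = (\<Sum>i. b i x / (\<Sum>i. b i x))" by (simp add: share_def)
  also have "\<dots> = (\<Sum>i. b i x) / (\<Sum>i. b i x)" by simp
  also have "\<dots> = 1" using assms by (intro ennreal_divide_self) auto
  finally have s: "(\<Sum>i. ennreal (share b i x)) = ennreal 1" by simp
  have "summable (\<lambda>i. share b i x)"
    using s by (intro summable_suminf_not_top share_nonneg) auto
  then show ?thesis using s share_nonneg[of b _ x]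
    by (simp add: sums_iff suminf_ennreal2 suminf_nonneg)
qed

lemma share_decomposition:
  fixes y :: complex
  assumes "ennreal (cmod y) \<le> (\<Sum>i. b i x)" "(\<Sum>i. b i x) < top"
  shows "(\<lambda>i. y * complex_of_real (share b i x)) sums y"
    and "(\<Sum>i. ennreal (cmod (y * complex_of_real (share b i x)))) = ennreal (cmod y)"
    and "ennreal (cmod (y * complex_of_real (share b i x))) \<le> b i x"
proof -
  have "(\<lambda>i. y * complex_of_real (share b i x)) sums y \<and>
      (\<Sum>i. ennreal (cmod (y * complex_of_real (share b i x)))) = ennreal (cmod y)"
  proof (cases "y = 0")
    case False
    then have "0 < (\<Sum>i. b i x)" using assms(1) by (auto intro: less_le_trans[rotated])
    then have s: "(\<lambda>i. share b i x) sums 1" using assms(2) by (rule share_sums)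
    have "(\<lambda>i. y * complex_of_real (share b i x)) sums (y * complex_of_real 1)"
      by (intro sums_mult sums_of_real s)
    moreover have "(\<Sum>i. ennreal (cmod (y * complex_of_real (share b i x)))) = ennreal (cmod y)"
    proof (rule suminf_ennreal_eq)
      show "(\<lambda>i. cmod (y * complex_of_real (share b i x))) sums cmod y"
        using sums_mult[OF s, of "cmod y"] by (simp add: norm_mult share_nonneg)
    qed simp
    ultimately show ?thesis by simp
  qed auto
  then show "(\<lambda>i. y * complex_of_real (share b i x)) sums y"
    "(\<Sum>i. ennreal (cmod (y * complex_of_real (share b i x)))) = ennreal (cmod y)" by auto
  have "ennreal (cmod (y * complex_of_real (share b i x))) = ennreal (share b i x) * ennreal (cmod y)"
    by (simp add: norm_mult share_nonneg ennreal_mult' mult.commute)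
  also have "\<dots> \<le> ennreal (share b i x) * (\<Sum>i. b i x)" using assms(1) by (rule mult_left_mono) simp
  also have "\<dots> \<le> b i x" by (rule share_mult_le)
  finally show "ennreal (cmod (y * complex_of_real (share b i x))) \<le> b i x" .
qed

section \<open>Hoelder duality between Morrey norms and atomic norms\<close>

locale morrey_exponents = conjugate_exponents p P for p P :: real +
  fixes r \<rho> :: real and dim :: "'n::finite itself"
  assumes r_lower: "- real CARD('n) / p < r" and r_neg: "r < 0" and r_rho: "r + \<rho> = - real CARD('n)"
begin

text \<open>From 1/P = 1 - 1/p and r + \<rho> = -n one gets n/P + \<rho> = -(n/p + r). Atomic
  weights and Morrey weights are therefore inverse to each other on every cube.\<close>

lemma atom_weight_eq: "atom_weight TYPE('n) \<rho> P J = ennreal (2 powr (- real_of_int J * (real CARD('n) / p + r)))"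
proof -
  have "real CARD('n) / P = real CARD('n) * (1 - 1 / p)" by (simp add: conj_inverse[symmetric])
  then have "real CARD('n) / P + \<rho> = - (real CARD('n) / p + r)" using r_rho by (simp add: algebra_simps)
  then show ?thesis unfolding atom_weight_def by (simp only: mult_minus_left mult_minus_right)
qed

text \<open>On each cube of a majorant Hoelder applies, and the atomic weight cancels the Morrey
  weight; summation leaves the cost of the majorant times the Morrey norm.\<close>

lemma atomic_duality:
  fixes F G :: "real ^ 'n \<Rightarrow> ennreal"
  assumes [measurable]: "F \<in> borel_measurable lebesgue" "G \<in> borel_measurable lebesgue"
    and fin: "morrey_enorm r p G < top"
  shows "(\<integral>\<^sup>+x. F x * G x \<partial>lebesgue) \<le> atomic_norm \<rho> P F * morrey_enorm r p G"
proof -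
  have le: "(\<integral>\<^sup>+x. F x * G x \<partial>lebesgue) \<le> morrey_enorm r p G * atomic_cost \<rho> P J b"
    if maj: "atomic_majorant F J M b" for J M b
  proof -
    note [measurable] = atomic_majorant_measurable[OF maj]
    have one: "(\<integral>\<^sup>+x. b i x * G x \<partial>lebesgue) \<le> morrey_enorm r p G * (atom_weight TYPE('n) \<rho> P (J i) * Lp_enorm_on P UNIV (b i))" for i
    proof -
      let ?Q = "dyadic_cube (J i) (M i)"
      have "(\<integral>\<^sup>+x. b i x * G x \<partial>lebesgue) = (\<integral>\<^sup>+x\<in>?Q. G x * b i x \<partial>lebesgue)"
        using maj by (intro nn_integral_cong) (auto simp: atomic_majorant_def indicator_def mult.commute)
      also have "\<dots> \<le> Lp_enorm_on p ?Q G * Lp_enorm_on P ?Q (b i)" by (rule Hoelder_on) auto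
      also have "\<dots> \<le> (atom_weight TYPE('n) \<rho> P (J i) * morrey_enorm r p G) * Lp_enorm_on P UNIV (b i)"
        unfolding atom_weight_eq using conj_pos by (intro mult_mono Lp_le_morrey Lp_le_UNIV) auto
      finally show ?thesis by (simp add: mult_ac)
    qed
    have "(\<integral>\<^sup>+x. F x * G x \<partial>lebesgue) \<le> (\<integral>\<^sup>+x. (\<Sum>i. b i x * G x) \<partial>lebesgue)"
      using maj by (intro nn_integral_mono_AE) (auto simp: atomic_majorant_def elim!: AE_mp intro!: mult_right_mono)
    also have "\<dots> = (\<Sum>i. \<integral>\<^sup>+x. b i x * G x \<partial>lebesgue)" by (rule nn_integral_suminf) auto
    also have "\<dots> \<le> (\<Sum>i. morrey_enorm r p G * (atom_weight TYPE('n) \<rho> P (J i) * Lp_enorm_on P UNIV (b i)))"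
      by (intro suminf_le one) auto
    finally show ?thesis by (simp add: atomic_cost_def)
  qed
  \<comment> \<open>In \<open>ennreal\<close> the product of top and 0 is 0, and passing to the
    infimum of the costs requires a nonzero factor. A vanishing Morrey norm is therefore treated on
    its own, through G = 0 almost everywhere.\<close>
  show ?thesis
  proof (cases "atomic_norm \<rho> P F = top \<and> morrey_enorm r p G \<noteq> 0")
    case True then show ?thesis by (simp add: ennreal_top_mult)
  next
    case False
    show ?thesis
    proof (cases "morrey_enorm r p G = 0")
      case True
      then have "AE x in lebesgue. G x = 0" using pos by (subst (asm) morrey_eq_0_iff) auto
      then have "(\<integral>\<^sup>+x. F x * G x \<partial>lebesgue) = (\<integral>\<^sup>+x. 0 \<partial>(lebesgue :: (real^'n) measure))"
        by (intro nn_integral_cong_AE) (auto elim: AE_mp)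
      then show ?thesis by simp
    next
      case n0: False
      have "(\<integral>\<^sup>+x. F x * G x \<partial>lebesgue) \<le> morrey_enorm r p G * atomic_norm \<rho> P F"
        unfolding atomic_norm_def using n0 fin by (rule le_cmult_Inf) (use le in blast)
      then show ?thesis by (simp add: mult.commute)
    qed
  qed
qed

lemma morrey_indicator_finite: "morrey_enorm r p (indicator (cube (x :: real ^ 'n) s)) < top"
proof -
  have "cube x s \<subseteq> cube x (max s 0)" by (rule cube_mono) simp
  then have "morrey_enorm r p (indicator (cube x s)) \<le> morrey_enorm r p (indicator (cube x (max s 0)))"
    using pos by (intro morrey_mono) (auto simp: indicator_def)
  also have "\<dots> \<le> ennreal (2 powr (real CARD('n) / p)) * 1 + Lp_enorm_on p UNIV (indicator (cube x (max s 0)))"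
    using pos r_lower r_neg by (intro morrey_le_sup_Lp) (auto simp: indicator_def)
  also have "Lp_enorm_on p UNIV (indicator (cube x (max s 0))) = Lp_enorm_on p (cube x (max s 0)) (\<lambda>_. 1)"
    using Lp_enorm_on_indicator[of p "\<lambda>_. 1" "cube x (max s 0)"] by simp
  also have "\<dots> = ennreal (((2 * max s 0) ^ CARD('n)) powr (1/p))"
    using pos by (simp add: Lp_const emeasure_cube_lborel)
  finally show ?thesis by (rule le_less_trans) (simp add: ennreal_mult_less_top)
qed

text \<open>Indicators of cubes have finite Morrey norm, so that duality makes F integrable over
  every cube.\<close>

lemma AE_finite_if_atomic_norm_finite:
  fixes F :: "real ^ 'n \<Rightarrow> ennreal"
  assumes [measurable]: "F \<in> borel_measurable lebesgue" and "atomic_norm \<rho> P F < top"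
  shows "AE x in lebesgue. F x < top"
proof (rule AE_cubesI)
  fix m :: nat
  have "(\<integral>\<^sup>+x. F x * indicator (cube 0 (2 ^ m)) x \<partial>lebesgue) \<le> atomic_norm \<rho> P F * morrey_enorm r p (indicator (cube (0 :: real ^ 'n) (2^m)))"
    by (rule atomic_duality) (auto simp: morrey_indicator_finite)
  also have "\<dots> < top" using assms(2) morrey_indicator_finite by (simp add: ennreal_mult_less_top)
  finally have "AE x in lebesgue. F x * indicator (cube 0 (2 ^ m)) x \<noteq> \<infinity>"
    by (intro nn_integral_noteq_infinite) auto
  then show "AE x in lebesgue. x \<in> cube 0 (2 ^ m) \<longrightarrow> F x < top"
    by eventually_elim (auto simp: less_top)
qed

lemma atomic_norm_eq_0D:
  fixes F :: "real ^ 'n \<Rightarrow> ennreal"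
  assumes [measurable]: "F \<in> borel_measurable lebesgue" and "atomic_norm \<rho> P F = 0"
  shows "AE x in lebesgue. F x = 0"
proof (rule AE_cubesI)
  fix m :: nat
  have "(\<integral>\<^sup>+x. F x * indicator (cube 0 (2 ^ m)) x \<partial>lebesgue) \<le> atomic_norm \<rho> P F * morrey_enorm r p (indicator (cube (0 :: real ^ 'n) (2^m)))"
    by (rule atomic_duality) (auto simp: morrey_indicator_finite)
  then have "(\<integral>\<^sup>+x. F x * indicator (cube 0 (2 ^ m)) x \<partial>lebesgue) = 0" using assms(2) by simp
  then have "AE x in lebesgue. F x * indicator (cube 0 (2 ^ m)) x = 0"
    by (subst (asm) nn_integral_0_iff_AE) auto
  then show "AE x in lebesgue. x \<in> cube 0 (2 ^ m) \<longrightarrow> F x = 0"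
    by eventually_elim auto
qed

lemma AE_majorant_finite:
  fixes F :: "real ^ 'n \<Rightarrow> ennreal"
  assumes maj: "atomic_majorant F J M b" and "atomic_cost \<rho> P J b < top"
  shows "AE x in lebesgue. (\<Sum>i. b i x) < top"
proof (rule AE_finite_if_atomic_norm_finite)
  note [measurable] = atomic_majorant_measurable[OF maj]
  show "(\<lambda>x. \<Sum>i. b i x) \<in> borel_measurable lebesgue" by measurable
  have "atomic_majorant (\<lambda>x. \<Sum>i. b i x) J M b" using maj by (simp add: atomic_majorant_def)
  then show "atomic_norm \<rho> P (\<lambda>x. \<Sum>i. b i x) < top" using assms(2) atomic_norm_le le_less_trans by blast
qed

lemma integrable_if_dual:
  fixes f g :: "'n cfun"
  assumes [measurable]: "f \<in> borel_measurable lebesgue" "g \<in> borel_measurable lebesgue"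
    and "morrey_enorm r p (eabs f) < top" "atomic_norm \<rho> P (eabs g) < top"
  shows "integrable lebesgue (\<lambda>x. f x * g x)"
    and "ennreal (cmod (pairing f g)) \<le> atomic_norm \<rho> P (eabs g) * morrey_enorm r p (eabs f)"
proof -
  have e: "(\<integral>\<^sup>+x. ennreal (cmod (f x * g x)) \<partial>lebesgue) \<le> atomic_norm \<rho> P (eabs g) * morrey_enorm r p (eabs f)"
    using atomic_duality[of "eabs g" "eabs f"] assms by (simp add: eabs_def norm_mult ennreal_mult' mult.commute)
  also have "\<dots> < top" using assms by (simp add: ennreal_mult_less_top)
  finally show i: "integrable lebesgue (\<lambda>x. f x * g x)" by (intro integrableI_bounded) auto
  have "ennreal (cmod (LINT x|lebesgue. f x * g x)) \<le> (\<integral>\<^sup>+x. ennreal (cmod (f x * g x)) \<partial>lebesgue)"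
    using i by (rule integral_norm_bound_ennreal)
  then show "ennreal (cmod (pairing f g)) \<le> atomic_norm \<rho> P (eabs g) * morrey_enorm r p (eabs f)"
    unfolding pairing_def using e by (rule order_trans)
qed

end

subsection \<open>The predual Morrey space\<close>

lemma schwartz_smooth: "\<phi> \<in> schwartz_functions \<Longrightarrow> smooth \<phi>"
  by (simp add: schwartz_functions_def)

lemma continuous_lebesgue_measurable:
  "continuous_on UNIV f \<Longrightarrow> (f :: 'a::euclidean_space \<Rightarrow> 'b::topological_space) \<in> borel_measurable lebesgue"
  by (intro measurable_completion) (simp add: borel_measurable_continuous_onI)

lemma schwartz_measurable [measurable_dest]: "\<phi> \<in> schwartz_functions \<Longrightarrow> \<phi> \<in> borel_measurable lebesgue"
  by (simp add: smooth_measurable schwartz_smooth)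

lemma schwartz_seminorm_ge:
  fixes \<phi> :: "('n::finite) cfun"
  assumes "\<phi> \<in> schwartz_functions"
  shows "(1 + norm x) ^ N * cmod (\<phi> x) \<le> schwartz_seminorm N \<phi>"
proof -
  have fin: "finite {is :: 'n list. length is \<le> N}"
    using finite_lists_length_le[of "UNIV :: 'n set" N] by simp
  have "\<exists>B. \<forall>x. (1 + norm x) ^ N * cmod (iterated_partial is \<phi> x) \<le> B" for "is"
  proof -
    have "bounded (range (\<lambda>x. (1 + norm x) ^ N *\<^sub>R iterated_partial is \<phi> x))"
      using assms by (simp add: schwartz_functions_def)
    then show ?thesis by (auto simp: bounded_iff)
  qed
  then obtain B where B: "\<And>is x. (1 + norm x) ^ N * cmod (iterated_partial is \<phi> x) \<le> B is" by metis
  have "bdd_above ((\<lambda>(is, x). (1 + norm x) ^ N * cmod (iterated_partial is \<phi> x)) ` ({is. length is \<le> N} \<times> UNIV))"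
  proof (rule bdd_aboveI2)
    fix z assume "z \<in> {is :: 'n list. length is \<le> N} \<times> (UNIV :: (real ^ 'n) set)"
    then obtain "is" x where z: "z = (is, x)" "length is \<le> N" by (cases z) auto
    have "B is \<le> Max (B ` {is. length is \<le> N})" using fin z by (intro Max_ge) auto
    then show "(case z of (is, x) \<Rightarrow> (1 + norm x) ^ N * cmod (iterated_partial is \<phi> x)) \<le> Max (B ` {is. length is \<le> N})"
      using B[of x "is"] z by simp
  qed
  then have "(case ([], x) of (is, x) \<Rightarrow> (1 + norm x) ^ N * cmod (iterated_partial is \<phi> x)) \<le> schwartz_seminorm N \<phi>"
    unfolding schwartz_seminorm_def by (intro cSUP_upper) auto
  then show ?thesis by simp
qed

lemma pairing_cong_AE:
  fixes f g :: "('n::finite) cfun"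
  assumes "f \<in> borel_measurable lebesgue" "g \<in> borel_measurable lebesgue" "f =ae g" "\<phi> \<in> borel_measurable lebesgue"
  shows "pairing f \<phi> = pairing g \<phi>"
  unfolding pairing_def using assms by (intro integral_cong_AE) (auto elim: AE_mp)

section \<open>Schwartz functions as elements of the Morrey space\<close>

context morrey_exponents
begin

text \<open>The weight is dominated by a series of indicators of cubes of radius 2^m with
  coefficients of order 2^(-(n+1)m). The L_p norm of such an indicator is at most of order 2^(nm),
  so that a geometric series with ratio 1/2 remains.\<close>

lemma morrey_weight_finite:
  "morrey_enorm r p (\<lambda>x :: real ^ 'n. ennreal (1 / (1 + norm x) ^ (CARD('n) + 1))) < top"
    (is "morrey_enorm r p ?w < top")
proof -
  let ?n = "CARD('n)"
  \<comment> \<open>The factor 2^(n+1) pays for the step from radius 2^m, the first cube containing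
    x, back to radius 2^(m-1), the last cube known to miss x.\<close>
  define c :: "nat \<Rightarrow> real" where "c m = 2 ^ (?n + 1) * (1 / 2 ^ (?n + 1)) ^ m" for m
  have w: "?w x \<le> (\<Sum>m. ennreal (c m) * indicator (cube 0 (2 ^ m)) x)" for x :: "real ^ 'n"
  proof -
    define m where "m = (LEAST m. x \<in> cube 0 (2 ^ m))"
    have ex: "\<exists>m. x \<in> cube 0 (2 ^ m)" using Un_cubes[of "0 :: real ^ 'n"] by blast
    have m: "x \<in> cube 0 (2 ^ m)" unfolding m_def using ex by (rule LeastI_ex)
    have "1 / (1 + norm x) ^ (?n + 1) \<le> c m"
    proof (cases m)
      case 0
      have "1 \<le> (1 + norm x) ^ (?n + 1)" by (rule one_le_power) simp
      then have "1 / (1 + norm x) ^ (?n + 1) \<le> 1" by (simp add: divide_le_eq)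
      also have "1 \<le> c m"
        using 0 one_le_power[of "2::real" "?n + 1"] by (simp only: c_def power_0 mult_1_right)
      finally show ?thesis .
    next
      case (Suc k)
      then have "x \<notin> cube 0 (2 ^ k)" using not_less_Least[of k "\<lambda>m. x \<in> cube 0 (2 ^ m)"] by (simp add: m_def[symmetric])
      then obtain i where "2 ^ k < \<bar>x $ i\<bar>" by (auto simp: cube_def not_le)
      then have "2 ^ k \<le> 1 + norm x" using component_le_norm_cart[of x i] by simp
      then have "(2 ^ k) ^ (?n + 1) \<le> (1 + norm x) ^ (?n + 1)" by (intro power_mono) auto
      then have "1 / (1 + norm x) ^ (?n + 1) \<le> 1 / (2 ^ k) ^ (?n + 1)"
        by (intro divide_left_mono mult_pos_pos zero_less_power) (auto intro: add_pos_nonneg)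
      also have "\<dots> = c m"
      proof -
        have "((2::real) ^ k) ^ (?n + 1) = (2 ^ (?n + 1)) ^ k" by (simp only: power_mult[symmetric] mult.commute)
        then show ?thesis unfolding c_def Suc by (simp add: power_one_over power_divide del: power_Suc) simp
      qed
      finally show ?thesis .
    qed
    then have "?w x \<le> ennreal (c m) * indicator (cube 0 (2 ^ m)) x"
      using m by (simp add: ennreal_leI)
    also have "\<dots> \<le> (\<Sum>m. ennreal (c m) * indicator (cube 0 (2 ^ m)) x)" by (rule ennreal_le_suminf)
    finally show ?thesis .
  qed
  have "Lp_enorm_on p UNIV ?w \<le> Lp_enorm_on p UNIV (\<lambda>x :: real ^ 'n. \<Sum>m. ennreal (c m) * indicator (cube 0 (2 ^ m)) x)"
    using pos by (intro Lp_mono w)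
  also have "\<dots> \<le> (\<Sum>m. Lp_enorm_on p UNIV (\<lambda>x :: real ^ 'n. ennreal (c m) * indicator (cube 0 (2 ^ m)) x))"
    using one_less by (intro Lp_suminf) auto
  also have "\<dots> \<le> (\<Sum>m. ennreal (4 ^ (?n + 1) * (1/2) ^ m))"
  proof (intro suminf_le allI)
    fix m
    have "Lp_enorm_on p UNIV (\<lambda>x :: real ^ 'n. ennreal (c m) * indicator (cube 0 (2 ^ m)) x) =
        Lp_enorm_on p (cube (0 :: real ^ 'n) (2 ^ m)) (\<lambda>_. ennreal (c m))"
      by (rule Lp_enorm_on_indicator)
    also have "\<dots> = ennreal (c m) * ennreal (((2 * 2 ^ m) ^ ?n) powr (1/p))"
      using pos by (simp add: Lp_const emeasure_cube_lborel)
    also have "\<dots> \<le> ennreal (c m) * ennreal ((2 * 2 ^ m) ^ ?n)"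
    proof (intro mult_left_mono ennreal_leI)
      have "1 \<le> (2 * 2 ^ m :: real) ^ ?n" by (intro one_le_power) (use one_le_power[of "2::real" m] in linarith)
      then have "((2 * 2 ^ m :: real) ^ ?n) powr (1/p) \<le> ((2 * 2 ^ m) ^ ?n) powr 1"
        using one_less by (intro powr_mono) auto
      then show "((2 * 2 ^ m :: real) ^ ?n) powr (1/p) \<le> (2 * 2 ^ m) ^ ?n" by simp
    qed auto
    also have "\<dots> = ennreal (c m * (2 * 2 ^ m) ^ ?n)" by (simp add: c_def ennreal_mult'[symmetric])
    also have "c m * (2 * 2 ^ m) ^ ?n \<le> 4 ^ (?n + 1) * (1/2) ^ m"
    proof -
      have e: "((2::real) * 2 ^ m) ^ ?n = 2 ^ ?n * (2 ^ ?n) ^ m"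
        by (simp only: power_mult_distrib power_mult[symmetric] mult.commute[of m])
      have "c m * (2 * 2 ^ m) ^ ?n = (2 ^ (?n + 1) * 2 ^ ?n) * ((1 / 2 ^ (?n + 1)) * 2 ^ ?n) ^ m"
        unfolding c_def e by (simp only: power_mult_distrib mult_ac)
      also have "(1 / 2 ^ (?n + 1)) * 2 ^ ?n = (1/2 :: real)" by simp
      also have "(2 ^ (?n + 1) * 2 ^ ?n :: real) \<le> 4 ^ (?n + 1)"
      proof -
        have "(4::real) ^ (?n + 1) = 2 ^ (?n + 1) * 2 ^ (?n + 1)" by (simp add: power_mult_distrib[symmetric])
        then show ?thesis by simp
      qed
      finally show ?thesis by (simp add: mult_right_mono)
    qed
    finally show "Lp_enorm_on p UNIV (\<lambda>x :: real ^ 'n. ennreal (c m) * indicator (cube 0 (2 ^ m)) x)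
        \<le> ennreal (4 ^ (?n + 1) * (1/2) ^ m)" by (simp add: ennreal_leI)
  qed auto
  also have "\<dots> < top"
    by (subst suminf_ennreal2) (auto intro!: summable_mult summable_geometric)
  finally have L: "Lp_enorm_on p UNIV ?w < top" .
  have "morrey_enorm r p ?w \<le> ennreal (2 powr (real CARD('n) / p)) * 1 + Lp_enorm_on p UNIV ?w"
  proof (rule morrey_le_sup_Lp[OF pos r_lower r_neg], rule AE_I2)
    fix x :: "real ^ 'n"
    have "1 \<le> (1 + norm x) ^ (?n + 1)" by (rule one_le_power) simp
    then show "?w x \<le> 1" by (simp add: divide_le_eq)
  qed
  also have "\<dots> < top" using L by (simp add: ennreal_mult_less_top)
  finally show ?thesis .
qed

text \<open>Together with duality this bound makes every function of finite atomic norm a tempered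
  distribution of order controlled by one seminorm.\<close>

lemma morrey_schwartz_le:
  obtains K :: real where "0 \<le> K"
    "\<And>\<phi>. (\<phi> :: 'n cfun) \<in> schwartz_functions \<Longrightarrow> morrey_enorm r p (eabs \<phi>) \<le> ennreal (K * schwartz_seminorm (CARD('n) + 1) \<phi>)"
proof -
  let ?w = "\<lambda>x :: real ^ 'n. ennreal (1 / (1 + norm x) ^ (CARD('n) + 1))"
  obtain K where K: "morrey_enorm r p ?w = ennreal K" "0 \<le> K"
    using morrey_weight_finite by (cases "morrey_enorm r p ?w") auto
  have "morrey_enorm r p (eabs \<phi>) \<le> ennreal (K * schwartz_seminorm (CARD('n) + 1) \<phi>)" if "\<phi> \<in> schwartz_functions" for \<phi> :: "'n cfun"
  proof -
    let ?s = "schwartz_seminorm (CARD('n) + 1) \<phi>"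
    have s: "cmod (\<phi> x) \<le> ?s * (1 / (1 + norm x) ^ (CARD('n) + 1))" for x
    proof -
      have "0 < (1 + norm x) ^ (CARD('n) + 1)" by (rule zero_less_power) (use norm_ge_zero[of x] in linarith)
      then show ?thesis using schwartz_seminorm_ge[OF that, of x "CARD('n) + 1"] by (simp add: le_divide_eq mult.commute)
    qed
    have "0 \<le> ?s" using order_trans[OF norm_ge_zero s[of 0]] by simp
    have "1 + norm x \<noteq> 0" for x :: "real ^ 'n" using norm_ge_zero[of x] by linarith
    then have "continuous_on UNIV (\<lambda>x :: real ^ 'n. 1 / (1 + norm x) ^ (CARD('n) + 1))"
      by (intro continuous_intros) auto
    then have [measurable]: "(\<lambda>x :: real ^ 'n. 1 / (1 + norm x) ^ (CARD('n) + 1)) \<in> borel_measurable lebesgue"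
      by (rule continuous_lebesgue_measurable)
    then have [measurable]: "?w \<in> borel_measurable lebesgue" by (rule measurable_compose) simp
    have "morrey_enorm r p (eabs \<phi>) \<le> morrey_enorm r p (\<lambda>x. ennreal ?s * ?w x)"
      using pos s \<open>0 \<le> ?s\<close> by (intro morrey_mono) (auto simp: eabs_def ennreal_mult'[symmetric] intro!: ennreal_leI)
    also have "\<dots> \<le> ennreal ?s * ennreal K"
      unfolding K(1)[symmetric] by (rule morrey_cmult_le[OF pos]) fact
    finally show ?thesis using K(2) \<open>0 \<le> ?s\<close> by (simp add: ennreal_mult'[symmetric] mult.commute)
  qed
  with K(2) show ?thesis by (rule that)
qed

lemma morrey_schwartz_finite: "(\<phi> :: 'n cfun) \<in> schwartz_functions \<Longrightarrow> morrey_enorm r p (eabs \<phi>) < top"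
  using morrey_schwartz_le by (metis ennreal_less_top le_less_trans)

lemma tempered_if_atomic_norm_finite:
  fixes f :: "'n cfun"
  assumes [measurable]: "f \<in> borel_measurable lebesgue" and fin: "atomic_norm \<rho> P (eabs f) < top"
  shows "\<forall>\<phi>\<in>schwartz_functions. integrable lebesgue (\<lambda>x. f x * \<phi> x)" and "tempered_distribution (pairing f)"
proof -
  have comm: "pairing f \<phi> = pairing \<phi> f" for \<phi> by (simp add: pairing_def mult.commute)
  have i: "integrable lebesgue (\<lambda>x. f x * \<phi> x)" if "\<phi> \<in> schwartz_functions" for \<phi>
    using integrable_if_dual(1)[of \<phi> f] that fin by (simp add: schwartz_measurable morrey_schwartz_finite mult.commute)
  then show "\<forall>\<phi>\<in>schwartz_functions. integrable lebesgue (\<lambda>x. f x * \<phi> x)" by blast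
  obtain A where A: "atomic_norm \<rho> P (eabs f) = ennreal A" "0 \<le> A" using fin by (cases "atomic_norm \<rho> P (eabs f)") auto
  obtain K :: real where K: "0 \<le> K"
    "\<And>\<phi>. (\<phi> :: 'n cfun) \<in> schwartz_functions \<Longrightarrow> morrey_enorm r p (eabs \<phi>) \<le> ennreal (K * schwartz_seminorm (CARD('n) + 1) \<phi>)"
    using morrey_schwartz_le by blast
  show "tempered_distribution (pairing f)"
    unfolding tempered_distribution_def
  proof (intro conjI ballI allI exI)
    fix \<phi> \<psi> :: "'n cfun" and a b assume s: "\<phi> \<in> schwartz_functions" "\<psi> \<in> schwartz_functions"
    have "pairing f (\<lambda>x. a * \<phi> x + b * \<psi> x) = (LINT x|lebesgue. a * (f x * \<phi> x) + b * (f x * \<psi> x))"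
      unfolding pairing_def by (intro Bochner_Integration.integral_cong) (auto simp: algebra_simps)
    also have "\<dots> = a * pairing f \<phi> + b * pairing f \<psi>"
      unfolding pairing_def using i[OF s(1)] i[OF s(2)] by simp
    finally show "pairing f (\<lambda>x. a * \<phi> x + b * \<psi> x) = a * pairing f \<phi> + b * pairing f \<psi>" .
  next
    fix \<phi> :: "'n cfun" assume s: "\<phi> \<in> schwartz_functions"
    have s0: "0 \<le> schwartz_seminorm (CARD('n) + 1) \<phi>"
      using order_trans[OF mult_nonneg_nonneg schwartz_seminorm_ge[OF s, of 0]] by simp
    have "ennreal (cmod (pairing f \<phi>)) \<le> ennreal A * morrey_enorm r p (eabs \<phi>)"
      unfolding comm A(1)[symmetric] using s fin
      by (intro integrable_if_dual(2)) (auto simp: schwartz_measurable morrey_schwartz_finite)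
    also have "\<dots> \<le> ennreal A * ennreal (K * schwartz_seminorm (CARD('n) + 1) \<phi>)"
      using K(2)[OF s] by (rule mult_left_mono) simp
    also have "\<dots> = ennreal (A * K * schwartz_seminorm (CARD('n) + 1) \<phi>)"
      using A(2) by (simp add: ennreal_mult'[symmetric] mult.assoc)
    finally show "cmod (pairing f \<phi>) \<le> A * K * schwartz_seminorm (CARD('n) + 1) \<phi>"
      using A(2) K(1) s0 by (simp add: ennreal_le_iff)
  qed
qed

text \<open>Duality applied to the sum of the absolute values yields absolute summability of the
  integrals; this justifies integration term by term against any function of finite Morrey
  norm.\<close>

lemma sums_integral_of_majorant:
  fixes u :: "nat \<Rightarrow> 'n cfun" and f \<phi> :: "'n cfun"
  assumes [measurable]: "\<And>k. u k \<in> borel_measurable lebesgue" "f \<in> borel_measurable lebesgue" "\<phi> \<in> borel_measurable lebesgue"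
    and maj: "atomic_norm \<rho> P (\<lambda>x. \<Sum>k. eabs (u k) x) < top" and m: "morrey_enorm r p (eabs \<phi>) < top"
    and s: "AE x in lebesgue. (\<lambda>k. u k x) sums f x"
  shows "(\<lambda>k. pairing (u k) \<phi>) sums pairing f \<phi>" "summable (\<lambda>k. cmod (pairing (u k) \<phi>))"
proof -
  have "(\<Sum>k. \<integral>\<^sup>+x. ennreal (cmod (u k x * \<phi> x)) \<partial>lebesgue) = (\<integral>\<^sup>+x. (\<Sum>k. eabs (u k) x * eabs \<phi> x) \<partial>lebesgue)"
    by (subst nn_integral_suminf[symmetric]) (auto simp: eabs_def norm_mult ennreal_mult')
  also have "\<dots> = (\<integral>\<^sup>+x. (\<Sum>k. eabs (u k) x) * eabs \<phi> x \<partial>lebesgue)" by simp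
  also have "\<dots> \<le> atomic_norm \<rho> P (\<lambda>x. \<Sum>k. eabs (u k) x) * morrey_enorm r p (eabs \<phi>)"
    using m by (intro atomic_duality) auto
  also have "\<dots> < top" using maj m by (simp add: ennreal_mult_less_top)
  finally have fin: "(\<Sum>k. \<integral>\<^sup>+x. ennreal (cmod (u k x * \<phi> x)) \<partial>lebesgue) < top" .
  have i: "integrable lebesgue (\<lambda>x. u k x * \<phi> x)" for k
  proof (rule integrableI_bounded)
    show "(\<integral>\<^sup>+x. ennreal (norm (u k x * \<phi> x)) \<partial>lebesgue) < \<infinity>"
      using fin ennreal_le_suminf[of "\<lambda>k. \<integral>\<^sup>+x. ennreal (cmod (u k x * \<phi> x)) \<partial>lebesgue" k] by (auto intro: le_less_trans)
  qed auto
  have e: "(\<integral>\<^sup>+x. ennreal (cmod (u k x * \<phi> x)) \<partial>lebesgue) = ennreal (LINT x|lebesgue. norm (u k x * \<phi> x))" for k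
    using i[of k] by (intro nn_integral_eq_integral) auto
  have sn: "summable (\<lambda>k. LINT x|lebesgue. norm (u k x * \<phi> x))"
    using fin unfolding e by (intro summable_suminf_not_top) (auto simp: less_top[symmetric])
  have "AE x in lebesgue. (\<Sum>k. ennreal (norm (u k x * \<phi> x))) \<noteq> \<infinity>"
  proof (rule nn_integral_noteq_infinite)
    show "(\<integral>\<^sup>+x. (\<Sum>k. ennreal (norm (u k x * \<phi> x))) \<partial>lebesgue) \<noteq> \<infinity>"
      using fin by (subst nn_integral_suminf) auto
  qed auto
  then have ae: "AE x in lebesgue. summable (\<lambda>k. norm (u k x * \<phi> x))"
    by eventually_elim (intro summable_suminf_not_top, auto)
  have "(\<lambda>k. LINT x|lebesgue. u k x * \<phi> x) sums (LINT x|lebesgue. (\<Sum>k. u k x * \<phi> x))"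
    by (rule sums_integral[OF i ae sn])
  also have "(LINT x|lebesgue. (\<Sum>k. u k x * \<phi> x)) = (LINT x|lebesgue. f x * \<phi> x)"
  proof (rule integral_cong_AE)
    show "AE x in lebesgue. (\<Sum>k. u k x * \<phi> x) = f x * \<phi> x"
      using s by eventually_elim (intro sums_unique[symmetric] sums_mult2)
  qed measurable
  finally show "(\<lambda>k. pairing (u k) \<phi>) sums pairing f \<phi>" by (simp add: pairing_def)
  show "summable (\<lambda>k. cmod (pairing (u k) \<phi>))"
    unfolding pairing_def by (rule summable_comparison_test[OF _ sn]) (auto intro!: exI[of _ 0] integral_norm_bound)
qed

end

lemma sums_if_suminf_norm_finite:
  fixes u :: "nat \<Rightarrow> complex"
  assumes "(\<Sum>k. ennreal (cmod (u k))) < top"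
  shows "u sums (\<Sum>k. u k)" "ennreal (cmod (\<Sum>k. u k)) \<le> (\<Sum>k. ennreal (cmod (u k)))"
proof -
  have s: "summable (\<lambda>k. cmod (u k))" using assms by (intro summable_suminf_not_top) auto
  then show "u sums (\<Sum>k. u k)" by (rule summable_sums[OF summable_norm_cancel])
  have "cmod (\<Sum>k. u k) \<le> (\<Sum>k. cmod (u k))" using s by (rule summable_norm)
  then show "ennreal (cmod (\<Sum>k. u k)) \<le> (\<Sum>k. ennreal (cmod (u k)))"
    using s by (simp add: suminf_ennreal2 ennreal_leI)
qed

lemma dyadic_enumeration:
  obtains e :: "nat \<Rightarrow> int \<times> (int ^ 'n::finite)" where "bij e"
proof -
  have "infinite (UNIV :: (int \<times> (int ^ 'n)) set)"
  proof
    assume "finite (UNIV :: (int \<times> (int ^ 'n)) set)"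
    then have "finite (range (fst :: int \<times> (int ^ 'n) \<Rightarrow> int))" by (rule finite_imageI)
    then show False by (simp add: infinite_UNIV_int)
  qed
  then show ?thesis using that bij_betw_from_nat_into[of "UNIV :: (int \<times> (int ^ 'n)) set"] by auto
qed

section \<open>Atomic representations and majorants give the same norm\<close>

context morrey_exponents
begin

text \<open>Summands on the same cube are first added up, since a representation has one atom per
  dyadic cube. Then f is split by \<open>share\<close> into pieces dominated by these sums, and each
  piece is normalised to an atom; the coefficients add up to at most the cost.\<close>

lemma atomic_representation_if_majorant:
  fixes f :: "'n cfun"
  assumes f [measurable]: "f \<in> borel_measurable lebesgue"
    and maj: "atomic_majorant (eabs f) J M b" and cost: "atomic_cost \<rho> P J b < top"
  obtains c a where "atomic_representation \<rho> P (pairing f) c a"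
    "ennreal (\<Sum>\<^sub>\<infinity>(J, M). cmod (c J M)) \<le> atomic_cost \<rho> P J b"
proof -
  obtain e :: "nat \<Rightarrow> int \<times> (int ^ 'n)" where e: "bij e" by (rule dyadic_enumeration)
  have inv_e [simp]: "inv e (e k) = k" for k using e by (simp add: bij_is_inj)
  have e_inv [simp]: "e (inv e z) = z" for z using e by (simp add: bij_is_surj surj_f_inv_f)
  have b [measurable]: "b i \<in> borel_measurable lebesgue" for i using maj by (rule atomic_majorant_measurable)
  \<comment> \<open>The index k runs through the enumeration \<open>e\<close> of all dyadic cubes,
    and \<open>B k\<close> collects every summand whose cube has number k.\<close>
  define B where "B k x = (\<Sum>i. if k = inv e (J i, M i) then b i x else 0)" for k x
  have B [measurable]: "B k \<in> borel_measurable lebesgue" for k unfolding B_def[abs_def] by measurable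
  have B_sum: "(\<Sum>k. B k x) = (\<Sum>i. b i x)" for x
    unfolding B_def by (subst suminf_ennreal_swap) (simp add: suminf_ennreal_single)
  define w where "w k = atom_weight TYPE('n) \<rho> P (fst (e k))" for k
  have w_cost: "(\<Sum>k. w k * Lp_enorm_on P UNIV (B k)) \<le> atomic_cost \<rho> P J b"
  proof -
    have "w k * Lp_enorm_on P UNIV (B k) \<le> (\<Sum>i. if k = inv e (J i, M i) then atom_weight TYPE('n) \<rho> P (J i) * Lp_enorm_on P UNIV (b i) else 0)" for k
    proof -
      have "Lp_enorm_on P UNIV (B k) \<le> (\<Sum>i. Lp_enorm_on P UNIV (\<lambda>x. if k = inv e (J i, M i) then b i x else 0))"
        unfolding B_def[abs_def] using conj_one_less by (intro Lp_suminf) auto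
      then have "w k * Lp_enorm_on P UNIV (B k) \<le> (\<Sum>i. w k * Lp_enorm_on P UNIV (\<lambda>x. if k = inv e (J i, M i) then b i x else 0))"
        using mult_left_mono[of "Lp_enorm_on P UNIV (B k)" _ "w k"] by simp
      also have "\<dots> = (\<Sum>i. if k = inv e (J i, M i) then atom_weight TYPE('n) \<rho> P (J i) * Lp_enorm_on P UNIV (b i) else 0)"
        by (intro suminf_cong) (auto simp: w_def Lp_enorm_on_def)
      finally show ?thesis .
    qed
    then have "(\<Sum>k. w k * Lp_enorm_on P UNIV (B k)) \<le>
        (\<Sum>k. \<Sum>i. if k = inv e (J i, M i) then atom_weight TYPE('n) \<rho> P (J i) * Lp_enorm_on P UNIV (b i) else 0)"
      by (intro suminf_le) auto
    also have "\<dots> = atomic_cost \<rho> P J b"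
      by (subst suminf_ennreal_swap) (simp add: suminf_ennreal_single atomic_cost_def)
    finally show ?thesis .
  qed
  define C where "C k = enn2real (w k * Lp_enorm_on P UNIV (B k))" for k
  have C0: "0 \<le> C k" for k by (simp add: C_def)
  have C: "ennreal (C k) = w k * Lp_enorm_on P UNIV (B k)" for k
  proof -
    have "w k * Lp_enorm_on P UNIV (B k) < top"
      using ennreal_le_suminf[of "\<lambda>k. w k * Lp_enorm_on P UNIV (B k)" k] w_cost cost by (auto intro: le_less_trans)
    then show ?thesis by (simp add: C_def)
  qed
  have C_sum: "(\<Sum>k. ennreal (C k)) \<le> atomic_cost \<rho> P J b" unfolding C by (rule w_cost)
  then have C_summable: "summable C" using cost C0 by (intro summable_suminf_not_top) (auto simp: top_unique)
  define u where "u k x = f x * complex_of_real (share B k x)" for k x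
  have u [measurable]: "u k \<in> borel_measurable lebesgue" for k unfolding u_def[abs_def] by measurable
  have ae: "AE x in lebesgue. eabs f x \<le> (\<Sum>k. B k x) \<and> (\<Sum>k. B k x) < top"
    using AE_majorant_finite[OF maj cost] maj unfolding B_sum atomic_majorant_def by auto
  have u_sums: "AE x in lebesgue. (\<lambda>k. u k x) sums f x"
    using ae by eventually_elim (auto simp: u_def eabs_def intro: share_decomposition(1))
  have u_le: "AE x in lebesgue. eabs (u k) x \<le> B k x" for k
    using ae by eventually_elim (auto simp: u_def eabs_def intro: share_decomposition(3))
  have u_sum: "AE x in lebesgue. (\<Sum>k. eabs (u k) x) = eabs f x"
    using ae by eventually_elim (unfold u_def eabs_def, rule share_decomposition(2), auto)
  have u_norm: "atomic_norm \<rho> P (\<lambda>x. \<Sum>k. eabs (u k) x) < top"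
    unfolding atomic_norm_cong_AE[OF u_sum] using atomic_norm_le[OF maj] cost by (rule le_less_trans)
  have u_Lp: "Lp_norm P (u k) \<le> Lp_enorm_on P UNIV (B k)" for k
    using conj_pos u_le[of k] by (intro Lp_mono_AE) auto
  \<comment> \<open>If \<open>C k\<close> is 0, division by zero makes the atom 0. In that case
    \<open>B k\<close> and hence \<open>u k\<close> vanish almost everywhere, so that the product of
    coefficient and pairing is still the pairing of \<open>u k\<close>.\<close>
  define a where "a k x = complex_of_real (1 / C k) * u k x" for k x
  have a [measurable]: "a k \<in> borel_measurable lebesgue" for k unfolding a_def[abs_def] by measurable
  have a_norm: "Lp_norm P (a k) \<le> ennreal (2 powr (- real_of_int (fst (e k)) * (real CARD('n) / P + \<rho>)))" for k
  proof -
    let ?\<omega> = "2 powr (real_of_int (fst (e k)) * (real CARD('n) / P + \<rho>))"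
    have w: "w k = ennreal ?\<omega>" by (simp add: w_def atom_weight_def)
    obtain \<beta> where \<beta>: "Lp_enorm_on P UNIV (B k) = ennreal \<beta>" "0 \<le> \<beta>"
      using C[of k] w by (cases "Lp_enorm_on P UNIV (B k)") (auto simp: ennreal_mult_top)
    have "C k = ?\<omega> * \<beta>" using \<beta>(2) by (simp add: C_def w \<beta>(1) enn2real_mult)
    then have "1 / C k * \<beta> \<le> 1 / ?\<omega>" by (cases "\<beta> = 0") auto
    also have "1 / ?\<omega> = 2 powr (- real_of_int (fst (e k)) * (real CARD('n) / P + \<rho>))"
      by (simp add: powr_minus divide_inverse)
    finally have le: "1 / C k * \<beta> \<le> 2 powr (- real_of_int (fst (e k)) * (real CARD('n) / P + \<rho>))" .
    have "Lp_norm P (a k) = ennreal (1 / C k) * Lp_norm P (u k)"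
      unfolding a_def using conj_pos C0[of k] by (subst Lp_norm_cmult) (auto simp: norm_divide)
    also have "\<dots> \<le> ennreal (1 / C k) * ennreal \<beta>"
      using u_Lp[of k] unfolding \<beta> by (rule mult_left_mono) simp
    also have "\<dots> = ennreal (1 / C k * \<beta>)" using C0[of k] by (intro ennreal_mult'[symmetric]) simp
    finally show ?thesis using ennreal_leI[OF le] by (rule order_trans)
  qed
  have a_supp: "a k x = 0" if "x \<notin> dyadic_cube (fst (e k)) (snd (e k))" for k x
  proof -
    have "b i x = 0" if "k = inv e (J i, M i)" for i
      using maj \<open>x \<notin> _\<close> that by (simp add: atomic_majorant_def)
    then have "(if k = inv e (J i, M i) then b i x else 0) = 0" for i by auto
    then have "B k x = 0" unfolding B_def by (simp only: suminf_zero)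
    then show ?thesis by (simp add: a_def u_def share_def)
  qed
  have pair: "complex_of_real (C k) * pairing (a k) \<phi> = pairing (u k) \<phi>" if [measurable]: "\<phi> \<in> borel_measurable lebesgue" for k \<phi>
  proof (cases "C k = 0")
    case False
    have "pairing (a k) \<phi> = (LINT x|lebesgue. complex_of_real (1 / C k) * (u k x * \<phi> x))"
      unfolding pairing_def a_def by (simp only: mult.assoc)
    also have "\<dots> = complex_of_real (1 / C k) * pairing (u k) \<phi>" by (simp add: pairing_def)
    finally show ?thesis using False by simp
  next
    case True
    then have "w k * Lp_enorm_on P UNIV (B k) = 0" using C[of k] by simp
    then have "Lp_enorm_on P UNIV (B k) = 0" by (simp add: w_def)
    then have "Lp_norm P (u k) = 0" using u_Lp[of k] by simp
    then have "AE x in lebesgue. u k x = 0" by (subst (asm) Lp_eq_0_iff) (auto simp: eabs_def)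
    then have "u k =ae (\<lambda>x. 0)" by simp
    then have "pairing (u k) \<phi> = pairing (\<lambda>x. 0) \<phi>" by (intro pairing_cong_AE) auto
    then show ?thesis using True by (simp add: pairing_def)
  qed
  define c' where "c' J M = complex_of_real (C (inv e (J, M)))" for J M
  define a' where "a' J M = a (inv e (J, M))" for J M
  have fe: "fst (e (inv e (J, M))) = J" "snd (e (inv e (J, M))) = M" for J M by auto
  have hs: "((\<lambda>(J, M). cmod (c' J M)) has_sum (\<Sum>k. C k)) UNIV"
  proof -
    have "(C has_sum (\<Sum>k. C k)) UNIV"
      using C_summable C0 by (intro norm_summable_imp_has_sum summable_sums) auto
    then show ?thesis
      using has_sum_reindex_bij_betw[OF e, of "\<lambda>(J, M). cmod (c' J M)"]
      by (simp add: c'_def split_beta C0)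
  qed
  have "atomic_representation \<rho> P (pairing f) c' a'"
    unfolding atomic_representation_def
  proof (intro conjI allI ballI)
    fix J :: int and M :: "int ^ 'n"
    show "a' J M \<in> borel_measurable lebesgue" by (simp add: a'_def)
    show "AE x in lebesgue. x \<notin> dyadic_cube J M \<longrightarrow> a' J M x = 0"
      using a_supp[of _ "inv e (J, M)"] by (auto simp: a'_def)
    show "Lp_norm P (a' J M) \<le> ennreal (2 powr (- real_of_int J * (real CARD('n) / P + \<rho>)))"
      using a_norm[of "inv e (J, M)"] by (simp add: a'_def)
  next
    show "(\<lambda>(J, M). cmod (c' J M)) summable_on UNIV" using hs by (rule has_sum_imp_summable)
  next
    fix \<phi> :: "'n cfun" assume \<phi>: "\<phi> \<in> schwartz_functions"
    note sm = sums_integral_of_majorant[OF u f schwartz_measurable[OF \<phi>] u_norm morrey_schwartz_finite[OF \<phi>] u_sums]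
    have "((\<lambda>k. pairing (u k) \<phi>) has_sum pairing f \<phi>) UNIV"
      using sm by (intro norm_summable_imp_has_sum) auto
    then show "((\<lambda>(J, M). c' J M * pairing (a' J M) \<phi>) has_sum pairing f \<phi>) UNIV"
      using has_sum_reindex_bij_betw[OF e, of "\<lambda>(J, M). c' J M * pairing (a' J M) \<phi>"]
      by (simp add: c'_def a'_def split_beta pair[OF schwartz_measurable[OF \<phi>]])
  qed
  moreover have "ennreal (\<Sum>\<^sub>\<infinity>(J, M). cmod (c' J M)) \<le> atomic_cost \<rho> P J b"
    using C_sum C_summable C0 by (simp add: infsumI[OF hs] suminf_ennreal2)
  ultimately show ?thesis by (rule that)
qed

text \<open>The atomic series converges absolutely almost everywhere to a function g whose norm is
  at most the sum of the coefficients. Integration term by term shows that g and f have equal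
  pairings with test functions, hence they agree almost everywhere.\<close>

lemma atomic_norm_le_if_representation:
  fixes f :: "'n cfun"
  assumes f [measurable]: "f \<in> borel_measurable lebesgue"
    and int: "\<forall>\<phi>\<in>schwartz_functions. integrable lebesgue (\<lambda>x. f x * \<phi> x)"
    and rep: "atomic_representation \<rho> P (pairing f) c a"
  shows "atomic_norm \<rho> P (eabs f) \<le> ennreal (\<Sum>\<^sub>\<infinity>(J, M). cmod (c J M))"
proof -
  obtain e :: "nat \<Rightarrow> int \<times> (int ^ 'n)" where e: "bij e" by (rule dyadic_enumeration)
  define C where "C k = (case e k of (J, M) \<Rightarrow> c J M)" for k
  define A where "A k = (case e k of (J, M) \<Rightarrow> a J M)" for k
  have A [measurable]: "A k \<in> borel_measurable lebesgue"
    and A_supp: "AE x in lebesgue. x \<notin> dyadic_cube (fst (e k)) (snd (e k)) \<longrightarrow> A k x = 0"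
    and A_norm: "Lp_norm P (A k) \<le> ennreal (2 powr (- real_of_int (fst (e k)) * (real CARD('n) / P + \<rho>)))" for k
    using rep by (auto simp: atomic_representation_def A_def split_beta)
  have "((\<lambda>(J, M). cmod (c J M)) has_sum (\<Sum>\<^sub>\<infinity>(J, M). cmod (c J M))) UNIV"
    using rep by (auto simp: atomic_representation_def)
  then have "((\<lambda>k. cmod (C k)) has_sum (\<Sum>\<^sub>\<infinity>(J, M). cmod (c J M))) UNIV"
    using has_sum_reindex_bij_betw[OF e, of "\<lambda>(J, M). cmod (c J M)"] by (simp add: C_def split_beta)
  then have "(\<lambda>k. cmod (C k)) sums (\<Sum>\<^sub>\<infinity>(J, M). cmod (c J M))" by (rule has_sum_imp_sums)
  then have C_sum: "(\<Sum>k. ennreal (cmod (C k))) = ennreal (\<Sum>\<^sub>\<infinity>(J, M). cmod (c J M))"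
    by (intro suminf_ennreal_eq) auto
  define u where "u k x = C k * A k x" for k x
  have u [measurable]: "u k \<in> borel_measurable lebesgue" for k unfolding u_def[abs_def] by measurable
  \<comment> \<open>Atoms vanish outside their cubes only almost everywhere, whereas a majorant has
    to vanish there at every point; the indicator repairs this.\<close>
  define b where "b k x = eabs (u k) x * indicator (dyadic_cube (fst (e k)) (snd (e k))) x" for k x
  have b [measurable]: "b k \<in> borel_measurable lebesgue" for k unfolding b_def[abs_def] by measurable
  have "AE x in lebesgue. \<forall>k. eabs (u k) x = b k x"
    unfolding AE_all_countable
  proof
    fix k show "AE x in lebesgue. eabs (u k) x = b k x"
      using A_supp[of k] by eventually_elim (auto simp: b_def u_def eabs_def indicator_def)
  qed
  then have "atomic_majorant (\<lambda>x. \<Sum>k. eabs (u k) x) (\<lambda>k. fst (e k)) (\<lambda>k. snd (e k)) b"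
    unfolding atomic_majorant_def by (auto simp: b_def[of _ "_ :: real ^ 'n"] elim!: AE_mp intro!: b)
  then have "atomic_norm \<rho> P (\<lambda>x. \<Sum>k. eabs (u k) x) \<le> atomic_cost \<rho> P (\<lambda>k. fst (e k)) b" by (rule atomic_norm_le)
  also have "\<dots> \<le> (\<Sum>k. ennreal (cmod (C k)))"
    unfolding atomic_cost_def
  proof (intro suminf_le allI)
    fix k
    let ?x = "real_of_int (fst (e k)) * (real CARD('n) / P + \<rho>)"
    have "Lp_enorm_on P UNIV (b k) \<le> Lp_norm P (u k)"
      using conj_pos by (intro Lp_mono) (auto simp: b_def indicator_def)
    also have "\<dots> = ennreal (cmod (C k)) * Lp_norm P (A k)"
      unfolding u_def using conj_pos by (intro Lp_norm_cmult) auto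
    also have "\<dots> \<le> ennreal (cmod (C k)) * ennreal (2 powr (- ?x))"
      using A_norm[of k] by (intro mult_left_mono) auto
    finally have "ennreal (2 powr ?x) * Lp_enorm_on P UNIV (b k) \<le> ennreal (2 powr ?x) * (ennreal (cmod (C k)) * ennreal (2 powr (- ?x)))"
      by (rule mult_left_mono) simp
    also have "\<dots> = ennreal (2 powr ?x * 2 powr (- ?x)) * ennreal (cmod (C k))" by (simp add: ennreal_mult' mult_ac)
    also have "2 powr ?x * 2 powr (- ?x) = 1" by (simp add: powr_add[symmetric])
    finally show "atom_weight TYPE('n) \<rho> P (fst (e k)) * Lp_enorm_on P UNIV (b k) \<le> ennreal (cmod (C k))"
      by (simp add: atom_weight_def)
  qed auto
  finally have u_norm: "atomic_norm \<rho> P (\<lambda>x. \<Sum>k. eabs (u k) x) \<le> ennreal (\<Sum>\<^sub>\<infinity>(J, M). cmod (c J M))" by (simp add: C_sum)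
  then have u_fin: "atomic_norm \<rho> P (\<lambda>x. \<Sum>k. eabs (u k) x) < top" by (rule le_less_trans) simp
  define g where "g x = (\<Sum>k. u k x)" for x
  have g [measurable]: "g \<in> borel_measurable lebesgue" unfolding g_def[abs_def] by measurable
  have "AE x in lebesgue. (\<Sum>k. eabs (u k) x) < top" using u_fin by (intro AE_finite_if_atomic_norm_finite) auto
  then have ae: "AE x in lebesgue. (\<lambda>k. u k x) sums g x \<and> eabs g x \<le> (\<Sum>k. eabs (u k) x)"
    by eventually_elim (unfold g_def eabs_def, intro conjI sums_if_suminf_norm_finite)
  then have g_norm: "atomic_norm \<rho> P (eabs g) \<le> atomic_norm \<rho> P (\<lambda>x. \<Sum>k. eabs (u k) x)"
    by (intro atomic_norm_mono_AE) auto
  have "AE x in lebesgue. f x - g x = 0"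
  proof (rule AE_zero_if_test_integrals_zero)
    fix \<phi> :: "'n cfun" assume "\<phi> \<in> test_functions"
    then have \<phi>: "\<phi> \<in> schwartz_functions" using test_subset_schwartz by blast
    have i: "integrable lebesgue (\<lambda>x. f x * \<phi> x)" using int \<phi> by blast
    have j: "integrable lebesgue (\<lambda>x. g x * \<phi> x)"
      using tempered_if_atomic_norm_finite(1)[OF g le_less_trans[OF g_norm u_fin]] \<phi> by blast
    show "integrable lebesgue (\<lambda>x. (f x - g x) * \<phi> x)" using i j by (simp add: left_diff_distrib)
    have "AE x in lebesgue. (\<lambda>k. u k x) sums g x" using ae by auto
    from sums_integral_of_majorant(1)[OF u g schwartz_measurable[OF \<phi>] u_fin morrey_schwartz_finite[OF \<phi>] this]
    have "(\<lambda>k. pairing (u k) \<phi>) sums pairing g \<phi>" .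
    moreover have "(\<lambda>k. pairing (u k) \<phi>) sums pairing f \<phi>"
    proof -
      have "((\<lambda>(J, M). c J M * pairing (a J M) \<phi>) has_sum pairing f \<phi>) UNIV"
        using rep \<phi> by (auto simp: atomic_representation_def)
      then have "((\<lambda>k. C k * pairing (A k) \<phi>) has_sum pairing f \<phi>) UNIV"
        using has_sum_reindex_bij_betw[OF e, of "\<lambda>(J, M). c J M * pairing (a J M) \<phi>"]
        by (simp add: C_def A_def split_beta)
      then have "(\<lambda>k. C k * pairing (A k) \<phi>) sums pairing f \<phi>" by (rule has_sum_imp_sums)
      moreover have "C k * pairing (A k) \<phi> = pairing (u k) \<phi>" for k
        by (simp add: pairing_def u_def mult.assoc)
      ultimately show ?thesis by simp
    qed
    ultimately have "pairing f \<phi> = pairing g \<phi>" by (rule sums_unique2[symmetric])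
    then show "pairing (\<lambda>x. f x - g x) \<phi> = 0" using i j by (simp add: pairing_def left_diff_distrib)
  qed measurable
  then have "AE x in lebesgue. eabs f x = eabs g x" by eventually_elim (simp add: eabs_def)
  then have "atomic_norm \<rho> P (eabs f) = atomic_norm \<rho> P (eabs g)" by (rule atomic_norm_cong_AE)
  then show ?thesis using g_norm u_norm by simp
qed

lemma predual_iff:
  "(f :: 'n cfun) \<in> predual \<rho> P \<longleftrightarrow> f \<in> borel_measurable lebesgue \<and> atomic_norm \<rho> P (eabs f) < top"
proof (intro iffI conjI)
  assume f: "f \<in> predual \<rho> P"
  then show "f \<in> borel_measurable lebesgue" by (simp add: predual_def)
  obtain c a where "atomic_representation \<rho> P (pairing f) c a"
    using f by (auto simp: predual_def predual_distributions_def)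
  then have "atomic_norm \<rho> P (eabs f) \<le> ennreal (\<Sum>\<^sub>\<infinity>(J, M). cmod (c J M))"
    using f by (intro atomic_norm_le_if_representation) (auto simp: predual_def)
  then show "atomic_norm \<rho> P (eabs f) < top" by (rule le_less_trans) simp
next
  assume f: "f \<in> borel_measurable lebesgue \<and> atomic_norm \<rho> P (eabs f) < top"
  then obtain J M b where "atomic_majorant (eabs f) J M b" "atomic_cost \<rho> P J b < top"
    using atomic_norm_less by blast
  then obtain c a where "atomic_representation \<rho> P (pairing f) c a"
    using atomic_representation_if_majorant f by blast
  then show "f \<in> predual \<rho> P"
    using tempered_if_atomic_norm_finite[of f] f by (auto simp: predual_def predual_distributions_def)
qed

lemma predual_enorm_eq:
  assumes f: "(f :: 'n cfun) \<in> predual \<rho> P"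
  shows "predual_enorm \<rho> P f = atomic_norm \<rho> P (eabs f)"
proof (rule antisym)
  show "predual_enorm \<rho> P f \<le> atomic_norm \<rho> P (eabs f)"
    unfolding atomic_norm_def
  proof (rule Inf_greatest, safe)
    fix J M b assume b: "atomic_majorant (eabs f) J M b"
    show "predual_enorm \<rho> P f \<le> atomic_cost \<rho> P J b"
    proof (cases "atomic_cost \<rho> P J b < top")
      case True
      then obtain c a where "atomic_representation \<rho> P (pairing f) c a"
        "ennreal (\<Sum>\<^sub>\<infinity>(J, M). cmod (c J M)) \<le> atomic_cost \<rho> P J b"
        using atomic_representation_if_majorant[OF _ b] f by (auto simp: predual_def)
      then show ?thesis unfolding predual_enorm_def predual_distribution_enorm_def
        by (intro Inf_lower2) auto
    qed (auto simp: not_less top_unique)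
  qed
  show "atomic_norm \<rho> P (eabs f) \<le> predual_enorm \<rho> P f"
    unfolding predual_enorm_def predual_distribution_enorm_def
    using f by (intro Inf_greatest) (auto simp: predual_def intro: atomic_norm_le_if_representation)
qed

end

subsection \<open>Extension of the operators to Lebesgue spaces\<close>

lemma summable_half: "summable (\<lambda>k. c * (1/2) ^ k :: real)"
  by (intro summable_mult summable_geometric) simp

lemma summable_if_suminf_finite:
  fixes u :: "nat \<Rightarrow> complex"
  shows "(\<Sum>k. ennreal (cmod (u k))) < top \<Longrightarrow> summable (\<lambda>k. cmod (u k))"
  by (intro summable_suminf_not_top) auto

text \<open>A geometric rate makes the sum of all errors finite in L_p and thus finite almost
  everywhere, so that the whole sequence converges pointwise and no subsequence has to be
  chosen.\<close>

lemma AE_tendsto_if_rapid: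
  fixes h :: "('n::finite) cfun"
  assumes p: "1 < p" and A: "A \<in> sets lebesgue"
    and [measurable]: "\<And>k. H k \<in> borel_measurable lebesgue" "h \<in> borel_measurable lebesgue"
    and le: "\<And>k. Lp_enorm_on p A (eabs (\<lambda>x. H k x - h x)) \<le> ennreal (c * (1/2) ^ k)"
  shows "AE x in lebesgue. x \<in> A \<longrightarrow> (\<lambda>k. H k x) \<longlonglongrightarrow> h x"
proof -
  have m: "(\<lambda>x. \<Sum>k. eabs (\<lambda>x. H k x - h x) x) \<in> borel_measurable lebesgue" by measurable
  have "Lp_enorm_on p A (\<lambda>x. \<Sum>k. eabs (\<lambda>x. H k x - h x) x) \<le> (\<Sum>k. Lp_enorm_on p A (eabs (\<lambda>x. H k x - h x)))"
    using p A by (intro Lp_suminf) auto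
  also have "\<dots> \<le> (\<Sum>k. ennreal (\<bar>c\<bar> * (1/2) ^ k))"
    by (intro suminf_le allI order_trans[OF le] ennreal_leI mult_right_mono) auto
  also have "\<dots> < top" using summable_half[of "\<bar>c\<bar>"] by (subst suminf_ennreal2) auto
  finally have "AE x in lebesgue. x \<in> A \<longrightarrow> (\<Sum>k. eabs (\<lambda>x. H k x - h x) x) < top"
    using p A m by (intro AE_finite_if_Lp_finite[of p]) auto
  then show ?thesis
  proof (eventually_elim, intro impI)
    fix x assume "x \<in> A \<longrightarrow> (\<Sum>k. eabs (\<lambda>x. H k x - h x) x) < top" "x \<in> A"
    then have "(\<Sum>k. eabs (\<lambda>x. H k x - h x) x) < top" by blast
    then have "(\<Sum>k. ennreal (cmod (H k x - h x))) < top" unfolding eabs_def .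
    then have "summable (\<lambda>k. cmod (H k x - h x))" by (rule summable_if_suminf_finite)
    then have "(\<lambda>k. cmod (H k x - h x)) \<longlonglongrightarrow> 0" by (rule summable_LIMSEQ_zero)
    then show "(\<lambda>k. H k x) \<longlonglongrightarrow> h x" by (simp add: tendsto_norm_zero_iff LIM_zero_iff)
  qed
qed

lemma AE_convergent_if_rapid:
  fixes H :: "nat \<Rightarrow> ('n::finite) cfun"
  assumes p: "1 < p" and A: "A \<in> sets lebesgue"
    and [measurable]: "\<And>k. H k \<in> borel_measurable lebesgue"
    and fin: "(\<Sum>k. Lp_enorm_on p A (eabs (\<lambda>x. H (Suc k) x - H k x))) < top"
  shows "AE x in lebesgue. x \<in> A \<longrightarrow> convergent (\<lambda>k. H k x)"
proof -
  have m: "(\<lambda>x. \<Sum>k. eabs (\<lambda>x. H (Suc k) x - H k x) x) \<in> borel_measurable lebesgue" by measurable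
  have "Lp_enorm_on p A (\<lambda>x. \<Sum>k. eabs (\<lambda>x. H (Suc k) x - H k x) x) \<le> (\<Sum>k. Lp_enorm_on p A (eabs (\<lambda>x. H (Suc k) x - H k x)))"
    using p A by (intro Lp_suminf) auto
  then have "AE x in lebesgue. x \<in> A \<longrightarrow> (\<Sum>k. eabs (\<lambda>x. H (Suc k) x - H k x) x) < top"
    using p A m fin by (intro AE_finite_if_Lp_finite[of p]) (auto intro: le_less_trans)
  then show ?thesis
  proof (eventually_elim, intro impI)
    fix x assume "x \<in> A \<longrightarrow> (\<Sum>k. eabs (\<lambda>x. H (Suc k) x - H k x) x) < top" "x \<in> A"
    then have "(\<Sum>k. eabs (\<lambda>x. H (Suc k) x - H k x) x) < top" by blast
    then have "(\<Sum>k. ennreal (cmod (H (Suc k) x - H k x))) < top" unfolding eabs_def .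
    then have "summable (\<lambda>k. cmod (H (Suc k) x - H k x))" by (rule summable_if_suminf_finite)
    then have "summable (\<lambda>k. H (Suc k) x - H k x)" by (rule summable_norm_cancel)
    then have "convergent (\<lambda>n. \<Sum>k<n. H (Suc k) x - H k x)" by (simp add: summable_iff_convergent)
    then have "convergent (\<lambda>n. H n x - H 0 x)" by (simp only: sum_lessThan_telescope[of "\<lambda>k. H k x"])
    then have "convergent (\<lambda>n. (H n x - H 0 x) + H 0 x)" by (intro convergent_add convergent_const)
    then show "convergent (\<lambda>k. H k x)" by simp
  qed
qed

lemma rapid_test_approx:
  fixes f :: "('n::finite) cfun"
  assumes p: "1 < p" and f: "f \<in> Lp_space p" and U: "open U" "\<And>x. x \<notin> U \<Longrightarrow> f x = 0" and c: "0 < c"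
  obtains \<phi> where "\<And>k. \<phi> k \<in> test_functions" "\<And>k. supp (\<phi> k) \<subseteq> U"
    "\<And>k. Lp_norm p (\<lambda>x. f x - \<phi> k x) \<le> ennreal (c * (1/2) ^ k)"
proof -
  have "\<exists>\<phi>\<in>test_functions. supp \<phi> \<subseteq> U \<and> Lp_norm p (\<lambda>x. f x - \<phi> x) \<le> ennreal (c * (1/2) ^ k)" for k
    using test_dense[OF p f U, of "c * (1/2) ^ k"] c by (metis less_imp_le mult_pos_pos zero_less_power half_gt_zero zero_less_one)
  then show ?thesis using that by metis
qed

text \<open>Index 0 stands for the whole cube of radius 2s. From index 1 on, the points are
  separated from the cube of radius s by a distance comparable to 2^k s.\<close>

definition annulus :: "real ^ 'n \<Rightarrow> real \<Rightarrow> nat \<Rightarrow> (real ^ 'n::finite) set" where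
  "annulus x s k = (if k = 0 then cube x (2 * s) else cube x (2 ^ (k + 1) * s) - cube x (2 ^ k * s))"

lemma annulus_sets [measurable]: "annulus x s k \<in> sets lebesgue"
  by (simp add: annulus_def)

lemma annulus_subset_cube: "annulus x s k \<subseteq> cube x (2 ^ (k + 1) * s)"
  by (auto simp: annulus_def)

lemma annulus_disjoint:
  assumes s: "0 < s" and k: "z \<in> annulus x s k" "z \<in> annulus x s l" shows "k = l"
proof -
  have "\<not> k < l" if "z \<in> annulus x s k" "z \<in> annulus x s l" for k l
  proof
    assume "k < l"
    then have "(2::real) ^ (k + 1) \<le> 2 ^ l" by (intro power_increasing) auto
    then have "cube x (2 ^ (k + 1) * s) \<subseteq> cube x (2 ^ l * s)" using s by (intro cube_mono mult_right_mono) auto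
    then show False using that annulus_subset_cube[of x s k] \<open>k < l\<close> by (auto simp: annulus_def)
  qed
  then show ?thesis using k by (meson nat_neq_iff)
qed

lemma annulus_cover:
  assumes "z \<in> cube x (2 ^ (m + 1) * s)" shows "\<exists>k\<le>m. z \<in> annulus x s k"
  using assms
proof (induction m)
  case (Suc m)
  show ?case
  proof (cases "z \<in> cube x (2 ^ (m + 1) * s)")
    case True then show ?thesis using Suc.IH le_SucI by blast
  next
    case False then show ?thesis using Suc.prems by (intro exI[of _ "Suc m"]) (auto simp: annulus_def)
  qed
qed (auto simp: annulus_def)

lemma annulus_sum:
  assumes s: "0 < s" and f: "\<And>z. z \<notin> cube x (2 ^ (m + 1) * s) \<Longrightarrow> f z = 0"
  shows "(\<Sum>k\<le>m. indicator (annulus x s k) z * f z) = (f z :: complex)"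
proof (cases "z \<in> cube x (2 ^ (m + 1) * s)")
  case True
  then obtain k where k: "k \<le> m" "z \<in> annulus x s k" using annulus_cover by blast
  have "(\<Sum>l\<le>m. indicator (annulus x s l) z * f z) = (\<Sum>l\<le>m. if l = k then f z else 0)"
  proof (intro sum.cong refl)
    fix l show "indicator (annulus x s l) z * f z = (if l = k then f z else 0)"
      using annulus_disjoint[OF s k(2), of l] k(2) by (cases "l = k") (auto simp: indicator_def)
  qed
  then show ?thesis using k(1) by simp
next
  case False then show ?thesis using f by simp
qed

text \<open>The axioms \<open>T_diff\<close> and \<open>T_zero\<close> are what the linear and the
  even subadditive case have in common; they suffice for the extension. Linearity enters as a
  separate assumption where adjoints and linear extensions are treated.\<close>

locale cz_family = morrey_exponents p P r \<rho> dim
  for p P r \<rho> :: real and dim :: "'n::finite itself" +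
  fixes q Q c\<^sub>1 c\<^sub>2 :: real and T :: "nat \<Rightarrow> 'n cfun \<Rightarrow> 'n cfun"
  assumes q_conj: "conjugate_exponents q Q"
    and T_bcontfun: "\<And>j \<phi>. \<phi> \<in> test_functions \<Longrightarrow> T j \<phi> \<in> bcontfun"
    and T_diff: "\<And>j \<phi> \<psi> y. \<phi> \<in> test_functions \<Longrightarrow> \<psi> \<in> test_functions \<Longrightarrow>
      cmod (T j \<phi> y - T j \<psi> y) \<le> cmod (T j (\<lambda>x. \<phi> x - \<psi> x) y)"
    and T_zero: "\<And>j. T j (\<lambda>x. 0) = (\<lambda>x. 0)"
    and T_kernel: "\<And>j f y. f \<in> test_functions \<Longrightarrow> y \<notin> supp f \<Longrightarrow>
      cmod (T j f y) \<le> c\<^sub>1 * (LINT z|lebesgue. cmod (f z) / norm (y - z) ^ CARD('n))"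
    and T_Lp: "\<And>f :: nat \<Rightarrow> 'n cfun. (\<And>j. f j \<in> test_functions) \<Longrightarrow>
      Lp_enorm_on p UNIV (lq_function q (\<lambda>j. T j (f j))) \<le> ennreal c\<^sub>2 * Lp_enorm_on p UNIV (lq_function q f)"
begin

lemma q_one: "1 < q" using q_conj by (rule conjugate_exponents.one_less)
lemma q_pos: "0 < q" using q_one by simp

lemma T_measurable [measurable]: "\<phi> \<in> test_functions \<Longrightarrow> T j \<phi> \<in> borel_measurable lebesgue"
  using T_bcontfun[of \<phi> j] by (intro continuous_lebesgue_measurable) (simp add: bcontfun_def)

lemma T_Lp_single:
  assumes \<phi>: "\<phi> \<in> test_functions" shows "Lp_norm p (T j \<phi>) \<le> ennreal c\<^sub>2 * Lp_norm p \<phi>"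
proof -
  have "(\<lambda>i. T i (if i = j then \<phi> else (\<lambda>x. 0))) = (\<lambda>i. if i = j then T j \<phi> else (\<lambda>x. 0))"
    by (auto simp: T_zero)
  then show ?thesis using T_Lp[of "\<lambda>i. if i = j then \<phi> else (\<lambda>x. 0)"] \<phi>
    by (simp add: lq_single_function[OF q_pos])
qed

lemma T_Lp_diff:
  assumes "\<phi> \<in> test_functions" "\<psi> \<in> test_functions"
  shows "Lp_norm p (\<lambda>x. T j \<phi> x - T j \<psi> x) \<le> ennreal c\<^sub>2 * Lp_norm p (\<lambda>x. \<phi> x - \<psi> x)"
proof -
  have "Lp_norm p (\<lambda>x. T j \<phi> x - T j \<psi> x) \<le> Lp_norm p (T j (\<lambda>x. \<phi> x - \<psi> x))"
    using assms pos T_diff by (intro Lp_mono) (auto simp: eabs_def intro: ennreal_leI)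
  also have "\<dots> \<le> ennreal c\<^sub>2 * Lp_norm p (\<lambda>x. \<phi> x - \<psi> x)" using assms by (intro T_Lp_single test_diff)
  finally show ?thesis .
qed

text \<open>Lipschitz estimates against all test functions determine h up to null sets, because test
  functions are dense in L_p. The extension can thus be chosen without reference to a particular
  approximating sequence.\<close>

definition ext_spec :: "nat \<Rightarrow> 'n cfun \<Rightarrow> 'n cfun \<Rightarrow> bool" where
  "ext_spec j f h \<longleftrightarrow> h \<in> Lp_space p \<and>
     (\<forall>\<phi>\<in>test_functions. Lp_norm p (\<lambda>x. h x - T j \<phi> x) \<le> ennreal c\<^sub>2 * Lp_norm p (\<lambda>x. f x - \<phi> x))"

definition ext :: "nat \<Rightarrow> 'n cfun \<Rightarrow> 'n cfun" where "ext j f = (SOME h. ext_spec j f h)"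

text \<open>Rapid approximants of f have images that converge almost everywhere. Fatou's lemma
  transfers the Lipschitz estimate for each pair of test functions to the limit.\<close>

lemma ext_spec_exists:
  assumes f: "f \<in> Lp_space p" shows "\<exists>h. ext_spec j f h"
proof -
  note [measurable] = Lp_space_measurable[OF f]
  obtain \<phi> where \<phi>: "\<And>k. \<phi> k \<in> test_functions" "\<And>k. Lp_norm p (\<lambda>x. f x - \<phi> k x) \<le> ennreal (1 * (1/2) ^ k)"
    using rapid_test_approx[OF one_less f open_UNIV, of 1] by auto
  have [measurable]: "\<phi> k \<in> borel_measurable lebesgue" for k using \<phi>(1) by (rule test_measurable)
  have [measurable]: "T j (\<phi> k) \<in> borel_measurable lebesgue" for k using \<phi>(1) by (rule T_measurable)
  have "Lp_enorm_on p UNIV (eabs (\<lambda>x. T j (\<phi> (Suc k)) x - T j (\<phi> k) x)) \<le> ennreal (2 * \<bar>c\<^sub>2\<bar> * (1/2) ^ k)" for k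
  proof -
    have "Lp_norm p (\<lambda>x. \<phi> (Suc k) x - \<phi> k x) = Lp_norm p (\<lambda>x. (\<phi> (Suc k) x - f x) + (f x - \<phi> k x))" by simp
    also have "\<dots> \<le> Lp_norm p (\<lambda>x. f x - \<phi> (Suc k) x) + Lp_norm p (\<lambda>x. f x - \<phi> k x)"
      unfolding Lp_norm_minus_commute[of p f "\<phi> (Suc k)"] using one_less by (intro Lp_norm_triangle) auto
    also have "\<dots> \<le> ennreal ((1/2) ^ Suc k) + ennreal ((1/2) ^ k)" using \<phi>(2)[of "Suc k"] \<phi>(2)[of k] by (intro add_mono) auto
    also have "\<dots> = ennreal ((1/2) ^ Suc k + (1/2) ^ k)" by (intro ennreal_plus[symmetric]) auto
    also have "\<dots> \<le> ennreal (2 * (1/2) ^ k)" by (intro ennreal_leI) simp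
    finally have "ennreal c\<^sub>2 * Lp_norm p (\<lambda>x. \<phi> (Suc k) x - \<phi> k x) \<le> ennreal \<bar>c\<^sub>2\<bar> * ennreal (2 * (1/2) ^ k)"
      by (intro mult_mono ennreal_leI) auto
    then show ?thesis using T_Lp_diff[OF \<phi>(1) \<phi>(1), of j "Suc k" k]
      by (auto simp: ennreal_mult'[symmetric] mult_ac intro: order_trans)
  qed
  then have "(\<Sum>k. Lp_enorm_on p UNIV (eabs (\<lambda>x. T j (\<phi> (Suc k)) x - T j (\<phi> k) x))) \<le> (\<Sum>k. ennreal (2 * \<bar>c\<^sub>2\<bar> * (1/2) ^ k))"
    by (intro suminf_le) auto
  also have "\<dots> < top" using summable_half[of "2 * \<bar>c\<^sub>2\<bar>"] by (subst suminf_ennreal2) auto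
  finally have "AE x in lebesgue. x \<in> UNIV \<longrightarrow> convergent (\<lambda>k. T j (\<phi> k) x)"
    using one_less by (intro AE_convergent_if_rapid[of p]) auto
  then have conv: "AE x in lebesgue. convergent (\<lambda>k. T j (\<phi> k) x)" by simp
  define h where "h x = lim (\<lambda>k. T j (\<phi> k) x)" for x
  have [measurable]: "h \<in> borel_measurable lebesgue" unfolding h_def[abs_def] by (rule borel_measurable_lim_metric) measurable
  have le: "Lp_norm p (\<lambda>x. h x - T j \<psi> x) \<le> ennreal c\<^sub>2 * Lp_norm p (\<lambda>x. f x - \<psi> x)" if \<psi>: "\<psi> \<in> test_functions" for \<psi>
  proof -
    note [measurable] = test_measurable[OF \<psi>] T_measurable[OF \<psi>]
    have "Lp_norm p (\<lambda>x. h x - T j \<psi> x) \<le> liminf (\<lambda>k. Lp_norm p (\<lambda>x. T j (\<phi> k) x - T j \<psi> x))"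
    proof (rule Lp_Fatou[OF pos])
      show "AE x in lebesgue. x \<in> UNIV \<longrightarrow> eabs (\<lambda>x. h x - T j \<psi> x) x \<le> liminf (\<lambda>k. eabs (\<lambda>x. T j (\<phi> k) x - T j \<psi> x) x)"
        using conv
      proof eventually_elim
        case (elim x)
        then have "(\<lambda>k. T j (\<phi> k) x) \<longlonglongrightarrow> h x" by (simp add: h_def convergent_LIMSEQ_iff)
        then have "(\<lambda>k. ennreal (cmod (T j (\<phi> k) x - T j \<psi> x))) \<longlonglongrightarrow> ennreal (cmod (h x - T j \<psi> x))"
          by (intro tendsto_ennrealI tendsto_intros)
        then have "liminf (\<lambda>k. ennreal (cmod (T j (\<phi> k) x - T j \<psi> x))) = ennreal (cmod (h x - T j \<psi> x))"
          by (intro lim_imp_Liminf) simp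
        then show ?case by (simp add: eabs_def)
      qed
    qed auto
    also have "\<dots> \<le> liminf (\<lambda>k. ennreal (\<bar>c\<^sub>2\<bar> * (1/2) ^ k) + ennreal c\<^sub>2 * Lp_norm p (\<lambda>x. f x - \<psi> x))"
    proof (intro Liminf_mono always_eventually allI)
      fix k
      have "Lp_norm p (\<lambda>x. \<phi> k x - \<psi> x) = Lp_norm p (\<lambda>x. (\<phi> k x - f x) + (f x - \<psi> x))" by simp
      also have "\<dots> \<le> Lp_norm p (\<lambda>x. f x - \<phi> k x) + Lp_norm p (\<lambda>x. f x - \<psi> x)"
        unfolding Lp_norm_minus_commute[of p f "\<phi> k"] using one_less by (intro Lp_norm_triangle) auto
      also have "\<dots> \<le> ennreal ((1/2) ^ k) + Lp_norm p (\<lambda>x. f x - \<psi> x)" using \<phi>(2)[of k] by (intro add_mono) auto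
      finally have 1: "ennreal c\<^sub>2 * Lp_norm p (\<lambda>x. \<phi> k x - \<psi> x) \<le> ennreal c\<^sub>2 * ennreal ((1/2) ^ k) + ennreal c\<^sub>2 * Lp_norm p (\<lambda>x. f x - \<psi> x)"
        unfolding distrib_left[symmetric] by (rule mult_left_mono) simp
      have 2: "ennreal c\<^sub>2 * ennreal ((1/2) ^ k) \<le> ennreal (\<bar>c\<^sub>2\<bar> * (1/2) ^ k)"
        by (subst ennreal_mult''[symmetric]) (auto intro!: ennreal_leI mult_right_mono)
      show "Lp_norm p (\<lambda>x. T j (\<phi> k) x - T j \<psi> x) \<le> ennreal (\<bar>c\<^sub>2\<bar> * (1/2) ^ k) + ennreal c\<^sub>2 * Lp_norm p (\<lambda>x. f x - \<psi> x)"
        by (rule order_trans[OF T_Lp_diff[OF \<phi>(1) \<psi>] order_trans[OF 1 add_right_mono[OF 2]]])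
    qed
    also have "\<dots> = ennreal 0 + ennreal c\<^sub>2 * Lp_norm p (\<lambda>x. f x - \<psi> x)"
    proof (rule lim_imp_Liminf)
      have "(\<lambda>k. \<bar>c\<^sub>2\<bar> * (1/2) ^ k) \<longlonglongrightarrow> 0" using summable_half by (rule summable_LIMSEQ_zero)
      then show "(\<lambda>k. ennreal (\<bar>c\<^sub>2\<bar> * (1/2) ^ k) + ennreal c\<^sub>2 * Lp_norm p (\<lambda>x. f x - \<psi> x))
          \<longlonglongrightarrow> ennreal 0 + ennreal c\<^sub>2 * Lp_norm p (\<lambda>x. f x - \<psi> x)"
        by (intro tendsto_add tendsto_ennrealI tendsto_const)
    qed simp
    finally show ?thesis by simp
  qed
  have "Lp_norm p h < top"
    using le[of "\<lambda>x. 0"] f by (auto simp: T_zero Lp_space_def ennreal_mult_less_top intro: le_less_trans)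
  then show ?thesis using le by (intro exI[of _ h]) (auto simp: ext_spec_def Lp_space_def)
qed

lemma ext_spec_ext: "f \<in> Lp_space p \<Longrightarrow> ext_spec j f (ext j f)"
  unfolding ext_def using ext_spec_exists by (rule someI_ex)

lemma ext_Lp_space: "f \<in> Lp_space p \<Longrightarrow> ext j f \<in> Lp_space p"
  using ext_spec_ext by (simp add: ext_spec_def)

lemma ext_measurable: "f \<in> Lp_space p \<Longrightarrow> ext j f \<in> borel_measurable lebesgue"
  using ext_Lp_space Lp_space_measurable by blast

lemma ext_approx:
  "f \<in> Lp_space p \<Longrightarrow> \<phi> \<in> test_functions \<Longrightarrow> Lp_norm p (\<lambda>x. ext j f x - T j \<phi> x) \<le> ennreal c\<^sub>2 * Lp_norm p (\<lambda>x. f x - \<phi> x)"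
  using ext_spec_ext by (simp add: ext_spec_def)

lemma ext_test:
  assumes \<phi>: "\<phi> \<in> test_functions" shows "ext j \<phi> =ae T j \<phi>"
proof -
  have f: "\<phi> \<in> Lp_space p" using pos \<phi> by (rule test_Lp_space)
  note [measurable] = T_measurable[OF \<phi>, of j] ext_measurable[OF f, of j]
  have "Lp_norm p (\<lambda>x. ext j \<phi> x - T j \<phi> x) = 0" using ext_approx[OF f \<phi>, of j] by simp
  then have "AE x in lebesgue. eabs (\<lambda>x. ext j \<phi> x - T j \<phi> x) x = 0"
    by (subst (asm) Lp_eq_0_iff) auto
  then show ?thesis by eventually_elim (simp add: eabs_def)
qed

text \<open>Pointwise relations between the values of T_j on test functions pass to the extension
  through this convergence; this is how \<open>ext_diff\<close>, \<open>ext_lincomb\<close> and the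
  kernel bound are obtained.\<close>

lemma ext_rapid:
  assumes f: "f \<in> Lp_space p" and \<phi>: "\<And>k. \<phi> k \<in> test_functions"
    and le: "\<And>k. Lp_norm p (\<lambda>x. f x - \<phi> k x) \<le> ennreal (c * (1/2) ^ k)"
  shows "AE x in lebesgue. (\<lambda>k. T j (\<phi> k) x) \<longlonglongrightarrow> ext j f x"
proof -
  have "AE x in lebesgue. x \<in> UNIV \<longrightarrow> (\<lambda>k. T j (\<phi> k) x) \<longlonglongrightarrow> ext j f x"
  proof (rule AE_tendsto_if_rapid[OF one_less])
    fix k
    have "Lp_norm p (\<lambda>x. T j (\<phi> k) x - ext j f x) \<le> ennreal c\<^sub>2 * Lp_norm p (\<lambda>x. f x - \<phi> k x)"
      unfolding Lp_norm_minus_commute[of p "T j (\<phi> k)"] using f \<phi> by (rule ext_approx)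
    also have "\<dots> \<le> ennreal \<bar>c\<^sub>2\<bar> * ennreal (\<bar>c\<bar> * (1/2) ^ k)"
      by (intro mult_mono ennreal_leI order_trans[OF le] mult_right_mono) auto
    also have "\<dots> = ennreal (\<bar>c\<^sub>2\<bar> * \<bar>c\<bar> * (1/2) ^ k)" by (simp add: ennreal_mult'[symmetric] mult.assoc)
    finally show "Lp_norm p (\<lambda>x. T j (\<phi> k) x - ext j f x) \<le> ennreal (\<bar>c\<^sub>2\<bar> * \<bar>c\<bar> * (1/2) ^ k)" .
  qed (use f \<phi> ext_measurable T_measurable in auto)
  then show ?thesis by simp
qed

lemma ext_diff:
  assumes f: "f \<in> Lp_space p" and g: "g \<in> Lp_space p"
  shows "AE x in lebesgue. cmod (ext j f x - ext j g x) \<le> cmod (ext j (\<lambda>x. f x - g x) x)"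
proof -
  note [measurable] = Lp_space_measurable[OF f] Lp_space_measurable[OF g]
  obtain \<phi> where \<phi>: "\<And>k. \<phi> k \<in> test_functions" "\<And>k. Lp_norm p (\<lambda>x. f x - \<phi> k x) \<le> ennreal (1 * (1/2) ^ k)"
    using rapid_test_approx[OF one_less f open_UNIV, of 1] by auto
  obtain \<psi> where \<psi>: "\<And>k. \<psi> k \<in> test_functions" "\<And>k. Lp_norm p (\<lambda>x. g x - \<psi> k x) \<le> ennreal (1 * (1/2) ^ k)"
    using rapid_test_approx[OF one_less g open_UNIV, of 1] by auto
  note [measurable] = test_measurable[OF \<phi>(1)] test_measurable[OF \<psi>(1)]
  have "Lp_norm p (\<lambda>x. (f x - g x) - (\<phi> k x - \<psi> k x)) \<le> ennreal (2 * (1/2) ^ k)" for k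
  proof -
    have "Lp_norm p (\<lambda>x. (f x - g x) - (\<phi> k x - \<psi> k x)) = Lp_norm p (\<lambda>x. (f x - \<phi> k x) + (\<psi> k x - g x))"
      by (intro arg_cong[of _ _ "\<lambda>h. Lp_enorm_on p UNIV (eabs h)"]) (auto simp: fun_eq_iff)
    also have "\<dots> \<le> Lp_norm p (\<lambda>x. f x - \<phi> k x) + Lp_norm p (\<lambda>x. g x - \<psi> k x)"
      unfolding Lp_norm_minus_commute[of p g "\<psi> k"] using one_less by (intro Lp_norm_triangle) auto
    also have "\<dots> \<le> ennreal (1 * (1/2) ^ k) + ennreal (1 * (1/2) ^ k)" by (intro add_mono \<phi>(2) \<psi>(2))
    also have "\<dots> = ennreal (2 * (1/2) ^ k)" by (subst ennreal_plus[symmetric]) auto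
    finally show ?thesis .
  qed
  then have "AE x in lebesgue. (\<lambda>k. T j (\<lambda>x. \<phi> k x - \<psi> k x) x) \<longlonglongrightarrow> ext j (\<lambda>x. f x - g x) x"
    using f g \<phi>(1) \<psi>(1) one_less by (intro ext_rapid Lp_space_diff test_diff)
  then show ?thesis using ext_rapid[OF f \<phi>, of j] ext_rapid[OF g \<psi>, of j]
  proof eventually_elim
    case (elim x)
    show ?case
      by (rule LIMSEQ_le[OF tendsto_norm[OF tendsto_diff[OF elim(2,3)]] tendsto_norm[OF elim(1)]])
        (use T_diff \<phi>(1) \<psi>(1) in blast)
  qed
qed

lemma ext_Lp:
  assumes f: "\<And>j. f j \<in> Lp_space p"
  shows "Lp_enorm_on p UNIV (lq_function q (\<lambda>j. ext j (f j))) \<le> ennreal c\<^sub>2 * Lp_enorm_on p UNIV (lq_function q f)"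
proof -
  note [measurable] = Lp_space_measurable[OF f] ext_measurable[OF f]
  \<comment> \<open>The tolerance decays in j as well as in k, so that the errors of all entries sum
    to 2 * 2^(-k) in the l_q norm.\<close>
  have "\<exists>\<phi>. (\<forall>k. \<phi> k \<in> test_functions) \<and> (\<forall>k. Lp_norm p (\<lambda>x. f j x - \<phi> k x) \<le> ennreal ((1/2) ^ j * (1/2) ^ k))" for j
  proof -
    obtain \<phi> where "\<And>k. \<phi> k \<in> test_functions" "\<And>k. Lp_norm p (\<lambda>x. f j x - \<phi> k x) \<le> ennreal ((1/2) ^ j * (1/2) ^ k)"
      using rapid_test_approx[OF one_less f[of j] open_UNIV, of "(1/2) ^ j"] by auto
    then show ?thesis by blast
  qed
  then obtain \<phi> where \<phi>: "\<And>j k. \<phi> j k \<in> test_functions" "\<And>j k. Lp_norm p (\<lambda>x. f j x - \<phi> j k x) \<le> ennreal ((1/2) ^ j * (1/2) ^ k)"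
    by metis
  have [measurable]: "\<phi> j k \<in> borel_measurable lebesgue" "T j (\<phi> j k) \<in> borel_measurable lebesgue" for j k
    using \<phi>(1) test_measurable T_measurable by blast+
  have bound: "Lp_enorm_on p UNIV (lq_function q (\<lambda>j. T j (\<phi> j k))) \<le> ennreal c\<^sub>2 * (Lp_enorm_on p UNIV (lq_function q f) + ennreal (2 * (1/2) ^ k))" for k
  proof -
    have "Lp_enorm_on p UNIV (lq_function q (\<lambda>j. \<phi> j k)) \<le>
        Lp_enorm_on p UNIV (\<lambda>x. lq_function q f x + lq_function q (\<lambda>j x. f j x - \<phi> j k x) x)"
    proof (intro Lp_mono pos lq_triangle q_one)
      fix x j
      have "cmod (\<phi> j k x) = cmod (f j x - (f j x - \<phi> j k x))" by simp
      also have "\<dots> \<le> cmod (f j x) + cmod (f j x - \<phi> j k x)" by (rule norm_triangle_ineq4)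
      finally show "cmod (\<phi> j k x) \<le> cmod (f j x) + cmod (f j x - \<phi> j k x)" .
    qed
    also have "\<dots> \<le> Lp_enorm_on p UNIV (lq_function q f) + Lp_enorm_on p UNIV (lq_function q (\<lambda>j x. f j x - \<phi> j k x))"
      using one_less by (intro Lp_add) auto
    also have "Lp_enorm_on p UNIV (lq_function q (\<lambda>j x. f j x - \<phi> j k x)) \<le> ennreal (2 * (1/2) ^ k)"
    proof -
      have "Lp_enorm_on p UNIV (lq_function q (\<lambda>j x. f j x - \<phi> j k x)) \<le> Lp_enorm_on p UNIV (\<lambda>x. \<Sum>j. eabs (\<lambda>x. f j x - \<phi> j k x) x)"
        unfolding eabs_def by (intro Lp_mono pos lq_le_suminf q_one)
      also have "\<dots> \<le> (\<Sum>j. Lp_norm p (\<lambda>x. f j x - \<phi> j k x))" using one_less by (intro Lp_suminf) auto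
      also have "\<dots> \<le> (\<Sum>j. ennreal ((1/2) ^ j * (1/2) ^ k))" by (intro suminf_le \<phi>(2)) auto
      also have "\<dots> = ennreal (2 * (1/2) ^ k)"
        using sums_mult2[OF geometric_sums[of "1/2::real"], of "(1/2) ^ k"] by (intro suminf_ennreal_eq) auto
      finally show ?thesis .
    qed
    finally have "ennreal c\<^sub>2 * Lp_enorm_on p UNIV (lq_function q (\<lambda>j. \<phi> j k))
        \<le> ennreal c\<^sub>2 * (Lp_enorm_on p UNIV (lq_function q f) + ennreal (2 * (1/2) ^ k))"
      by (intro mult_left_mono) (auto simp: add_left_mono)
    then show ?thesis using T_Lp[of "\<lambda>j. \<phi> j k"] \<phi>(1) by (meson order_trans)
  qed
  have "AE x in lebesgue. \<forall>j. (\<lambda>k. T j (\<phi> j k) x) \<longlonglongrightarrow> ext j (f j) x"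
    unfolding AE_all_countable using ext_rapid[OF f \<phi>] by blast
  then have "AE x in lebesgue. x \<in> UNIV \<longrightarrow> lq_function q (\<lambda>j. ext j (f j)) x \<le> liminf (\<lambda>k. lq_function q (\<lambda>j. T j (\<phi> j k)) x)"
    by eventually_elim (auto intro: lq_Fatou q_pos)
  then have "Lp_enorm_on p UNIV (lq_function q (\<lambda>j. ext j (f j))) \<le> liminf (\<lambda>k. Lp_enorm_on p UNIV (lq_function q (\<lambda>j. T j (\<phi> j k))))"
    using pos by (intro Lp_Fatou) auto
  also have "\<dots> \<le> liminf (\<lambda>k. ennreal c\<^sub>2 * (Lp_enorm_on p UNIV (lq_function q f) + ennreal (2 * (1/2) ^ k)))"
    by (intro Liminf_mono always_eventually allI bound)
  also have "\<dots> = ennreal c\<^sub>2 * (Lp_enorm_on p UNIV (lq_function q f) + ennreal 0)"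
  proof (rule lim_imp_Liminf)
    have "(\<lambda>k. 2 * (1/2) ^ k :: real) \<longlonglongrightarrow> 0" using summable_half by (rule summable_LIMSEQ_zero)
    then show "(\<lambda>k. ennreal c\<^sub>2 * (Lp_enorm_on p UNIV (lq_function q f) + ennreal (2 * (1/2) ^ k)))
        \<longlonglongrightarrow> ennreal c\<^sub>2 * (Lp_enorm_on p UNIV (lq_function q f) + ennreal 0)"
      by (intro ennreal_tendsto_cmult tendsto_add tendsto_ennrealI tendsto_const) auto
  qed simp
  finally show ?thesis by simp
qed

lemma ext_Lp_single:
  assumes f: "f \<in> Lp_space p" shows "Lp_norm p (ext j f) \<le> ennreal c\<^sub>2 * Lp_norm p f"
  using ext_approx[OF f test_zero, of j] by (simp add: T_zero)

lemma ext_zero: "ext j (\<lambda>x. 0) =ae (\<lambda>x. 0)"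
  using ext_test[OF test_zero, of j] by (simp add: T_zero)

lemma ext_lincomb:
  assumes lin: "linear_on_test_functions (T j)" and f: "f \<in> Lp_space p" and g: "g \<in> Lp_space p"
  shows "ext j (\<lambda>x. a * f x + b * g x) =ae (\<lambda>x. a * ext j f x + b * ext j g x)"
proof -
  note [measurable] = Lp_space_measurable[OF f] Lp_space_measurable[OF g]
  obtain \<phi> where \<phi>: "\<And>k. \<phi> k \<in> test_functions" "\<And>k. Lp_norm p (\<lambda>x. f x - \<phi> k x) \<le> ennreal (1 * (1/2) ^ k)"
    using rapid_test_approx[OF one_less f open_UNIV, of 1] by auto
  obtain \<psi> where \<psi>: "\<And>k. \<psi> k \<in> test_functions" "\<And>k. Lp_norm p (\<lambda>x. g x - \<psi> k x) \<le> ennreal (1 * (1/2) ^ k)"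
    using rapid_test_approx[OF one_less g open_UNIV, of 1] by auto
  note [measurable] = test_measurable[OF \<phi>(1)] test_measurable[OF \<psi>(1)]
  have "Lp_norm p (\<lambda>x. (a * f x + b * g x) - (a * \<phi> k x + b * \<psi> k x)) \<le> ennreal ((cmod a + cmod b) * (1/2) ^ k)" for k
  proof -
    have "Lp_norm p (\<lambda>x. (a * f x + b * g x) - (a * \<phi> k x + b * \<psi> k x)) = Lp_norm p (\<lambda>x. a * (f x - \<phi> k x) + b * (g x - \<psi> k x))"
      by (intro arg_cong[of _ _ "\<lambda>h. Lp_enorm_on p UNIV (eabs h)"]) (auto simp: fun_eq_iff algebra_simps)
    also have "\<dots> \<le> ennreal (cmod a) * Lp_norm p (\<lambda>x. f x - \<phi> k x) + ennreal (cmod b) * Lp_norm p (\<lambda>x. g x - \<psi> k x)"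
      using one_less by (intro order_trans[OF Lp_norm_triangle]) (auto simp: Lp_norm_cmult)
    also have "\<dots> \<le> ennreal (cmod a) * ennreal (1 * (1/2) ^ k) + ennreal (cmod b) * ennreal (1 * (1/2) ^ k)"
      by (intro add_mono mult_left_mono \<phi>(2) \<psi>(2)) auto
    also have "\<dots> = ennreal ((cmod a + cmod b) * (1/2) ^ k)" by (simp add: ennreal_mult'[symmetric] ennreal_plus[symmetric] distrib_right del: ennreal_plus)
    finally show ?thesis .
  qed
  then have "AE x in lebesgue. (\<lambda>k. T j (\<lambda>x. a * \<phi> k x + b * \<psi> k x) x) \<longlonglongrightarrow> ext j (\<lambda>x. a * f x + b * g x) x"
    using f g \<phi>(1) \<psi>(1) one_less by (intro ext_rapid Lp_space_lincomb test_lincomb)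
  then show ?thesis using ext_rapid[OF f \<phi>, of j] ext_rapid[OF g \<psi>, of j]
  proof eventually_elim
    case (elim x)
    have "T j (\<lambda>x. a * \<phi> k x + b * \<psi> k x) x = a * T j (\<phi> k) x + b * T j (\<psi> k) x" for k
      using lin \<phi>(1) \<psi>(1) by (auto simp: linear_on_test_functions_def)
    then have "(\<lambda>k. a * T j (\<phi> k) x + b * T j (\<psi> k) x) \<longlonglongrightarrow> ext j (\<lambda>x. a * f x + b * g x) x" using elim(1) by simp
    moreover have "(\<lambda>k. a * T j (\<phi> k) x + b * T j (\<psi> k) x) \<longlonglongrightarrow> a * ext j f x + b * ext j g x"
      by (intro tendsto_intros elim)
    ultimately show ?case by (rule LIMSEQ_unique)
  qed
qed

end

subsection \<open>Local estimates\<close>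

lemma open_cube_sets:
  fixes x :: "real ^ 'n::finite"
  shows "open {z. \<forall>i. \<bar>z $ i - x $ i\<bar> < s}"
proof -
  have "{z. \<forall>i. \<bar>z $ i - x $ i\<bar> < s} = (\<Inter>i. {z. \<bar>z $ i - x $ i\<bar> < s})" by auto
  moreover have "open (\<Inter>i. {z. \<bar>z $ i - x $ i\<bar> < s})"
    by (intro open_INT) (auto intro!: open_Collect_less continuous_intros)
  ultimately show ?thesis by simp
qed

lemma (in conjugate_exponents) integral_le_Lp_cube:
  fixes F :: "real ^ 'n::finite \<Rightarrow> ennreal"
  assumes [measurable]: "F \<in> borel_measurable lebesgue" and F: "\<And>z. z \<notin> cube x s \<Longrightarrow> F z = 0" and s: "0 \<le> s"
  shows "(\<integral>\<^sup>+z. F z \<partial>lebesgue) \<le> ennreal (((2 * s) ^ CARD('n)) powr (1 / P)) * Lp_enorm_on p UNIV F"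
proof -
  have "(\<integral>\<^sup>+z. F z \<partial>lebesgue) = (\<integral>\<^sup>+z\<in>cube x s. F z * 1 \<partial>lebesgue)"
    using F by (intro nn_integral_cong) (auto simp: indicator_def)
  also have "\<dots> \<le> Lp_enorm_on p (cube x s) F * Lp_enorm_on P (cube x s) (\<lambda>_. 1)"
    by (rule Hoelder_on) auto
  also have "\<dots> \<le> Lp_enorm_on p UNIV F * ennreal (((2 * s) ^ CARD('n)) powr (1 / P))"
    using s conj_pos pos by (intro mult_mono Lp_le_UNIV) (auto simp: Lp_const emeasure_cube_lborel)
  finally show ?thesis by (simp add: mult.commute)
qed

lemma power_cube_eq: "((2 powr a) ^ n) = 2 powr (real n * a)"
  by (simp add: powr_realpow[symmetric] powr_powr mult.commute)

context cz_family
begin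

lemma test_integral_finite:
  assumes \<phi>: "\<phi> \<in> test_functions" shows "integrable lebesgue (\<phi> :: 'n cfun)"
proof -
  obtain B where B: "0 \<le> B" "\<And>x. cmod (\<phi> x) \<le> B" using test_bounded[OF \<phi>] by blast
  have l: "supp \<phi> \<in> lmeasurable" using \<phi> by (intro lmeasurable_compact test_compact)
  show ?thesis
  proof (rule Bochner_Integration.integrable_bound)
    show "integrable lebesgue (\<lambda>x. B * indicator (supp \<phi>) x :: real)"
      using l by (intro integrable_mult_right integrable_real_indicator) (auto simp: fmeasurable_def)
    show "AE x in lebesgue. norm (\<phi> x) \<le> norm (B * indicator (supp \<phi>) x :: real)"
      using B by (intro AE_I2) (auto simp: indicator_def not_in_supp)
    show "\<phi> \<in> borel_measurable lebesgue" using \<phi> by (rule test_measurable)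
  qed
qed

text \<open>A lower bound d for the distance to the support replaces the singular kernel by the
  constant d^(-n). The absolute value of c_1 appears because the sign of c_1 is left open.\<close>

lemma T_kernel_bound:
  assumes \<phi>: "\<phi> \<in> test_functions" and d: "0 < d" and far: "\<And>z. z \<in> supp \<phi> \<Longrightarrow> d \<le> norm (y - z)"
  shows "ennreal (cmod (T j \<phi> y)) \<le> ennreal (\<bar>c\<^sub>1\<bar> / d ^ CARD('n)) * (\<integral>\<^sup>+z. eabs \<phi> z \<partial>lebesgue)"
proof -
  have y: "y \<notin> supp \<phi>" using far[of y] d by auto
  have i: "integrable lebesgue (\<lambda>z. cmod (\<phi> z))" using test_integral_finite[OF \<phi>] by simp
  have "(LINT z|lebesgue. cmod (\<phi> z) / norm (y - z) ^ CARD('n)) \<le> (LINT z|lebesgue. cmod (\<phi> z) / d ^ CARD('n))"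
  proof (rule integral_mono')
    show "integrable lebesgue (\<lambda>z. cmod (\<phi> z) / d ^ CARD('n))" using i by simp
    fix z show "cmod (\<phi> z) / norm (y - z) ^ CARD('n) \<le> cmod (\<phi> z) / d ^ CARD('n)"
    proof (cases "z \<in> supp \<phi>")
      case True
      then have "d ^ CARD('n) \<le> norm (y - z) ^ CARD('n)" using far d by (intro power_mono) auto
      moreover have "0 < norm (y - z)" using far[OF True] d by linarith
      ultimately show ?thesis using d by (intro divide_left_mono mult_pos_pos zero_less_power) auto
    qed (simp add: not_in_supp)
    show "0 \<le> cmod (\<phi> z) / d ^ CARD('n)" using d by simp
  qed
  then have le: "(LINT z|lebesgue. cmod (\<phi> z) / norm (y - z) ^ CARD('n)) \<le> (LINT z|lebesgue. cmod (\<phi> z)) / d ^ CARD('n)"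
    by simp
  have "0 \<le> (LINT z|lebesgue. cmod (\<phi> z) / norm (y - z) ^ CARD('n))" by (rule integral_nonneg_AE) simp
  then have "cmod (T j \<phi> y) \<le> \<bar>c\<^sub>1\<bar> * (LINT z|lebesgue. cmod (\<phi> z) / norm (y - z) ^ CARD('n))"
    using T_kernel[OF \<phi> y, of j] by (meson abs_ge_self mult_right_mono order_trans)
  also have "\<dots> \<le> \<bar>c\<^sub>1\<bar> * ((LINT z|lebesgue. cmod (\<phi> z)) / d ^ CARD('n))" using le by (rule mult_left_mono) simp
  finally have "ennreal (cmod (T j \<phi> y)) \<le> ennreal (\<bar>c\<^sub>1\<bar> / d ^ CARD('n) * (LINT z|lebesgue. cmod (\<phi> z)))"
    by (intro ennreal_leI) simp
  also have "\<dots> = ennreal (\<bar>c\<^sub>1\<bar> / d ^ CARD('n)) * ennreal (LINT z|lebesgue. cmod (\<phi> z))"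
    using d by (intro ennreal_mult') simp
  also have "ennreal (LINT z|lebesgue. cmod (\<phi> z)) = (\<integral>\<^sup>+z. eabs \<phi> z \<partial>lebesgue)"
    unfolding eabs_def using i by (intro nn_integral_eq_integral[symmetric]) auto
  finally show ?thesis .
qed

text \<open>The approximants are supported in U, so that all of them satisfy the kernel bound with
  the same d. Since U is bounded, their convergence in L_p implies convergence of the integrals on
  the right.\<close>

lemma ext_kernel_bound:
  assumes f: "f \<in> Lp_space p" and U: "open U" "U \<subseteq> cube x R" "0 \<le> R" "\<And>z. z \<notin> U \<Longrightarrow> f z = 0"
    and d: "0 < d" and far: "\<And>y z. y \<in> A \<Longrightarrow> z \<in> U \<Longrightarrow> d \<le> norm (y - z)"
  shows "AE y in lebesgue. y \<in> A \<longrightarrow> eabs (ext j f) y \<le> ennreal (\<bar>c\<^sub>1\<bar> / d ^ CARD('n)) * (\<integral>\<^sup>+z. eabs f z \<partial>lebesgue)"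
proof -
  note [measurable] = Lp_space_measurable[OF f]
  obtain \<phi> where \<phi>: "\<And>k. \<phi> k \<in> test_functions" "\<And>k. supp (\<phi> k) \<subseteq> U"
    "\<And>k. Lp_norm p (\<lambda>x. f x - \<phi> k x) \<le> ennreal (1 * (1/2) ^ k)"
    using rapid_test_approx[OF one_less f U(1) U(4), of 1] by auto
  note [measurable] = test_measurable[OF \<phi>(1)]
  \<comment> \<open>This is the factor from Hoelder's inequality on the cube of radius R, which
    contains all the supports.\<close>
  let ?V = "((2 * R) ^ CARD('n)) powr (1 / P)"
  have int: "(\<integral>\<^sup>+z. eabs (\<phi> k) z \<partial>lebesgue) \<le> (\<integral>\<^sup>+z. eabs f z \<partial>lebesgue) + ennreal (?V * (1/2) ^ k)" for k
  proof -
    have "(\<integral>\<^sup>+z. eabs (\<phi> k) z \<partial>lebesgue) \<le> (\<integral>\<^sup>+z. eabs f z + eabs (\<lambda>z. f z - \<phi> k z) z \<partial>lebesgue)"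
    proof (intro nn_integral_mono)
      fix z
      have "eabs (\<lambda>z. f z + (\<phi> k z - f z)) z \<le> eabs f z + eabs (\<lambda>z. \<phi> k z - f z) z" by (rule eabs_triangle)
      then show "eabs (\<phi> k) z \<le> eabs f z + eabs (\<lambda>z. f z - \<phi> k z) z" by (simp add: eabs_def norm_minus_commute)
    qed
    also have "\<dots> = (\<integral>\<^sup>+z. eabs f z \<partial>lebesgue) + (\<integral>\<^sup>+z. eabs (\<lambda>z. f z - \<phi> k z) z \<partial>lebesgue)"
      by (intro nn_integral_add) auto
    also have "(\<integral>\<^sup>+z. eabs (\<lambda>z. f z - \<phi> k z) z \<partial>lebesgue) \<le> ennreal ?V * Lp_norm p (\<lambda>z. f z - \<phi> k z)"
    proof (rule integral_le_Lp_cube[OF _ _ U(3)])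
      fix z assume "z \<notin> cube x R"
      then have "z \<notin> U" "z \<notin> supp (\<phi> k)" using U(2) \<phi>(2) by auto
      then show "eabs (\<lambda>z. f z - \<phi> k z) z = 0" using U(4) not_in_supp by (simp add: eabs_def)
    qed measurable
    also have "\<dots> \<le> ennreal ?V * ennreal (1 * (1/2) ^ k)" using \<phi>(3) by (rule mult_left_mono) simp
    finally show ?thesis by (simp add: ennreal_mult'[symmetric] add_left_mono)
  qed
  show ?thesis using ext_rapid[OF f \<phi>(1,3), of j]
  proof (eventually_elim, intro impI)
    fix y assume lim: "(\<lambda>k. T j (\<phi> k) y) \<longlonglongrightarrow> ext j f y" and y: "y \<in> A"
    let ?K = "ennreal (\<bar>c\<^sub>1\<bar> / d ^ CARD('n))"
    have "(\<lambda>k. ennreal (cmod (T j (\<phi> k) y))) \<longlonglongrightarrow> eabs (ext j f) y"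
      unfolding eabs_def by (intro tendsto_ennrealI tendsto_norm lim)
    moreover have "(\<lambda>k. ?K * ((\<integral>\<^sup>+z. eabs f z \<partial>lebesgue) + ennreal (?V * (1/2) ^ k)))
        \<longlonglongrightarrow> ?K * ((\<integral>\<^sup>+z. eabs f z \<partial>lebesgue) + ennreal 0)"
      by (intro ennreal_tendsto_cmult tendsto_add tendsto_ennrealI tendsto_const summable_LIMSEQ_zero summable_half) auto
    moreover have "ennreal (cmod (T j (\<phi> k) y)) \<le> ?K * ((\<integral>\<^sup>+z. eabs f z \<partial>lebesgue) + ennreal (?V * (1/2) ^ k))" for k
      using T_kernel_bound[OF \<phi>(1) d, of k y j] far[OF y] \<phi>(2)[of k] int[of k]
      by (meson mult_left_mono order_trans subsetD zero_le)
    ultimately have "eabs (ext j f) y \<le> ?K * ((\<integral>\<^sup>+z. eabs f z \<partial>lebesgue) + ennreal 0)"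
      by (intro LIMSEQ_le[of "\<lambda>k. ennreal (cmod (T j (\<phi> k) y))"]) auto
    then show "eabs (ext j f) y \<le> ?K * (\<integral>\<^sup>+z. eabs f z \<partial>lebesgue)" by simp
  qed
qed

text \<open>The first summand serves the innermost piece, where only boundedness on L_p is
  available. The second is what the distance 2^(k-1) s and the enlarged radius 2^(k+2) s leave over
  once the factor 2^(-kn/p) is split off.\<close>

definition K_loc :: ennreal where
  "K_loc = ennreal c\<^sub>2 + ennreal (\<bar>c\<^sub>1\<bar> * 2 powr (2 * real CARD('n) + 2 * real CARD('n) / P))"

lemma K_loc_finite: "K_loc < top" by (simp add: K_loc_def)

definition decay :: "nat \<Rightarrow> ennreal" where "decay k = K_loc * ennreal (2 powr (- real k * real CARD('n) / p))"

lemma local_estimate_far: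
  assumes f: "\<And>j. f j \<in> Lp_space p" and supp: "\<And>j z. z \<notin> annulus x s k \<Longrightarrow> f j z = 0" and s: "0 < s" and k: "k \<noteq> 0"
  shows "Lp_enorm_on p (cube x s) (lq_function q (\<lambda>j. ext j (f j))) \<le> decay k * Lp_enorm_on p UNIV (lq_function q f)"
proof -
  note [measurable] = Lp_space_measurable[OF f] ext_measurable[OF f]
  let ?n = "real CARD('n)"
  define d where "d = 2 ^ (k - 1) * s"
  define R where "R = 2 ^ (k + 2) * s"
  have d: "0 < d" using s by (simp add: d_def)
  have R: "0 \<le> R" using s by (simp add: R_def)
  \<comment> \<open>Approximation by test functions requires an open set around the annulus. Only
    the outer boundary is enlarged, to radius 2^(k+2) s; the inner cube stays excluded, so that the
    distance to the cube of radius s remains at least 2^k s - s >= 2^(k-1) s.\<close>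
  let ?U = "{z. \<forall>i. \<bar>z $ i - x $ i\<bar> < R} \<inter> - cube x (2 ^ k * s)"
  have U: "open ?U" using compact_imp_closed[OF compact_cube] by (intro open_Int open_cube_sets) auto
  have UR: "?U \<subseteq> cube x R" by (auto simp: cube_def less_imp_le)
  have fU: "f j z = 0" if "z \<notin> ?U" for j z
  proof (rule supp)
    have "(2::real) ^ (k + 1) * s < R" using s by (simp add: R_def)
    then have "annulus x s k \<subseteq> ?U" using k by (auto simp: annulus_def cube_def intro: le_less_trans)
    then show "z \<notin> annulus x s k" using that by blast
  qed
  have far: "d \<le> norm (y - z)" if y: "y \<in> cube x s" and z: "z \<in> ?U" for y z
  proof -
    obtain i where i: "2 ^ k * s < \<bar>z $ i - x $ i\<bar>" using z by (auto simp: cube_def not_le)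
    have "\<bar>y $ i - x $ i\<bar> \<le> s" using y by (simp add: cube_def)
    then have "2 ^ k * s - s \<le> \<bar>(y - z) $ i\<bar>" using i by (simp add: abs_if split: if_splits)
    moreover have "2 ^ k * s - s \<ge> d"
    proof -
      obtain l where l: "k = Suc l" using k by (cases k) auto
      have "1 * s \<le> 2 ^ l * s" using s by (intro mult_right_mono one_le_power) auto
      moreover have "d = 2 ^ l * s" "2 ^ k * s = 2 ^ l * s + 2 ^ l * s" by (simp_all add: d_def l)
      ultimately show ?thesis by linarith
    qed
    ultimately show ?thesis using component_le_norm_cart[of "y - z" i] by linarith
  qed
  let ?K = "ennreal (\<bar>c\<^sub>1\<bar> / d ^ CARD('n))"
  let ?I = "\<integral>\<^sup>+z. lq_function q f z \<partial>lebesgue"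
  have "AE y in lebesgue. \<forall>j. y \<in> cube x s \<longrightarrow> eabs (ext j (f j)) y \<le> ?K * (\<integral>\<^sup>+z. eabs (f j) z \<partial>lebesgue)"
    unfolding AE_all_countable using ext_kernel_bound[OF f U UR R fU d far] by blast
  then have "AE y in lebesgue. y \<in> cube x s \<longrightarrow> lq_function q (\<lambda>j. ext j (f j)) y \<le> ?K * ?I"
  proof (eventually_elim, intro impI)
    fix y assume *: "\<forall>j. y \<in> cube x s \<longrightarrow> eabs (ext j (f j)) y \<le> ?K * (\<integral>\<^sup>+z. eabs (f j) z \<partial>lebesgue)" and y: "y \<in> cube x s"
    have "lq_function q (\<lambda>j. ext j (f j)) y \<le> Lnorm (count_space UNIV) q (\<lambda>j. ?K * (\<integral>\<^sup>+z. eabs (f j) z \<partial>lebesgue))"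
      unfolding lq_function_eq using * y q_pos by (intro Lnorm_mono_AE) (auto simp: eabs_def)
    also have "\<dots> = ?K * Lnorm (count_space UNIV) q (\<lambda>j. \<integral>\<^sup>+z. eabs (f j) z \<partial>lebesgue)"
      using q_pos by (intro Lnorm_cmult) auto
    \<comment> \<open>Minkowski's integral inequality replaces the l_q norm of the integrals by the
      integral of the l_q norm; the kernel constant is the same for all j.\<close>
    also have "\<dots> \<le> ?K * (\<integral>\<^sup>+z. Lnorm (count_space UNIV) q (\<lambda>j. eabs (f j) z) \<partial>lebesgue)"
      using q_one by (intro mult_left_mono Lnorm_count_integral_le) auto
    finally show "lq_function q (\<lambda>j. ext j (f j)) y \<le> ?K * ?I" by (simp add: lq_function_eq eabs_def)
  qed
  then have "Lp_enorm_on p (cube x s) (lq_function q (\<lambda>j. ext j (f j))) \<le> Lp_enorm_on p (cube x s) (\<lambda>_. ?K * ?I)"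
    using pos by (intro Lp_mono_AE) auto
  also have "\<dots> = ?K * ?I * ennreal (((2 * s) ^ CARD('n)) powr (1/p))"
    using pos s by (simp add: Lp_const emeasure_cube_lborel)
  also have "\<dots> \<le> ?K * (ennreal (((2 * R) ^ CARD('n)) powr (1 / P)) * Lp_enorm_on p UNIV (lq_function q f)) * ennreal (((2 * s) ^ CARD('n)) powr (1/p))"
  proof (intro mult_right_mono mult_left_mono integral_le_Lp_cube R)
    fix z assume "z \<notin> cube x R"
    then have "f j z = 0" for j using UR fU by blast
    then show "lq_function q f z = 0" by (simp add: lq_function_def)
  qed auto
  also have "\<dots> = ennreal (\<bar>c\<^sub>1\<bar> / d ^ CARD('n) * ((2 * R) ^ CARD('n)) powr (1 / P) * ((2 * s) ^ CARD('n)) powr (1/p)) * Lp_enorm_on p UNIV (lq_function q f)"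
  proof -
    have "ennreal A * (ennreal B * X) * ennreal E = ennreal (A * B * E) * X" if "0 \<le> A" "0 \<le> B" "0 \<le> E" for A B E X
      using that by (simp add: ennreal_mult mult_ac)
    then show ?thesis using d by simp
  qed
  also have "\<bar>c\<^sub>1\<bar> / d ^ CARD('n) * ((2 * R) ^ CARD('n)) powr (1 / P) * ((2 * s) ^ CARD('n)) powr (1/p) =
      \<bar>c\<^sub>1\<bar> * 2 powr (2 * ?n + 2 * ?n / P) * 2 powr (- real k * ?n / p)"
  proof -
    \<comment> \<open>With s written as a power of 2 the identity becomes one between exponents that
      are linear in t, and t cancels because 1/p + 1/P = 1.\<close>
    define t where "t = log 2 s"
    have st: "s = 2 powr t" using s by (simp add: t_def)
    have e1: "d = 2 powr (real k - 1 + t)"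
      using k by (cases k) (auto simp: d_def st powr_add powr_realpow)
    have e2: "2 * R = 2 powr (real k + 3 + t)" by (simp add: R_def st powr_add powr_realpow)
    have e3: "2 * s = 2 powr (1 + t)" by (simp add: st powr_add)
    have iP: "1 / P = 1 - 1 / p" by (rule conj_inverse)
    have "1 / d ^ CARD('n) * ((2 * R) ^ CARD('n)) powr (1 / P) * ((2 * s) ^ CARD('n)) powr (1/p)
        = 2 powr (- (?n * (real k - 1 + t))) * 2 powr (?n * (real k + 3 + t) * (1 / P)) * 2 powr (?n * (1 + t) * (1 / p))"
      unfolding e1 e2 e3 power_cube_eq powr_powr by (simp only: powr_minus divide_inverse mult_1)
    also have "\<dots> = 2 powr (- (?n * (real k - 1 + t)) + ?n * (real k + 3 + t) * (1 / P) + ?n * (1 + t) * (1 / p))"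
      by (simp only: powr_add)
    also have "- (?n * (real k - 1 + t)) + ?n * (real k + 3 + t) * (1 / P) + ?n * (1 + t) * (1 / p)
        = (2 * ?n + 2 * ?n / P) + (- real k * ?n / p)"
    proof -
      have e: "2 * ?n / P = 2 * ?n * (1 - 1 / p)" unfolding iP[symmetric] by simp
      show ?thesis unfolding e iP by (simp add: algebra_simps)
    qed
    also have "2 powr \<dots> = 2 powr (2 * ?n + 2 * ?n / P) * 2 powr (- real k * ?n / p)" by (rule powr_add)
    finally have *: "1 / d ^ CARD('n) * ((2 * R) ^ CARD('n)) powr (1 / P) * ((2 * s) ^ CARD('n)) powr (1/p)
        = 2 powr (2 * ?n + 2 * ?n / P) * 2 powr (- real k * ?n / p)" .
    have gen: "c / d * X * Y = c * (1 / d * X * Y)" for c d X Y :: real by simp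
    show ?thesis unfolding gen[of "\<bar>c\<^sub>1\<bar>"] * by (rule mult.assoc[symmetric])
  qed
  also have "ennreal (\<bar>c\<^sub>1\<bar> * 2 powr (2 * ?n + 2 * ?n / P) * 2 powr (- real k * ?n / p)) \<le> decay k"
    unfolding decay_def K_loc_def by (subst ennreal_mult') (auto intro!: mult_right_mono)
  finally show ?thesis by (simp add: mult_right_mono)
qed

lemma local_estimate:
  assumes f: "\<And>j. f j \<in> Lp_space p" and supp: "\<And>j z. z \<notin> annulus x s k \<Longrightarrow> f j z = 0" and s: "0 < s"
  shows "Lp_enorm_on p (cube x s) (lq_function q (\<lambda>j. ext j (f j))) \<le> decay k * Lp_enorm_on p UNIV (lq_function q f)"
proof (cases "k = 0")
  case True
  have "Lp_enorm_on p (cube x s) (lq_function q (\<lambda>j. ext j (f j))) \<le> Lp_enorm_on p UNIV (lq_function q (\<lambda>j. ext j (f j)))"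
    using pos by (rule Lp_le_UNIV)
  also have "\<dots> \<le> ennreal c\<^sub>2 * Lp_enorm_on p UNIV (lq_function q f)" using f by (rule ext_Lp)
  also have "\<dots> \<le> decay k * Lp_enorm_on p UNIV (lq_function q f)"
    using True by (intro mult_right_mono) (auto simp: decay_def K_loc_def)
  finally show ?thesis .
next
  case False then show ?thesis using local_estimate_far assms by blast
qed

lemma indicator_Lp_space:
  assumes "f \<in> Lp_space p" "A \<in> sets lebesgue" shows "(\<lambda>x. indicator A x * f x) \<in> Lp_space p"
  using assms pos by (intro Lp_space_dominated[OF pos _ assms(1)]) (auto simp: indicator_def Lp_space_measurable intro!: borel_measurable_times borel_measurable_indicator)

text \<open>Applying \<open>ext_diff\<close> to f + g and g gives |ext (f + g)| <= |ext f| + |ext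
  g|, a substitute for linearity that is enough for absolute values.\<close>

lemma ext_sum_le:
  assumes "\<And>k. k \<in> A \<Longrightarrow> f k \<in> Lp_space p" "finite A"
  shows "AE x in lebesgue. cmod (ext j (\<lambda>x. \<Sum>k\<in>A. f k x) x) \<le> (\<Sum>k\<in>A. cmod (ext j (f k) x))"
  using assms(2,1)
proof (induction A rule: finite_induct)
  case empty then show ?case using ext_zero[of j] by simp
next
  case (insert a A)
  have S: "(\<lambda>x. \<Sum>k\<in>A. f k x) \<in> Lp_space p" if "\<And>k. k \<in> A \<Longrightarrow> f k \<in> Lp_space p"
    using insert.hyps(1) that by (induction A rule: finite_induct) (auto intro: Lp_space_add[OF one_less])
  have SA: "(\<lambda>x. \<Sum>k\<in>A. f k x) \<in> Lp_space p" and fa: "f a \<in> Lp_space p" using insert.prems S by auto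
  have e: "(\<lambda>x. \<Sum>k\<in>insert a A. f k x) = (\<lambda>x. f a x + (\<Sum>k\<in>A. f k x))" using insert.hyps by simp
  have "AE x in lebesgue. cmod (ext j (f a) x) \<ge> cmod (ext j (\<lambda>x. f a x + (\<Sum>k\<in>A. f k x)) x - ext j (\<lambda>x. \<Sum>k\<in>A. f k x) x)"
    using ext_diff[OF Lp_space_add[OF one_less fa SA] SA, of j] by simp
  moreover have "AE x in lebesgue. cmod (ext j (\<lambda>x. \<Sum>k\<in>A. f k x) x) \<le> (\<Sum>k\<in>A. cmod (ext j (f k) x))"
    using insert.IH insert.prems by simp
  ultimately show ?case unfolding e
  proof eventually_elim
    case (elim x)
    then show ?case using insert.hyps norm_triangle_ineq2[of "ext j (\<lambda>x. f a x + (\<Sum>k\<in>A. f k x)) x" "ext j (\<lambda>x. \<Sum>k\<in>A. f k x) x"]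
      by simp
  qed
qed

text \<open>Write a = n/p + r. The k-th annulus around a cube of level J fits into a dyadic cube of
  level J - k - 2, and the quotient of the Morrey weights is 2^((k+2)a). The local decay 2^(-kn/p)
  reduces this to 2^(2a) 2^(kr).\<close>

definition C_morrey :: ennreal where
  "C_morrey = (\<Sum>k. K_loc * ennreal (2 powr (2 * (real CARD('n) / p + r)) * (2 powr r) ^ k))"

lemma C_morrey_finite: "C_morrey < top"
proof -
  have "2 powr r < 2 powr 0" using r_neg by (intro powr_less_mono) auto
  then have "summable (\<lambda>k. 2 powr (2 * (real CARD('n) / p + r)) * (2 powr r) ^ k)"
    by (intro summable_mult summable_geometric) simp
  then show ?thesis using K_loc_finite by (simp add: C_morrey_def suminf_ennreal2 ennreal_mult_less_top)
qed

lemma ext_morrey: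
  assumes f: "\<And>j. f j \<in> Lp_space p" and supp: "\<And>j. \<exists>R. \<forall>z. z \<notin> cube 0 R \<longrightarrow> f j z = 0"
  shows "morrey_enorm r p (lq_function q (\<lambda>j. ext j (f j))) \<le> C_morrey * morrey_enorm r p (lq_function q f)"
proof (rule morrey_enorm_leI)
  fix J and M :: "int ^ 'n"
  define s where "s = 2 powr (- real_of_int J)"
  define x :: "real ^ 'n" where "x = s *\<^sub>R (\<chi> i. real_of_int (M $ i))"
  have s: "0 < s" by (simp add: s_def)
  have Q: "dyadic_cube J M = cube x s" by (simp add: dyadic_cube_eq x_def s_def)
  let ?a = "real CARD('n) / p + r"
  note [measurable] = Lp_space_measurable[OF f] ext_measurable[OF f]
  define g where "g k j z = indicator (annulus x s k) z * f j z" for k j z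
  have g: "g k j \<in> Lp_space p" for k j unfolding g_def[abs_def] using f by (intro indicator_Lp_space) auto
  note [measurable] = Lp_space_measurable[OF g] ext_measurable[OF g]
  have "AE z in lebesgue. eabs (ext j (f j)) z \<le> (\<Sum>k. eabs (ext j (g k j)) z)" for j
  proof -
    obtain R where R: "\<And>z. z \<notin> cube 0 R \<Longrightarrow> f j z = 0" using supp by blast
    obtain m :: nat where m: "(R + norm x) / s < 2 ^ m" using real_arch_pow[of 2] by auto
    have "f j z = 0" if z: "z \<notin> cube x (2 ^ (m + 1) * s)" for z
    proof (rule R)
      obtain i where i: "2 ^ (m + 1) * s < \<bar>z $ i - x $ i\<bar>" using z by (auto simp: cube_def not_le)
      have "R + norm x < 2 ^ m * s" using m s by (simp add: divide_less_eq)
      moreover have "2 ^ m * s \<le> 2 ^ (m + 1) * s" using s by simp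
      ultimately have "R < \<bar>z $ i\<bar>" using i component_le_norm_cart[of x i] by linarith
      then show "z \<notin> cube 0 R" by (auto simp: cube_def not_le)
    qed
    then have e: "f j = (\<lambda>z. \<Sum>k\<le>m. g k j z)" unfolding g_def by (intro ext annulus_sum[OF s, symmetric]) auto
    have "AE z in lebesgue. cmod (ext j (\<lambda>z. \<Sum>k\<le>m. g k j z) z) \<le> (\<Sum>k\<le>m. cmod (ext j (g k j) z))"
      by (rule ext_sum_le) (use g in auto)
    then show ?thesis unfolding e[symmetric]
    proof eventually_elim
      case (elim z)
      have "eabs (ext j (f j)) z \<le> ennreal (\<Sum>k\<le>m. cmod (ext j (g k j) z))"
        unfolding eabs_def using elim by (rule ennreal_leI)
      also have "\<dots> = (\<Sum>k\<le>m. eabs (ext j (g k j)) z)" by (simp add: eabs_def)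
      also have "\<dots> \<le> (\<Sum>k. eabs (ext j (g k j)) z)" by (intro sum_le_suminf) auto
      finally show ?case .
    qed
  qed
  then have "AE z in lebesgue. \<forall>j. eabs (ext j (f j)) z \<le> (\<Sum>k. eabs (ext j (g k j)) z)"
    unfolding AE_all_countable by blast
  then have "AE z in lebesgue. lq_function q (\<lambda>j. ext j (f j)) z \<le> (\<Sum>k. lq_function q (\<lambda>j. ext j (g k j)) z)"
    by eventually_elim (auto simp: eabs_def intro!: lq_suminf q_one)
  then have "Lp_enorm_on p (cube x s) (lq_function q (\<lambda>j. ext j (f j))) \<le> Lp_enorm_on p (cube x s) (\<lambda>z. \<Sum>k. lq_function q (\<lambda>j. ext j (g k j)) z)"
    using pos by (intro Lp_mono_AE) auto
  also have "\<dots> \<le> (\<Sum>k. Lp_enorm_on p (cube x s) (lq_function q (\<lambda>j. ext j (g k j))))"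
    using one_less by (intro Lp_suminf) auto
  finally have 1: "Lp_enorm_on p (cube x s) (lq_function q (\<lambda>j. ext j (f j))) \<le> (\<Sum>k. Lp_enorm_on p (cube x s) (lq_function q (\<lambda>j. ext j (g k j))))" .
  have 2: "ennreal (2 powr (real_of_int J * ?a)) * Lp_enorm_on p (cube x s) (lq_function q (\<lambda>j. ext j (g k j)))
      \<le> K_loc * ennreal (2 powr (2 * ?a) * (2 powr r) ^ k) * morrey_enorm r p (lq_function q f)" for k
  proof -
    have "Lp_enorm_on p (cube x s) (lq_function q (\<lambda>j. ext j (g k j))) \<le> decay k * Lp_enorm_on p UNIV (lq_function q (g k))"
      by (rule local_estimate[OF g _ s]) (simp add: g_def)
    also have "Lp_enorm_on p UNIV (lq_function q (g k)) \<le> Lp_enorm_on p (cube x (2 ^ (k + 1) * s)) (lq_function q f)"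
    proof -
      have "lq_function q (g k) z \<le> lq_function q f z * indicator (cube x (2 ^ (k + 1) * s)) z" for z
      proof (cases "z \<in> annulus x s k")
        case True
        then have "z \<in> cube x (2 ^ (k + 1) * s)" using annulus_subset_cube by blast
        then show ?thesis using q_pos by (auto intro!: lq_mono simp: g_def indicator_def)
      next
        case False then show ?thesis by (simp add: g_def[abs_def] lq_function_def)
      qed
      then have "Lp_enorm_on p UNIV (lq_function q (g k)) \<le> Lp_enorm_on p UNIV (\<lambda>z. lq_function q f z * indicator (cube x (2 ^ (k + 1) * s)) z)"
        using pos by (intro Lp_mono)
      then show ?thesis by (simp add: Lp_enorm_on_indicator)
    qed
    also have "\<dots> \<le> ennreal (2 powr (- real_of_int (J - int k - 2) * ?a)) * morrey_enorm r p (lq_function q f)"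
    proof (rule Lp_cube_le_morrey[OF pos])
      have "2 powr (real k + 2 + (- real_of_int J)) = 2 powr real k * 2 powr 2 * 2 powr (- real_of_int J)"
        by (simp only: powr_add)
      then have "2 * (2 ^ (k + 1) * s) = 2 powr (real k + 2 + (- real_of_int J))" by (simp add: s_def powr_realpow)
      then show "2 * (2 ^ (k + 1) * s) \<le> 2 powr (- real_of_int (J - int k - 2))" by (simp add: algebra_simps)
    qed
    finally have "ennreal (2 powr (real_of_int J * ?a)) * Lp_enorm_on p (cube x s) (lq_function q (\<lambda>j. ext j (g k j)))
        \<le> ennreal (2 powr (real_of_int J * ?a)) * (decay k * (ennreal (2 powr (- real_of_int (J - int k - 2) * ?a)) * morrey_enorm r p (lq_function q f)))"
      by (meson mult_left_mono order_trans zero_le)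
    also have "\<dots> = K_loc * ennreal (2 powr (real_of_int J * ?a) * 2 powr (- real k * real CARD('n) / p) * 2 powr (- real_of_int (J - int k - 2) * ?a)) * morrey_enorm r p (lq_function q f)"
      by (simp add: decay_def ennreal_mult' mult_ac)
    also have "2 powr (real_of_int J * ?a) * 2 powr (- real k * real CARD('n) / p) * 2 powr (- real_of_int (J - int k - 2) * ?a)
        = 2 powr (real_of_int J * ?a + - real k * real CARD('n) / p + - real_of_int (J - int k - 2) * ?a)"
      by (simp only: powr_add)
    also have "real_of_int J * ?a + - real k * real CARD('n) / p + - real_of_int (J - int k - 2) * ?a = 2 * ?a + real k * r"
      by (simp add: algebra_simps)
    also have "2 powr (2 * ?a + real k * r) = 2 powr (2 * ?a) * (2 powr r) ^ k"
      by (simp only: powr_add power_cube_eq)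
    finally show ?thesis .
  qed
  have "ennreal (2 powr (real_of_int J * ?a)) * Lp_enorm_on p (cube x s) (lq_function q (\<lambda>j. ext j (f j)))
      \<le> (\<Sum>k. ennreal (2 powr (real_of_int J * ?a)) * Lp_enorm_on p (cube x s) (lq_function q (\<lambda>j. ext j (g k j))))"
    using mult_left_mono[OF 1, of "ennreal (2 powr (real_of_int J * ?a))"] by simp
  also have "\<dots> \<le> (\<Sum>k. K_loc * ennreal (2 powr (2 * ?a) * (2 powr r) ^ k) * morrey_enorm r p (lq_function q f))"
    by (intro suminf_le 2) auto
  also have "\<dots> = C_morrey * morrey_enorm r p (lq_function q f)" unfolding C_morrey_def by (rule ennreal_suminf_multc)
  finally show "ennreal (2 powr (real_of_int J * ?a)) * Lp_enorm_on p (dyadic_cube J M) (lq_function q (\<lambda>j. ext j (f j)))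
      \<le> C_morrey * morrey_enorm r p (lq_function q f)" unfolding Q .
qed

end

subsection \<open>Extension of the operators to Morrey spaces\<close>

lemma morrey_measurable: "f \<in> morrey r p \<Longrightarrow> f \<in> borel_measurable lebesgue"
  by (simp add: morrey_def Lp_loc_def)

lemma morrey_finite: "f \<in> morrey r p \<Longrightarrow> morrey_enorm r p (eabs f) < top"
  by (simp add: morrey_def)

lemma morrey_lincomb_le:
  fixes f g :: "('n::finite) cfun"
  assumes p: "1 < p" and [measurable]: "f \<in> borel_measurable lebesgue" "g \<in> borel_measurable lebesgue"
  shows "morrey_enorm r p (eabs (\<lambda>x. a * f x + b * g x))
      \<le> ennreal (cmod a) * morrey_enorm r p (eabs f) + ennreal (cmod b) * morrey_enorm r p (eabs g)"
proof -
  have "morrey_enorm r p (eabs (\<lambda>x. a * f x + b * g x))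
      \<le> morrey_enorm r p (\<lambda>x. ennreal (cmod a) * eabs f x + ennreal (cmod b) * eabs g x)"
  proof (rule morrey_mono)
    fix x show "eabs (\<lambda>x. a * f x + b * g x) x \<le> ennreal (cmod a) * eabs f x + ennreal (cmod b) * eabs g x"
      using eabs_triangle[of "\<lambda>x. a * f x" "\<lambda>x. b * g x" x] by (simp add: eabs_def norm_mult ennreal_mult')
  qed (use p in simp)
  also have "\<dots> \<le> morrey_enorm r p (\<lambda>x. ennreal (cmod a) * eabs f x) + morrey_enorm r p (\<lambda>x. ennreal (cmod b) * eabs g x)"
    using p by (intro morrey_add) auto
  also have "\<dots> \<le> ennreal (cmod a) * morrey_enorm r p (eabs f) + ennreal (cmod b) * morrey_enorm r p (eabs g)"
    using p by (intro add_mono morrey_cmult_le) auto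
  finally show ?thesis .
qed

lemma morrey_lincomb:
  assumes "1 < p" "f \<in> morrey r p" "g \<in> morrey r p" shows "(\<lambda>x. a * f x + b * g x) \<in> morrey r p"
proof -
  note [measurable] = assms(2,3)[THEN morrey_measurable]
  have "ennreal (cmod a) * morrey_enorm r p (eabs f) + ennreal (cmod b) * morrey_enorm r p (eabs g) < top"
    using assms(2,3)[THEN morrey_finite] by (simp add: ennreal_mult_less_top)
  then show ?thesis
    using morrey_lincomb_le[of p f g r a b] assms(1) by (auto simp: morrey_iff intro: le_less_trans)
qed

lemma morrey_diff: "1 < p \<Longrightarrow> f \<in> morrey r p \<Longrightarrow> g \<in> morrey r p \<Longrightarrow> (\<lambda>x. f x - g x) \<in> morrey r p"
  using morrey_lincomb[of p f r g 1 "-1"] by simp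

lemma morrey_triangle:
  fixes f g h :: "('n::finite) cfun"
  assumes "1 < p" "f \<in> borel_measurable lebesgue" "g \<in> borel_measurable lebesgue" "h \<in> borel_measurable lebesgue"
  shows "morrey_enorm r p (eabs (\<lambda>x. f x - h x)) \<le> morrey_enorm r p (eabs (\<lambda>x. f x - g x)) + morrey_enorm r p (eabs (\<lambda>x. g x - h x))"
  using morrey_lincomb_le[of p "\<lambda>x. f x - g x" "\<lambda>x. g x - h x" r 1 1] assms by simp

lemma eabs_minus_commute: "eabs (\<lambda>x. f x - g x) = eabs (\<lambda>x. g x - f x)"
  by (simp add: eabs_def fun_eq_iff norm_minus_commute)

lemma morrey_diff_eq_0D:
  fixes f g :: "('n::finite) cfun"
  assumes "1 < p" and [measurable]: "f \<in> borel_measurable lebesgue" "g \<in> borel_measurable lebesgue"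
    and "\<And>e. 0 < e \<Longrightarrow> morrey_enorm r p (eabs (\<lambda>x. f x - g x)) \<le> ennreal e"
  shows "f =ae g"
proof -
  have "morrey_enorm r p (eabs (\<lambda>x. f x - g x)) \<le> 0"
    by (rule ennreal_le_epsilon) (use assms(4) in simp)
  then have "morrey_enorm r p (eabs (\<lambda>x. f x - g x)) = 0" by simp
  then have "AE x in lebesgue. eabs (\<lambda>x. f x - g x) x = 0"
    using assms(1) by (subst (asm) morrey_eq_0_iff) auto
  then show ?thesis by eventually_elim (simp add: eabs_def)
qed

lemma morrey0_closed:
  fixes f :: "('n::finite) cfun"
  assumes p: "1 < p" and f: "f \<in> morrey r p"
    and approx: "\<And>e. 0 < e \<Longrightarrow> \<exists>g\<in>morrey0 r p. morrey_enorm r p (eabs (\<lambda>x. f x - g x)) < ennreal e"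
  shows "f \<in> morrey0 r p"
  unfolding morrey0_def
proof (intro CollectI conjI allI impI f)
  fix e :: real assume e: "0 < e"
  obtain g where g: "g \<in> morrey0 r p" "morrey_enorm r p (eabs (\<lambda>x. f x - g x)) < ennreal (e/2)"
    using approx[of "e/2"] e by auto
  obtain \<phi> where \<phi>: "\<phi> \<in> test_functions" "morrey_enorm r p (eabs (\<lambda>x. g x - \<phi> x)) < ennreal (e/2)"
    using g(1) e by (auto simp: morrey0_def dest!: spec[of _ "e/2"])
  have "morrey_enorm r p (eabs (\<lambda>x. f x - \<phi> x)) \<le> morrey_enorm r p (eabs (\<lambda>x. f x - g x)) + morrey_enorm r p (eabs (\<lambda>x. g x - \<phi> x))"
    using p f g(1) \<phi>(1) by (intro morrey_triangle) (auto simp: morrey0_def morrey_measurable test_measurable)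
  also have "\<dots> < ennreal (e/2) + ennreal (e/2)" using g(2) \<phi>(2) by (rule add_strict_mono)
  also have "\<dots> = ennreal e" using e by (simp add: ennreal_plus[symmetric] del: ennreal_plus)
  finally show "\<exists>\<phi>\<in>test_functions. morrey_enorm r p (eabs (\<lambda>x. f x - \<phi> x)) < ennreal e" using \<phi>(1) by blast
qed

lemma morrey0_subset: "morrey0 r p \<subseteq> morrey r p"
  by (auto simp: morrey0_def)

lemma morrey0_approx:
  assumes "f \<in> morrey0 r p" "0 < e"
  obtains \<phi> where "\<phi> \<in> test_functions" "morrey_enorm r p (eabs (\<lambda>x. f x - \<phi> x)) < ennreal e"
  using assms by (auto simp: morrey0_def)

lemma ennreal_mult_less_epsilon:
  assumes "C < top" "0 < e"
  obtains d :: real where "0 < d" "\<And>x. x < ennreal d \<Longrightarrow> C * x < ennreal e"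
proof -
  obtain c where c: "C = ennreal c" "0 \<le> c" using assms(1) by (cases C) auto
  have "C * x < ennreal e" if x: "x < ennreal (e / (c + 1))" for x
  proof -
    have "C * x \<le> ennreal c * ennreal (e / (c + 1))" unfolding c using x by (intro mult_left_mono) auto
    also have "\<dots> = ennreal (c * (e / (c + 1)))" using c assms by (simp add: ennreal_mult'[symmetric])
    also have "\<dots> < ennreal e" using c assms by (intro ennreal_lessI) (auto simp: field_simps)
    finally show ?thesis .
  qed
  then show ?thesis using that[of "e / (c + 1)"] c assms by auto
qed

context cz_family
begin

definition trunc :: "nat \<Rightarrow> 'n cfun \<Rightarrow> 'n cfun" where
  "trunc m f = (\<lambda>x. indicator (cube 0 (2 ^ m)) x * f x)"

text \<open>The pointwise limit gives a meaning to the operator also on functions that are not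
  limits of test functions in the Morrey norm.\<close>

definition Te :: "nat \<Rightarrow> 'n cfun \<Rightarrow> 'n cfun" where
  "Te j f = (\<lambda>x. lim (\<lambda>m. ext j (trunc m f) x))"

lemma trunc_Lp_space:
  assumes f: "f \<in> morrey r p" shows "trunc m f \<in> Lp_space p"
proof -
  have "eabs (trunc m f) = (\<lambda>x. eabs f x * indicator (cube 0 (2 ^ m)) x)"
    by (auto simp: trunc_def eabs_def indicator_def fun_eq_iff)
  then have "Lp_norm p (trunc m f) = Lp_enorm_on p (cube 0 (2 ^ m)) (eabs f)" by (simp add: Lp_enorm_on_indicator)
  also have "\<dots> < top" using f by (intro Lp_cube_finite pos morrey_finite)
  finally show ?thesis
    using morrey_measurable[OF f]
    by (auto simp: Lp_space_def trunc_def intro!: borel_measurable_times borel_measurable_indicator)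
qed

lemma local_estimate_single:
  assumes f: "f \<in> Lp_space p" and supp: "\<And>z. z \<notin> annulus x s k \<Longrightarrow> f z = 0" and s: "0 < s"
  shows "Lp_enorm_on p (cube x s) (eabs (ext j f)) \<le> decay k * Lp_norm p f"
proof -
  let ?f = "\<lambda>i. if i = j then f else (\<lambda>x. 0)"
  have "Lp_enorm_on p (cube x s) (eabs (ext j f)) \<le> Lp_enorm_on p (cube x s) (lq_function q (\<lambda>i. ext i (?f i)))"
  proof (rule Lp_mono[OF pos])
    fix z show "eabs (ext j f) z \<le> lq_function q (\<lambda>i. ext i (?f i)) z"
      using lq_ge[OF q_pos, of "\<lambda>i. ext i (?f i)" j z] by (simp add: eabs_def)
  qed
  also have "\<dots> \<le> decay k * Lp_enorm_on p UNIV (lq_function q ?f)"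
    by (rule local_estimate[OF _ _ s]) (use f supp in auto)
  finally show ?thesis by (simp add: lq_single_function[OF q_pos])
qed

lemma ext_trunc_convergent:
  assumes f: "f \<in> morrey r p" shows "AE x in lebesgue. convergent (\<lambda>m. ext j (trunc m f) x)"
proof (rule AE_cubesI)
  fix i :: nat
  let ?A = "cube (0 :: real ^ 'n) (2 ^ i)" and ?n = "real CARD('n)"
  \<comment> \<open>After the shift by i + 1, consecutive truncations differ by f on exactly the
    annulus of index m + 1 around the cube of radius 2^i. The local estimate then gives differences
    of order (2^r)^m in L_p of that cube, which are summable.\<close>
  define H where "H m = ext j (trunc (m + i + 1) f)" for m
  have [measurable]: "H m \<in> borel_measurable lebesgue" for m unfolding H_def using f by (intro ext_measurable trunc_Lp_space)
  obtain N where N: "morrey_enorm r p (eabs f) = ennreal N" "0 \<le> N"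
    using morrey_finite[OF f] by (cases "morrey_enorm r p (eabs f)") auto
  have "Lp_enorm_on p ?A (eabs (\<lambda>x. H (Suc m) x - H m x))
      \<le> K_loc * ennreal (2 powr ((real i + 2) * ?n / p + (real i + 3) * r) * N * (2 powr r) ^ m)" for m
  proof -
    define u where "u x = trunc (m + i + 2) f x - trunc (m + i + 1) f x" for x
    have u: "u \<in> Lp_space p" unfolding u_def[abs_def] using f by (intro Lp_space_diff one_less trunc_Lp_space)
    have an: "annulus (0 :: real ^ 'n) (2 ^ i) (m + 1) = cube 0 (2 ^ (m + i + 2)) - cube 0 (2 ^ (m + i + 1))"
      by (simp add: annulus_def power_add mult_ac)
    have ind: "u z = indicator (annulus 0 (2 ^ i) (m + 1)) z * f z" for z
    proof -
      have "cube (0 :: real ^ 'n) (2 ^ (m + i + 1)) \<subseteq> cube 0 (2 ^ (m + i + 2))" by (intro cube_mono power_increasing) auto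
      then show ?thesis unfolding an by (auto simp: u_def trunc_def indicator_def)
    qed
    have "AE x in lebesgue. eabs (\<lambda>x. H (Suc m) x - H m x) x \<le> eabs (ext j u) x"
      using ext_diff[OF trunc_Lp_space[OF f] trunc_Lp_space[OF f], of j "m + i + 2" "m + i + 1"]
      unfolding u_def[symmetric] H_def by eventually_elim (simp add: eabs_def ennreal_leI)
    then have "Lp_enorm_on p ?A (eabs (\<lambda>x. H (Suc m) x - H m x)) \<le> Lp_enorm_on p ?A (eabs (ext j u))"
      using pos by (intro Lp_mono_AE) auto
    also have "\<dots> \<le> decay (m + 1) * Lp_norm p u" by (rule local_estimate_single[OF u]) (auto simp: ind)
    finally have 1: "Lp_enorm_on p ?A (eabs (\<lambda>x. H (Suc m) x - H m x)) \<le> decay (m + 1) * Lp_norm p u" .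
    have "Lp_norm p u \<le> Lp_enorm_on p UNIV (\<lambda>x. eabs f x * indicator (cube 0 (2 ^ (m + i + 2))) x)"
      unfolding eabs_def ind an by (intro Lp_mono pos) (simp add: indicator_def)
    also have "\<dots> = Lp_enorm_on p (cube 0 (2 ^ (m + i + 2))) (eabs f)" by (rule Lp_enorm_on_indicator)
    also have "\<dots> \<le> ennreal (2 powr (- real_of_int (- int (m + i + 3)) * (?n / p + r))) * morrey_enorm r p (eabs f)"
    proof (rule Lp_cube_le_morrey[OF pos])
      have "(2::real) powr (- real_of_int (- int (m + i + 3))) = 2 powr real (m + i + 3)"
        by (simp only: of_int_minus of_int_of_nat_eq minus_minus)
      also have "\<dots> = 2 ^ (m + i + 3)" by (rule powr_realpow) simp
      also have "\<dots> = 2 * 2 ^ (m + i + 2)" by (simp add: power_add)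
      finally show "2 * 2 ^ (m + i + 2) \<le> (2::real) powr (- real_of_int (- int (m + i + 3)))" by (simp only: order_refl)
    qed
    finally have 2: "Lp_norm p u \<le> ennreal (2 powr (real (m + i + 3) * (?n / p + r))) * ennreal N"
      unfolding N by (simp only: of_int_minus of_int_of_nat_eq minus_minus)
    have "2 powr (- real (m + 1) * ?n / p) * 2 powr (real (m + i + 3) * (?n / p + r))
        = 2 powr (- real (m + 1) * ?n / p + real (m + i + 3) * (?n / p + r))" by (rule powr_add[symmetric])
    also have "- real (m + 1) * ?n / p + real (m + i + 3) * (?n / p + r)
        = ((real i + 2) * ?n / p + (real i + 3) * r) + real m * r"
    proof -
      define c where "c = ?n / p"
      have "- real (m + 1) * ?n / p = - real (m + 1) * c" "(real i + 2) * ?n / p = (real i + 2) * c" by (simp_all add: c_def)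
      then show ?thesis unfolding c_def[symmetric] by (simp add: algebra_simps)
    qed
    also have "2 powr \<dots> = 2 powr ((real i + 2) * ?n / p + (real i + 3) * r) * (2 powr r) ^ m"
      by (simp only: powr_add power_cube_eq)
    finally have 3: "2 powr (- real (m + 1) * ?n / p) * 2 powr (real (m + i + 3) * (?n / p + r))
        = 2 powr ((real i + 2) * ?n / p + (real i + 3) * r) * (2 powr r) ^ m" .
    have "decay (m + 1) * (ennreal (2 powr (real (m + i + 3) * (?n / p + r))) * ennreal N)
        = K_loc * ennreal (2 powr (- real (m + 1) * ?n / p) * 2 powr (real (m + i + 3) * (?n / p + r)) * N)"
      unfolding decay_def using N(2) by (simp add: ennreal_mult mult.assoc)
    also have "\<dots> = K_loc * ennreal (2 powr ((real i + 2) * ?n / p + (real i + 3) * r) * N * (2 powr r) ^ m)"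
      unfolding 3 by (simp only: mult_ac)
    finally show ?thesis using order_trans[OF 1 mult_left_mono[OF 2]] by simp
  qed
  then have "(\<Sum>m. Lp_enorm_on p ?A (eabs (\<lambda>x. H (Suc m) x - H m x)))
      \<le> (\<Sum>m. K_loc * ennreal (2 powr ((real i + 2) * ?n / p + (real i + 3) * r) * N * (2 powr r) ^ m))"
    by (intro suminf_le) auto
  also have "\<dots> < top"
  proof -
    have "2 powr r < 2 powr 0" using r_neg by (intro powr_less_mono) auto
    then have "summable (\<lambda>m. 2 powr ((real i + 2) * ?n / p + (real i + 3) * r) * N * (2 powr r) ^ m)"
      by (intro summable_mult summable_geometric) simp
    then show ?thesis using K_loc_finite N(2) by (simp add: suminf_ennreal2 ennreal_mult_less_top)
  qed
  finally have "AE x in lebesgue. x \<in> ?A \<longrightarrow> convergent (\<lambda>m. H m x)"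
    by (intro AE_convergent_if_rapid[OF one_less]) auto
  then show "AE x in lebesgue. x \<in> ?A \<longrightarrow> convergent (\<lambda>m. ext j (trunc m f) x)"
  proof eventually_elim
    case (elim x)
    then show ?case unfolding H_def
      using convergent_ignore_initial_segment[of "\<lambda>m. ext j (trunc m f) x" "i + 1"] by (simp add: add.assoc)
  qed
qed

lemma Te_limit:
  assumes "f \<in> morrey r p" shows "AE x in lebesgue. (\<lambda>m. ext j (trunc m f) x) \<longlonglongrightarrow> Te j f x"
  using ext_trunc_convergent[OF assms, of j] by eventually_elim (simp add: Te_def convergent_LIMSEQ_iff)

lemma Te_measurable [measurable]:
  assumes "f \<in> morrey r p" shows "Te j f \<in> borel_measurable lebesgue"
  unfolding Te_def using assms by (intro borel_measurable_lim_metric ext_measurable trunc_Lp_space)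

text \<open>The estimate for truncations has a constant independent of m, and the Morrey norm is
  lower semicontinuous under almost everywhere convergence.\<close>

lemma Te_lq_le:
  assumes f: "\<And>j. f j \<in> morrey r p"
  shows "morrey_enorm r p (lq_function q (\<lambda>j. Te j (f j))) \<le> C_morrey * morrey_enorm r p (lq_function q f)"
proof (rule morrey_Fatou[OF pos])
  have "AE x in lebesgue. \<forall>j. (\<lambda>m. ext j (trunc m (f j)) x) \<longlonglongrightarrow> Te j (f j) x"
    unfolding AE_all_countable using f Te_limit by blast
  then show "AE x in lebesgue. lq_function q (\<lambda>j. Te j (f j)) x \<le> liminf (\<lambda>m. lq_function q (\<lambda>j. ext j (trunc m (f j))) x)"
    by eventually_elim (auto intro: lq_Fatou q_pos)
  show "morrey_enorm r p (lq_function q (\<lambda>j. ext j (trunc m (f j)))) \<le> C_morrey * morrey_enorm r p (lq_function q f)" for m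
  proof -
    have "morrey_enorm r p (lq_function q (\<lambda>j. ext j (trunc m (f j)))) \<le> C_morrey * morrey_enorm r p (lq_function q (\<lambda>j. trunc m (f j)))"
      by (rule ext_morrey) (auto simp: trunc_def[of _ "f _"] intro: f trunc_Lp_space[unfolded trunc_def] intro!: exI[of _ "2 ^ m"])
    also have "\<dots> \<le> C_morrey * morrey_enorm r p (lq_function q f)"
      using q_pos by (intro mult_left_mono morrey_mono pos lq_mono) (auto simp: trunc_def indicator_def)
    finally show ?thesis .
  qed
  show "lq_function q (\<lambda>j. ext j (trunc m (f j))) \<in> borel_measurable lebesgue" for m
    using f by (intro measurable_lq_function ext_measurable trunc_Lp_space)
qed

lemma Te_diff:
  assumes f: "f \<in> morrey r p" and g: "g \<in> morrey r p"
  shows "AE x in lebesgue. cmod (Te j f x - Te j g x) \<le> cmod (Te j (\<lambda>x. f x - g x) x)"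
proof -
  have t: "trunc m (\<lambda>x. f x - g x) = (\<lambda>x. trunc m f x - trunc m g x)" for m
    by (simp add: trunc_def right_diff_distrib)
  have "AE x in lebesgue. \<forall>m. cmod (ext j (trunc m f) x - ext j (trunc m g) x) \<le> cmod (ext j (trunc m (\<lambda>x. f x - g x)) x)"
    unfolding AE_all_countable t using ext_diff[OF trunc_Lp_space[OF f] trunc_Lp_space[OF g]] by blast
  then show ?thesis using Te_limit[OF f, of j] Te_limit[OF g, of j] Te_limit[OF morrey_diff[OF one_less f g], of j]
  proof eventually_elim
    case (elim x)
    show ?case
      by (rule LIMSEQ_le[OF tendsto_norm[OF tendsto_diff[OF elim(2,3)]] tendsto_norm[OF elim(4)]]) (use elim(1) in blast)
  qed
qed

lemma Te_lq_diff_le: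
  assumes f: "\<And>j. f j \<in> morrey r p" and g: "\<And>j. g j \<in> morrey r p"
  shows "morrey_enorm r p (lq_function q (\<lambda>j x. Te j (f j) x - Te j (g j) x))
      \<le> C_morrey * morrey_enorm r p (lq_function q (\<lambda>j x. f j x - g j x))"
proof -
  have "AE x in lebesgue. \<forall>j. cmod (Te j (f j) x - Te j (g j) x) \<le> cmod (Te j (\<lambda>x. f j x - g j x) x)"
    unfolding AE_all_countable using Te_diff[OF f g] by blast
  then have "AE x in lebesgue. lq_function q (\<lambda>j x. Te j (f j) x - Te j (g j) x) x \<le> lq_function q (\<lambda>j. Te j (\<lambda>x. f j x - g j x)) x"
    by eventually_elim (auto intro: lq_mono q_pos)
  then have "morrey_enorm r p (lq_function q (\<lambda>j x. Te j (f j) x - Te j (g j) x))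
      \<le> morrey_enorm r p (lq_function q (\<lambda>j. Te j (\<lambda>x. f j x - g j x)))"
    using pos by (intro morrey_mono_AE) auto
  also have "\<dots> \<le> C_morrey * morrey_enorm r p (lq_function q (\<lambda>j x. f j x - g j x))"
    using f g by (intro Te_lq_le morrey_diff one_less)
  finally show ?thesis .
qed

lemma zero_morrey: "(\<lambda>x. 0 :: complex) \<in> (morrey r p :: 'n cfun set)"
proof -
  have "morrey_enorm r p (eabs (\<lambda>x::real^'n. 0)) = 0" using pos by (subst morrey_eq_0_iff) (auto simp: eabs_def)
  then show ?thesis using pos by (simp add: morrey_iff)
qed

lemma Te_diff_le:
  assumes f: "f \<in> morrey r p" and g: "g \<in> morrey r p"
  shows "morrey_enorm r p (eabs (\<lambda>x. Te j f x - Te j g x)) \<le> C_morrey * morrey_enorm r p (eabs (\<lambda>x. f x - g x))"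
proof -
  let ?f = "\<lambda>i. if i = j then f else (\<lambda>x. 0)" and ?g = "\<lambda>i. if i = j then g else (\<lambda>x. 0)"
  have "morrey_enorm r p (eabs (\<lambda>x. Te j f x - Te j g x)) \<le> morrey_enorm r p (lq_function q (\<lambda>i x. Te i (?f i) x - Te i (?g i) x))"
  proof (rule morrey_mono[OF pos])
    fix x show "eabs (\<lambda>x. Te j f x - Te j g x) x \<le> lq_function q (\<lambda>i x. Te i (?f i) x - Te i (?g i) x) x"
      using lq_ge[OF q_pos, of "\<lambda>i x. Te i (?f i) x - Te i (?g i) x" j x] by (simp add: eabs_def)
  qed
  also have "\<dots> \<le> C_morrey * morrey_enorm r p (lq_function q (\<lambda>i x. ?f i x - ?g i x))"
    by (rule Te_lq_diff_le) (use f g zero_morrey in auto)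
  also have "(\<lambda>i x. ?f i x - ?g i x) = (\<lambda>i. if i = j then (\<lambda>x. f x - g x) else (\<lambda>x. 0))" by (auto simp: fun_eq_iff)
  finally show ?thesis by (simp only: lq_single_function[OF q_pos])
qed

lemma trunc_eventually:
  assumes "compact (supp \<phi>)" shows "eventually (\<lambda>m. trunc m \<phi> = \<phi>) sequentially"
proof -
  obtain B where B: "\<And>x. x \<in> supp \<phi> \<Longrightarrow> norm x \<le> B" using compact_imp_bounded[OF assms] by (auto simp: bounded_iff)
  obtain k :: nat where k: "B < 2 ^ k" using real_arch_pow[of 2] by auto
  have "trunc m \<phi> = \<phi>" if "k \<le> m" for m
  proof
    fix x
    have "x \<in> cube 0 (2 ^ m)" if "x \<in> supp \<phi>"
    proof -
      have "norm x \<le> 2 ^ k" using B[OF that] k by simp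
      also have "\<dots> \<le> 2 ^ m" using \<open>k \<le> m\<close> by (intro power_increasing) auto
      finally show ?thesis using component_le_norm_cart[of x] by (auto simp: cube_def intro: order_trans)
    qed
    then show "trunc m \<phi> x = \<phi> x" using not_in_supp[of x \<phi>] by (auto simp: trunc_def indicator_def)
  qed
  then show ?thesis by (auto simp: eventually_sequentially)
qed

lemma test_morrey:
  fixes \<phi> :: "'n cfun"
  assumes \<phi>: "\<phi> \<in> test_functions" shows "\<phi> \<in> morrey r p"
proof -
  have "morrey_enorm r p (eabs \<phi>) < top" using \<phi> test_subset_schwartz by (intro morrey_schwartz_finite) auto
  then show ?thesis using pos \<phi> by (simp add: morrey_iff test_measurable)
qed

lemma Te_test:
  assumes \<phi>: "\<phi> \<in> test_functions" shows "Te j \<phi> =ae T j \<phi>"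
  using ext_test[OF \<phi>, of j] Te_limit[OF test_morrey[OF \<phi>], of j]
proof eventually_elim
  case (elim x)
  have "eventually (\<lambda>m. ext j (trunc m \<phi>) x = ext j \<phi> x) sequentially"
    using trunc_eventually[OF test_compact[OF \<phi>]] by eventually_elim simp
  then have "(\<lambda>m. ext j (trunc m \<phi>) x) \<longlonglongrightarrow> ext j \<phi> x" by (rule tendsto_eventually)
  then show ?case using elim LIMSEQ_unique by metis
qed

lemma Te_lincomb:
  assumes lin: "linear_on_test_functions (T j)" and f: "f \<in> morrey r p" and g: "g \<in> morrey r p"
  shows "Te j (\<lambda>x. a * f x + b * g x) =ae (\<lambda>x. a * Te j f x + b * Te j g x)"
proof -
  have t: "trunc m (\<lambda>x. a * f x + b * g x) = (\<lambda>x. a * trunc m f x + b * trunc m g x)" for m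
    by (simp add: trunc_def algebra_simps)
  have "AE x in lebesgue. \<forall>m. ext j (trunc m (\<lambda>x. a * f x + b * g x)) x = a * ext j (trunc m f) x + b * ext j (trunc m g) x"
    unfolding AE_all_countable t using ext_lincomb[OF lin trunc_Lp_space[OF f] trunc_Lp_space[OF g]] by blast
  then show ?thesis using Te_limit[OF f, of j] Te_limit[OF g, of j] Te_limit[OF morrey_lincomb[OF one_less f g, of a b], of j]
  proof eventually_elim
    case (elim x)
    have "(\<lambda>m. ext j (trunc m (\<lambda>x. a * f x + b * g x)) x) \<longlonglongrightarrow> a * Te j f x + b * Te j g x"
      unfolding elim(1)[rule_format] by (intro tendsto_intros elim)
    then show ?case using elim(4) LIMSEQ_unique by blast
  qed
qed

end

lemma compact_subset_cube:
  fixes K :: "(real ^ 'n::finite) set"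
  assumes "compact K" obtains R where "0 \<le> R" "K \<subseteq> cube 0 R"
proof -
  obtain B where B: "\<And>x. x \<in> K \<Longrightarrow> norm x \<le> B" using compact_imp_bounded[OF assms] by (auto simp: bounded_iff)
  have "K \<subseteq> cube 0 (max B 0)"
  proof
    fix x assume "x \<in> K"
    then have "\<bar>x $ i\<bar> \<le> max B 0" for i using B[of x] component_le_norm_cart[of x i] by linarith
    then show "x \<in> cube 0 (max B 0)" by (simp add: cube_def)
  qed
  then show ?thesis using that[of "max B 0"] by simp
qed

context cz_family
begin

lemma T_decay:
  assumes \<phi>: "\<phi> \<in> test_functions" and e: "0 < e"
  obtains R where "\<And>y. y \<notin> cube 0 R \<Longrightarrow> cmod (T j \<phi> y) \<le> e"
proof -
  obtain R where R: "0 \<le> R" "supp \<phi> \<subseteq> cube 0 R" using compact_subset_cube[OF test_compact[OF \<phi>]] by blast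
  have "(\<integral>\<^sup>+z. eabs \<phi> z \<partial>lebesgue) = ennreal (LINT z|lebesgue. cmod (\<phi> z))"
    unfolding eabs_def using test_integral_finite[OF \<phi>] by (intro nn_integral_eq_integral) auto
  then obtain I where I: "(\<integral>\<^sup>+z. eabs \<phi> z \<partial>lebesgue) = ennreal I" "0 \<le> I" by (simp add: integral_nonneg_AE)
  \<comment> \<open>At distance t the kernel bound gives |c_1| I / t^n. Since t >= 1 this is at most
    |c_1| I / t, and the choice of t makes it at most e.\<close>
  define t where "t = 1 + \<bar>c\<^sub>1\<bar> * I / e"
  have t: "1 \<le> t" using e I by (simp add: t_def)
  have "cmod (T j \<phi> y) \<le> e" if y: "y \<notin> cube 0 (R + t)" for y
  proof -
    obtain i where i: "R + t < \<bar>y $ i\<bar>" using y by (auto simp: cube_def not_le)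
    have "t \<le> norm (y - z)" if "z \<in> supp \<phi>" for z
    proof -
      have "\<bar>z $ i\<bar> \<le> R" using that R(2) by (auto simp: cube_def)
      then have "t \<le> \<bar>(y - z) $ i\<bar>" using i by simp
      then show ?thesis using component_le_norm_cart[of "y - z" i] by linarith
    qed
    then have "ennreal (cmod (T j \<phi> y)) \<le> ennreal (\<bar>c\<^sub>1\<bar> / t ^ CARD('n)) * ennreal I"
      unfolding I(1)[symmetric] using t by (intro T_kernel_bound[OF \<phi>]) auto
    also have "\<dots> = ennreal (\<bar>c\<^sub>1\<bar> / t ^ CARD('n) * I)" using t I by (intro ennreal_mult[symmetric]) auto
    finally have "cmod (T j \<phi> y) \<le> \<bar>c\<^sub>1\<bar> / t ^ CARD('n) * I" using t I by (simp add: ennreal_le_iff)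
    also have "\<dots> = \<bar>c\<^sub>1\<bar> * I / t ^ CARD('n)" by simp
    also have "\<dots> \<le> \<bar>c\<^sub>1\<bar> * I / t"
    proof -
      have "t ^ 1 \<le> t ^ CARD('n)" using t by (intro power_increasing) (auto simp: Suc_le_eq)
      then show ?thesis using t I by (intro divide_left_mono) auto
    qed
    also have "\<dots> \<le> e"
    proof -
      have "\<bar>c\<^sub>1\<bar> * I \<le> e * t" using e by (simp add: t_def distrib_left)
      then show ?thesis using t by (simp add: divide_le_eq)
    qed
    finally show ?thesis .
  qed
  then show ?thesis by (rule that)
qed

lemma test_morrey0: "\<phi> \<in> test_functions \<Longrightarrow> \<phi> \<in> (morrey0 r p :: 'n cfun set)"
proof -
  assume \<phi>: "\<phi> \<in> test_functions"
  have "morrey_enorm r p (eabs (\<lambda>x. \<phi> x - \<phi> x)) = 0" using pos by (subst morrey_eq_0_iff) (auto simp: eabs_def)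
  then show ?thesis using \<phi> test_morrey[OF \<phi>] by (auto simp: morrey0_def intro!: bexI[of _ \<phi>])
qed

lemma T_test_morrey:
  assumes \<phi>: "\<phi> \<in> test_functions" shows "T j \<phi> \<in> morrey r p"
proof -
  note [measurable] = T_measurable[OF \<phi>, of j]
  obtain B where B: "\<And>x. cmod (T j \<phi> x) \<le> B"
    using T_bcontfun[OF \<phi>, of j] by (auto simp: bcontfun_def bounded_iff)
  have "morrey_enorm r p (eabs (T j \<phi>)) \<le> ennreal (2 powr (real CARD('n) / p)) * ennreal B + Lp_norm p (T j \<phi>)"
    using B by (intro morrey_le_sup_Lp pos r_lower r_neg AE_I2) (auto simp: eabs_def intro: ennreal_leI)
  also have "\<dots> < top"
    using T_Lp_single[OF \<phi>, of j] test_Lp_space[OF pos \<phi>]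
    by (auto simp: ennreal_mult_less_top Lp_space_def intro: le_less_trans)
  finally show ?thesis using pos by (simp add: morrey_iff)
qed

text \<open>\<open>T\<^sub>j \<phi>\<close> vanishes at infinity, both uniformly and in \<open>L\<^sub>p\<close>; cut it off and approximate uniformly.\<close>
lemma T_test_morrey0:
  assumes \<phi>: "\<phi> \<in> test_functions" shows "T j \<phi> \<in> morrey0 r p"
  unfolding morrey0_def
proof (intro CollectI conjI allI impI T_test_morrey[OF \<phi>])
  fix e :: real assume e: "0 < e"
  let ?h = "T j \<phi>" and ?c = "2 powr (real CARD('n) / p)"
  have [measurable]: "?h \<in> borel_measurable lebesgue" using \<phi> by (rule T_measurable)
  have hc: "continuous_on UNIV ?h" using T_bcontfun[OF \<phi>, of j] by (simp add: bcontfun_def)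
  have hLp: "?h \<in> Lp_space p"
    using T_Lp_single[OF \<phi>, of j] test_Lp_space[OF pos \<phi>]
    by (auto simp: ennreal_mult_less_top Lp_space_def intro: le_less_trans)
  \<comment> \<open>The error budget consists of three parts of size e/4: the supremum norm of the
    part cut off, its L_p norm, and the error of the uniform approximation. The constant
    \<open>?c\<close> is the factor of the supremum in \<open>morrey_le_sup_Lp\<close>.\<close>
  define d where "d = e / (4 * ?c)"
  have d: "0 < d" using e by (simp add: d_def)
  obtain R where R: "\<And>y. y \<notin> cube 0 R \<Longrightarrow> cmod (?h y) \<le> d" using T_decay[OF \<phi> d, of j] by blast
  obtain k :: nat where k: "R < 2 ^ k" using real_arch_pow[of 2] by auto
  have lim: "(\<lambda>m. indicator (cube 0 (2 ^ m)) x * ?h x) \<longlonglongrightarrow> ?h x" for x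
  proof -
    have "x \<in> (\<Union>m. cube 0 (2 ^ m))" by (simp add: Un_cubes)
    then obtain l where l: "x \<in> cube 0 (2 ^ l)" by (rule UN_E)
    have "x \<in> cube 0 (2 ^ m)" if "l \<le> m" for m
      using l cube_mono[OF power_increasing[OF that, of "2::real"], of 0] by auto
    then show ?thesis by (intro tendsto_eventually) (auto simp: eventually_sequentially intro!: exI[of _ l])
  qed
  have "eventually (\<lambda>m. Lp_norm p (\<lambda>x. ?h x - indicator (cube 0 (2 ^ m)) x * ?h x) < ennreal (e/4)) sequentially"
    using e by (intro Lp_dominated_convergence[OF one_less hLp, where K=1] lim) (auto simp: indicator_def)
  then obtain m0 where m0: "\<And>m. m0 \<le> m \<Longrightarrow> Lp_norm p (\<lambda>x. ?h x - indicator (cube 0 (2 ^ m)) x * ?h x) < ennreal (e/4)"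
    by (auto simp: eventually_sequentially)
  \<comment> \<open>The bound \<open>m0\<close> makes the L_p tail small; \<open>k\<close> ensures
    that T_j \<phi> is uniformly small outside the cube of radius 2^m.\<close>
  define m where "m = max m0 k"
  let ?C = "cube (0 :: real ^ 'n) (2 ^ m)"
  have "(2::real) ^ k \<le> 2 ^ m" by (intro power_increasing) (auto simp: m_def)
  then have RC: "cube 0 R \<subseteq> ?C" using k by (intro cube_mono) linarith
  obtain \<psi> :: "real ^ 'n \<Rightarrow> real" where \<psi>: "smooth (\<lambda>z. complex_of_real (\<psi> z))" "\<And>z. 0 \<le> \<psi> z" "\<And>z. \<psi> z \<le> 1"
    "\<And>z. z \<in> ?C \<Longrightarrow> \<psi> z = 1" "\<And>z. z \<notin> cube 0 (2 ^ m + 1) \<Longrightarrow> \<psi> z = 0"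
    using cube_plateau[of 1 "0 :: real ^ 'n" "2 ^ m"] by auto
  define g where "g x = complex_of_real (\<psi> x) * ?h x" for x
  have gc: "continuous_on UNIV g" unfolding g_def by (intro continuous_on_mult smooth_continuous \<psi>(1) hc)
  have [measurable]: "g \<in> borel_measurable lebesgue" using gc by (rule continuous_lebesgue_measurable)
  have hg: "cmod (?h x - g x) \<le> cmod (?h x - indicator ?C x * ?h x)" for x
  proof -
    have "?h x - g x = complex_of_real (1 - \<psi> x) * ?h x" by (simp add: g_def algebra_simps)
    then have "cmod (?h x - g x) = \<bar>1 - \<psi> x\<bar> * cmod (?h x)" by (simp only: norm_mult norm_of_real)
    then show ?thesis using \<psi>(2,3,4)[of x] by (auto simp: indicator_def intro: mult_left_le_one_le)
  qed
  define V where "V = ((2 * (2 ^ m + 2)) ^ CARD('n)) powr (1 / p)"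
  have V: "0 \<le> V" by (simp add: V_def)
  define s where "s = e / (4 * (?c + V))"
  have cV: "0 < ?c + V" using V by (simp add: add_pos_nonneg)
  have s: "0 < s" using e cV by (simp add: s_def)
  obtain \<phi>' where \<phi>': "\<phi>' \<in> test_functions" "\<And>x. cmod (g x - \<phi>' x) \<le> s" "\<And>x. x \<notin> cube 0 (2 ^ m + 1 + 1) \<Longrightarrow> \<phi>' x = 0"
    by (rule test_uniform_approx[OF gc, of "2 ^ m + 1" s]) (use \<psi>(5) s in \<open>auto simp: g_def\<close>)
  note [measurable] = test_measurable[OF \<phi>'(1)]
  have "morrey_enorm r p (eabs (\<lambda>x. ?h x - g x)) \<le> ennreal ?c * ennreal d + Lp_norm p (\<lambda>x. ?h x - g x)"
  proof (intro morrey_le_sup_Lp pos r_lower r_neg AE_I2)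
    fix x show "eabs (\<lambda>x. ?h x - g x) x \<le> ennreal d"
    proof (cases "x \<in> ?C")
      case False
      then have "cmod (?h x - g x) \<le> cmod (?h x)" "cmod (?h x) \<le> d" using hg[of x] R[of x] RC by auto
      then show ?thesis unfolding eabs_def by (intro ennreal_leI) linarith
    qed (use hg[of x] d in \<open>simp add: eabs_def\<close>)
  qed
  also have "Lp_norm p (\<lambda>x. ?h x - g x) \<le> Lp_norm p (\<lambda>x. ?h x - indicator ?C x * ?h x)"
    using hg by (intro Lp_mono pos) (auto simp: eabs_def intro: ennreal_leI)
  also have "\<dots> < ennreal (e/4)" by (rule m0) (simp add: m_def)
  finally have 1: "morrey_enorm r p (eabs (\<lambda>x. ?h x - g x)) \<le> ennreal (e/4) + ennreal (e/4)"
    by (simp add: ennreal_mult'[symmetric] d_def add_left_mono less_imp_le)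
  have "morrey_enorm r p (eabs (\<lambda>x. g x - \<phi>' x)) \<le> ennreal ?c * ennreal s + Lp_norm p (\<lambda>x. g x - \<phi>' x)"
    using \<phi>'(2) by (intro morrey_le_sup_Lp pos r_lower r_neg AE_I2) (auto simp: eabs_def intro: ennreal_leI)
  also have "Lp_norm p (\<lambda>x. g x - \<phi>' x) \<le> ennreal s * epowr (emeasure lebesgue (cube (0 :: real ^ 'n) (2 ^ m + 2))) (1 / p)"
  proof (rule Lp_norm_bounded_finite_support[OF pos \<phi>'(2)])
    fix x :: "real ^ 'n" assume x: "x \<notin> cube 0 (2 ^ m + 2)"
    then have "x \<notin> cube 0 (2 ^ m + 1)" using cube_mono[of "2 ^ m + 1" "2 ^ m + 2"] by auto
    moreover have "(2::real) ^ m + 1 + 1 = 2 ^ m + 2" by simp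
    ultimately show "g x - \<phi>' x = 0" using x \<phi>'(3) \<psi>(5) by (simp only: g_def) simp
  qed auto
  also have "epowr (emeasure lebesgue (cube (0 :: real ^ 'n) (2 ^ m + 2))) (1 / p) = ennreal V"
    by (simp add: emeasure_cube_lborel V_def)
  also have "ennreal ?c * ennreal s + ennreal s * ennreal V = ennreal (s * (?c + V))"
    using s V by (simp add: ennreal_mult'[symmetric] ennreal_plus[symmetric] algebra_simps del: ennreal_plus)
  also have "s * (?c + V) = e/4"
  proof -
    have gen: "e / (4 * W) * W = e / 4" if "W \<noteq> 0" for W :: real using that by simp
    show ?thesis unfolding s_def by (rule gen) (use cV in simp)
  qed
  finally have 2: "morrey_enorm r p (eabs (\<lambda>x. g x - \<phi>' x)) \<le> ennreal (e/4)" by (simp add: add_left_mono)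
  have "morrey_enorm r p (eabs (\<lambda>x. ?h x - \<phi>' x)) \<le> (ennreal (e/4) + ennreal (e/4)) + ennreal (e/4)"
    by (rule order_trans[OF morrey_triangle[OF one_less] add_mono[OF 1 2]]) auto
  also have "\<dots> = ennreal (3 * e / 4)" using e by (simp add: ennreal_plus[symmetric] del: ennreal_plus)
  also have "\<dots> < ennreal e" using e by (intro ennreal_lessI) auto
  finally show "\<exists>\<phi>\<in>test_functions. morrey_enorm r p (eabs (\<lambda>x. ?h x - \<phi> x)) < ennreal e" using \<phi>'(1) by blast
qed

lemma Te_zero: "Te j (\<lambda>x. 0) =ae (\<lambda>x. 0)"
  using Te_test[OF test_zero, of j] by (simp add: T_zero)

lemma Te_le:
  assumes f: "f \<in> morrey r p"
  shows "morrey_enorm r p (eabs (Te j f)) \<le> C_morrey * morrey_enorm r p (eabs f)"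
proof -
  have "AE x in lebesgue. eabs (Te j f) x = eabs (\<lambda>x. Te j f x - Te j (\<lambda>x. 0) x) x"
    using Te_zero[of j] by eventually_elim (simp add: eabs_def)
  then have "morrey_enorm r p (eabs (Te j f)) = morrey_enorm r p (eabs (\<lambda>x. Te j f x - Te j (\<lambda>x. 0) x))"
    by (rule morrey_cong_AE[OF pos])
  then show ?thesis using Te_diff_le[OF f zero_morrey, of j] by simp
qed

lemma Te_morrey:
  assumes f: "f \<in> morrey r p" shows "Te j f \<in> morrey r p"
proof -
  have "C_morrey * morrey_enorm r p (eabs f) < top" using C_morrey_finite morrey_finite[OF f] by (simp add: ennreal_mult_less_top)
  then show ?thesis using Te_le[OF f, of j] f pos by (auto simp: morrey_iff[of p "Te j f"] intro: le_less_trans)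
qed

text \<open>One test function approximates f while its image under T_j itself approximates
  \<open>Te j f\<close>. Invariance, uniqueness and the dual identity on the closure are all reduced
  to test functions by it.\<close>

lemma morrey0_approx_T:
  assumes f: "f \<in> morrey0 r p" and e: "0 < e"
  obtains \<phi> where "\<phi> \<in> test_functions" "morrey_enorm r p (eabs (\<lambda>x. f x - \<phi> x)) < ennreal e"
    "morrey_enorm r p (eabs (\<lambda>x. Te j f x - T j \<phi> x)) < ennreal e"
proof -
  obtain d where d: "0 < d" "\<And>x. x < ennreal d \<Longrightarrow> C_morrey * x < ennreal e"
    using ennreal_mult_less_epsilon[OF C_morrey_finite e] by blast
  obtain \<phi> where \<phi>: "\<phi> \<in> test_functions" "morrey_enorm r p (eabs (\<lambda>x. f x - \<phi> x)) < ennreal (min d e)"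
    using morrey0_approx[OF f, of "min d e"] d e by auto
  have le: "morrey_enorm r p (eabs (\<lambda>x. f x - \<phi> x)) < ennreal d" "morrey_enorm r p (eabs (\<lambda>x. f x - \<phi> x)) < ennreal e"
    using \<phi>(2) by (auto elim!: less_le_trans intro!: ennreal_leI)
  have "AE x in lebesgue. eabs (\<lambda>x. Te j f x - T j \<phi> x) x = eabs (\<lambda>x. Te j f x - Te j \<phi> x) x"
    using Te_test[OF \<phi>(1), of j] by eventually_elim (simp add: eabs_def)
  then have "morrey_enorm r p (eabs (\<lambda>x. Te j f x - T j \<phi> x)) = morrey_enorm r p (eabs (\<lambda>x. Te j f x - Te j \<phi> x))"
    by (rule morrey_cong_AE[OF pos])
  also have "\<dots> \<le> C_morrey * morrey_enorm r p (eabs (\<lambda>x. f x - \<phi> x))"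
    by (rule Te_diff_le[OF subsetD[OF morrey0_subset f] test_morrey[OF \<phi>(1)]])
  also have "\<dots> < ennreal e" using le(1) by (rule d(2))
  finally show ?thesis using that \<phi>(1) le(2) by blast
qed

lemma Te_morrey0:
  assumes f: "f \<in> morrey0 r p" shows "Te j f \<in> morrey0 r p"
proof (rule morrey0_closed[OF one_less])
  show "Te j f \<in> morrey r p" using f morrey0_subset by (intro Te_morrey) auto
  fix e :: real assume "0 < e"
  then obtain \<phi> where "\<phi> \<in> test_functions" "morrey_enorm r p (eabs (\<lambda>x. Te j f x - T j \<phi> x)) < ennreal e"
    using morrey0_approx_T[OF f] by blast
  then show "\<exists>g\<in>morrey0 r p. morrey_enorm r p (eabs (\<lambda>x. Te j f x - g x)) < ennreal e"
    using T_test_morrey0 by blast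
qed

lemma Te_cong_AE:
  assumes f: "f \<in> morrey r p" and g: "g \<in> morrey r p" and eq: "f =ae g" shows "Te j f =ae Te j g"
proof (rule morrey_diff_eq_0D[OF one_less])
  note [measurable] = f[THEN morrey_measurable] g[THEN morrey_measurable]
  have "AE x in lebesgue. eabs (\<lambda>x. f x - g x) x = 0" using eq by eventually_elim (simp add: eabs_def)
  then have "morrey_enorm r p (eabs (\<lambda>x. f x - g x)) = 0"
    using pos by (subst morrey_eq_0_iff) auto
  then show "morrey_enorm r p (eabs (\<lambda>x. Te j f x - Te j g x)) \<le> ennreal e" for e
    using Te_diff_le[OF f g, of j] by simp
qed (use f g in \<open>auto intro: Te_measurable\<close>)

section \<open>Boundedness, continuity and uniqueness of the extensions\<close>

lemma Te_bounded_extension: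
  assumes X: "X = morrey0 r p \<or> X = morrey r p"
  shows "bounded_extension X (\<lambda>f. morrey_enorm r p (eabs f)) (T j) (Te j)"
proof -
  have XM: "X \<subseteq> morrey r p" using X morrey0_subset by auto
  have "Te j f \<in> X" if "f \<in> X" for f using X that Te_morrey Te_morrey0 by auto
  moreover have "Te j f =ae Te j g" if "f \<in> X" "g \<in> X" "f =ae g" for f g
    using that XM Te_cong_AE by blast
  moreover have "\<exists>c::real. \<forall>f\<in>X. morrey_enorm r p (eabs (Te j f)) \<le> ennreal c * morrey_enorm r p (eabs f)"
  proof -
    obtain c where "C_morrey = ennreal c" using C_morrey_finite by (cases C_morrey) auto
    then show ?thesis using Te_le XM by (intro exI[of _ c]) auto
  qed
  moreover have "test_functions \<subseteq> X" using X test_morrey test_morrey0 by auto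
  ultimately show ?thesis
    using Te_test by (auto simp: bounded_extension_def bounded_operator_def operator_on_def)
qed

lemma Te_continuous: "continuous_operator (morrey0 r p) (\<lambda>f. morrey_enorm r p (eabs f)) (Te j)"
  unfolding continuous_operator_def
proof (intro ballI allI impI)
  fix f :: "'n cfun" and e assume f: "f \<in> morrey0 r p" and e: "(0::real) < e"
  obtain d where d: "0 < d" "\<And>x. x < ennreal d \<Longrightarrow> C_morrey * x < ennreal e"
    using ennreal_mult_less_epsilon[OF C_morrey_finite e] by blast
  have "morrey_enorm r p (eabs (\<lambda>x. Te j g x - Te j f x)) < ennreal e"
    if "g \<in> morrey0 r p" "morrey_enorm r p (eabs (\<lambda>x. g x - f x)) < ennreal d" for g
    using Te_diff_le[of g f j] d(2)[OF that(2)] that(1) f morrey0_subset by (meson le_less_trans subsetD)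
  then show "\<exists>\<delta>>0. \<forall>g\<in>morrey0 r p. morrey_enorm r p (eabs (\<lambda>x. g x - f x)) < ennreal \<delta> \<longrightarrow>
      morrey_enorm r p (eabs (\<lambda>x. Te j g x - Te j f x)) < ennreal e" using d(1) by blast
qed

text \<open>For nonlinear operators it is continuity, not boundedness, that carries agreement on
  test functions over to the closure.\<close>

lemma Te_unique_if_continuous:
  assumes S: "continuous_bounded_extension (morrey0 r p) (\<lambda>f. morrey_enorm r p (eabs f)) (T j) S" and f: "f \<in> morrey0 r p"
  shows "S f =ae Te j f"
proof (rule morrey_diff_eq_0D[OF one_less])
  have S0: "S g \<in> morrey0 r p" if "g \<in> morrey0 r p" for g
    using S that by (auto simp: continuous_bounded_extension_def bounded_extension_def bounded_operator_def operator_on_def)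
  show m1: "S f \<in> borel_measurable lebesgue" "Te j f \<in> borel_measurable lebesgue"
    using S0[OF f] Te_morrey0[OF f, of j] morrey0_subset morrey_measurable by blast+
  fix e :: real assume e: "0 < e"
  obtain d where d: "0 < d" "\<And>g. g \<in> morrey0 r p \<Longrightarrow> morrey_enorm r p (eabs (\<lambda>x. g x - f x)) < ennreal d \<Longrightarrow>
      morrey_enorm r p (eabs (\<lambda>x. S g x - S f x)) < ennreal (e/2)"
    using S f e unfolding continuous_bounded_extension_def continuous_operator_def by (meson half_gt_zero)
  obtain \<phi> where \<phi>: "\<phi> \<in> test_functions" "morrey_enorm r p (eabs (\<lambda>x. f x - \<phi> x)) < ennreal (min d (e/2))"
    "morrey_enorm r p (eabs (\<lambda>x. Te j f x - T j \<phi> x)) < ennreal (min d (e/2))"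
  proof -
    have "0 < min d (e/2)" using d(1) e by simp
    from morrey0_approx_T[OF f this, of j] show ?thesis using that by blast
  qed
  have "ennreal (min d (e/2)) \<le> ennreal d" "ennreal (min d (e/2)) \<le> ennreal (e/2)" by (auto intro: ennreal_leI)
  then have le: "morrey_enorm r p (eabs (\<lambda>x. \<phi> x - f x)) < ennreal d" "morrey_enorm r p (eabs (\<lambda>x. T j \<phi> x - Te j f x)) < ennreal (e/2)"
    using \<phi>(2,3) unfolding eabs_minus_commute[of \<phi> f] eabs_minus_commute[of "T j \<phi>"] by (auto intro: less_le_trans)
  have "S \<phi> =ae T j \<phi>" using S \<phi>(1) by (simp add: continuous_bounded_extension_def bounded_extension_def)
  then have "AE x in lebesgue. eabs (\<lambda>x. S f x - T j \<phi> x) x = eabs (\<lambda>x. S \<phi> x - S f x) x"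
    by eventually_elim (simp add: eabs_def norm_minus_commute)
  then have "morrey_enorm r p (eabs (\<lambda>x. S f x - T j \<phi> x)) = morrey_enorm r p (eabs (\<lambda>x. S \<phi> x - S f x))"
    by (rule morrey_cong_AE[OF pos])
  also have "\<dots> < ennreal (e/2)" using \<phi>(1) le(1) by (intro d(2) test_morrey0)
  finally have le1: "morrey_enorm r p (eabs (\<lambda>x. S f x - T j \<phi> x)) < ennreal (e/2)" .
  have "morrey_enorm r p (eabs (\<lambda>x. S f x - Te j f x))
      \<le> morrey_enorm r p (eabs (\<lambda>x. S f x - T j \<phi> x)) + morrey_enorm r p (eabs (\<lambda>x. T j \<phi> x - Te j f x))"
    using m1 T_measurable[OF \<phi>(1), of j] by (intro morrey_triangle one_less)
  also have "\<dots> \<le> ennreal (e/2) + ennreal (e/2)" using le1 le(2) by (intro add_mono less_imp_le)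
  also have "\<dots> = ennreal e" using e by (simp add: ennreal_plus[symmetric] del: ennreal_plus)
  finally show "morrey_enorm r p (eabs (\<lambda>x. S f x - Te j f x)) \<le> ennreal e" .
qed

text \<open>This reduces uniqueness among linear bounded extensions to uniqueness among continuous
  ones. The space X has to be closed under differences for the bound to apply to g - f.\<close>

lemma linear_bounded_imp_continuous:
  assumes X: "X \<subseteq> (morrey r p :: 'n cfun set)" and S: "bounded_operator X (\<lambda>f. morrey_enorm r p (eabs f)) S" "linear_operator X S"
    and diff: "\<And>f g. f \<in> X \<Longrightarrow> g \<in> X \<Longrightarrow> (\<lambda>x. f x - g x) \<in> X"
  shows "continuous_operator X (\<lambda>f. morrey_enorm r p (eabs f)) S"
  unfolding continuous_operator_def
proof (intro ballI allI impI)
  fix f e assume f: "f \<in> X" and e: "(0::real) < e"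
  obtain c where c: "\<And>f. f \<in> X \<Longrightarrow> morrey_enorm r p (eabs (S f)) \<le> ennreal c * morrey_enorm r p (eabs f)"
    using S(1) by (auto simp: bounded_operator_def)
  obtain d where d: "0 < d" "\<And>x. x < ennreal d \<Longrightarrow> ennreal c * x < ennreal e"
    using ennreal_mult_less_epsilon[of "ennreal c", OF _ e] by auto
  have "morrey_enorm r p (eabs (\<lambda>x. S g x - S f x)) < ennreal e"
    if g: "g \<in> X" and le: "morrey_enorm r p (eabs (\<lambda>x. g x - f x)) < ennreal d" for g
  proof -
    have "S (\<lambda>x. 1 * g x + (-1) * f x) =ae (\<lambda>x. 1 * S g x + (-1) * S f x)"
      using S(2) f g unfolding linear_operator_def by blast
    then have "AE x in lebesgue. eabs (\<lambda>x. S g x - S f x) x = eabs (S (\<lambda>x. g x - f x)) x"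
      by (simp add: eabs_def) (auto elim: AE_mp)
    then have "morrey_enorm r p (eabs (\<lambda>x. S g x - S f x)) = morrey_enorm r p (eabs (S (\<lambda>x. g x - f x)))"
      by (rule morrey_cong_AE[OF pos])
    also have "\<dots> \<le> ennreal c * morrey_enorm r p (eabs (\<lambda>x. g x - f x))" using f g by (intro c diff)
    also have "\<dots> < ennreal e" using le by (rule d(2))
    finally show ?thesis .
  qed
  then show "\<exists>\<delta>>0. \<forall>g\<in>X. morrey_enorm r p (eabs (\<lambda>x. g x - f x)) < ennreal \<delta> \<longrightarrow>
      morrey_enorm r p (eabs (\<lambda>x. S g x - S f x)) < ennreal e" using d(1) by blast
qed

lemma morrey0_diff:
  assumes f: "f \<in> morrey0 r p" and g: "g \<in> morrey0 r p" shows "(\<lambda>x. f x - g x) \<in> (morrey0 r p :: 'n cfun set)"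
  unfolding morrey0_def
proof (intro CollectI conjI allI impI)
  have fg: "f \<in> morrey r p" "g \<in> morrey r p" using f g morrey0_subset by auto
  then show "(\<lambda>x. f x - g x) \<in> morrey r p" by (intro morrey_diff one_less)
  fix e :: real assume e: "0 < e"
  obtain \<phi> where \<phi>: "\<phi> \<in> test_functions" "morrey_enorm r p (eabs (\<lambda>x. f x - \<phi> x)) < ennreal (e/2)"
    using morrey0_approx[OF f, of "e/2"] e by auto
  obtain \<psi> where \<psi>: "\<psi> \<in> test_functions" "morrey_enorm r p (eabs (\<lambda>x. g x - \<psi> x)) < ennreal (e/2)"
    using morrey0_approx[OF g, of "e/2"] e by auto
  have "(\<lambda>x. f x - g x - (\<phi> x - \<psi> x)) = (\<lambda>x. 1 * (f x - \<phi> x) + (-1) * (g x - \<psi> x))" by (auto simp: algebra_simps)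
  then have "morrey_enorm r p (eabs (\<lambda>x. f x - g x - (\<phi> x - \<psi> x)))
      \<le> ennreal (cmod 1) * morrey_enorm r p (eabs (\<lambda>x. f x - \<phi> x)) + ennreal (cmod (-1)) * morrey_enorm r p (eabs (\<lambda>x. g x - \<psi> x))"
    using fg[THEN morrey_measurable] \<phi>(1)[THEN test_measurable] \<psi>(1)[THEN test_measurable]
    by (simp only:) (intro morrey_lincomb_le one_less borel_measurable_diff)
  also have "\<dots> < ennreal (e/2) + ennreal (e/2)" using add_strict_mono[OF \<phi>(2) \<psi>(2)] by simp
  also have "\<dots> = ennreal e" using e by (simp add: ennreal_plus[symmetric] del: ennreal_plus)
  finally show "\<exists>\<phi>\<in>test_functions. morrey_enorm r p (eabs (\<lambda>x. f x - g x - \<phi> x)) < ennreal e"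
    using test_diff[OF \<phi>(1) \<psi>(1)] by (intro bexI[of _ "\<lambda>x. \<phi> x - \<psi> x"])
qed

lemma Te_unique_continuous:
  "unique_operator_on (morrey0 r p) (continuous_bounded_extension (morrey0 r p) (\<lambda>f. morrey_enorm r p (eabs f)) (T j)) (Te j)"
  unfolding unique_operator_on_def
  using Te_unique_if_continuous Te_bounded_extension[of "morrey0 r p" j] Te_continuous[of j]
  by (auto simp: continuous_bounded_extension_def)

lemma Te_linear:
  "X \<subseteq> morrey r p \<Longrightarrow> linear_on_test_functions (T j) \<Longrightarrow> linear_operator X (Te j)"
  unfolding linear_operator_def using Te_lincomb by blast

lemma Te_unique_linear:
  assumes lin: "linear_on_test_functions (T j)"
  shows "unique_operator_on (morrey0 r p) (linear_bounded_extension (morrey0 r p) (\<lambda>f. morrey_enorm r p (eabs f)) (T j)) (Te j)"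
  unfolding unique_operator_on_def
proof (intro conjI allI impI ballI)
  show "linear_bounded_extension (morrey0 r p) (\<lambda>f. morrey_enorm r p (eabs f)) (T j) (Te j)"
    using Te_bounded_extension[of "morrey0 r p" j] Te_linear[OF morrey0_subset lin] by (simp add: linear_bounded_extension_def)
  fix S and f :: "'n cfun" assume S: "linear_bounded_extension (morrey0 r p) (\<lambda>f. morrey_enorm r p (eabs f)) (T j) S" and f: "f \<in> morrey0 r p"
  have "continuous_operator (morrey0 r p) (\<lambda>f. morrey_enorm r p (eabs f)) S"
    using S by (intro linear_bounded_imp_continuous morrey0_subset morrey0_diff)
      (auto simp: linear_bounded_extension_def bounded_extension_def)
  then show "S f =ae Te j f"
    using S f by (intro Te_unique_if_continuous) (auto simp: continuous_bounded_extension_def linear_bounded_extension_def)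
qed

lemma Te_linear_extension_morrey:
  assumes "linear_on_test_functions (T j)"
  shows "linear_bounded_extension (morrey r p) (\<lambda>f. morrey_enorm r p (eabs f)) (T j) (Te j)"
  using Te_bounded_extension[of "morrey r p" j] Te_linear[OF subset_refl assms] by (simp add: linear_bounded_extension_def)

section \<open>Bounds on vector-valued Morrey spaces\<close>

lemma C_morrey_real: obtains c :: real where "C_morrey = ennreal c"
  using C_morrey_finite by (cases C_morrey) auto

lemma Te_morrey_lq: "f \<in> morrey_lq r p q \<Longrightarrow> (\<lambda>j. Te j (f j)) \<in> morrey_lq r p q"
proof -
  assume f: "f \<in> morrey_lq r p q"
  then have "C_morrey * morrey_enorm r p (lq_function q f) < top"
    using C_morrey_finite by (simp add: morrey_lq_def ennreal_mult_less_top)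
  then show ?thesis using f Te_morrey Te_lq_le[of f] by (auto simp: morrey_lq_def intro: le_less_trans)
qed

lemma Te_bounded_morrey_lq:
  "bounded_sequence_operator (morrey_lq r p q) (\<lambda>f. morrey_enorm r p (lq_function q f)) Te"
proof -
  obtain c where "C_morrey = ennreal c" by (rule C_morrey_real)
  then show ?thesis using Te_morrey_lq Te_lq_le
    by (auto simp: bounded_sequence_operator_def morrey_lq_def intro!: exI[of _ c])
qed

lemma Te_morrey0_lq:
  assumes f: "f \<in> morrey0_lq r p q" shows "(\<lambda>j. Te j (f j)) \<in> morrey0_lq r p q"
proof -
  have fM: "f \<in> morrey_lq r p q" using f by (simp add: morrey0_lq_def)
  then have fm: "f j \<in> morrey r p" for j by (simp add: morrey_lq_def)
  obtain \<phi> where \<phi>: "\<And>k j. \<phi> k j \<in> test_functions" "\<And>k j. j > k \<Longrightarrow> \<phi> k j = (\<lambda>x. 0)"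
    "(\<lambda>k. morrey_enorm r p (lq_function q (\<lambda>j x. f j x - \<phi> k j x))) \<longlonglongrightarrow> 0"
    using f by (auto simp: morrey0_lq_def)
  \<comment> \<open>The images of the approximants are again approximated by test functions, exactly
    by 0 for j > k as the definition of the closure demands. The tolerance 2^(-j) 2^(-k) makes the
    total error over j at most 2 * 2^(-k).\<close>
  define G where "G k j \<psi> \<longleftrightarrow> \<psi> \<in> test_functions \<and> (j > k \<longrightarrow> \<psi> = (\<lambda>x. 0)) \<and>
      morrey_enorm r p (eabs (\<lambda>x. Te j (\<phi> k j) x - \<psi> x)) \<le> ennreal ((1/2) ^ j * (1/2) ^ k)" for k j \<psi>
  have "\<exists>\<psi>. G k j \<psi>" for j k
  proof (cases "j > k")
    case True
    have "AE x in lebesgue. eabs (\<lambda>x. Te j (\<phi> k j) x - 0) x = 0"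
      using Te_zero[of j] \<phi>(2)[OF True] by (auto simp: eabs_def elim: AE_mp)
    then have "morrey_enorm r p (eabs (\<lambda>x. Te j (\<phi> k j) x - 0)) = 0"
      using pos \<phi>(1) by (subst morrey_eq_0_iff) (simp_all add: measurable_eabs Te_measurable test_morrey)
    then show ?thesis unfolding G_def by (intro exI[of _ "\<lambda>x. 0"]) auto
  next
    case False
    have "Te j (\<phi> k j) \<in> morrey0 r p" using \<phi>(1) by (intro Te_morrey0 test_morrey0)
    then obtain \<psi> where "\<psi> \<in> test_functions" "morrey_enorm r p (eabs (\<lambda>x. Te j (\<phi> k j) x - \<psi> x)) < ennreal ((1/2) ^ j * (1/2) ^ k)"
      by (rule morrey0_approx[of _ r p "(1/2) ^ j * (1/2) ^ k"]) auto
    then show ?thesis unfolding G_def using False by (intro exI[of _ \<psi>]) auto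
  qed
  then obtain \<psi> where "\<And>k j. G k j (\<psi> k j)" by metis
  then have \<psi>: "\<And>k j. \<psi> k j \<in> test_functions" "\<And>k j. j > k \<Longrightarrow> \<psi> k j = (\<lambda>x. 0)"
    "\<And>k j. morrey_enorm r p (eabs (\<lambda>x. Te j (\<phi> k j) x - \<psi> k j x)) \<le> ennreal ((1/2) ^ j * (1/2) ^ k)"
    unfolding G_def by blast+
  have [measurable]: "Te j (f j) \<in> borel_measurable lebesgue" "Te j (\<phi> k j) \<in> borel_measurable lebesgue" "\<psi> k j \<in> borel_measurable lebesgue" for j k
    by (rule Te_measurable[OF fm] Te_measurable[OF test_morrey[OF \<phi>(1)]] test_measurable[OF \<psi>(1)])+
  have le: "morrey_enorm r p (lq_function q (\<lambda>j x. Te j (f j) x - \<psi> k j x))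
      \<le> C_morrey * morrey_enorm r p (lq_function q (\<lambda>j x. f j x - \<phi> k j x)) + ennreal (2 * (1/2) ^ k)" for k
  proof -
    have "morrey_enorm r p (lq_function q (\<lambda>j x. Te j (f j) x - \<psi> k j x))
        \<le> morrey_enorm r p (\<lambda>x. lq_function q (\<lambda>j x. Te j (f j) x - Te j (\<phi> k j) x) x + lq_function q (\<lambda>j x. Te j (\<phi> k j) x - \<psi> k j x) x)"
    proof (intro morrey_mono pos lq_triangle q_one)
      fix x j show "cmod (Te j (f j) x - \<psi> k j x) \<le> cmod (Te j (f j) x - Te j (\<phi> k j) x) + cmod (Te j (\<phi> k j) x - \<psi> k j x)"
        using norm_triangle_ineq[of "Te j (f j) x - Te j (\<phi> k j) x" "Te j (\<phi> k j) x - \<psi> k j x"] by simp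
    qed
    also have "\<dots> \<le> morrey_enorm r p (lq_function q (\<lambda>j x. Te j (f j) x - Te j (\<phi> k j) x)) + morrey_enorm r p (lq_function q (\<lambda>j x. Te j (\<phi> k j) x - \<psi> k j x))"
      by (intro morrey_add one_less) auto
    also have "\<dots> \<le> C_morrey * morrey_enorm r p (lq_function q (\<lambda>j x. f j x - \<phi> k j x)) + ennreal (2 * (1/2) ^ k)"
    proof (rule add_mono)
      show "morrey_enorm r p (lq_function q (\<lambda>j x. Te j (f j) x - Te j (\<phi> k j) x)) \<le> C_morrey * morrey_enorm r p (lq_function q (\<lambda>j x. f j x - \<phi> k j x))"
        by (rule Te_lq_diff_le[OF fm test_morrey[OF \<phi>(1)]])
      have "morrey_enorm r p (lq_function q (\<lambda>j x. Te j (\<phi> k j) x - \<psi> k j x))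
          \<le> morrey_enorm r p (\<lambda>x. \<Sum>j. eabs (\<lambda>x. Te j (\<phi> k j) x - \<psi> k j x) x)"
        unfolding eabs_def by (intro morrey_mono pos lq_le_suminf q_one)
      also have "\<dots> \<le> (\<Sum>j. morrey_enorm r p (eabs (\<lambda>x. Te j (\<phi> k j) x - \<psi> k j x)))"
        by (intro morrey_suminf one_less) auto
      also have "\<dots> \<le> (\<Sum>j. ennreal ((1/2) ^ j * (1/2) ^ k))" by (intro suminf_le \<psi>(3)) auto
      also have "\<dots> = ennreal (2 * (1/2) ^ k)"
        using sums_mult2[OF geometric_sums[of "1/2::real"], of "(1/2) ^ k"] by (intro suminf_ennreal_eq) auto
      finally show "morrey_enorm r p (lq_function q (\<lambda>j x. Te j (\<phi> k j) x - \<psi> k j x)) \<le> ennreal (2 * (1/2) ^ k)" .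
    qed
    finally show ?thesis .
  qed
  have lim: "(\<lambda>k. C_morrey * morrey_enorm r p (lq_function q (\<lambda>j x. f j x - \<phi> k j x)) + ennreal (2 * (1/2) ^ k)) \<longlonglongrightarrow> C_morrey * 0 + ennreal 0"
    using C_morrey_finite by (intro tendsto_add ennreal_tendsto_cmult tendsto_ennrealI \<phi>(3) summable_LIMSEQ_zero summable_half)
  have "(\<lambda>k. morrey_enorm r p (lq_function q (\<lambda>j x. Te j (f j) x - \<psi> k j x))) \<longlonglongrightarrow> 0"
  proof (rule tendsto_sandwich[OF _ _ tendsto_const])
    show "(\<lambda>k. C_morrey * morrey_enorm r p (lq_function q (\<lambda>j x. f j x - \<phi> k j x)) + ennreal (2 * (1/2) ^ k)) \<longlonglongrightarrow> 0"
      using lim by simp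
  qed (use le in \<open>auto intro: always_eventually\<close>)
  then show ?thesis using Te_morrey_lq[OF fM] \<psi>(1,2) by (auto simp: morrey0_lq_def)
qed

lemma Te_bounded_morrey0_lq:
  "bounded_sequence_operator (morrey0_lq r p q) (\<lambda>f. morrey_enorm r p (lq_function q f)) Te"
proof -
  obtain c where "C_morrey = ennreal c" by (rule C_morrey_real)
  then show ?thesis using Te_morrey0_lq Te_lq_le
    by (auto simp: bounded_sequence_operator_def morrey0_lq_def morrey_lq_def intro!: exI[of _ c])
qed

end

subsection \<open>Adjoints and atoms\<close>

text \<open>This is the sequence of equality in Hoelder's inequality for l_p and l_P, given by an
  explicit formula so that it depends measurably on the point. Finitely many entries keep
  \<open>N\<close> finite; for N = 0 the quotient is 0 and the last sum is 0, hence an inequality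
  there.\<close>

lemma (in conjugate_exponents) lq_dual_witness:
  fixes y :: "nat \<Rightarrow> 'a \<Rightarrow> complex" and m :: nat and x :: 'a
  defines "N \<equiv> (\<Sum>j<m. cmod (y j x) powr P) powr (1 / P)"
  defines "\<beta> \<equiv> \<lambda>j. complex_of_real (cmod (y j x) powr (P - 2) / N powr (P - 1)) * cnj (y j x)"
  shows "(\<Sum>j<m. \<beta> j * y j x) = complex_of_real N"
    and "\<And>j. j < m \<Longrightarrow> \<beta> j * y j x = complex_of_real (cmod (\<beta> j) * cmod (y j x))"
    and "(\<Sum>j<m. cmod (\<beta> j) powr p) \<le> 1"
proof -
  have abs: "cmod (\<beta> j) = cmod (y j x) powr (P - 1) / N powr (P - 1)" for j
  proof (cases "y j x = 0")
    case False
    then have "cmod (y j x) powr (P - 2) * cmod (y j x) = cmod (y j x) powr (P - 1)"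
      using powr_add[of "cmod (y j x)" "P - 2" 1] by simp
    then show ?thesis by (simp add: \<beta>_def norm_mult norm_divide)
  qed (use conj_one_less in \<open>simp add: \<beta>_def\<close>)
  have prod: "\<beta> j * y j x = complex_of_real (cmod (\<beta> j) * cmod (y j x))" for j
  proof (cases "y j x = 0")
    case False
    have "cnj (y j x) * y j x = complex_of_real (cmod (y j x) * cmod (y j x))"
      by (simp add: complex_norm_square[symmetric] mult.commute power2_eq_square[symmetric])
    then have "\<beta> j * y j x = complex_of_real (cmod (y j x) powr (P - 2) / N powr (P - 1) * (cmod (y j x) * cmod (y j x)))"
      by (simp add: \<beta>_def mult.assoc)
    also have "cmod (y j x) powr (P - 2) / N powr (P - 1) * (cmod (y j x) * cmod (y j x)) = cmod (\<beta> j) * cmod (y j x)"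
      by (simp add: \<beta>_def norm_mult norm_divide)
    finally show ?thesis .
  qed simp
  then show "\<And>j. j < m \<Longrightarrow> \<beta> j * y j x = complex_of_real (cmod (\<beta> j) * cmod (y j x))" by blast
  let ?S = "\<Sum>j<m. cmod (y j x) powr P"
  have S0: "0 \<le> ?S" by (intro sum_nonneg) simp
  have NP: "N powr P = ?S" using S0 conj_pos by (simp add: N_def powr_powr)
  have N0: "0 \<le> N" by (simp add: N_def)
  have "(\<Sum>j<m. cmod (\<beta> j) * cmod (y j x)) = N"
  proof (cases "N = 0")
    case False
    have "cmod (y j x) powr (P - 1) * cmod (y j x) = cmod (y j x) powr P" for j
      using powr_add[of "cmod (y j x)" "P - 1" 1] by (cases "y j x = 0") auto
    then have "(\<Sum>j<m. cmod (\<beta> j) * cmod (y j x)) = ?S / N powr (P - 1)"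
      by (simp add: abs sum_divide_distrib)
    also have "\<dots> = N" unfolding NP[symmetric] using False N0 powr_diff[of N P "P - 1"] by simp
    finally show ?thesis .
  qed (simp add: abs)
  then show "(\<Sum>j<m. \<beta> j * y j x) = complex_of_real N" by (simp only: prod of_real_sum[symmetric])
  have "cmod (\<beta> j) powr p = cmod (y j x) powr P / N powr P" for j
    unfolding abs by (simp add: powr_divide powr_powr conj_mult')
  then have "(\<Sum>j<m. cmod (\<beta> j) powr p) = ?S / N powr P" by (simp add: sum_divide_distrib)
  also have "\<dots> \<le> 1" by (simp add: NP divide_le_eq_1)
  finally show "(\<Sum>j<m. cmod (\<beta> j) powr p) \<le> 1" .
qed

context cz_family
begin

lemma Q_one: "1 < Q" using q_conj by (rule conjugate_exponents.conj_one_less)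
lemma Q_pos: "0 < Q" using Q_one by simp

lemma lq_finite_sum:
  assumes "0 < t"
  shows "lq_function t (\<lambda>j x. if j < m then h j x else 0) x = ennreal ((\<Sum>j<m. cmod (h j x) powr t) powr (1 / t))"
proof -
  have "(\<Sum>j. ennreal (cmod (if j < m then h j x else 0) powr t)) = (\<Sum>j<m. ennreal (cmod (if j < m then h j x else 0) powr t))"
    using assms by (intro suminf_finite) auto
  also have "\<dots> = ennreal (\<Sum>j<m. cmod (h j x) powr t)" by (subst sum_ennreal[symmetric]) auto
  finally show ?thesis by (simp add: lq_function_def sum_nonneg)
qed

context
  assumes lin: "\<And>j. linear_on_test_functions (T j)"
begin

lemma adj_exists:
  assumes g: "g \<in> Lp_space P"
  shows "\<exists>h\<in>Lp_space P. \<forall>f\<in>Lp_space p. pairing (ext j f) g = pairing f h"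
proof -
  have C: "ennreal c\<^sub>2 * Lp_norm P g < top" using g by (simp add: Lp_space_def ennreal_mult_less_top)
  obtain h where h: "h \<in> Lp_space P" "\<And>f. f \<in> Lp_space p \<Longrightarrow> pairing (ext j f) g = pairing f h"
  proof (rule Riesz_representation[of "\<lambda>f. pairing (ext j f) g", OF _ _ C])
    fix f f' :: "'n cfun" and a b assume f: "f \<in> Lp_space p" "f' \<in> Lp_space p"
    note [measurable] = Lp_space_measurable[OF g] ext_measurable[OF f(1)] ext_measurable[OF f(2)]
      ext_measurable[OF Lp_space_lincomb[OF one_less f]]
    have "pairing (ext j (\<lambda>x. a * f x + b * f' x)) g = (LINT x|lebesgue. a * (ext j f x * g x) + b * (ext j f' x * g x))"
      unfolding pairing_def
    proof (rule integral_cong_AE)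
      show "AE x in lebesgue. ext j (\<lambda>x. a * f x + b * f' x) x * g x = a * (ext j f x * g x) + b * (ext j f' x * g x)"
        using ext_lincomb[OF lin f, of j a b] by eventually_elim (simp add: algebra_simps)
    qed measurable
    also have "\<dots> = a * pairing (ext j f) g + b * pairing (ext j f') g"
      unfolding pairing_def using integrable_mult(1)[OF ext_Lp_space[OF f(1)] g] integrable_mult(1)[OF ext_Lp_space[OF f(2)] g]
      by simp
    finally show "pairing (ext j (\<lambda>x. a * f x + b * f' x)) g = a * pairing (ext j f) g + b * pairing (ext j f') g" .
  next
    fix f :: "'n cfun" assume f: "f \<in> Lp_space p"
    have "ennreal (cmod (pairing (ext j f) g)) \<le> Lp_norm p (ext j f) * Lp_norm P g"
      unfolding pairing_def by (rule integrable_mult(2)[OF ext_Lp_space[OF f] g])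
    also have "\<dots> \<le> (ennreal c\<^sub>2 * Lp_norm p f) * Lp_norm P g" by (intro mult_right_mono ext_Lp_single f) simp
    finally show "ennreal (cmod (pairing (ext j f) g)) \<le> ennreal c\<^sub>2 * Lp_norm P g * Lp_norm p f" by (simp add: mult_ac)
  qed blast
  then show ?thesis by blast
qed

definition adj :: "nat \<Rightarrow> 'n cfun \<Rightarrow> 'n cfun" where
  "adj j g = (SOME h. h \<in> Lp_space P \<and> (\<forall>f\<in>Lp_space p. pairing (ext j f) g = pairing f h))"

lemma adj:
  assumes "g \<in> Lp_space P"
  shows "adj j g \<in> Lp_space P" "\<And>f. f \<in> Lp_space p \<Longrightarrow> pairing (ext j f) g = pairing f (adj j g)"
proof -
  have "adj j g \<in> Lp_space P \<and> (\<forall>f\<in>Lp_space p. pairing (ext j f) g = pairing f (adj j g))"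
    using adj_exists[OF assms, of j] unfolding adj_def Bex_def by (rule someI_ex)
  then show "adj j g \<in> Lp_space P" "\<And>f. f \<in> Lp_space p \<Longrightarrow> pairing (ext j f) g = pairing f (adj j g)" by auto
qed

lemma adj_measurable: "g \<in> Lp_space P \<Longrightarrow> adj j g \<in> borel_measurable lebesgue"
  using adj(1) Lp_space_measurable by blast

text \<open>Dual testing of the l_Q-valued norm on the annulus produces functions f_j supported in
  that annulus. The adjoints are moved onto the f_j, and the local estimate is applied on the cube
  that carries b. Restricting to j < m makes the exchange of sum and integral elementary.\<close>

lemma adj_local_finite:
  assumes s: "0 < s" and b [measurable]: "b \<in> borel_measurable lebesgue" and bs: "\<And>z. z \<notin> cube x s \<Longrightarrow> b z = 0"
    and g: "\<And>j. g j \<in> Lp_space P" and gb: "\<And>z. lq_function Q g z \<le> b z"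
  shows "Lp_enorm_on P (annulus x s k) (lq_function Q (\<lambda>j x. if j < m then adj j (g j) x else 0)) \<le> decay k * Lp_enorm_on P UNIV b"
proof -
  interpret qQ: conjugate_exponents q Q by (rule q_conj)
  let ?A = "annulus x s k"
  define h where "h j = adj j (g j)" for j
  have h: "h j \<in> Lp_space P" for j unfolding h_def using g by (rule adj(1))
  note [measurable] = Lp_space_measurable[OF h] Lp_space_measurable[OF g]
  define N where "N z = (\<Sum>j<m. cmod (h j z) powr Q) powr (1 / Q)" for z
  have [measurable]: "N \<in> borel_measurable lebesgue" unfolding N_def[abs_def] by measurable
  have N0: "0 \<le> N z" for z by (simp add: N_def)
  have HN: "lq_function Q (\<lambda>j x. if j < m then adj j (g j) x else 0) = (\<lambda>z. ennreal (N z))"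
    unfolding N_def h_def by (rule ext) (rule lq_finite_sum[OF Q_pos])
  have "Lnorm lebesgue P (\<lambda>z. ennreal (N z) * indicator ?A z) \<le> decay k * Lp_enorm_on P UNIV b"
  proof (rule conjugate_exponents.Lnorm_leI_dual[OF conj_sym sigma_finite_lebesgue])
    fix B :: "real ^ 'n \<Rightarrow> real"
    assume B [measurable]: "B \<in> borel_measurable lebesgue" and B0: "\<And>x. 0 \<le> B x"
      and Bf: "Lnorm lebesgue p (\<lambda>x. ennreal (B x)) < top"
    define \<beta> where "\<beta> j z = complex_of_real (cmod (h j z) powr (Q - 2) / N z powr (Q - 1)) * cnj (h j z)" for j z
    note wit = qQ.lq_dual_witness[where y=h and m=m, folded N_def, folded \<beta>_def]
    have [measurable]: "cnj \<in> borel_measurable borel"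
      by (intro borel_measurable_continuous_onI continuous_intros)
    have [measurable]: "\<beta> j \<in> borel_measurable lebesgue" for j unfolding \<beta>_def[abs_def] by measurable
    \<comment> \<open>The scalar test function is spread over the entries by the extremal sequence
      \<beta>. The l_q norm of the family stays below \<open>B\<close>, while its pairing with the
      adjoints reproduces \<open>B\<close> times their l_Q norm.\<close>
    define f where "f j z = (if j < m then complex_of_real (B z * indicator ?A z) * \<beta> j z else 0)" for j z
    have fm [measurable]: "f j \<in> borel_measurable lebesgue" for j unfolding f_def[abs_def] by measurable
    have lqf: "lq_function q f z \<le> ennreal (B z * indicator ?A z)" for z
    proof -
      have "lq_function q f z = lq_function q (\<lambda>j z. complex_of_real (B z * indicator ?A z) * (if j < m then \<beta> j z else 0)) z"
        unfolding lq_function_def f_def by (intro arg_cong[of _ _ "\<lambda>t. epowr t _"] suminf_cong) auto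
      also have "\<dots> = ennreal (cmod (complex_of_real (B z * indicator ?A z))) * lq_function q (\<lambda>j z. if j < m then \<beta> j z else 0) z"
        by (rule lq_scale[OF q_pos])
      also have "\<dots> \<le> ennreal (B z * indicator ?A z) * ennreal 1"
      proof (intro mult_mono)
        have "(\<Sum>j<m. cmod (\<beta> j z) powr q) powr (1 / q) \<le> 1 powr (1 / q)"
          using wit(3)[of z] q_pos by (intro powr_mono2 sum_nonneg) auto
        then show "lq_function q (\<lambda>j z. if j < m then \<beta> j z else 0) z \<le> ennreal 1"
          unfolding lq_finite_sum[OF q_pos] by (intro ennreal_leI) simp
        show "ennreal (cmod (complex_of_real (B z * indicator ?A z))) \<le> ennreal (B z * indicator ?A z)"
          using B0[of z] by (simp add: norm_mult indicator_def)
      qed auto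
      finally show ?thesis by simp
    qed
    have f: "f j \<in> Lp_space p" for j
    proof -
      have "Lp_norm p (f j) \<le> Lp_enorm_on p UNIV (\<lambda>z. ennreal (B z))"
      proof (intro Lp_mono pos)
        fix z
        have "eabs (f j) z \<le> ennreal (B z * indicator ?A z)"
          unfolding eabs_def using lq_ge[OF q_pos] lqf by (rule order_trans)
        also have "\<dots> \<le> ennreal (B z)" using B0[of z] by (intro ennreal_leI) (auto simp: indicator_def)
        finally show "eabs (f j) z \<le> ennreal (B z)" .
      qed
      then show ?thesis using Bf fm by (auto simp: Lp_space_def Lp_enorm_on_UNIV intro: le_less_trans)
    qed
    have supp: "f j z = 0" if "z \<notin> ?A" for j z using that by (simp add: f_def)
    define S where "S z = (\<Sum>j<m. f j z * h j z)" for z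
    have S: "S z = complex_of_real (B z * indicator ?A z * N z)" for z
    proof -
      have "S z = complex_of_real (B z * indicator ?A z) * (\<Sum>j<m. \<beta> j z * h j z)"
        by (simp add: S_def f_def sum_distrib_left mult.assoc)
      then show ?thesis by (simp add: wit(1))
    qed
    have i: "integrable lebesgue (\<lambda>z. f j z * h j z)" for j using f h by (rule integrable_mult(1))
    then have Si: "integrable lebesgue S" unfolding S_def by (intro Bochner_Integration.integrable_sum)
    have SN: "norm (S z) = B z * indicator ?A z * N z" for z
      unfolding S norm_of_real using B0[of z] N0[of z] by (simp add: indicator_def)
    have "(\<integral>\<^sup>+z. ennreal (B z) * (ennreal (N z) * indicator ?A z) \<partial>lebesgue) = (\<integral>\<^sup>+z. ennreal (norm (S z)) \<partial>lebesgue)"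
      unfolding SN using B0 N0 by (intro nn_integral_cong) (auto simp: indicator_def ennreal_mult)
    also have "\<dots> = ennreal (LINT z|lebesgue. norm (S z))" using Si by (intro nn_integral_eq_integral) auto
    also have "(LINT z|lebesgue. norm (S z)) = Re (LINT z|lebesgue. S z)"
      unfolding SN unfolding S integral_complex_of_real by simp
    also have "\<dots> \<le> cmod (LINT z|lebesgue. S z)" by (rule complex_Re_le_cmod)
    \<comment> \<open>Here the adjoint is exchanged for the extension acting on f_j, so that only
      values on the support of the g_j matter from now on.\<close>
    also have "(LINT z|lebesgue. S z) = (\<Sum>j<m. pairing (ext j (f j)) (g j))"
      unfolding S_def using i adj(2)[OF g f] by (simp add: pairing_def h_def)
    also have "cmod (\<Sum>j<m. pairing (ext j (f j)) (g j)) \<le> (\<Sum>j<m. cmod (pairing (ext j (f j)) (g j)))" by (rule norm_sum)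
    also have "ennreal (\<Sum>j<m. cmod (pairing (ext j (f j)) (g j))) = (\<Sum>j<m. ennreal (cmod (pairing (ext j (f j)) (g j))))"
      by (subst sum_ennreal) auto
    also have "\<dots> \<le> (\<Sum>j<m. \<integral>\<^sup>+z. ennreal (cmod (ext j (f j) z)) * ennreal (cmod (g j z)) \<partial>lebesgue)"
    proof (intro sum_mono)
      fix j
      have "ennreal (cmod (pairing (ext j (f j)) (g j))) \<le> (\<integral>\<^sup>+z. ennreal (cmod (ext j (f j) z * g j z)) \<partial>lebesgue)"
        unfolding pairing_def using integrable_mult(1)[OF ext_Lp_space[OF f] g] by (rule integral_norm_bound_ennreal)
      then show "ennreal (cmod (pairing (ext j (f j)) (g j))) \<le> (\<integral>\<^sup>+z. ennreal (cmod (ext j (f j) z)) * ennreal (cmod (g j z)) \<partial>lebesgue)"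
        by (simp add: norm_mult ennreal_mult')
    qed
    also have "\<dots> \<le> (\<Sum>j. \<integral>\<^sup>+z. ennreal (cmod (ext j (f j) z)) * ennreal (cmod (g j z)) \<partial>lebesgue)"
      by (intro sum_le_suminf) auto
    also have "\<dots> = (\<integral>\<^sup>+z. (\<Sum>j. ennreal (cmod (ext j (f j) z)) * ennreal (cmod (g j z))) \<partial>lebesgue)"
    proof -
      note [measurable] = ext_measurable[OF f]
      show ?thesis by (intro nn_integral_suminf[symmetric]) measurable
    qed
    also have "\<dots> \<le> (\<integral>\<^sup>+z\<in>cube x s. lq_function q (\<lambda>j. ext j (f j)) z * b z \<partial>lebesgue)"
    proof (intro nn_integral_mono)
      fix z
      have "(\<Sum>j. ennreal (cmod (ext j (f j) z)) * ennreal (cmod (g j z))) \<le> lq_function q (\<lambda>j. ext j (f j)) z * lq_function Q g z"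
        by (rule qQ.lq_Hoelder)
      also have "\<dots> \<le> lq_function q (\<lambda>j. ext j (f j)) z * b z" using gb by (intro mult_left_mono) auto
      also have "\<dots> = lq_function q (\<lambda>j. ext j (f j)) z * b z * indicator (cube x s) z" using bs[of z] by (auto simp: indicator_def)
      finally show "(\<Sum>j. ennreal (cmod (ext j (f j) z)) * ennreal (cmod (g j z))) \<le> lq_function q (\<lambda>j. ext j (f j)) z * b z * indicator (cube x s) z" .
    qed
    also have "\<dots> \<le> Lp_enorm_on p (cube x s) (lq_function q (\<lambda>j. ext j (f j))) * Lp_enorm_on P (cube x s) b"
      by (rule Hoelder_on) (auto intro: measurable_lq_function ext_measurable f)
    also have "\<dots> \<le> (decay k * Lp_enorm_on p UNIV (lq_function q f)) * Lp_enorm_on P UNIV b"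
      using conj_pos by (intro mult_mono local_estimate[OF f supp s] Lp_le_UNIV) auto
    also have "\<dots> \<le> (decay k * Lnorm lebesgue p (\<lambda>x. ennreal (B x))) * Lp_enorm_on P UNIV b"
    proof (intro mult_right_mono mult_left_mono)
      show "Lp_enorm_on p UNIV (lq_function q f) \<le> Lnorm lebesgue p (\<lambda>x. ennreal (B x))"
        unfolding Lp_enorm_on_UNIV
      proof (intro Lnorm_mono_AE pos AE_I2)
        fix z
        show "lq_function q f z \<le> ennreal (B z)"
          using B0[of z] by (intro order_trans[OF lqf ennreal_leI]) (auto simp: indicator_def)
      qed
    qed auto
    finally show "(\<integral>\<^sup>+z. ennreal (B z) * (ennreal (N z) * indicator ?A z) \<partial>lebesgue)
        \<le> decay k * Lp_enorm_on P UNIV b * Lnorm lebesgue p (\<lambda>x. ennreal (B x))"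
      by (simp add: mult_ac ennreal_leI)
  qed measurable
  then show ?thesis by (simp add: HN Lp_enorm_on_eq)
qed

text \<open>Truncating the sequence at j < m does not change the bound, and Fatou's lemma lets m
  tend to infinity.\<close>

lemma adj_local:
  assumes s: "0 < s" and b: "b \<in> borel_measurable lebesgue" and bs: "\<And>z. z \<notin> cube x s \<Longrightarrow> b z = 0"
    and g: "\<And>j. g j \<in> Lp_space P" and gb: "\<And>z. lq_function Q g z \<le> b z"
  shows "Lp_enorm_on P (annulus x s k) (lq_function Q (\<lambda>j. adj j (g j))) \<le> decay k * Lp_enorm_on P UNIV b"
proof (rule Lp_Fatou_le[OF conj_pos])
  note [measurable] = adj_measurable[OF g]
  show "lq_function Q (\<lambda>j x. if j < m then adj j (g j) x else 0) \<in> borel_measurable lebesgue" for m by measurable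
  show "AE z in lebesgue. z \<in> annulus x s k \<longrightarrow> lq_function Q (\<lambda>j. adj j (g j)) z
      \<le> liminf (\<lambda>m. lq_function Q (\<lambda>j x. if j < m then adj j (g j) x else 0) z)"
  proof (intro AE_I2 impI lq_Fatou Q_pos)
    fix z j
    have "eventually (\<lambda>m. (if j < m then adj j (g j) z else 0) = adj j (g j) z) sequentially"
      using eventually_gt_at_top[of j] by eventually_elim simp
    then show "(\<lambda>m. if j < m then adj j (g j) z else 0) \<longlonglongrightarrow> adj j (g j) z" by (rule tendsto_eventually)
  qed
qed (use adj_local_finite[OF assms] in auto)

lemma Un_annulus:
  assumes s: "0 < s" obtains k where "z \<in> annulus x s k"
proof -
  obtain m :: nat where m: "norm (z - x) / s < 2 ^ m" using real_arch_pow[of 2] by auto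
  have "norm (z - x) \<le> 2 ^ (m + 1) * s"
  proof -
    have "norm (z - x) < 2 ^ m * s" using m s by (simp add: divide_less_eq)
    also have "\<dots> \<le> 2 ^ (m + 1) * s" using s by simp
    finally show ?thesis by simp
  qed
  then have "z \<in> cube x (2 ^ (m + 1) * s)"
    using component_le_norm_cart[of "z - x"] by (auto simp: cube_def intro: order_trans)
  then show ?thesis using annulus_cover that by blast
qed

text \<open>The part of the image on the k-th annulus is a multiple of an atom at level J - k - 2.
  The change of weight and the decay are those of the Morrey estimate, so that summation over k
  gives \<open>C_morrey\<close> again.\<close>

lemma adj_atomic_norm:
  assumes b [measurable]: "b \<in> borel_measurable lebesgue" and bs: "\<And>z. z \<notin> dyadic_cube J M \<Longrightarrow> b z = 0"
    and g: "\<And>j. g j \<in> Lp_space P" and gb: "\<And>z. lq_function Q g z \<le> b z"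
  shows "atomic_norm \<rho> P (lq_function Q (\<lambda>j. adj j (g j))) \<le> C_morrey * (atom_weight TYPE('n) \<rho> P J * Lp_enorm_on P UNIV b)"
proof -
  define s where "s = 2 powr (- real_of_int J)"
  define x :: "real ^ 'n" where "x = s *\<^sub>R (\<chi> i. real_of_int (M $ i))"
  have s: "0 < s" by (simp add: s_def)
  have Q': "dyadic_cube J M = cube x s" by (simp add: dyadic_cube_eq x_def s_def)
  let ?a = "real CARD('n) / p + r"
  let ?H = "lq_function Q (\<lambda>j. adj j (g j))"
  note [measurable] = adj_measurable[OF g]
  have one: "atomic_norm \<rho> P (\<lambda>z. ?H z * indicator (annulus x s k) z)
      \<le> K_loc * ennreal (2 powr (2 * ?a) * (2 powr r) ^ k) * (atom_weight TYPE('n) \<rho> P J * Lp_enorm_on P UNIV b)" for k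
  proof -
    have "atomic_norm \<rho> P (\<lambda>z. ?H z * indicator (annulus x s k) z)
        \<le> atom_weight TYPE('n) \<rho> P (J - int k - 2) * Lp_enorm_on P UNIV (\<lambda>z. ?H z * indicator (annulus x s k) z)"
    proof (rule atomic_norm_cube)
      show "?H z * indicator (annulus x s k) z = 0" if "z \<notin> cube x (2 ^ (k + 1) * s)" for z
        using that annulus_subset_cube[of x s k] by (auto simp: indicator_def)
      have "2 powr (real k + 2 + (- real_of_int J)) = 2 powr real k * 2 powr 2 * 2 powr (- real_of_int J)"
        by (simp only: powr_add)
      then have "2 * (2 ^ (k + 1) * s) = 2 powr (real k + 2 + (- real_of_int J))" by (simp add: s_def powr_realpow)
      then show "2 * (2 ^ (k + 1) * s) \<le> 2 powr (- real_of_int (J - int k - 2))" by (simp add: algebra_simps)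
    qed measurable
    also have "\<dots> \<le> atom_weight TYPE('n) \<rho> P (J - int k - 2) * (decay k * Lp_enorm_on P UNIV b)"
      unfolding Lp_enorm_on_indicator using bs unfolding Q' by (intro mult_left_mono adj_local[OF s b _ g gb]) auto
    also have "\<dots> = K_loc * ennreal (2 powr (- real_of_int (J - int k - 2) * ?a) * 2 powr (- real k * real CARD('n) / p)) * Lp_enorm_on P UNIV b"
      by (simp add: decay_def atom_weight_eq ennreal_mult' mult_ac)
    also have "2 powr (- real_of_int (J - int k - 2) * ?a) * 2 powr (- real k * real CARD('n) / p)
        = 2 powr (- real_of_int (J - int k - 2) * ?a + - real k * real CARD('n) / p)" by (simp only: powr_add)
    also have "- real_of_int (J - int k - 2) * ?a + - real k * real CARD('n) / p = 2 * ?a + real k * r + - real_of_int J * ?a"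
      by (simp add: algebra_simps)
    also have "2 powr (2 * ?a + real k * r + - real_of_int J * ?a) = 2 powr (2 * ?a) * (2 powr r) ^ k * 2 powr (- real_of_int J * ?a)"
      by (simp only: powr_add power_cube_eq)
    also have "K_loc * ennreal (2 powr (2 * ?a) * (2 powr r) ^ k * 2 powr (- real_of_int J * ?a)) * Lp_enorm_on P UNIV b
        = K_loc * ennreal (2 powr (2 * ?a) * (2 powr r) ^ k) * (atom_weight TYPE('n) \<rho> P J * Lp_enorm_on P UNIV b)"
      unfolding atom_weight_eq by (subst ennreal_mult) (auto simp: mult_ac)
    finally show ?thesis .
  qed
  have "atomic_norm \<rho> P ?H \<le> atomic_norm \<rho> P (\<lambda>z. \<Sum>k. ?H z * indicator (annulus x s k) z)"
  proof (intro atomic_norm_mono_AE AE_I2)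
    fix z
    obtain k where k: "z \<in> annulus x s k" using Un_annulus[OF s] by blast
    then show "?H z \<le> (\<Sum>k. ?H z * indicator (annulus x s k) z)"
      using ennreal_le_suminf[of "\<lambda>k. ?H z * indicator (annulus x s k) z" k] by simp
  qed
  also have "\<dots> \<le> (\<Sum>k. atomic_norm \<rho> P (\<lambda>z. ?H z * indicator (annulus x s k) z))" by (rule atomic_norm_suminf)
  also have "\<dots> \<le> (\<Sum>k. K_loc * ennreal (2 powr (2 * ?a) * (2 powr r) ^ k) * (atom_weight TYPE('n) \<rho> P J * Lp_enorm_on P UNIV b))"
    by (intro suminf_le one) auto
  also have "\<dots> = C_morrey * (atom_weight TYPE('n) \<rho> P J * Lp_enorm_on P UNIV b)"
    unfolding C_morrey_def by (rule ennreal_suminf_multc)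
  finally show ?thesis .
qed

text \<open>Every g_j is split along one majorant of the l_Q norm, so that the i-th pieces of all
  entries are dominated together by \<open>b i\<close> and the vector-valued estimate for atoms
  applies to them. The function h_j is the sum over i of the adjoints of these pieces.\<close>

lemma dual_of_majorant:
  assumes g: "\<And>j. g j \<in> borel_measurable lebesgue"
    and maj: "atomic_majorant (lq_function Q g) J M b" and cost: "atomic_cost \<rho> P J b < top"
  obtains h where "\<And>j. h j \<in> borel_measurable lebesgue"
    "atomic_norm \<rho> P (lq_function Q h) \<le> C_morrey * atomic_cost \<rho> P J b"
    "\<And>j \<phi>. \<phi> \<in> test_functions \<Longrightarrow> pairing (T j \<phi>) (g j) = pairing \<phi> (h j)"
proof -
  note [measurable] = g
  have b [measurable]: "b i \<in> borel_measurable lebesgue" for i using maj by (rule atomic_majorant_measurable)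
  \<comment> \<open>The majorant dominates only almost everywhere, while the estimate for atoms asks
    for domination at every point; cutting to \<open>E\<close> removes the exceptional null
    set.\<close>
  define E where "E = {x \<in> space lebesgue. lq_function Q g x \<le> (\<Sum>i. b i x)}"
  have E [measurable]: "E \<in> sets lebesgue" unfolding E_def by measurable
  define u where "u i j x = indicator E x * (complex_of_real (share b i x) * g j x)" for i j x
  have u [measurable]: "u i j \<in> borel_measurable lebesgue" for i j unfolding u_def[abs_def] by measurable
  have u_lq: "lq_function Q (u i) x \<le> b i x" for i x
  proof -
    have "lq_function Q (u i) x = ennreal (cmod (indicator E x * complex_of_real (share b i x))) * lq_function Q g x"
      using lq_scale[OF Q_pos, of "\<lambda>x. indicator E x * complex_of_real (share b i x)" g x]
      by (simp add: u_def[abs_def] mult.assoc)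
    also have "\<dots> \<le> ennreal (share b i x) * (\<Sum>i. b i x)"
      by (cases "x \<in> E") (auto simp: E_def norm_mult share_nonneg intro!: mult_left_mono)
    also have "\<dots> \<le> b i x" by (rule share_mult_le)
    finally show ?thesis .
  qed
  have u_le: "eabs (u i j) x \<le> b i x" for i j x
    using order_trans[OF lq_ge[OF Q_pos, of "u i" j x] u_lq[of i x]] by (simp add: eabs_def)
  have fin: "Lp_enorm_on P UNIV (b i) < top" for i
  proof -
    have "atom_weight TYPE('n) \<rho> P (J i) * Lp_enorm_on P UNIV (b i) < top"
      using ennreal_le_suminf[of "\<lambda>i. atom_weight TYPE('n) \<rho> P (J i) * Lp_enorm_on P UNIV (b i)" i] cost
      unfolding atomic_cost_def by (rule le_less_trans)
    then show ?thesis by (auto simp: ennreal_mult_less_top)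
  qed
  have uP: "u i j \<in> Lp_space P" for i j
  proof -
    have "Lp_norm P (u i j) \<le> Lp_enorm_on P UNIV (b i)" using u_le conj_pos by (intro Lp_mono)
    then show ?thesis using fin[of i] u by (auto simp: Lp_space_def intro: le_less_trans)
  qed
  define a where "a i j = adj j (u i j)" for i j
  have a [measurable]: "a i j \<in> borel_measurable lebesgue" for i j unfolding a_def using uP by (rule adj_measurable)
  define h where "h j x = (\<Sum>i. a i j x)" for j x
  have h [measurable]: "h j \<in> borel_measurable lebesgue" for j unfolding h_def[abs_def] by measurable
  have h_le: "eabs (h j) x \<le> (\<Sum>i. eabs (a i j) x)" for j x
  proof (cases "(\<Sum>i. eabs (a i j) x) < top")
    case True
    then have "(\<Sum>i. ennreal (cmod (a i j x))) < top" unfolding eabs_def .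
    from sums_if_suminf_norm_finite(2)[OF this] show ?thesis by (simp only: h_def eabs_def)
  qed (auto simp: not_less top_unique)
  have a_norm: "(\<Sum>i. atomic_norm \<rho> P (lq_function Q (\<lambda>j. a i j))) \<le> C_morrey * atomic_cost \<rho> P J b"
  proof -
    have "atomic_norm \<rho> P (lq_function Q (\<lambda>j. a i j)) \<le> C_morrey * (atom_weight TYPE('n) \<rho> P (J i) * Lp_enorm_on P UNIV (b i))" for i
      unfolding a_def using maj by (intro adj_atomic_norm[OF b _ uP u_lq]) (auto simp: atomic_majorant_def)
    then have "(\<Sum>i. atomic_norm \<rho> P (lq_function Q (\<lambda>j. a i j))) \<le> (\<Sum>i. C_morrey * (atom_weight TYPE('n) \<rho> P (J i) * Lp_enorm_on P UNIV (b i)))"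
      by (intro suminf_le) auto
    then show ?thesis by (simp add: atomic_cost_def)
  qed
  have h_norm: "atomic_norm \<rho> P (lq_function Q h) \<le> C_morrey * atomic_cost \<rho> P J b"
  proof -
    have "lq_function Q h x \<le> (\<Sum>i. lq_function Q (\<lambda>j. a i j) x)" for x
      using h_le by (intro lq_suminf Q_one) (simp add: eabs_def)
    then have "atomic_norm \<rho> P (lq_function Q h) \<le> atomic_norm \<rho> P (\<lambda>x. \<Sum>i. lq_function Q (\<lambda>j. a i j) x)"
      by (intro atomic_norm_mono_AE AE_I2)
    also have "\<dots> \<le> (\<Sum>i. atomic_norm \<rho> P (lq_function Q (\<lambda>j. a i j)))" by (rule atomic_norm_suminf)
    finally show ?thesis using a_norm by (rule order_trans)
  qed
  \<comment> \<open>Both series may be integrated term by term: on the left because T_j \<phi> lies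
    in the Morrey space, on the right because the sum of the |a i j| has finite atomic norm. For
    single pieces the identity is the definition of the adjoint on L_p'.\<close>
  have pair: "pairing (T j \<phi>) (g j) = pairing \<phi> (h j)" if \<phi>: "\<phi> \<in> test_functions" for j \<phi>
  proof -
    have comm: "pairing f f' = pairing f' f" for f f' :: "'n cfun" by (simp add: pairing_def mult.commute)
    note [measurable] = test_measurable[OF \<phi>] T_measurable[OF \<phi>, of j]
    have "(\<lambda>i. pairing (u i j) (T j \<phi>)) sums pairing (g j) (T j \<phi>)"
    proof (rule sums_integral_of_majorant(1))
      have "atomic_norm \<rho> P (\<lambda>x. \<Sum>i. eabs (u i j) x) \<le> atomic_norm \<rho> P (\<lambda>x. \<Sum>i. b i x)"
        by (intro atomic_norm_mono_AE AE_I2 suminf_le u_le) auto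
      also have "\<dots> \<le> atomic_cost \<rho> P J b" using maj by (intro atomic_norm_le[of _ J M]) (simp add: atomic_majorant_def)
      finally show "atomic_norm \<rho> P (\<lambda>x. \<Sum>i. eabs (u i j) x) < top" using cost by (rule le_less_trans)
      show "morrey_enorm r p (eabs (T j \<phi>)) < top" using T_test_morrey[OF \<phi>, of j] by (rule morrey_finite)
      have "AE x in lebesgue. (\<Sum>i. b i x) < top" using AE_majorant_finite[OF maj cost] .
      moreover have "AE x in lebesgue. lq_function Q g x \<le> (\<Sum>i. b i x)" using maj by (simp add: atomic_majorant_def)
      ultimately show "AE x in lebesgue. (\<lambda>i. u i j x) sums g j x"
      proof eventually_elim
        case (elim x)
        have "ennreal (cmod (g j x)) \<le> (\<Sum>i. b i x)" using order_trans[OF lq_ge[OF Q_pos] elim(2)] .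
        from share_decomposition(1)[where y="g j x" and b=b and x=x, OF this elim(1)] show ?case using elim(2) by (simp add: u_def E_def mult.commute)
      qed
    qed measurable
    moreover have "(\<lambda>i. pairing (a i j) \<phi>) sums pairing (h j) \<phi>"
    proof (rule sums_integral_of_majorant(1))
      have "atomic_norm \<rho> P (\<lambda>x. \<Sum>i. eabs (a i j) x) \<le> (\<Sum>i. atomic_norm \<rho> P (eabs (a i j)))" by (rule atomic_norm_suminf)
      also have "\<dots> \<le> (\<Sum>i. atomic_norm \<rho> P (lq_function Q (\<lambda>j. a i j)))"
        using lq_ge[OF Q_pos, of "\<lambda>j. a _ j"] by (intro suminf_le atomic_norm_mono_AE AE_I2) (auto simp: eabs_def)
      also have "\<dots> \<le> C_morrey * atomic_cost \<rho> P J b" by (rule a_norm)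
      also have "\<dots> < top" using C_morrey_finite cost by (simp add: ennreal_mult_less_top)
      finally show an: "atomic_norm \<rho> P (\<lambda>x. \<Sum>i. eabs (a i j) x) < top" .
      show "morrey_enorm r p (eabs \<phi>) < top" using test_morrey[OF \<phi>] by (rule morrey_finite)
      have "AE x in lebesgue. (\<Sum>i. eabs (a i j) x) < top" using an by (intro AE_finite_if_atomic_norm_finite) auto
      then show "AE x in lebesgue. (\<lambda>i. a i j x) sums h j x"
        unfolding h_def eabs_def by eventually_elim (rule sums_if_suminf_norm_finite(1))
    qed measurable
    moreover have "pairing (u i j) (T j \<phi>) = pairing (a i j) \<phi>" for i
    proof -
      have "pairing (T j \<phi>) (u i j) = pairing (ext j \<phi>) (u i j)"
        using ext_test[OF \<phi>, of j] ext_measurable[OF test_Lp_space[OF pos \<phi>], of j]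
        by (intro pairing_cong_AE) (auto elim: AE_mp)
      also have "\<dots> = pairing \<phi> (a i j)" unfolding a_def by (rule adj(2)[OF uP test_Lp_space[OF pos \<phi>]])
      finally show ?thesis by (simp add: comm[of "u i j"] comm[of "a i j"])
    qed
    ultimately have "pairing (g j) (T j \<phi>) = pairing (h j) \<phi>" by (simp add: sums_iff)
    then show ?thesis by (simp add: comm[of "T j \<phi>"] comm[of \<phi>])
  qed
  show ?thesis by (rule that[OF h h_norm pair])
qed

end

end

subsection \<open>Test functions in the predual space\<close>

lemma test_sum: "finite I \<Longrightarrow> (\<And>i. i \<in> I \<Longrightarrow> \<phi> i \<in> test_functions) \<Longrightarrow> (\<lambda>x. \<Sum>i\<in>I. \<phi> i x) \<in> test_functions"
  by (induction I rule: finite_induct) (auto intro: test_add)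

lemma suminf_tail_less:
  fixes f :: "nat \<Rightarrow> ennreal"
  assumes "suminf f < top" "0 < e"
  obtains m where "(\<Sum>i. f (i + m)) < ennreal e"
proof -
  have lt: "f i < top" for i using ennreal_le_suminf[of f i] assms(1) by (rule le_less_trans)
  define g where "g i = enn2real (f i)" for i
  have fg: "f i = ennreal (g i)" and g0: "0 \<le> g i" for i using lt[of i] by (auto simp: g_def)
  have "(\<Sum>i. ennreal (g i)) < top" using assms(1) by (simp add: fg[symmetric])
  then have s: "summable g" using g0 by (intro summable_suminf_not_top) auto
  obtain m where "norm (\<Sum>i. g (i + m)) < e" using suminf_exist_split[OF assms(2) s] by auto
  moreover have "0 \<le> (\<Sum>i. g (i + m))" using s g0 by (intro suminf_nonneg) (auto simp: summable_iff_shift)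
  ultimately have "(\<Sum>i. g (i + m)) < e" by simp
  moreover have "(\<Sum>i. f (i + m)) = ennreal (\<Sum>i. g (i + m))"
    unfolding fg using s g0 by (intro suminf_ennreal2) (auto simp: summable_iff_shift)
  ultimately show ?thesis using assms(2) by (intro that[of m]) (simp add: ennreal_less_iff \<open>0 \<le> (\<Sum>i. g (i + m))\<close>)
qed

lemma atomic_norm_zero: "atomic_norm \<rho> p (\<lambda>x :: real ^ 'n::finite. 0) = 0"
proof -
  have "atomic_norm \<rho> p (\<lambda>x :: real ^ 'n. 0) \<le> atomic_cost \<rho> p (\<lambda>_. 0) (\<lambda>_ _ :: real ^ 'n. 0)"
    by (rule atomic_norm_le[of _ _ undefined]) (simp add: atomic_majorant_def)
  also have "\<dots> = 0" by (simp add: atomic_cost_def Lp_enorm_on_def)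
  finally show ?thesis by simp
qed

lemma atomic_norm_sum:
  "finite I \<Longrightarrow> atomic_norm \<rho> p (\<lambda>x. \<Sum>i\<in>I. F i x) \<le> (\<Sum>i\<in>I. atomic_norm \<rho> p (F i))"
proof (induction I rule: finite_induct)
  case (insert i I)
  have "atomic_norm \<rho> p (\<lambda>x. F i x + (\<Sum>i\<in>I. F i x)) \<le> atomic_norm \<rho> p (F i) + atomic_norm \<rho> p (\<lambda>x. \<Sum>i\<in>I. F i x)"
    by (rule atomic_norm_add)
  also have "\<dots> \<le> atomic_norm \<rho> p (F i) + (\<Sum>i\<in>I. atomic_norm \<rho> p (F i))" by (intro add_left_mono insert.IH)
  finally show ?case using insert.hyps by simp
qed (simp add: atomic_norm_zero)

context morrey_exponents
begin

lemma P_one: "1 < P" by (rule conj_one_less)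

lemma predual_measurable: "(f :: 'n cfun) \<in> predual \<rho> P \<Longrightarrow> f \<in> borel_measurable lebesgue"
  by (simp add: predual_iff)

lemma predual_finite: "(f :: 'n cfun) \<in> predual \<rho> P \<Longrightarrow> atomic_norm \<rho> P (eabs f) < top"
  by (simp add: predual_iff)

lemma atomic_norm_lincomb_le:
  fixes f g :: "'n cfun"
  shows "atomic_norm \<rho> P (eabs (\<lambda>x. a * f x + b * g x))
    \<le> ennreal (cmod a) * atomic_norm \<rho> P (eabs f) + ennreal (cmod b) * atomic_norm \<rho> P (eabs g)"
proof -
  have "atomic_norm \<rho> P (eabs (\<lambda>x. a * f x + b * g x))
      \<le> atomic_norm \<rho> P (\<lambda>x. ennreal (cmod a) * eabs f x + ennreal (cmod b) * eabs g x)"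
  proof (intro atomic_norm_mono_AE AE_I2)
    fix x
    have "cmod (a * f x + b * g x) \<le> cmod a * cmod (f x) + cmod b * cmod (g x)"
      by (rule order_trans[OF norm_triangle_ineq]) (simp add: norm_mult)
    then show "eabs (\<lambda>x. a * f x + b * g x) x \<le> ennreal (cmod a) * eabs f x + ennreal (cmod b) * eabs g x"
      unfolding eabs_def by (simp add: ennreal_mult'[symmetric] ennreal_plus[symmetric] ennreal_leI del: ennreal_plus)
  qed
  also have "\<dots> \<le> atomic_norm \<rho> P (\<lambda>x. ennreal (cmod a) * eabs f x) + atomic_norm \<rho> P (\<lambda>x. ennreal (cmod b) * eabs g x)"
    by (rule atomic_norm_add)
  also have "\<dots> \<le> ennreal (cmod a) * atomic_norm \<rho> P (eabs f) + ennreal (cmod b) * atomic_norm \<rho> P (eabs g)"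
    using conj_pos by (intro add_mono atomic_norm_cmult_le) auto
  finally show ?thesis .
qed

lemma predual_lincomb:
  fixes f g :: "'n cfun"
  assumes f: "f \<in> predual \<rho> P" and g: "g \<in> predual \<rho> P"
  shows "(\<lambda>x. a * f x + b * g x) \<in> predual \<rho> P"
proof -
  note [measurable] = predual_measurable[OF f] predual_measurable[OF g]
  have "ennreal (cmod a) * atomic_norm \<rho> P (eabs f) + ennreal (cmod b) * atomic_norm \<rho> P (eabs g) < top"
    using predual_finite[OF f] predual_finite[OF g] by (simp add: ennreal_mult_less_top)
  with atomic_norm_lincomb_le have "atomic_norm \<rho> P (eabs (\<lambda>x. a * f x + b * g x)) < top" by (rule le_less_trans)
  then show ?thesis by (simp add: predual_iff)
qed

lemma predual_diff:
  fixes f g :: "'n cfun"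
  shows "f \<in> predual \<rho> P \<Longrightarrow> g \<in> predual \<rho> P \<Longrightarrow> (\<lambda>x. f x - g x) \<in> predual \<rho> P"
  using predual_lincomb[of f g 1 "-1"] by simp

lemma test_predual:
  fixes \<phi> :: "'n cfun"
  assumes \<phi>: "\<phi> \<in> test_functions" shows "\<phi> \<in> predual \<rho> P"
proof -
  note [measurable] = test_measurable[OF \<phi>]
  obtain R where R: "\<And>x. x \<in> supp \<phi> \<Longrightarrow> norm x \<le> R"
    using compact_imp_bounded[OF test_compact[OF \<phi>]] unfolding bounded_iff by blast
  obtain m :: nat where "R < 2 ^ m" using real_arch_pow[of 2 R] by auto
  then have "supp \<phi> \<subseteq> ball 0 (2 ^ m)" using R by fastforce
  then have s: "supp \<phi> \<subseteq> cube 0 (2 ^ m)" using ball_subset_cube by (rule order_trans)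
  have "atomic_norm \<rho> P (eabs \<phi>) \<le> atom_weight TYPE('n) \<rho> P (- int m - 1) * Lp_enorm_on P UNIV (eabs \<phi>)"
  proof (rule atomic_norm_cube[of _ 0 "2 ^ m"])
    show "eabs \<phi> x = 0" if "x \<notin> cube 0 (2 ^ m)" for x using that s not_in_supp[of x \<phi>] by (auto simp: eabs_def)
    show "2 * 2 ^ m \<le> 2 powr - real_of_int (- int m - 1)" by (simp add: powr_add powr_realpow)
  qed measurable
  also have "\<dots> < top" using test_Lp_space[OF conj_pos \<phi>] by (simp add: Lp_space_def ennreal_mult_less_top)
  finally show ?thesis by (simp add: predual_iff)
qed

lemma ae_eq_if_test_pairings_eq:
  fixes f g :: "'n cfun"
  assumes [measurable]: "f \<in> borel_measurable lebesgue" "g \<in> borel_measurable lebesgue"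
    and f: "\<And>\<phi>. \<phi> \<in> test_functions \<Longrightarrow> integrable lebesgue (\<lambda>x. \<phi> x * f x)"
    and g: "\<And>\<phi>. \<phi> \<in> test_functions \<Longrightarrow> integrable lebesgue (\<lambda>x. \<phi> x * g x)"
    and eq: "\<And>\<phi>. \<phi> \<in> test_functions \<Longrightarrow> pairing \<phi> f = pairing \<phi> g"
  shows "f =ae g"
proof -
  have "AE x in lebesgue. f x - g x = 0"
  proof (rule AE_zero_if_test_integrals_zero)
    fix \<phi> :: "'n cfun" assume \<phi>: "\<phi> \<in> test_functions"
    have e: "(\<lambda>x. (f x - g x) * \<phi> x) = (\<lambda>x. \<phi> x * f x - \<phi> x * g x)" by (simp add: algebra_simps)
    show "integrable lebesgue (\<lambda>x. (f x - g x) * \<phi> x)"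
      unfolding e using f[OF \<phi>] g[OF \<phi>] by (rule Bochner_Integration.integrable_diff)
    show "pairing (\<lambda>x. f x - g x) \<phi> = 0"
      unfolding pairing_def e using f[OF \<phi>] g[OF \<phi>] eq[OF \<phi>] by (simp add: pairing_def)
  qed measurable
  then show ?thesis by eventually_elim simp
qed

lemma test_integrable_predual:
  fixes \<phi> g :: "'n cfun"
  assumes \<phi>: "\<phi> \<in> test_functions" and g: "g \<in> predual \<rho> P"
  shows "integrable lebesgue (\<lambda>x. \<phi> x * g x)"
  using \<phi> test_subset_schwartz predual_measurable[OF g] predual_finite[OF g] test_measurable[OF \<phi>]
  by (intro integrable_if_dual(1) morrey_schwartz_finite) auto

lemma predual_ae_eq:
  fixes f g :: "'n cfun"
  assumes "f \<in> predual \<rho> P" "g \<in> predual \<rho> P" "\<And>\<phi>. \<phi> \<in> test_functions \<Longrightarrow> pairing \<phi> f = pairing \<phi> g"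
  shows "f =ae g"
  using assms by (intro ae_eq_if_test_pairings_eq predual_measurable test_integrable_predual) auto

text \<open>Approximation in L_P with supports in a slightly larger open cube leaves an error that
  is itself a multiple of an atom, so that a small L_P norm means a small atomic norm.\<close>

lemma atom_test_approx:
  fixes u :: "'n cfun"
  assumes [measurable]: "u \<in> borel_measurable lebesgue" and u: "\<And>x. x \<notin> dyadic_cube J M \<Longrightarrow> u x = 0"
    and fin: "Lp_norm P u < top" and e: "0 < e"
  obtains \<phi> where "\<phi> \<in> test_functions" "atomic_norm \<rho> P (eabs (\<lambda>x. u x - \<phi> x)) < ennreal e"
proof -
  define s where "s = 2 powr (- real_of_int J)"
  define z :: "real ^ 'n" where "z = s *\<^sub>R (\<chi> i. real_of_int (M $ i))"
  have s: "0 < s" by (simp add: s_def)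
  have D: "dyadic_cube J M = cube z s" by (simp add: dyadic_cube_eq s_def z_def)
  let ?U = "{w :: real ^ 'n. \<forall>i. \<bar>w $ i - z $ i\<bar> < 2 * s}"
  have U: "u x = 0" if "x \<notin> ?U" for x
  proof (rule u)
    show "x \<notin> dyadic_cube J M" unfolding D
    proof
      assume "x \<in> cube z s"
      then have "\<bar>x $ i - z $ i\<bar> \<le> s" for i by (simp add: cube_def)
      then have "\<bar>x $ i - z $ i\<bar> < 2 * s" for i by (rule le_less_trans) (use s in simp)
      then show False using that by simp
    qed
  qed
  \<comment> \<open>The error lives in the cube of radius 2s, and its inclusion in a dyadic cube
    doubles the radius once more; hence the level J - 2.\<close>
  let ?w = "atom_weight TYPE('n) \<rho> P (J - 2)"
  obtain d where d: "0 < d" "\<And>x. x < ennreal d \<Longrightarrow> ?w * x < ennreal e"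
    using ennreal_mult_less_epsilon[of ?w e] e by auto
  have "u \<in> Lp_space P" using fin by (simp add: Lp_space_def)
  then obtain \<phi> where \<phi>: "\<phi> \<in> test_functions" "supp \<phi> \<subseteq> ?U" "Lp_norm P (\<lambda>x. u x - \<phi> x) < ennreal d"
    by (rule test_dense[OF P_one _ open_cube_sets, where f=u, OF _ U d(1)])
  note [measurable] = test_measurable[OF \<phi>(1)]
  have "atomic_norm \<rho> P (eabs (\<lambda>x. u x - \<phi> x)) \<le> ?w * Lp_norm P (\<lambda>x. u x - \<phi> x)"
  proof (rule atomic_norm_cube[of _ z "2 * s"])
    fix x assume "x \<notin> cube z (2 * s)"
    then have "x \<notin> ?U" unfolding cube_def by (auto simp: not_le) (meson less_asym)
    then show "eabs (\<lambda>x. u x - \<phi> x) x = 0" using U[of x] \<phi>(2) not_in_supp[of x \<phi>] by (auto simp: eabs_def)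
  next
    have "2 powr - real_of_int (J - 2) = 2 powr (2 + - real_of_int J)" by simp
    also have "\<dots> = 2 powr 2 * s" unfolding s_def by (rule powr_add)
    finally show "2 * (2 * s) \<le> 2 powr - real_of_int (J - 2)" by simp
  qed measurable
  also have "\<dots> < ennreal e" by (rule d(2)) (rule \<phi>(3))
  finally show ?thesis using \<phi>(1) that by blast
qed

text \<open>A finite cost has small tails. The first m pieces of g are approximated one at a time,
  and the remaining pieces are controlled by the tail of the majorant.\<close>

lemma predual_test_dense:
  fixes g :: "'n cfun"
  assumes g: "g \<in> predual \<rho> P" and e: "0 < e"
  obtains \<phi> where "\<phi> \<in> test_functions" "atomic_norm \<rho> P (eabs (\<lambda>x. g x - \<phi> x)) < ennreal e"
proof -
  note [measurable] = predual_measurable[OF g]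
  obtain J M b where maj: "atomic_majorant (eabs g) J M b" and cost: "atomic_cost \<rho> P J b < top"
    using predual_finite[OF g] by (rule atomic_norm_less)
  have [measurable]: "b i \<in> borel_measurable lebesgue" for i using maj by (rule atomic_majorant_measurable)
  have b0: "b i x = 0" if "x \<notin> dyadic_cube (J i) (M i)" for i x using maj that by (simp add: atomic_majorant_def)
  let ?c = "\<lambda>i. atom_weight TYPE('n) \<rho> P (J i) * Lp_enorm_on P UNIV (b i)"
  have c: "suminf ?c < top" using cost by (simp add: atomic_cost_def)
  define E where "E = {x \<in> space lebesgue. eabs g x \<le> (\<Sum>i. b i x)}"
  have [measurable]: "E \<in> sets lebesgue" unfolding E_def by measurable
  define u where "u i x = indicator E x * (g x * complex_of_real (share b i x))" for i x
  have u [measurable]: "u i \<in> borel_measurable lebesgue" for i unfolding u_def[abs_def] by measurable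
  have ub: "eabs (u i) x \<le> b i x" for i x
  proof (cases "x \<in> E")
    case True
    have "eabs (u i) x = ennreal (share b i x) * eabs g x"
      using True by (simp add: u_def eabs_def norm_mult share_nonneg ennreal_mult' mult.commute)
    also have "\<dots> \<le> ennreal (share b i x) * (\<Sum>i. b i x)" using True by (intro mult_left_mono) (auto simp: E_def)
    also have "\<dots> \<le> b i x" by (rule share_mult_le)
    finally show ?thesis .
  qed (simp add: u_def eabs_def)
  obtain m where m: "(\<Sum>i. ?c (i + m)) < ennreal (e / 2)" using suminf_tail_less[OF c, of "e / 2"] e by auto
  \<comment> \<open>The m errors together are at most m/(m+1) times e/2; the summand 1 in the
    denominator admits m = 0.\<close>
  have "\<exists>\<phi>. \<phi> \<in> test_functions \<and> atomic_norm \<rho> P (eabs (\<lambda>x. u i x - \<phi> x)) < ennreal (e / 2 / (m + 1))" for i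
  proof -
    have "?c i < top" using ennreal_le_suminf[of ?c i] c by (rule le_less_trans)
    then have "Lp_enorm_on P UNIV (b i) < top" by (auto simp: ennreal_mult_less_top)
    moreover have "Lp_norm P (u i) \<le> Lp_enorm_on P UNIV (b i)" using conj_pos ub by (intro Lp_mono) auto
    ultimately have fin: "Lp_norm P (u i) < top" by (rule le_less_trans[rotated])
    have "u i x = 0" if "x \<notin> dyadic_cube (J i) (M i)" for x
      using ub[of i x] b0[OF that] by (simp add: eabs_def)
    moreover have "0 < e / 2 / (m + 1)" using e by simp
    ultimately show ?thesis using fin atom_test_approx[OF u, of "J i" "M i" i "e / 2 / (m + 1)"] by metis
  qed
  then obtain \<phi> where \<phi>: "\<And>i. \<phi> i \<in> test_functions"
      "\<And>i. atomic_norm \<rho> P (eabs (\<lambda>x. u i x - \<phi> i x)) < ennreal (e / 2 / (m + 1))"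
    by metis
  have tail: "atomic_norm \<rho> P (\<lambda>x. \<Sum>i. b (i + m) x) \<le> (\<Sum>i. ?c (i + m))"
  proof -
    have "atomic_majorant (\<lambda>x. \<Sum>i. b (i + m) x) (\<lambda>i. J (i + m)) (\<lambda>i. M (i + m)) (\<lambda>i. b (i + m))"
      using maj by (simp add: atomic_majorant_def)
    then show ?thesis by (rule order_trans[OF atomic_norm_le]) (simp add: atomic_cost_def)
  qed
  have pw: "AE x in lebesgue. eabs (\<lambda>x. g x - (\<Sum>i<m. \<phi> i x)) x \<le> (\<Sum>i<m. eabs (\<lambda>x. u i x - \<phi> i x) x) + (\<Sum>i. b (i + m) x)"
  proof -
    have "AE x in lebesgue. eabs g x \<le> (\<Sum>i. b i x)" using maj by (simp add: atomic_majorant_def)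
    moreover have "AE x in lebesgue. (\<Sum>i. b i x) < top" using AE_majorant_finite[OF maj cost] .
    ultimately show ?thesis
    proof eventually_elim
      case (elim x)
      have le: "ennreal (cmod (g x)) \<le> (\<Sum>i. b i x)" using elim(1) by (simp add: eabs_def)
      have ux: "u i x = g x * complex_of_real (share b i x)" for i using elim(1) by (simp add: u_def E_def)
      have s: "(\<lambda>i. u i x) sums g x"
        unfolding ux using share_decomposition(1)[where y="g x" and b=b and x=x, OF le elim(2)] .
      have fin: "(\<Sum>i. ennreal (cmod (u (i + m) x))) \<le> (\<Sum>i. b (i + m) x)"
        using ub by (intro suminf_le allI) (auto simp: eabs_def)
      have tl: "ennreal (cmod (\<Sum>i. u (i + m) x)) \<le> (\<Sum>i. ennreal (cmod (u (i + m) x)))"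
      proof -
        have "(\<Sum>i. ennreal (cmod (u i x))) = ennreal (cmod (g x))"
          unfolding ux using share_decomposition(2)[where y="g x" and b=b and x=x, OF le elim(2)] .
        then have "summable (\<lambda>i. cmod (u i x))" by (intro summable_suminf_not_top) auto
        then have "summable (\<lambda>i. cmod (u (i + m) x))" by (rule summable_ignore_initial_segment)
        then show ?thesis by (subst suminf_ennreal2) (auto intro!: ennreal_leI summable_norm)
      qed
      have "g x = (\<Sum>i. u (i + m) x) + (\<Sum>i<m. u i x)"
        using suminf_split_initial_segment[OF sums_summable[OF s], of m] sums_unique[OF s] by simp
      then have "g x - (\<Sum>i<m. \<phi> i x) = (\<Sum>i<m. u i x - \<phi> i x) + (\<Sum>i. u (i + m) x)" by (simp add: sum_subtractf)
      then have "cmod (g x - (\<Sum>i<m. \<phi> i x)) \<le> (\<Sum>i<m. cmod (u i x - \<phi> i x)) + cmod (\<Sum>i. u (i + m) x)"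
        by (simp only:) (intro norm_triangle_le add_right_mono norm_sum)
      then have "ennreal (cmod (g x - (\<Sum>i<m. \<phi> i x))) \<le> ennreal ((\<Sum>i<m. cmod (u i x - \<phi> i x)) + cmod (\<Sum>i. u (i + m) x))"
        by (rule ennreal_leI)
      also have "\<dots> = (\<Sum>i<m. ennreal (cmod (u i x - \<phi> i x))) + ennreal (cmod (\<Sum>i. u (i + m) x))"
        by (subst ennreal_plus) (auto intro: sum_nonneg simp: sum_ennreal)
      also have "\<dots> \<le> (\<Sum>i<m. ennreal (cmod (u i x - \<phi> i x))) + (\<Sum>i. b (i + m) x)"
        by (intro add_left_mono order_trans[OF tl fin])
      finally show ?case unfolding eabs_def .
    qed
  qed
  have "atomic_norm \<rho> P (eabs (\<lambda>x. g x - (\<Sum>i<m. \<phi> i x)))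
      \<le> atomic_norm \<rho> P (\<lambda>x. (\<Sum>i<m. eabs (\<lambda>x. u i x - \<phi> i x) x) + (\<Sum>i. b (i + m) x))"
    using pw by (rule atomic_norm_mono_AE)
  also have "\<dots> \<le> atomic_norm \<rho> P (\<lambda>x. \<Sum>i<m. eabs (\<lambda>x. u i x - \<phi> i x) x) + atomic_norm \<rho> P (\<lambda>x. \<Sum>i. b (i + m) x)"
    by (rule atomic_norm_add)
  also have "\<dots> \<le> (\<Sum>i<m. atomic_norm \<rho> P (eabs (\<lambda>x. u i x - \<phi> i x))) + (\<Sum>i. ?c (i + m))"
    by (intro add_mono tail atomic_norm_sum) simp
  also have "\<dots> \<le> (\<Sum>i<m. ennreal (e / 2 / (m + 1))) + (\<Sum>i. ?c (i + m))"
    using \<phi>(2) by (intro add_right_mono sum_mono less_imp_le)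
  also have "\<dots> = ennreal (m * (e / 2 / (m + 1))) + (\<Sum>i. ?c (i + m))"
    using e by (simp add: ennreal_of_nat_eq_real_of_nat ennreal_mult[symmetric])
  also have "\<dots> \<le> ennreal (e / 2) + (\<Sum>i. ?c (i + m))"
    using e by (intro add_right_mono ennreal_leI) (simp add: field_simps)
  also have "\<dots> < ennreal (e / 2) + ennreal (e / 2)" using m by (intro ennreal_add_left_cancel_less[THEN iffD2]) simp
  also have "\<dots> = ennreal e" using e by (simp add: ennreal_plus[symmetric] del: ennreal_plus)
  finally have "atomic_norm \<rho> P (eabs (\<lambda>x. g x - (\<Sum>i<m. \<phi> i x))) < ennreal e" .
  moreover have "(\<lambda>x. \<Sum>i<m. \<phi> i x) \<in> test_functions" using \<phi>(1) by (intro test_sum) auto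
  ultimately show ?thesis using that by blast
qed

text \<open>Both extensions are linear and bounded, hence Lipschitz, and they agree on the dense set
  of test functions.\<close>

lemma predual_extension_unique:
  fixes S S' :: "'n cfun \<Rightarrow> 'n cfun"
  assumes S: "linear_bounded_extension (predual \<rho> P) (predual_enorm \<rho> P) T S"
    and S': "linear_bounded_extension (predual \<rho> P) (predual_enorm \<rho> P) T S'"
    and g: "g \<in> predual \<rho> P"
  shows "S g =ae S' g"
proof -
  have cl: "R f \<in> predual \<rho> P" if "f \<in> predual \<rho> P" "linear_bounded_extension (predual \<rho> P) (predual_enorm \<rho> P) T R" for R f
    using that by (auto simp: linear_bounded_extension_def bounded_extension_def bounded_operator_def operator_on_def)
  have bd: "\<exists>c::real. 0 \<le> c \<and> (\<forall>f\<in>predual \<rho> P. atomic_norm \<rho> P (eabs (R f)) \<le> ennreal c * atomic_norm \<rho> P (eabs f))"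
    if R: "linear_bounded_extension (predual \<rho> P) (predual_enorm \<rho> P) T R" for R
  proof -
    obtain c :: real where c: "\<And>f. f \<in> predual \<rho> P \<Longrightarrow> predual_enorm \<rho> P (R f) \<le> ennreal c * predual_enorm \<rho> P f"
      using R by (auto simp: linear_bounded_extension_def bounded_extension_def bounded_operator_def)
    have "atomic_norm \<rho> P (eabs (R f)) \<le> ennreal (max 0 c) * atomic_norm \<rho> P (eabs f)" if f: "f \<in> predual \<rho> P" for f
      using c[OF f] unfolding predual_enorm_eq[OF f] predual_enorm_eq[OF cl[OF f R]]
      by (rule order_trans) (intro mult_right_mono ennreal_leI, auto)
    then show ?thesis by (intro exI[of _ "max 0 c"]) auto
  qed
  obtain c where c: "0 \<le> c" "\<And>f. f \<in> predual \<rho> P \<Longrightarrow> atomic_norm \<rho> P (eabs (S f)) \<le> ennreal c * atomic_norm \<rho> P (eabs f)"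
    using bd[OF S] by blast
  obtain c' where c': "0 \<le> c'" "\<And>f. f \<in> predual \<rho> P \<Longrightarrow> atomic_norm \<rho> P (eabs (S' f)) \<le> ennreal c' * atomic_norm \<rho> P (eabs f)"
    using bd[OF S'] by blast
  have mS: "S g \<in> predual \<rho> P" "S' g \<in> predual \<rho> P" using cl[OF g] S S' by auto
  note [measurable] = predual_measurable[OF mS(1)] predual_measurable[OF mS(2)]
  have "atomic_norm \<rho> P (eabs (\<lambda>x. S g x - S' g x)) = 0"
  proof (rule ccontr)
    assume "atomic_norm \<rho> P (eabs (\<lambda>x. S g x - S' g x)) \<noteq> 0"
    moreover have "atomic_norm \<rho> P (eabs (\<lambda>x. S g x - S' g x)) < top" using predual_finite[OF predual_diff[OF mS]] .
    ultimately obtain t where t: "atomic_norm \<rho> P (eabs (\<lambda>x. S g x - S' g x)) = ennreal t" "0 < t"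
      by (cases "atomic_norm \<rho> P (eabs (\<lambda>x. S g x - S' g x))") (auto simp: less_le)
    \<comment> \<open>The test function is chosen so close to g that the two Lipschitz bounds
      together fall below the supposed norm t of the difference.\<close>
    obtain d where d: "0 < d" "\<And>x. x < ennreal d \<Longrightarrow> (ennreal c + ennreal c') * x < ennreal t"
      using ennreal_mult_less_epsilon[of "ennreal c + ennreal c'" t] t(2) by auto
    obtain \<phi> where \<phi>: "\<phi> \<in> test_functions" "atomic_norm \<rho> P (eabs (\<lambda>x. g x - \<phi> x)) < ennreal d"
      using predual_test_dense[OF g d(1)] by blast
    have lin: "R (\<lambda>x. g x - \<phi> x) =ae (\<lambda>x. R g x - T \<phi> x)"
      if R: "linear_bounded_extension (predual \<rho> P) (predual_enorm \<rho> P) T R" for R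
    proof -
      have "R (\<lambda>x. 1 * g x + (-1) * \<phi> x) =ae (\<lambda>x. 1 * R g x + (-1) * R \<phi> x)"
        using R g test_predual[OF \<phi>(1)] unfolding linear_bounded_extension_def linear_operator_def by blast
      moreover have "R \<phi> =ae T \<phi>" using R \<phi>(1) unfolding linear_bounded_extension_def bounded_extension_def by blast
      ultimately show ?thesis by eventually_elim simp
    qed
    have df: "(\<lambda>x. g x - \<phi> x) \<in> predual \<rho> P" using g test_predual[OF \<phi>(1)] by (rule predual_diff)
    have "atomic_norm \<rho> P (eabs (\<lambda>x. S g x - S' g x)) = atomic_norm \<rho> P (eabs (\<lambda>x. 1 * S (\<lambda>x. g x - \<phi> x) x + (-1) * S' (\<lambda>x. g x - \<phi> x) x))"
    proof (rule atomic_norm_cong_AE)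
      show "AE x in lebesgue. eabs (\<lambda>x. S g x - S' g x) x = eabs (\<lambda>x. 1 * S (\<lambda>x. g x - \<phi> x) x + (-1) * S' (\<lambda>x. g x - \<phi> x) x) x"
        using lin[OF S] lin[OF S'] by eventually_elim (simp add: eabs_def)
    qed
    also have "\<dots> \<le> ennreal (cmod 1) * atomic_norm \<rho> P (eabs (S (\<lambda>x. g x - \<phi> x))) + ennreal (cmod (-1)) * atomic_norm \<rho> P (eabs (S' (\<lambda>x. g x - \<phi> x)))"
      by (rule atomic_norm_lincomb_le)
    also have "\<dots> \<le> (ennreal c + ennreal c') * atomic_norm \<rho> P (eabs (\<lambda>x. g x - \<phi> x))"
      using add_mono[OF c(2)[OF df] c'(2)[OF df]] by (simp add: distrib_right)
    also have "\<dots> < ennreal t" by (rule d(2)) (rule \<phi>(2))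
    finally show False using t by simp
  qed
  then have "AE x in lebesgue. eabs (\<lambda>x. S g x - S' g x) x = 0" by (intro atomic_norm_eq_0D) auto
  then show ?thesis by eventually_elim (simp add: eabs_def)
qed

end

subsection \<open>Dual operators on the predual space\<close>

context cz_family
begin

context
  assumes lin: "\<And>j. linear_on_test_functions (T j)"
begin

text \<open>The sequence whose only nonzero entry is g makes \<open>dual_of_majorant\<close> produce
  the candidate h. The identity holds for test functions, and both sides are continuous in f for the
  Morrey norm, so that it extends to the closure.\<close>

lemma dual_exists:
  assumes g: "g \<in> predual \<rho> P"
  shows "\<exists>h\<in>predual \<rho> P. \<forall>f\<in>morrey0 r p. pairing (Te j f) g = pairing f h"
proof -
  note [measurable] = predual_measurable[OF g]
  define G :: "nat \<Rightarrow> 'n cfun" where "G i = (if i = j then g else (\<lambda>x. 0))" for i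
  have G: "G i \<in> borel_measurable lebesgue" for i by (simp add: G_def)
  have lqG: "lq_function Q G = eabs g" unfolding G_def by (rule lq_single_function[OF Q_pos])
  obtain J M b where maj: "atomic_majorant (lq_function Q G) J M b" and cost: "atomic_cost \<rho> P J b < top"
    using predual_finite[OF g] unfolding lqG[symmetric] by (rule atomic_norm_less)
  obtain h where h: "\<And>i. h i \<in> borel_measurable lebesgue"
    "atomic_norm \<rho> P (lq_function Q h) \<le> C_morrey * atomic_cost \<rho> P J b"
    "\<And>i \<phi>. \<phi> \<in> test_functions \<Longrightarrow> pairing (T i \<phi>) (G i) = pairing \<phi> (h i)"
    using dual_of_majorant[OF lin G maj cost] by blast
  have "atomic_norm \<rho> P (eabs (h j)) \<le> atomic_norm \<rho> P (lq_function Q h)"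
    using lq_ge[OF Q_pos, of h j] by (intro atomic_norm_mono_AE AE_I2) (simp add: eabs_def)
  also have "\<dots> < top" using h(2) C_morrey_finite cost by (auto simp: ennreal_mult_less_top intro: le_less_trans)
  finally have hP: "h j \<in> predual \<rho> P" using h(1) by (simp add: predual_iff)
  note [measurable] = h(1)[of j]
  have "pairing (Te j f) g = pairing f (h j)" if f: "f \<in> morrey0 r p" for f
  proof (rule ccontr)
    assume ne: "pairing (Te j f) g \<noteq> pairing f (h j)"
    let ?D = "pairing (Te j f) g - pairing f (h j)"
    let ?C = "atomic_norm \<rho> P (eabs g) + atomic_norm \<rho> P (eabs (h j))"
    have "?C < top" using predual_finite[OF g] predual_finite[OF hP] by simp
    then obtain d where d: "0 < d" "\<And>x. x < ennreal d \<Longrightarrow> ?C * x < ennreal (cmod ?D)"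
      using ennreal_mult_less_epsilon[of ?C "cmod ?D"] ne by auto
    have d2: "0 < d / 2" using d(1) by simp
    obtain \<phi> where \<phi>: "\<phi> \<in> test_functions" "morrey_enorm r p (eabs (\<lambda>x. f x - \<phi> x)) < ennreal (d / 2)"
      "morrey_enorm r p (eabs (\<lambda>x. Te j f x - T j \<phi> x)) < ennreal (d / 2)"
      using morrey0_approx_T[OF f d2] by blast
    have m: "f \<in> morrey r p" "\<phi> \<in> morrey r p" "Te j f \<in> morrey r p" "T j \<phi> \<in> morrey r p"
      using f Te_morrey0[OF f, of j] test_morrey[OF \<phi>(1)] T_test_morrey[OF \<phi>(1)] morrey0_subset by auto
    note [measurable] = m[THEN morrey_measurable]
    have i: "integrable lebesgue (\<lambda>x. k x * l x)" if "k \<in> morrey r p" "l \<in> predual \<rho> P" for k l :: "'n cfun"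
      using that by (intro integrable_if_dual(1) morrey_measurable morrey_finite predual_measurable predual_finite)
    have s: "pairing (\<lambda>x. k x - k' x) l = pairing k l - pairing k' l"
      if "k \<in> morrey r p" "k' \<in> morrey r p" "l \<in> predual \<rho> P" for k k' l :: "'n cfun"
      unfolding pairing_def using i[OF that(1,3)] i[OF that(2,3)] by (simp add: left_diff_distrib)
    have G': "pairing (T j \<phi>) g = pairing \<phi> (h j)" using h(3)[OF \<phi>(1), of j] by (simp add: G_def)
    have D: "?D = pairing (\<lambda>x. Te j f x - T j \<phi> x) g - pairing (\<lambda>x. f x - \<phi> x) (h j)"
      using s[OF m(3,4) g] s[OF m(1,2) hP] G' by simp
    have "ennreal (cmod ?D) \<le> ennreal (cmod (pairing (\<lambda>x. Te j f x - T j \<phi> x) g)) + ennreal (cmod (pairing (\<lambda>x. f x - \<phi> x) (h j)))"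
      unfolding D by (simp add: ennreal_plus[symmetric] norm_triangle_ineq4 ennreal_leI del: ennreal_plus)
    also have "\<dots> \<le> atomic_norm \<rho> P (eabs g) * morrey_enorm r p (eabs (\<lambda>x. Te j f x - T j \<phi> x)) +
        atomic_norm \<rho> P (eabs (h j)) * morrey_enorm r p (eabs (\<lambda>x. f x - \<phi> x))"
      using predual_finite[OF g] predual_finite[OF hP] \<phi>(2,3)
      by (intro add_mono integrable_if_dual(2)) (auto intro: less_trans)
    also have "\<dots> \<le> ?C * ennreal (d / 2)"
      unfolding distrib_right by (intro add_mono mult_left_mono less_imp_le[OF \<phi>(2)] less_imp_le[OF \<phi>(3)] zero_le)
    also have "\<dots> < ennreal (cmod ?D)" using d by (intro d(2) ennreal_lessI) auto
    finally show False by simp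
  qed
  with hP show ?thesis by blast
qed

text \<open>Choosing a representing function for each g gives a map of representatives. It respects
  equality almost everywhere because its values are determined by their pairings with test
  functions.\<close>

lemma dual_operator_exists: "\<exists>Td. \<forall>j. dual_operator (morrey0 r p) (predual \<rho> P) (Te j) (Td j)"
proof -
  define G where "G j g h \<longleftrightarrow> h \<in> predual \<rho> P \<and> (\<forall>f\<in>morrey0 r p. pairing (Te j f) g = pairing f h)" for j g h
  define Td where "Td j g = (SOME h. G j g h)" for j g
  have Td: "G j g (Td j g)" if "g \<in> predual \<rho> P" for j g
    using dual_exists[OF that, of j] unfolding Td_def G_def Bex_def by (rule someI_ex)
  have "dual_operator (morrey0 r p) (predual \<rho> P) (Te j) (Td j)" for j
    unfolding dual_operator_def operator_on_def
  proof (intro conjI ballI impI)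
    show "Td j g \<in> predual \<rho> P" if "g \<in> predual \<rho> P" for g using Td[OF that] by (simp add: G_def)
    show "pairing (Te j f) g = pairing f (Td j g)" if "f \<in> morrey0 r p" "g \<in> predual \<rho> P" for f g
      using Td[OF that(2)] that(1) by (simp add: G_def)
    fix g g' :: "'n cfun" assume g: "g \<in> predual \<rho> P" "g' \<in> predual \<rho> P" and eq: "g =ae g'"
    show "Td j g =ae Td j g'"
    proof (rule predual_ae_eq)
      show "Td j g \<in> predual \<rho> P" "Td j g' \<in> predual \<rho> P" using Td g by (auto simp: G_def)
      fix \<phi> :: "'n cfun" assume \<phi>: "\<phi> \<in> test_functions"
      have "Te j \<phi> \<in> borel_measurable lebesgue" using test_morrey[OF \<phi>] by (rule Te_measurable)
      then have "pairing g (Te j \<phi>) = pairing g' (Te j \<phi>)"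
        using predual_measurable[OF g(1)] predual_measurable[OF g(2)] eq by (intro pairing_cong_AE)
      then show "pairing \<phi> (Td j g) = pairing \<phi> (Td j g')"
        using Td g test_morrey0[OF \<phi>] by (simp add: G_def pairing_def mult.commute)
    qed
  qed
  then show ?thesis by blast
qed

context
  fixes Td :: "nat \<Rightarrow> 'n cfun \<Rightarrow> 'n cfun"
  assumes dual: "\<And>j. dual_operator (morrey0 r p) (predual \<rho> P) (Te j) (Td j)"
begin

lemma Td_predual: "g \<in> predual \<rho> P \<Longrightarrow> Td j g \<in> predual \<rho> P"
  using dual[of j] by (simp add: dual_operator_def operator_on_def)

text \<open>These pairings fix \<open>Td j g\<close> up to null sets. What follows about
  \<open>Td\<close> is derived from them, and hence holds for every operator dual to
  \<open>Te\<close>, not just for the one constructed above.\<close>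

lemma Td_test_pairing:
  assumes \<phi>: "\<phi> \<in> test_functions" and g: "g \<in> predual \<rho> P"
  shows "pairing \<phi> (Td j g) = pairing (T j \<phi>) g"
proof -
  have "pairing (T j \<phi>) g = pairing (Te j \<phi>) g"
    using Te_test[OF \<phi>, of j] test_morrey[OF \<phi>] \<phi> g
    by (intro pairing_cong_AE T_measurable Te_measurable predual_measurable) (auto elim: AE_mp)
  also have "\<dots> = pairing \<phi> (Td j g)" using dual[of j] test_morrey0[OF \<phi>] g by (simp add: dual_operator_def)
  finally show ?thesis by simp
qed

text \<open>Each majorant of the l_Q norm yields functions h_j with the same pairings as
  \<open>Td j (g j)\<close>, hence equal to them almost everywhere, and with norm bounded by its
  cost. The constant is raised by 1 since passing to the infimum requires a nonzero factor and
  \<open>C_morrey\<close> may vanish.\<close>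

lemma Td_lq_le:
  assumes g: "\<And>j. g j \<in> predual \<rho> P"
  shows "atomic_norm \<rho> P (lq_function Q (\<lambda>j. Td j (g j))) \<le> (C_morrey + 1) * atomic_norm \<rho> P (lq_function Q g)"
proof -
  have "atomic_norm \<rho> P (lq_function Q (\<lambda>j. Td j (g j))) \<le> (C_morrey + 1) * X"
    if X: "X \<in> {atomic_cost \<rho> P J b | J M b. atomic_majorant (lq_function Q g) J M b}" for X
  proof (cases "X < top")
    case True
    obtain J M b where maj: "atomic_majorant (lq_function Q g) J M b" and XJ: "X = atomic_cost \<rho> P J b"
      using X by blast
    obtain h where h: "\<And>j. h j \<in> borel_measurable lebesgue"
      "atomic_norm \<rho> P (lq_function Q h) \<le> C_morrey * X"
      "\<And>j \<phi>. \<phi> \<in> test_functions \<Longrightarrow> pairing (T j \<phi>) (g j) = pairing \<phi> (h j)"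
      using dual_of_majorant[OF lin predual_measurable[OF g] maj] True unfolding XJ by blast
    have eq: "Td j (g j) =ae h j" for j
    proof (rule predual_ae_eq)
      have "atomic_norm \<rho> P (eabs (h j)) \<le> atomic_norm \<rho> P (lq_function Q h)"
        using lq_ge[OF Q_pos, of h j] by (intro atomic_norm_mono_AE AE_I2) (simp add: eabs_def)
      also have "\<dots> < top" using h(2) C_morrey_finite True by (auto simp: ennreal_mult_less_top intro: le_less_trans)
      finally show "h j \<in> predual \<rho> P" using h(1) by (simp add: predual_iff)
    qed (use g in \<open>auto simp: Td_predual Td_test_pairing h(3)\<close>)
    have "atomic_norm \<rho> P (lq_function Q (\<lambda>j. Td j (g j))) = atomic_norm \<rho> P (lq_function Q h)"
    proof (rule atomic_norm_cong_AE)
      have "AE x in lebesgue. \<forall>j. Td j (g j) x = h j x" using eq by (simp add: AE_all_countable)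
      then show "AE x in lebesgue. lq_function Q (\<lambda>j. Td j (g j)) x = lq_function Q h x"
        by eventually_elim (simp add: lq_function_def)
    qed
    also have "\<dots> \<le> C_morrey * X" by (rule h(2))
    also have "\<dots> \<le> (C_morrey + 1) * X" by (intro mult_right_mono) auto
    finally show ?thesis .
  next
    case False
    then have "(C_morrey + 1) * X = top" by (simp add: less_top[symmetric] ennreal_mult_top)
    then show ?thesis by simp
  qed
  then show ?thesis unfolding atomic_norm_def[of _ _ "lq_function Q g"]
    using C_morrey_finite by (intro le_cmult_Inf) auto
qed

lemma lq_cfun_predual:
  fixes g :: "nat \<Rightarrow> 'n cfun"
  assumes g: "\<And>j. g j \<in> predual \<rho> P" and fin: "AE x in lebesgue. lq_function Q g x < top"
  shows "atomic_norm \<rho> P (eabs (lq_cfun Q g)) = atomic_norm \<rho> P (lq_function Q g)"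
    and "lq_cfun Q g \<in> borel_measurable lebesgue"
proof -
  show "atomic_norm \<rho> P (eabs (lq_cfun Q g)) = atomic_norm \<rho> P (lq_function Q g)"
    by (rule atomic_norm_cong_AE, use fin in eventually_elim) (simp add: eabs_def lq_cfun_def)
  note [measurable] = predual_measurable[OF g]
  show "lq_cfun Q g \<in> borel_measurable lebesgue" unfolding lq_cfun_def by measurable
qed

lemma Td_bounded_lq:
  "bounded_sequence_operator (predual_lq \<rho> P Q) (\<lambda>g. predual_enorm \<rho> P (lq_cfun Q g)) Td"
proof -
  obtain c :: real where c: "C_morrey = ennreal c" "0 \<le> c" using C_morrey_finite by (cases C_morrey) auto
  have main: "(\<lambda>j. Td j (g j)) \<in> predual_lq \<rho> P Q \<and>
      predual_enorm \<rho> P (lq_cfun Q (\<lambda>j. Td j (g j))) \<le> ennreal (c + 1) * predual_enorm \<rho> P (lq_cfun Q g)"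
    if G: "g \<in> predual_lq \<rho> P Q" for g
  proof -
    have g: "g j \<in> predual \<rho> P" for j using G by (simp add: predual_lq_def)
    have Tg: "Td j (g j) \<in> predual \<rho> P" for j using g by (rule Td_predual)
    have fin: "AE x in lebesgue. lq_function Q g x < top" and lqP: "lq_cfun Q g \<in> predual \<rho> P"
      using G by (auto simp: predual_lq_def)
    note lqg = lq_cfun_predual[OF g fin]
    have le: "atomic_norm \<rho> P (lq_function Q (\<lambda>j. Td j (g j))) \<le> ennreal (c + 1) * atomic_norm \<rho> P (lq_function Q g)"
      using Td_lq_le[of g] g c by simp
    also have "\<dots> < top" using predual_finite[OF lqP] lqg(1) by (simp add: ennreal_mult_less_top)
    finally have Tfin: "atomic_norm \<rho> P (lq_function Q (\<lambda>j. Td j (g j))) < top" .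
    note [measurable] = predual_measurable[OF Tg]
    have Tae: "AE x in lebesgue. lq_function Q (\<lambda>j. Td j (g j)) x < top"
      using Tfin by (intro AE_finite_if_atomic_norm_finite) measurable
    note lqT = lq_cfun_predual[of "\<lambda>j. Td j (g j)", OF Tg Tae]
    have TlqP: "lq_cfun Q (\<lambda>j. Td j (g j)) \<in> predual \<rho> P" using lqT Tfin by (simp add: predual_iff)
    show ?thesis using Tg Tae TlqP le unfolding predual_enorm_eq[OF TlqP] predual_enorm_eq[OF lqP] lqg(1) lqT(1)
      by (simp add: predual_lq_def)
  qed
  then show ?thesis unfolding bounded_sequence_operator_def by blast
qed

lemma Td_le:
  assumes g: "g \<in> predual \<rho> P"
  shows "atomic_norm \<rho> P (eabs (Td j g)) \<le> (C_morrey + 1) * atomic_norm \<rho> P (eabs g)"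
proof -
  define G :: "nat \<Rightarrow> 'n cfun" where "G i = (if i = j then g else (\<lambda>x. 0))" for i
  have G: "G i \<in> predual \<rho> P" for i using g test_predual[OF test_zero] by (simp add: G_def)
  have lqG: "lq_function Q G = eabs g" unfolding G_def by (rule lq_single_function[OF Q_pos])
  have "atomic_norm \<rho> P (eabs (Td j g)) \<le> atomic_norm \<rho> P (lq_function Q (\<lambda>i. Td i (G i)))"
    using lq_ge[OF Q_pos, of "\<lambda>i. Td i (G i)" j] by (intro atomic_norm_mono_AE AE_I2) (simp add: eabs_def G_def)
  also have "\<dots> \<le> (C_morrey + 1) * atomic_norm \<rho> P (lq_function Q G)" using G by (rule Td_lq_le)
  finally show ?thesis unfolding lqG .
qed

text \<open>Self-adjointness turns the pairing with T_j \<phi> into the pairing of \<phi> with T_j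
  g, which identifies \<open>Td j g\<close> for a test function g. Linearity is read off from the
  pairings in the same way.\<close>

lemma Td_extension:
  assumes self: "formally_self_adjoint (T j)"
  shows "linear_bounded_extension (predual \<rho> P) (predual_enorm \<rho> P) (T j) (Td j)"
  unfolding linear_bounded_extension_def bounded_extension_def bounded_operator_def linear_operator_def
proof (intro conjI ballI allI)
  show "test_functions \<subseteq> (predual \<rho> P :: 'n cfun set)" using test_predual by blast
  show "operator_on (predual \<rho> P) (Td j)" using dual[of j] by (simp add: dual_operator_def)
  obtain c :: real where c: "C_morrey = ennreal c" "0 \<le> c" using C_morrey_finite by (cases C_morrey) auto
  have "predual_enorm \<rho> P (Td j g) \<le> ennreal (c + 1) * predual_enorm \<rho> P g" if "g \<in> predual \<rho> P" for g
    using Td_le[OF that, of j] c that Td_predual[OF that] by (simp add: predual_enorm_eq)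
  then show "\<exists>c::real. \<forall>f\<in>predual \<rho> P. predual_enorm \<rho> P (Td j f) \<le> ennreal c * predual_enorm \<rho> P f" by blast
next
  fix g :: "'n cfun" assume g: "g \<in> test_functions"
  note gP = test_predual[OF g]
  show "Td j g =ae T j g"
  proof (rule ae_eq_if_test_pairings_eq)
    show "Td j g \<in> borel_measurable lebesgue" using Td_predual[OF gP] by (rule predual_measurable)
    show "T j g \<in> borel_measurable lebesgue" using g by (rule T_measurable)
    fix \<phi> :: "'n cfun" assume \<phi>: "\<phi> \<in> test_functions"
    show "integrable lebesgue (\<lambda>x. \<phi> x * Td j g x)" using \<phi> Td_predual[OF gP] by (rule test_integrable_predual)
    have "integrable lebesgue (\<lambda>x. T j g x * \<phi> x)"
      using T_test_morrey[OF g, of j] test_predual[OF \<phi>] g \<phi>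
      by (intro integrable_if_dual(1) T_measurable morrey_finite predual_finite test_measurable)
    then show "integrable lebesgue (\<lambda>x. \<phi> x * T j g x)" by (simp add: mult.commute)
    show "pairing \<phi> (Td j g) = pairing \<phi> (T j g)"
      using Td_test_pairing[OF \<phi> gP] self \<phi> g by (simp add: formally_self_adjoint_def)
  qed
next
  fix f g :: "'n cfun" and a b assume f: "f \<in> predual \<rho> P" and g: "g \<in> predual \<rho> P"
  show "Td j (\<lambda>x. a * f x + b * g x) =ae (\<lambda>x. a * Td j f x + b * Td j g x)"
  proof (rule predual_ae_eq)
    show "Td j (\<lambda>x. a * f x + b * g x) \<in> predual \<rho> P" using f g by (intro Td_predual predual_lincomb)
    show "(\<lambda>x. a * Td j f x + b * Td j g x) \<in> predual \<rho> P" using f g by (intro Td_predual predual_lincomb)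
    fix \<phi> :: "'n cfun" assume \<phi>: "\<phi> \<in> test_functions"
    have split: "pairing k (\<lambda>x. a * u x + b * v x) = a * pairing k u + b * pairing k v"
      if "k \<in> morrey r p" "u \<in> predual \<rho> P" "v \<in> predual \<rho> P" for k u v :: "'n cfun"
    proof -
      have "integrable lebesgue (\<lambda>x. k x * w x)" if "w \<in> predual \<rho> P" for w :: "'n cfun"
        using \<open>k \<in> morrey r p\<close> that
        by (intro integrable_if_dual(1) morrey_measurable morrey_finite predual_measurable predual_finite)
      note this[OF that(2)] this[OF that(3)]
      moreover have "(\<lambda>x. k x * (a * u x + b * v x)) = (\<lambda>x. a * (k x * u x) + b * (k x * v x))" by (simp add: algebra_simps)
      ultimately show ?thesis by (simp add: pairing_def)
    qed
    show "pairing \<phi> (Td j (\<lambda>x. a * f x + b * g x)) = pairing \<phi> (\<lambda>x. a * Td j f x + b * Td j g x)"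
      using f g by (simp add: Td_test_pairing[OF \<phi>] predual_lincomb split Td_predual T_test_morrey[OF \<phi>] test_morrey[OF \<phi>])
  qed
qed

lemma Td_unique_extension:
  assumes "formally_self_adjoint (T j)"
  shows "unique_operator_on (predual \<rho> P) (linear_bounded_extension (predual \<rho> P) (predual_enorm \<rho> P) (T j)) (Td j)"
  unfolding unique_operator_on_def using Td_extension[OF assms] predual_extension_unique by blast

end

end

end

subsection \<open>The theorem\<close>

theorem theorem4p3:
  fixes T :: "nat \<Rightarrow> ('n::finite) cfun \<Rightarrow> 'n cfun"
    and p p' q q' r \<rho> c\<^sub>1 c\<^sub>2 :: real
  assumes p: "1 < p" and p': "1 / p + 1 / p' = 1"
    and q: "1 < q" and q': "1 / q + 1 / q' = 1"
    and r: "- real CARD('n) / p < r" "r < 0"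
    and \<rho>: "r + \<rho> = - real CARD('n)"
    and T_maps: "\<And>j f. f \<in> test_functions \<Longrightarrow> T j f \<in> bcontfun"
    and T_kind: "\<And>j. linear_on_test_functions (T j) \<or> even_subadditive_on_test_functions (T j)"
    and T_kernel: "\<And>j f y. f \<in> test_functions \<Longrightarrow> y \<notin> supp f \<Longrightarrow>
          cmod (T j f y) \<le> c\<^sub>1 * (LINT z|lebesgue. cmod (f z) / norm (y - z) ^ CARD('n))"
    and T_Lp: "\<And>f :: nat \<Rightarrow> 'n cfun. (\<And>j. f j \<in> test_functions) \<Longrightarrow>
          Lp_enorm_on p UNIV (lq_function q (\<lambda>j. T j (f j)))
            \<le> ennreal c\<^sub>2 * Lp_enorm_on p UNIV (lq_function q f)"
  shows
    "(\<exists>Te. (\<forall>j. unique_operator_on (morrey0 r p)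
               (continuous_bounded_extension (morrey0 r p) (\<lambda>f. morrey_enorm r p (eabs f)) (T j)) (Te j)) \<and>
           bounded_sequence_operator (morrey0_lq r p q) (\<lambda>f. morrey_enorm r p (lq_function q f)) Te)
     \<and>
     ((\<forall>j. linear_on_test_functions (T j)) \<longrightarrow>
       (\<exists>Te. (\<forall>j. unique_operator_on (morrey0 r p)
                 (linear_bounded_extension (morrey0 r p) (\<lambda>f. morrey_enorm r p (eabs f)) (T j)) (Te j)) \<and>
             (\<exists>Td. \<forall>j. dual_operator (morrey0 r p) (predual \<rho> p') (Te j) (Td j)) \<and>
             (\<forall>Td. (\<forall>j. dual_operator (morrey0 r p) (predual \<rho> p') (Te j) (Td j)) \<longrightarrow>
                bounded_sequence_operator (predual_lq \<rho> p' q')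
                  (\<lambda>g. predual_enorm \<rho> p' (lq_cfun q' g)) Td \<and>
                ((\<forall>j. formally_self_adjoint (T j)) \<longrightarrow>
                  (\<forall>j. unique_operator_on (predual \<rho> p')
                     (linear_bounded_extension (predual \<rho> p') (predual_enorm \<rho> p') (T j)) (Td j))))))
     \<and>
     ((\<forall>j. linear_on_test_functions (T j)) \<longrightarrow>
       (\<exists>Te. (\<forall>j. linear_bounded_extension (morrey r p) (\<lambda>f. morrey_enorm r p (eabs f)) (T j) (Te j)) \<and>
             bounded_sequence_operator (morrey_lq r p q) (\<lambda>f. morrey_enorm r p (lq_function q f)) Te))"
proof -
  have zero: "T j (\<lambda>x. 0) = (\<lambda>x. 0)" for j
  proof (cases "linear_on_test_functions (T j)")
    case True
    from this[unfolded linear_on_test_functions_def, rule_format, OF test_zero test_zero, of 0 0]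
    show ?thesis by simp
  next
    case False
    then show ?thesis using T_kind[of j] by (simp add: even_subadditive_on_test_functions_def)
  qed
  \<comment> \<open>This is the common inequality behind the extension. In the linear case it is an
    equality.\<close>
  have diff: "cmod (T j f y - T j g y) \<le> cmod (T j (\<lambda>x. f x - g x) y)"
    if f: "f \<in> test_functions" and g: "g \<in> test_functions" for j f g y
  proof (cases "linear_on_test_functions (T j)")
    case True
    then have "T j (\<lambda>x. 1 * f x + (-1) * g x) = (\<lambda>x. 1 * T j f x + (-1) * T j g x)"
      unfolding linear_on_test_functions_def using f g by blast
    then show ?thesis by simp
  next
    case False
    then have ev: "even_subadditive_on_test_functions (T j)" using T_kind[of j] by blast
    then have real: "T j h y \<in> \<real>" if "h \<in> test_functions" for h
      using that unfolding even_subadditive_on_test_functions_def by blast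
    have sub: "Re (T j (\<lambda>x. h x + k x) y) \<le> Re (T j h y) + Re (T j k y)"
      if "h \<in> test_functions" "k \<in> test_functions" for h k
      using ev that unfolding even_subadditive_on_test_functions_def by blast
    have "T j (\<lambda>x. f x - g x) y = T j (\<lambda>x. - (f x - g x)) y"
      using ev test_diff[OF f g] unfolding even_subadditive_on_test_functions_def by blast
    \<comment> \<open>Evenness lets g - f replace f - g, so that subadditivity in both directions
      bounds the absolute value of the real difference.\<close>
    then have even: "T j (\<lambda>x. g x - f x) y = T j (\<lambda>x. f x - g x) y" by simp
    have "Re (T j f y) \<le> Re (T j g y) + Re (T j (\<lambda>x. f x - g x) y)"
      using sub[OF g test_diff[OF f g]] by simp
    moreover have "Re (T j g y) \<le> Re (T j f y) + Re (T j (\<lambda>x. f x - g x) y)"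
      using sub[OF f test_diff[OF g f]] even by simp
    ultimately have "\<bar>Re (T j f y - T j g y)\<bar> \<le> \<bar>Re (T j (\<lambda>x. f x - g x) y)\<bar>" by simp
    moreover have "T j f y - T j g y \<in> \<real>" using f g by (intro Reals_diff real)
    moreover have "T j (\<lambda>x. f x - g x) y \<in> \<real>" using f g by (intro real test_diff)
    ultimately show ?thesis by (simp add: in_Reals_norm del: minus_complex.sel)
  qed
  interpret cz_family p p' r \<rho> "TYPE('n)" q q' c\<^sub>1 c\<^sub>2 T
    using p p' q q' r \<rho> T_maps T_kernel T_Lp zero diff
    by unfold_locales auto
  show ?thesis
  proof (intro conjI impI)
    show "\<exists>Te. (\<forall>j. unique_operator_on (morrey0 r p)
               (continuous_bounded_extension (morrey0 r p) (\<lambda>f. morrey_enorm r p (eabs f)) (T j)) (Te j)) \<and>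
           bounded_sequence_operator (morrey0_lq r p q) (\<lambda>f. morrey_enorm r p (lq_function q f)) Te"
      using Te_unique_continuous Te_bounded_morrey0_lq by blast
  next
    assume lin: "\<forall>j. linear_on_test_functions (T j)"
    then show "\<exists>Te. (\<forall>j. linear_bounded_extension (morrey r p) (\<lambda>f. morrey_enorm r p (eabs f)) (T j) (Te j)) \<and>
             bounded_sequence_operator (morrey_lq r p q) (\<lambda>f. morrey_enorm r p (lq_function q f)) Te"
      using Te_linear_extension_morrey Te_bounded_morrey_lq by blast
    show "\<exists>Te. (\<forall>j. unique_operator_on (morrey0 r p)
                 (linear_bounded_extension (morrey0 r p) (\<lambda>f. morrey_enorm r p (eabs f)) (T j)) (Te j)) \<and>
             (\<exists>Td. \<forall>j. dual_operator (morrey0 r p) (predual \<rho> p') (Te j) (Td j)) \<and>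
             (\<forall>Td. (\<forall>j. dual_operator (morrey0 r p) (predual \<rho> p') (Te j) (Td j)) \<longrightarrow>
                bounded_sequence_operator (predual_lq \<rho> p' q')
                  (\<lambda>g. predual_enorm \<rho> p' (lq_cfun q' g)) Td \<and>
                ((\<forall>j. formally_self_adjoint (T j)) \<longrightarrow>
                  (\<forall>j. unique_operator_on (predual \<rho> p')
                     (linear_bounded_extension (predual \<rho> p') (predual_enorm \<rho> p') (T j)) (Td j))))"
    \<comment> \<open>The extension constructed for the first statement also serves here; on the
      closure it is the unique linear one as well.\<close>
    proof (rule exI[of _ Te], intro conjI allI impI)
      show "unique_operator_on (morrey0 r p)
          (linear_bounded_extension (morrey0 r p) (\<lambda>f. morrey_enorm r p (eabs f)) (T j)) (Te j)" for j
        using lin by (intro Te_unique_linear) blast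
      show "\<exists>Td. \<forall>j. dual_operator (morrey0 r p) (predual \<rho> p') (Te j) (Td j)"
        using lin by (intro dual_operator_exists) blast
    next
      fix Td assume dual: "\<forall>j. dual_operator (morrey0 r p) (predual \<rho> p') (Te j) (Td j)"
      show "bounded_sequence_operator (predual_lq \<rho> p' q') (\<lambda>g. predual_enorm \<rho> p' (lq_cfun q' g)) Td"
        using lin dual by (intro Td_bounded_lq) auto
      show "unique_operator_on (predual \<rho> p')
          (linear_bounded_extension (predual \<rho> p') (predual_enorm \<rho> p') (T j)) (Td j)"
        if "\<forall>j. formally_self_adjoint (T j)" for j
        using lin dual that by (intro Td_unique_extension) auto
    qed
  qed
qed

end
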